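(* Let $d\geq 1$. Let $f,g\in W^{1,\infty}(\mathbb{R},\mathbb{R}^d)$ with $f(0)=g(0)=0$; let $A\in W^{1,\infty}(\mathbb{R})$ be nondecreasing with $A(0)=0$; let $u_0,v_0\in L^\infty(\mathbb{R}^d)\cap L^1(\mathbb{R}^d)\cap BV(\mathbb{R}^d)$; and let $\mu,\nu$ be nonnegative Radon measures on $\mathbb{R}^d\setminus\{0\}$ with $\int_{\mathbb{R}^d\setminus\{0\}}|z|^2\wedge1\,\mathrm{d}\mu(z)<+\infty$ and $\int_{\mathbb{R}^d\setminus\{0\}}|z|^2\wedge1\,\mathrm{d}\nu(z)<+\infty$. Let $u$ and $v$ be respectively the entropy solutions of $$\partial_tu+\mathrm{div}f(u)=\mathcal{L}^\mu[A(u)],\ u(\cdot,0)=u_0,\qquad\text{and}\qquad \partial_tv+\mathrm{div}g(v)=\mathcal{L}^\nu[A(v)],\ v(\cdot,0)=v_0.$$ Then for all $T,r>0$, $$\begin{aligned} \|u-v\|_{C([0,T];L^1)}\le\ &\|u_0-v_0\|_{L^1(\mathbb{R}^d)}+|u_0|_{BV(\mathbb{R}^d)}\,T\,\|f'-g'\|_{L^\infty(\mathbb{R},\mathbb{R}^d)}\\ &+|u_0|_{BV(\mathbb{R}^d)}\sqrt{c_d\,T\,\|A'\|_{L^\infty(\mathbb{R})}\int_{0<|z|\le r}|z|^2\,\mathrm{d}|\mu-\nu|(z)}\\ &+|u_0|_{BV(\mathbb{R}^d)}\,T\,\|A'\|_{L^\infty(\mathbb{R})}\,\Big|\int_{r\wedge1<|z|\le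 r\vee1}z\,\mathrm{d}(\mu-\nu)(z)\Big|\\ &+T\,\|A'\|_{L^\infty(\mathbb{R})}\int_{|z|>r}\|u_0(\cdot+z)-u_0\|_{L^1(\mathbb{R}^d)}\,\mathrm{d}|\mu-\nu|(z), \end{aligned}$$ where $c_d=\frac{4d^2}{d+1}$.
   Context: Notation: $Q_T=\mathbb{R}^d\times(0,T)$; $a\wedge b=\min\{a,b\}$, $a\vee b=\max\{a,b\}$; $|\cdot|$ is the Euclidean norm; $|\mu-\nu|$ is the total variation measure of the signed Radon measure $\mu-\nu$ on $\mathbb{R}^d\setminus\{0\}$; $|\cdot|_{BV(\mathbb{R}^d)}$ is the total variation semi-norm; $C([0,T];L^1)$ means $C([0,T];L^1(\mathbb{R}^d))$ with the sup norm; $D$ is the gradient in $x$; $\mathrm{sgn}(u)=\pm1$ if $\pm u>0$ and $\mathrm{sgn}(0)=0$. Operators. For a Lévy measure $\mu$ (nonnegative Radon measure on $\mathbb{R}^d\setminus\{0\}$ with $\int|z|^2\wedge1\,\mathrm{d}\mu<\infty$) and $r>0$: $\mathcal{L}^\mu[\phi](x)=\int_{\mathbb{R}^d\setminus\{0\}}\phi(x+z)-\phi(x)-z\cdot D\phi(x)\mathbf{1}_{|z|\le1}\,\mathrm{d}\mu(z)$, $\mathcal{L}^\mu_r[\phi](x)=\int_{0<|z|\le r}\phi(x+z)-\phi(x)-z\cdot D\phi(x)\mathbf{1}_{|z|\le1}\,\mathrm{d}\mu(z)$, $b^\mu_r=-\int_{|z|>r}z\,\mathbf{1}_{|z|\le1}\,\mathrm{d}\mu(z)$,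 $\mathcal{L}^{\mu,r}[\phi](x)=\int_{|z|>r}\phi(x+z)-\phi(x)\,\mathrm{d}\mu(z)$. The dual measure $\mu^\ast$ is defined by $\int\phi(z)\,\mathrm{d}\mu^\ast(z)=\int\phi(-z)\,\mathrm{d}\mu(z)$. The entropy flux is $q_f(u,k)=\mathrm{sgn}(u-k)(f(u)-f(k))$. Entropy solution on $Q_T$ of $\partial_tu+\mathrm{div}f(u)=\mathcal{L}^\mu[A(u)]$, $u(\cdot,0)=u_0$: a function $u\in L^\infty(Q_T)\cap C([0,T];L^1(\mathbb{R}^d))$ such that for all $k\in\mathbb{R}$, all $r>0$ and all nonnegative $\phi\in C_c^\infty(\mathbb{R}^{d+1})$, $$\begin{aligned}&\int_{Q_T}|u-k|\,\partial_t\phi+\big(q_f(u,k)+b_r^{\mu^\ast}|A(u)-A(k)|\big)\cdot D\phi\,\mathrm{d}x\,\mathrm{d}t\\&+\int_{Q_T}|A(u)-A(k)|\,\mathcal{L}^{\mu^\ast}_r[\phi]+\mathrm{sgn}(u-k)\,\mathcal{L}^{\mu,r}[A(u)]\,\phi\,\mathrm{d}x\,\mathrm{d}t\\&-\int_{\mathbb{R}^d}|u(x,T)-k|\,\phi(x,T)\,\mathrm{d}x+\int_{\mathbb{R}^d}|u_0(x)-k|\,\phi(x,0)\,\mathrm{d}x\ge0.\end{aligned}$$ Under the stated assumptions on the data it is known that there is exactly one entropy solution for every $T>0$. *)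

theory Defs
  imports "HOL-Analysis.Analysis" "HOL-Probability.Essential_Supremum"
begin

section \<open>Function spaces\<close>

text \<open>Elements of the Lebesgue spaces are given by Borel representatives.  This matters for the
  nonlocal operators: for a Borel (possibly singular) measure \<open>\<mu>\<close>, the map \<open>z \<mapsto> u (x + z)\<close> need not
  be \<open>\<mu>\<close>-measurable if \<open>u\<close> is merely Lebesgue measurable.\<close>

definition Linf :: "'a measure \<Rightarrow> ('a \<Rightarrow> 'b::euclidean_space) \<Rightarrow> bool" where
  "Linf M h \<longleftrightarrow> h \<in> borel_measurable M \<and> esssup M (\<lambda>x. ereal (norm (h x))) < \<infinity>"

definition Linf_norm :: "'a measure \<Rightarrow> ('a \<Rightarrow> 'b::euclidean_space) \<Rightarrow> real" where
  "Linf_norm M h = real_of_ereal (esssup M (\<lambda>x. ereal (norm (h x))))"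

text \<open>Functions of class \<open>C\<^sup>k\<close>: all iterated partial derivatives up to order \<open>k\<close> exist and are
  continuous.\<close>

primrec Ck :: "nat \<Rightarrow> ('a::euclidean_space \<Rightarrow> 'b::real_normed_vector) \<Rightarrow> bool" where
  "Ck 0 \<phi> = continuous_on UNIV \<phi>"
| "Ck (Suc k) \<phi> = ((\<forall>x. \<phi> differentiable (at x)) \<and>
      (\<forall>b\<in>Basis. Ck k (\<lambda>x. frechet_derivative \<phi> (at x) b)))"

definition compact_support :: "('a::euclidean_space \<Rightarrow> 'b::real_normed_vector) \<Rightarrow> bool" where
  "compact_support \<phi> \<longleftrightarrow> compact (closure {x. \<phi> x \<noteq> 0})"

definition Cc_infty :: "('a::euclidean_space \<Rightarrow> real) \<Rightarrow> bool" where
  "Cc_infty \<phi> \<longleftrightarrow> (\<forall>k. Ck k \<phi>) \<and> compact_support \<phi>"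

definition grad :: "('a::euclidean_space \<Rightarrow> real) \<Rightarrow> 'a \<Rightarrow> 'a" where
  "grad \<phi> x = (\<Sum>b\<in>Basis. frechet_derivative \<phi> (at x) b *\<^sub>R b)"

definition divergence :: "('a::euclidean_space \<Rightarrow> 'a) \<Rightarrow> 'a \<Rightarrow> real" where
  "divergence \<Phi> x = (\<Sum>b\<in>Basis. frechet_derivative \<Phi> (at x) b \<bullet> b)"

text \<open>\<open>W1inf f f'\<close>: \<open>f\<close> is the continuous representative of an element of \<open>W\<^sup>1\<^sup>,\<^sup>\<infinity>\<close> on the real line,
  and \<open>f'\<close> is a representative of its weak derivative.\<close>

definition weak_derivative :: "(real \<Rightarrow> 'b::euclidean_space) \<Rightarrow> (real \<Rightarrow> 'b) \<Rightarrow> bool" where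
  "weak_derivative f f' \<longleftrightarrow>
     (\<forall>\<phi>. Cc_infty \<phi> \<longrightarrow> (LINT s|lborel. deriv \<phi> s *\<^sub>R f s) = - (LINT s|lborel. \<phi> s *\<^sub>R f' s))"

definition W1inf :: "(real \<Rightarrow> 'b::euclidean_space) \<Rightarrow> (real \<Rightarrow> 'b) \<Rightarrow> bool" where
  "W1inf f f' \<longleftrightarrow> continuous_on UNIV f \<and> Linf lborel f \<and> Linf lborel f' \<and> weak_derivative f f'"

definition total_variation :: "('a::euclidean_space \<Rightarrow> real) \<Rightarrow> ereal" where
  "total_variation w =
     (SUP \<Phi>\<in>{\<Phi>. Ck 1 \<Phi> \<and> compact_support \<Phi> \<and> (\<forall>x. norm (\<Phi> x) \<le> 1)}.
        ereal (LINT x|lborel. w x * divergence \<Phi> x))"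

definition BV :: "('a::euclidean_space \<Rightarrow> real) \<Rightarrow> bool" where
  "BV w \<longleftrightarrow> integrable lborel w \<and> total_variation w < \<infinity>"

definition BV_seminorm :: "('a::euclidean_space \<Rightarrow> real) \<Rightarrow> real" where
  "BV_seminorm w = real_of_ereal (total_variation w)"

section \<open>Radon measures on the punctured space\<close>

text \<open>On this locally compact, \<open>\<sigma>\<close>-compact metric space every locally finite Borel measure is
  automatically regular, so local finiteness is all that has to be required.\<close>

definition radon_punctured :: "'a::euclidean_space measure \<Rightarrow> bool" where
  "radon_punctured \<mu> \<longleftrightarrow> sets \<mu> = sets (restrict_space borel (- {0})) \<and>
     (\<forall>K. compact K \<and> K \<subseteq> - {0} \<longrightarrow> emeasure \<mu> K < \<infinity>)"

definition levy_measure :: "'a::euclidean_space measure \<Rightarrow> bool" where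
  "levy_measure \<mu> \<longleftrightarrow> radon_punctured \<mu> \<and> (\<integral>\<^sup>+z. ennreal (min ((norm z)\<^sup>2) 1) \<partial>\<mu>) < \<infinity>"

definition dual_measure :: "'a::euclidean_space measure \<Rightarrow> 'a measure" where
  "dual_measure \<mu> = distr \<mu> \<mu> uminus"

text \<open>The total variation measure of \<open>\<mu> - \<nu>\<close>.  Since \<open>\<mu>\<close> and \<open>\<nu>\<close> may both be infinite near \<open>0\<close>, the
  supremum runs over finite families of disjoint sets that are relatively compact in the
  punctured space, where \<open>\<mu> E - \<nu> E\<close> makes sense.\<close>

definition tv_families :: "'a::euclidean_space measure \<Rightarrow> 'a set \<Rightarrow> 'a set set set" where
  "tv_families \<mu> B = {P. finite P \<and> disjoint P \<and>
     (\<forall>E\<in>P. E \<in> sets \<mu> \<and> E \<subseteq> B \<and> compact (closure E) \<and> 0 \<notin> closure E)}"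

definition tv_value :: "'a::euclidean_space measure \<Rightarrow> 'a measure \<Rightarrow> 'a set \<Rightarrow> ennreal" where
  "tv_value \<mu> \<nu> B = (SUP P\<in>tv_families \<mu> B. \<Sum>E\<in>P. ennreal \<bar>measure \<mu> E - measure \<nu> E\<bar>)"

definition tv_measure :: "'a::euclidean_space measure \<Rightarrow> 'a measure \<Rightarrow> 'a measure" where
  "tv_measure \<mu> \<nu> = measure_of (space \<mu>) (sets \<mu>) (tv_value \<mu> \<nu>)"

lemma tv_value_mono: "B \<subseteq> C \<Longrightarrow> tv_value \<mu> \<nu> B \<le> tv_value \<mu> \<nu> C"
  unfolding tv_value_def by (rule SUP_subset_mono) (auto simp: tv_families_def)

lemma tv_families_empty: "{} \<in> tv_families \<mu> B"
  by (auto simp: tv_families_def)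

lemma tv_value_superadditive:
  assumes "B \<inter> C = {}"
  shows "tv_value \<mu> \<nu> B + tv_value \<mu> \<nu> C \<le> tv_value \<mu> \<nu> (B \<union> C)"
proof -
  let ?s = "\<lambda>P. \<Sum>E\<in>P. ennreal \<bar>measure \<mu> E - measure \<nu> E\<bar>"
  have ne: "tv_families \<mu> D \<noteq> {}" for D
    using tv_families_empty by auto
  have key: "?s P + ?s Q \<le> tv_value \<mu> \<nu> (B \<union> C)"
    if P: "P \<in> tv_families \<mu> B" and Q: "Q \<in> tv_families \<mu> C" for P Q
  proof -
    have PQ: "E \<inter> F = {}" if "E \<in> P" "F \<in> Q" for E F
      using that P Q assms by (force simp: tv_families_def)
    have "P \<inter> Q \<subseteq> {{}}"
      using PQ by blast
    then have "?s P + ?s Q = ?s (P \<union> Q)"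
      using P Q by (subst sum.union_inter_neutral) (auto simp: tv_families_def)
    moreover have "P \<union> Q \<in> tv_families \<mu> (B \<union> C)"
      using P Q PQ by (auto simp: tv_families_def intro!: disjoint_union)
    ultimately show ?thesis
      unfolding tv_value_def by (auto intro: SUP_upper)
  qed
  have "tv_value \<mu> \<nu> B + tv_value \<mu> \<nu> C
      = (SUP P\<in>tv_families \<mu> B. SUP Q\<in>tv_families \<mu> C. ?s P + ?s Q)"
    unfolding tv_value_def
    by (simp add: ennreal_SUP_add_left[symmetric] ennreal_SUP_add_right[symmetric] ne)
  also have "\<dots> \<le> tv_value \<mu> \<nu> (B \<union> C)"
    using key by (auto intro!: SUP_least)
  finally show ?thesis .
qed

lemma tv_value_countably_additive:
  assumes \<mu>: "radon_punctured \<mu>" and \<nu>: "radon_punctured \<nu>"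
  shows "countably_additive (sets \<mu>) (tv_value \<mu> \<nu>)"
proof (rule countably_additiveI)
  fix A :: "nat \<Rightarrow> 'a set"
  assume A: "range A \<subseteq> sets \<mu>" and disj: "disjoint_family A"
  let ?t = "\<lambda>E. ennreal \<bar>measure \<mu> E - measure \<nu> E\<bar>"
  have sets_eq: "sets \<nu> = sets \<mu>"
    using \<mu> \<nu> by (simp add: radon_punctured_def)
  have "(\<Sum>i<n. tv_value \<mu> \<nu> (A i)) \<le> tv_value \<mu> \<nu> (\<Union>i<n. A i)" for n
  proof (induction n)
    case (Suc n)
    have "(\<Union>i<n. A i) \<inter> A n = {}"
    proof -
      have "A i \<inter> A n = {}" if "i < n" for i
        using disj that by (simp add: disjoint_family_on_def)
      then show ?thesis by auto
    qed
    note sup = tv_value_superadditive[OF this, of \<mu> \<nu>]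
    have "(\<Sum>i<Suc n. tv_value \<mu> \<nu> (A i)) \<le> tv_value \<mu> \<nu> (\<Union>i<n. A i) + tv_value \<mu> \<nu> (A n)"
      using add_right_mono[OF Suc] by simp
    also note sup
    also have "(\<Union>i<n. A i) \<union> A n = (\<Union>i<Suc n. A i)"
      by (auto simp: lessThan_Suc)
    finally show ?case .
  qed simp
  then have le: "(\<Sum>i. tv_value \<mu> \<nu> (A i)) \<le> tv_value \<mu> \<nu> (\<Union>i. A i)"
    by (intro suminf_le_const) (auto intro: order_trans[OF _ tv_value_mono])
  have ge: "(\<Sum>E\<in>P. ?t E) \<le> (\<Sum>i. tv_value \<mu> \<nu> (A i))"
    if P: "P \<in> tv_families \<mu> (\<Union>i. A i)" for P
  proof -
    have E: "?t E \<le> (\<Sum>i. ?t (E \<inter> A i))" if "E \<in> P" for E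
    proof -
      have Es: "E \<in> sets \<mu>" "E \<subseteq> (\<Union>i. A i)" "compact (closure E)" "0 \<notin> closure E"
        using P that by (auto simp: tv_families_def)
      have sums: "(\<lambda>i. measure M (E \<inter> A i)) sums measure M E"
        if M: "radon_punctured M" "sets M = sets \<mu>" for M
      proof -
        have "closure E \<in> sets M"
          using M Es by (auto simp: radon_punctured_def sets_restrict_space image_iff)
        then have "emeasure M E \<le> emeasure M (closure E)"
          by (intro emeasure_mono closure_subset)
        also have "\<dots> < \<infinity>"
          using M Es by (auto simp: radon_punctured_def)
        finally have fin: "emeasure M E \<noteq> \<infinity>" by simp
        have U: "(\<Union>i. E \<inter> A i) = E"
          using Es by auto
        have "(\<lambda>i. measure M (E \<inter> A i)) sums measure M (\<Union>i. E \<inter> A i)"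
        proof (rule measure_UNION)
          show "range (\<lambda>i. E \<inter> A i) \<subseteq> sets M"
            using A Es(1) M(2) by auto
          show "disjoint_family (\<lambda>i. E \<inter> A i)"
            using disj by (auto simp: disjoint_family_on_def)
          show "emeasure M (\<Union>i. E \<inter> A i) \<noteq> \<infinity>"
            unfolding U by (rule fin)
        qed
        then show ?thesis unfolding U .
      qed
      have s1: "(\<lambda>i. measure \<mu> (E \<inter> A i)) sums measure \<mu> E"
        and s2: "(\<lambda>i. measure \<nu> (E \<inter> A i)) sums measure \<nu> E"
        using sums \<mu> \<nu> sets_eq by auto
      let ?d = "\<lambda>i. measure \<mu> (E \<inter> A i) - measure \<nu> (E \<inter> A i)"
      have d: "?d sums (measure \<mu> E - measure \<nu> E)"
        by (rule sums_diff[OF s1 s2])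
      have summ: "summable (\<lambda>i. \<bar>?d i\<bar>)"
      proof (rule summable_comparison_test')
        show "summable (\<lambda>i. measure \<mu> (E \<inter> A i) + measure \<nu> (E \<inter> A i))"
          using s1 s2 by (intro summable_add) (auto simp: sums_iff)
        show "norm \<bar>?d i\<bar> \<le> measure \<mu> (E \<inter> A i) + measure \<nu> (E \<inter> A i)" if "i \<ge> 0" for i
          using measure_nonneg[of \<mu> "E \<inter> A i"] measure_nonneg[of \<nu> "E \<inter> A i"]
          unfolding real_norm_def by linarith
      qed
      have "\<bar>measure \<mu> E - measure \<nu> E\<bar> \<le> (\<Sum>i. \<bar>?d i\<bar>)"
        using summable_rabs[OF summ] d by (simp add: sums_iff)
      then have "?t E \<le> ennreal (\<Sum>i. \<bar>?d i\<bar>)"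
        by (rule ennreal_leI)
      also have "\<dots> = (\<Sum>i. ?t (E \<inter> A i))"
        using summ by (subst suminf_ennreal2) auto
      finally show ?thesis .
    qed
    have "(\<Sum>E\<in>P. ?t E) \<le> (\<Sum>E\<in>P. \<Sum>i. ?t (E \<inter> A i))"
      using E by (rule sum_mono)
    also have "\<dots> = (\<Sum>i. \<Sum>E\<in>P. ?t (E \<inter> A i))"
      by (intro suminf_sum[symmetric]) auto
    also have "\<dots> \<le> (\<Sum>i. tv_value \<mu> \<nu> (A i))"
    proof (intro suminf_le)
      fix i
      have dP: "disjoint P" "finite P"
        using P by (auto simp: tv_families_def)
      have "(\<Sum>E\<in>P. ?t (E \<inter> A i)) = (\<Sum>F\<in>(\<lambda>E. E \<inter> A i) ` P. ?t F)"
      proof (subst sum.reindex_nontrivial)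
        fix E F assume EF: "E \<in> P" "F \<in> P" "E \<noteq> F" "E \<inter> A i = F \<inter> A i"
        then have "E \<inter> F = {}"
          using dP by (auto simp: disjoint_def)
        then have "E \<inter> A i = {}"
          using EF by blast
        then show "?t (E \<inter> A i) = 0" by simp
      qed (auto simp: dP)
      also have "(\<lambda>E. E \<inter> A i) ` P \<in> tv_families \<mu> (A i)"
      proof -
        have "disjoint ((\<lambda>E. E \<inter> A i) ` P)"
          using dP by (fastforce simp: disjoint_def)
        moreover have "compact (closure (E \<inter> A i)) \<and> 0 \<notin> closure (E \<inter> A i) \<and> E \<inter> A i \<in> sets \<mu>"
          if "E \<in> P" for E
        proof -
          have *: "E \<in> sets \<mu>" "compact (closure E)" "0 \<notin> closure E"
            using that P by (auto simp: tv_families_def)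
          have "closure (E \<inter> A i) \<subseteq> closure E"
            by (intro closure_mono) auto
          moreover have "bounded (E \<inter> A i)"
            using *(2) by (intro bounded_subset[of E "E \<inter> A i"]) (auto simp: compact_closure)
          ultimately show ?thesis
            using * A by (auto simp: compact_closure)
        qed
        ultimately show ?thesis
          using dP by (auto simp: tv_families_def)
      qed
      then have "(\<Sum>F\<in>(\<lambda>E. E \<inter> A i) ` P. ?t F) \<le> tv_value \<mu> \<nu> (A i)"
        unfolding tv_value_def by (rule SUP_upper)
      finally show "(\<Sum>E\<in>P. ?t (E \<inter> A i)) \<le> tv_value \<mu> \<nu> (A i)" .
    qed auto
    finally show ?thesis .
  qed
  have "tv_value \<mu> \<nu> (\<Union>i. A i) \<le> (\<Sum>i. tv_value \<mu> \<nu> (A i))"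
    unfolding tv_value_def[of \<mu> \<nu> "\<Union>i. A i"] using ge by (rule SUP_least)
  with le show "(\<Sum>i. tv_value \<mu> \<nu> (A i)) = tv_value \<mu> \<nu> (\<Union>i. A i)"
    by (rule antisym)
qed

lemma sets_tv_measure [simp]: "sets (tv_measure \<mu> \<nu>) = sets \<mu>"
  and space_tv_measure [simp]: "space (tv_measure \<mu> \<nu>) = space \<mu>"
  by (simp_all add: tv_measure_def)

lemma emeasure_tv_measure:
  assumes "radon_punctured \<mu>" "radon_punctured \<nu>" "B \<in> sets \<mu>"
  shows "emeasure (tv_measure \<mu> \<nu>) B = tv_value \<mu> \<nu> B"
proof (rule emeasure_measure_of[OF tv_measure_def])
  show "positive (sets (tv_measure \<mu> \<nu>)) (tv_value \<mu> \<nu>)"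
  proof -
    have "(\<Sum>E\<in>P. ennreal \<bar>measure \<mu> E - measure \<nu> E\<bar>) = 0" if "P \<in> tv_families \<mu> {}" for P
      using that by (intro sum.neutral) (auto simp: tv_families_def)
    then have "tv_value \<mu> \<nu> {} \<le> 0"
      unfolding tv_value_def by (intro SUP_least) simp
    then show ?thesis
      by (simp add: positive_def)
  qed
qed (use assms sets.space_closed in \<open>auto simp: tv_value_countably_additive\<close>)

section \<open>Nonlocal operators and entropy solutions\<close>

definition levy_op_in :: "'a::euclidean_space measure \<Rightarrow> real \<Rightarrow> ('a \<Rightarrow> real) \<Rightarrow> 'a \<Rightarrow> real" where
  "levy_op_in \<mu> r \<phi> x =
     (LINT z:{z. 0 < norm z \<and> norm z \<le> r}|\<mu>.
        \<phi> (x + z) - \<phi> x - (z \<bullet> grad \<phi> x) * indicator {z. norm z \<le> 1} z)"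

definition levy_drift :: "'a::euclidean_space measure \<Rightarrow> real \<Rightarrow> 'a" where
  "levy_drift \<mu> r = - (LINT z:{z. norm z > r}|\<mu>. indicator {z. norm z \<le> 1} z *\<^sub>R z)"

definition levy_op_out :: "'a::euclidean_space measure \<Rightarrow> real \<Rightarrow> ('a \<Rightarrow> real) \<Rightarrow> 'a \<Rightarrow> real" where
  "levy_op_out \<mu> r \<phi> x = (LINT z:{z. norm z > r}|\<mu>. \<phi> (x + z) - \<phi> x)"

definition entropy_flux :: "(real \<Rightarrow> 'a::euclidean_space) \<Rightarrow> real \<Rightarrow> real \<Rightarrow> 'a" where
  "entropy_flux f w k = sgn (w - k) *\<^sub>R (f w - f k)"

definition Q :: "real \<Rightarrow> ('a::euclidean_space \<times> real) set" where
  "Q T = UNIV \<times> {0<..<T}"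

definition C_L1 :: "real \<Rightarrow> ('a::euclidean_space \<times> real \<Rightarrow> real) \<Rightarrow> bool" where
  "C_L1 T u \<longleftrightarrow> (\<forall>t\<in>{0..T}. integrable lborel (\<lambda>x. u (x, t))) \<and>
     (\<forall>s\<in>{0..T}. ((\<lambda>t. LINT x|lborel. \<bar>u (x, t) - u (x, s)\<bar>) \<longlongrightarrow> 0) (at s within {0..T}))"

definition C_L1_norm :: "real \<Rightarrow> ('a::euclidean_space \<times> real \<Rightarrow> real) \<Rightarrow> real" where
  "C_L1_norm T w = (SUP t\<in>{0..T}. LINT x|lborel. \<bar>w (x, t)\<bar>)"

text \<open>The first condition selects a representative that is jointly Borel on the closed time strip
  and whose time slices are those of the curve in \<open>C([0,T]; L\<^sup>1)\<close>; every element of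
  \<open>L\<^sup>\<infinity>(Q\<^sub>T) \<inter> C([0,T]; L\<^sup>1)\<close> has one.\<close>

definition entropy_solution ::
  "real \<Rightarrow> (real \<Rightarrow> 'a::euclidean_space) \<Rightarrow> (real \<Rightarrow> real) \<Rightarrow> 'a measure \<Rightarrow> ('a \<Rightarrow> real)
     \<Rightarrow> ('a \<times> real \<Rightarrow> real) \<Rightarrow> bool" where
  "entropy_solution T f A \<mu> u0 u \<longleftrightarrow>
     u \<in> borel_measurable (restrict_space borel (UNIV \<times> {0..T})) \<and>
     Linf (restrict_space lborel (Q T)) u \<and> C_L1 T u \<and>
     (\<forall>k r \<phi>. r > 0 \<and> Cc_infty \<phi> \<and> (\<forall>p. \<phi> p \<ge> 0) \<longrightarrow>
        (LINT (x, t):Q T|lborel.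
            \<bar>u (x, t) - k\<bar> * deriv (\<lambda>s. \<phi> (x, s)) t
            + (entropy_flux f (u (x, t)) k
                 + \<bar>A (u (x, t)) - A k\<bar> *\<^sub>R levy_drift (dual_measure \<mu>) r)
              \<bullet> grad (\<lambda>y. \<phi> (y, t)) x)
        + (LINT (x, t):Q T|lborel.
            \<bar>A (u (x, t)) - A k\<bar> * levy_op_in (dual_measure \<mu>) r (\<lambda>y. \<phi> (y, t)) x
            + sgn (u (x, t) - k) * levy_op_out \<mu> r (\<lambda>y. A (u (y, t))) x * \<phi> (x, t))
        - (LINT x|lborel. \<bar>u (x, T) - k\<bar> * \<phi> (x, T))
        + (LINT x|lborel. \<bar>u0 x - k\<bar> * \<phi> (x, 0)) \<ge> 0)"

end

theory Submission
 imports Defs "HOL-Probability.Distributions"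
begin

text \<open>Kruzkov's doubling of variables.  In time, averaging over the moving square \<open>[\<tau>, \<tau> + \<delta>]\<^sup>2\<close>
 bounds the growth of the doubled functional by the supremum over all pairs of times of the doubled
 spatial terms.  Comparing a solution with its translates shows that \<open>\<parallel>u(t, \<cdot> + z) - u(t, \<cdot>)\<parallel>\<close> never exceeds
 its initial value, so that only \<open>|u\<^sub>0|\<close> in \<open>BV\<close> enters.  The jumps \<open>z\<close> contribute \<open>X d\<mu> + Y d\<nu>\<close> with
 \<open>X + Y <= 0\<close> and \<open>X, Y <= \<xi>\<close>, hence at most \<open>\<xi> d|\<mu> - \<nu>|\<close>; here \<open>\<xi>\<close> is quadratic in \<open>z\<close> for \<open>|z| <= r\<close>, by a
 second difference of the doubled functional, and the translation modulus of \<open>u\<^sub>0\<close> for \<open>|z| > r\<close>.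
 The kernel is a product of one-dimensional plateaus of half-width \<open>e\<close>, whose translation modulus and first
 moment are \<open>sqrt d |z| / e\<close> and at most \<open>e d sqrt d / (d + 1)\<close>; optimising \<open>e\<close> yields \<open>4d\<^sup>2/(d + 1)\<close>.\<close>

text \<open>The measures may be infinite near the origin, so the entropy inequality is used with a
  cutoff \<open>\<kappa>\<close> unrelated to the \<open>r\<close> of the theorem. Jumps beyond
  \<open>\<kappa>\<close> form finite measures, to which Fubini and a Hahn decomposition apply;
  jumps below it act on the kernel and cost \<open>small_moment \<kappa>\<close> times a constant
  that may be huge for a concentrated kernel. Hence \<open>\<kappa>\<close> tends to 0 while the
  kernel is fixed, and only afterwards is the scale \<open>e\<close> chosen. The contribution of a
  jump becomes quadratic only after its first-order part \<open>z \<bullet> VV\<close> has been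
  split off, which uses up the compensating drift on the ball of radius \<open>r\<close>; the
  operators compensate on the unit ball, and the mismatch is the integral of \<open>z\<close> over
  the annulus. In the second difference one increment falls on u and the other on the kernel, since
  the final bound involves the variation of the first datum alone: this is where
  \<open>norm z / e\<close> enters. Comparison with translates controls directional variations of
  u(t) only, whereas the convective term needs the isotropic variation; averaging over Gaussian
  directions recovers it without loss.\<close>

abbreviation (input) "ind T t \<equiv> indicator {0<..<T} t"
abbreviation (input) "lborel2 \<equiv> lborel \<Otimes>\<^sub>M lborel"
abbreviation (input) "Borel \<equiv> borel_measurable borel"
abbreviation (input) "L1 \<equiv> integrable lborel"
abbreviation (input) lebesgue_nn :: "('a::euclidean_space \<Rightarrow> ennreal) \<Rightarrow> ennreal" (binder \<open>NN \<close> 10)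
  where "lebesgue_nn h \<equiv> nn_integral lborel h"
abbreviation (input) lebesgue_int :: "('a::euclidean_space \<Rightarrow> 'b::{banach, second_countable_topology}) \<Rightarrow> 'b" (binder \<open>LB \<close> 10)
  where "lebesgue_int h \<equiv> integral\<^sup>L lborel h"

lemmas integrable_abs = Bochner_Integration.integrable_abs
  and integrable_add = Bochner_Integration.integrable_add
  and integrable_bound = Bochner_Integration.integrable_bound
  and integrable_diff = Bochner_Integration.integrable_diff
  and integral_add = Bochner_Integration.integral_add
  and integral_cong = Bochner_Integration.integral_cong
  and integral_diff = Bochner_Integration.integral_diff
  and integral_minus = Bochner_Integration.integral_minus
  and integral_mult_right_zero = Bochner_Integration.integral_mult_right_zero
  and integral_sum = Bochner_Integration.integral_sum

subsection \<open>Smooth functions\<close>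

text \<open>Derivatives are obtained from quadratic remainders three times: at the edge of the bump,
  for a kernel, and for a mollified function, where this takes the place of differentiation under
  the integral sign.\<close>

lemma has_derivative_quadI:
 fixes f :: "'a::real_normed_vector => 'b::real_normed_vector"
 assumes L: "bounded_linear L"
  and bd: "!!h. norm (f (x + h) - f x - L h) <= K * (norm h)\<^sup>2"
 shows "(f has_derivative L) (at x)"
 unfolding has_derivative_at
proof (intro conjI L)
 have lim: "((%h::'a. \<bar>K\<bar> * norm h) \<longlongrightarrow> 0) (at 0)"
  by (rule tendsto_mult_right_zero[OF tendsto_norm_zero[OF tendsto_ident_at]])
 show "(%h. norm (f (x + h) - f x - L h) / norm h) \<midarrow>0\<rightarrow> 0"
 proof (rule Lim_null_comparison[OF _ lim])
  show "\<forall>\<^sub>F h in at 0. norm (norm (f (x + h) - f x - L h) / norm h) <= \<bar>K\<bar> * norm h"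
  proof (intro eventuallyI)
   fix h
   have "norm (f (x + h) - f x - L h) <= \<bar>K\<bar> * (norm h)\<^sup>2"
    using bd[of h] by (meson abs_ge_self mult_right_mono order_trans zero_le_power2)
   then show "norm (norm (f (x + h) - f x - L h) / norm h) <= \<bar>K\<bar> * norm h"
    by (cases "h = 0") (auto simp: field_simps power2_eq_square)
  qed
 qed
qed

text \<open>Smoothness is witnessed by one sequence of all derivatives, so affine substitutions and
  linear combinations are treated on the whole sequence at once, without iterating
  \<open>deriv\<close>.\<close>

definition smooth1 :: "(real => real) => bool" where
 "smooth1 g \<longleftrightarrow> (\<exists>G. G (0::nat) = g \<and> (\<forall>n x. (G n has_real_derivative G (Suc n) x) (at x)))"

text \<open>Choosing for each member of the set a derivative in the same set, and iterating the
  choice, yields the witness sequence. The explicit family \<open>bump_fun\<close> is such a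
  set.\<close>

lemma smooth1_coinduct:
 assumes "g \<in> S" and "!!h. h \<in> S ==> \<exists>h'\<in>S. \<forall>x. (h has_real_derivative h' x) (at x)"
 shows "smooth1 g"
proof -
 obtain d where d: "!!h. h \<in> S ==> d h \<in> S \<and> (\<forall>x. (h has_real_derivative d h x) (at x))"
  using assms(2) by metis
 have "(d ^^ n) g \<in> S" for n
  by (induction n) (use assms(1) d in auto)
 then show ?thesis
  unfolding smooth1_def using d by (intro exI[of _ "%n. (d ^^ n) g"]) auto
qed

lemma smooth1_derivE:
 assumes "smooth1 g"
 obtains g' where "smooth1 g'" "!!x. (g has_real_derivative g' x) (at x)"
proof -
 obtain G where G: "G (0::nat) = g" "!!n x. (G n has_real_derivative G (Suc n) x) (at x)"
  using assms by (auto simp: smooth1_def)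
 have "smooth1 (G 1)"
  unfolding smooth1_def using G by (intro exI[of _ "%n. G (Suc n)"]) auto
 moreover have "(g has_real_derivative G 1 x) (at x)" for x
  using G(2)[of 0] G(1) by simp
 ultimately show ?thesis by (rule that)
qed

lemma smooth1_primitive:
 assumes "smooth1 h" "!!x. (g has_real_derivative h x) (at x)"
 shows "smooth1 g"
proof -
 obtain G where G: "G (0::nat) = h" "!!n x. (G n has_real_derivative G (Suc n) x) (at x)"
  using assms by (auto simp: smooth1_def)
 show ?thesis
  unfolding smooth1_def using G assms(2)
  by (intro exI[of _ "%n. case n of 0 => g | Suc n => G n"]) (auto split: nat.splits)
qed

lemma smooth1_affine:
 assumes "smooth1 g" shows "smooth1 (%x. g (a * x + c))"
proof -
 obtain G where G: "G (0::nat) = g" "!!n x. (G n has_real_derivative G (Suc n) x) (at x)"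
  using assms by (auto simp: smooth1_def)
 have "((%x. a ^ n * G n (a * x + c)) has_real_derivative a ^ Suc n * G (Suc n) (a * x + c)) (at x)"
  for n x
  by (auto intro!: derivative_eq_intros DERIV_chain2[OF G(2)])
 then show ?thesis
  unfolding smooth1_def using G(1) by (intro exI[of _ "%n x. a ^ n * G n (a * x + c)"]) auto
qed

lemma smooth1_lincomb:
 assumes "smooth1 g" "smooth1 h" shows "smooth1 (%x. a * g x + b * h x)"
proof -
 obtain G where G: "G (0::nat) = g" "!!n x. (G n has_real_derivative G (Suc n) x) (at x)"
  using assms by (auto simp: smooth1_def)
 obtain H where H: "H (0::nat) = h" "!!n x. (H n has_real_derivative H (Suc n) x) (at x)"
  using assms by (auto simp: smooth1_def)
 have "((%x. a * G n x + b * H n x) has_real_derivative a * G (Suc n) x + b * H (Suc n) x) (at x)"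
  for n x
  by (auto intro!: derivative_eq_intros G(2) H(2))
 then show ?thesis
  unfolding smooth1_def using G(1) H(1) by (intro exI[of _ "%n x. a * G n x + b * H n x"]) auto
qed

lemma smooth1_const: "smooth1 (%x. c)"
 unfolding smooth1_def
 by (intro exI[of _ "%n x. if n = 0 then c else 0"]) auto

lemma smooth1_continuous: "smooth1 g ==> continuous_on S g"
 by (erule smooth1_derivE) (blast intro: DERIV_continuous_on DERIV_subset)

lemma smooth1_measurable [measurable_dest]: "smooth1 g ==> g \<in> Borel"
 by (intro borel_measurable_continuous_onI smooth1_continuous)

text \<open>The derivatives of \<open>exp (-1 / (1 - x\<^sup>2))\<close> have the form \<open>bump_fun R n\<close>.\<close>

definition bump_fun :: "real poly => nat => real => real" where
 "bump_fun R n x = (if \<bar>x\<bar> < 1 then poly R x * inverse (1 - x\<^sup>2) ^ n * exp (- inverse (1 - x\<^sup>2)) else 0)"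

text \<open>With w = 1 - x^2 the factor exp (-1/w) beats every inverse power: the term of order n +
  2 of the exponential series gives w^-n exp (-1/w) <= (n + 2)! w^2, and w <= 2 |x - y| when |x| < 1
  <= |y|. A quadratic bound is exactly what \<open>has_derivative_quadI\<close> asks for at and
  beyond the edge.\<close>

lemma bump_fun_bound:
 obtains K where "!!x y. 1 <= \<bar>y\<bar> ==> \<bar>bump_fun R n x\<bar> <= K * (x - y)\<^sup>2" "K \<ge> 0"
proof -
 obtain C where C: "!!x. x \<in> {-1..1} ==> \<bar>poly R x\<bar> <= C"
 proof -
  have "compact (poly R ` {-1..1})"
   by (intro compact_continuous_image continuous_intros) auto
  then show ?thesis
   using that by (metis bounded_iff compact_imp_bounded imageI real_norm_def)
 qed
 have C0: "0 <= C" using C[of 0] by simp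
 have "\<bar>bump_fun R n x\<bar> <= (4 * C * fact (n + 2)) * (x - y)\<^sup>2" if y: "1 <= \<bar>y\<bar>" for x y
 proof (cases "\<bar>x\<bar> < 1")
  case True
  define w where "w = 1 - x\<^sup>2"
  have w: "0 < w"
   using True by (simp add: w_def abs_square_less_1)
  have "w = (1 - \<bar>x\<bar>) * (1 + \<bar>x\<bar>)"
   by (simp add: w_def algebra_simps power2_eq_square)
  also have "... <= \<bar>x - y\<bar> * 2"
   using True y by (intro mult_mono) auto
  finally have wle: "w\<^sup>2 <= 4 * (x - y)\<^sup>2"
   using w power_mono[of w "\<bar>x - y\<bar> * 2" 2] by (simp add: power_mult_distrib)
  have "(\<Sum>k\<in>{n + 2}. (1 / w) ^ k /\<^sub>R fact k) <= exp (1 / w)"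
   unfolding exp_def using w by (intro sum_le_suminf summable_exp_generic) auto
  then have "(1 / w) ^ (n + 2) / fact (n + 2) <= exp (1 / w)"
   by (simp add: divide_inverse mult.commute del: fact_Suc)
  then have "1 <= exp (1 / w) * (fact (n + 2) * w ^ (n + 2))"
   using w by (simp add: power_divide pos_divide_le_eq mult_ac del: fact_Suc power_Suc)
  then have "exp (- inverse w) <= fact (n + 2) * w ^ (n + 2)"
   by (simp add: exp_minus divide_inverse[symmetric] inverse_eq_divide pos_divide_le_eq mult_ac del: fact_Suc power_Suc)
  then have "inverse w ^ n * exp (- inverse w) <= inverse w ^ n * (fact (n + 2) * w ^ (n + 2))"
   using w by (intro mult_left_mono) auto
  also have "... = fact (n + 2) * w\<^sup>2"
   using w by (simp add: power_add power_inverse power2_eq_square field_simps del: fact_Suc)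
  finally have e: "inverse w ^ n * exp (- inverse w) <= fact (n + 2) * w\<^sup>2" .
  have "\<bar>bump_fun R n x\<bar> = \<bar>poly R x\<bar> * (inverse w ^ n * exp (- inverse w))"
   using True w by (simp add: bump_fun_def w_def[symmetric] abs_mult del: fact_Suc)
  also have "... <= C * (fact (n + 2) * w\<^sup>2)"
   using C[of x] True w C0 by (intro mult_mono[OF _ e]) (auto simp: abs_less_iff)
  also have "... <= C * (fact (n + 2) * (4 * (x - y)\<^sup>2))"
   using wle C0 by (intro mult_left_mono) auto
  finally show ?thesis by (simp only: mult_ac)
 qed (use C0 in \<open>auto simp: bump_fun_def\<close>)
 then show ?thesis using C0 by (intro that[of "4 * C * fact (n + 2)"]) auto
qed

text \<open>With v = 1 / (1 - x^2) one has v' = 2 x v^2. The three product-rule terms are brought to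
  the common power v^(n + 2) by inserting factors (1 - x^2) v = 1, which explains the occurrences of
  \<open>[:1, 0, -1:]\<close>. At |x| >= 1 the derivative 0 comes from
  \<open>bump_fun_bound\<close>.\<close>

lemma bump_fun_deriv:
 "(bump_fun R n has_real_derivative
   bump_fun (pderiv R * [:1, 0, -1:] ^ 2 + smult (2 * of_nat n) ([:0, 1:] * R * [:1, 0, -1:]) - [:0, 2:] * R)
    (n + 2) x) (at x)"
proof (cases "\<bar>x\<bar> < 1")
 case True
 have w: "1 - x\<^sup>2 > 0" using True by (simp add: abs_square_less_1)
 define v where "v = inverse (1 - x\<^sup>2)"
 have bf: "bump_fun P k x = poly P x * v ^ k * exp (- v)" for P k
  using True by (simp add: bump_fun_def v_def)
 have wv: "(1 - x\<^sup>2) * v = 1" using w by (simp add: v_def)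
 have dv: "((%x. inverse (1 - x\<^sup>2)) has_real_derivative 2 * x * v\<^sup>2) (at x)"
  using w by (auto intro!: derivative_eq_intros simp: v_def power2_eq_square)
 have vn: "real n * (2 * x * v\<^sup>2 * v ^ (n - 1)) = real n * 2 * x * v ^ (n + 1)"
  by (cases n) (auto simp: power2_eq_square)
 have "((%x. poly R x * inverse (1 - x\<^sup>2) ^ n * exp (- inverse (1 - x\<^sup>2))) has_real_derivative
   (poly (pderiv R) x * v ^ n + poly R x * (real n * 2 * x * v ^ (n + 1)) - poly R x * v ^ n * (2 * x * v\<^sup>2)) * exp (- v)) (at x)"
  unfolding mult.assoc
  by (rule DERIV_cong[OF DERIV_mult[OF poly_DERIV DERIV_mult[OF DERIV_power[OF dv] DERIV_fun_exp[OF DERIV_minus[OF dv]]]]])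
    (use vn in \<open>auto simp: v_def[symmetric] algebra_simps\<close>)
 also have "(poly (pderiv R) x * v ^ n + poly R x * (real n * 2 * x * v ^ (n + 1)) - poly R x * v ^ n * (2 * x * v\<^sup>2)) * exp (- v)
   = (poly (pderiv R) x * ((1 - x\<^sup>2) * v)\<^sup>2 * v ^ n
    + poly R x * (real n * 2 * x * v ^ n * v * ((1 - x\<^sup>2) * v)) - poly R x * v ^ n * (2 * x * v\<^sup>2)) * exp (- v)"
  unfolding wv by simp
 also have "... = bump_fun (pderiv R * [:1, 0, -1:] ^ 2 + smult (2 * of_nat n) ([:0, 1:] * R * [:1, 0, -1:]) - [:0, 2:] * R)
    (n + 2) x"
  unfolding bf by (simp add: power_add power2_eq_square algebra_simps)
 finally have "((%x. poly R x * inverse (1 - x\<^sup>2) ^ n * exp (- inverse (1 - x\<^sup>2))) has_real_derivative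
   bump_fun (pderiv R * [:1, 0, -1:] ^ 2 + smult (2 * of_nat n) ([:0, 1:] * R * [:1, 0, -1:]) - [:0, 2:] * R)
    (n + 2) x) (at x)" .
 then show ?thesis
 proof (rule DERIV_cong_ev[THEN iffD1, rotated -1])
  have "\<forall>\<^sub>F x in nhds x. x \<in> {-1<..<1}"
   using True by (intro eventually_nhds_in_open) (auto simp: abs_less_iff)
  then show "\<forall>\<^sub>F x in nhds x. poly R x * inverse (1 - x\<^sup>2) ^ n * exp (- inverse (1 - x\<^sup>2)) = bump_fun R n x"
   by eventually_elim (auto simp: bump_fun_def)
 qed auto
next
 case False
 obtain K where K: "!!x y. 1 <= \<bar>y\<bar> ==> \<bar>bump_fun R n x\<bar> <= K * (x - y)\<^sup>2"
  using bump_fun_bound by blast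
 have z: "bump_fun P k x = 0" for P k using False by (simp add: bump_fun_def)
 have "(bump_fun R n has_derivative (%h. 0)) (at x)"
 proof (rule has_derivative_quadI)
  show "norm (bump_fun R n (x + h) - bump_fun R n x - 0) <= K * (norm h)\<^sup>2" for h
   using K[of x "x + h"] False by (simp add: z)
 qed simp
 then show ?thesis
  by (simp add: has_field_derivative_def z lambda_zero)
qed

lemma smooth1_bump_fun: "smooth1 (bump_fun R n)"
 by (rule smooth1_coinduct[of _ "{bump_fun R n | R n. True}"])
   (auto intro!: bexI[OF _ CollectI] bump_fun_deriv)

text \<open>The normalised primitive of the bump exp (-1 / (1 - x^2)). It is the profile of the
  plateau kernels, the test function for weak derivatives and the cutoff in time.\<close>

lemma smooth_step_exists:
 obtains S s where "smooth1 S" "smooth1 s"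
  "!!x. (S has_real_derivative s x) (at x)" "!!x. 0 <= s x" "!!x. 1 <= \<bar>x\<bar> ==> s x = 0"
  "!!x. x <= -1 ==> S x = 0" "!!x. 1 <= x ==> S x = 1" "mono S"
  "!!x. 0 <= S x" "!!x. S x <= 1"
proof -
 let ?p = "bump_fun 1 0"
 have "continuous_on UNIV ?p" by (rule smooth1_continuous[OF smooth1_bump_fun])
 then obtain F where F: "!!x. (F has_real_derivative ?p x) (at x)"
  using einterval_antiderivative[of "-\<infinity>" \<infinity> ?p]
  by (auto simp: has_real_derivative_iff_has_vector_derivative continuous_on_eq_continuous_at)
 have p0: "0 <= ?p x" for x by (simp add: bump_fun_def)
 have pz: "?p x = 0" if "1 <= \<bar>x\<bar>" for x using that by (simp add: bump_fun_def)
 have mono: "F x <= F y" if "x <= y" for x y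
  using F p0 that by (intro DERIV_nonneg_imp_nondecreasing[of x y F]) auto
 have strict: "F (-1) < F 1"
 proof -
  have "F (-1) <= F (-1/2)" "F (1/2) <= F 1" by (auto intro!: mono)
  moreover have "F (-1/2) < F (1/2)"
   using F by (intro DERIV_pos_imp_increasing[of "-1/2" "1/2" F]) (force simp: bump_fun_def)+
  ultimately show ?thesis by simp
 qed
 have left: "F x = F (-1)" if "x <= -1" for x
 proof (cases "x = -1")
  case False
  then have "x < -1" using that by simp
  then obtain z where "x < z" "z < -1" "F (-1) - F x = (-1 - x) * ?p z"
   using MVT2[of x "-1" F ?p] F by auto
  then show ?thesis using pz[of z] by simp
 qed simp
 have right: "F x = F 1" if "1 <= x" for x
 proof (cases "x = 1")
  case False
  then have "1 < x" using that by simp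
  then obtain z where "1 < z" "z < x" "F x - F 1 = (x - 1) * ?p z"
   using MVT2[of 1 x F ?p] F by auto
  then show ?thesis using pz[of z] by simp
 qed simp
 define c where "c = F 1 - F (-1)"
 define S where "S x = (F x - F (-1)) / c" for x
 define s where "s x = ?p x / c" for x
 have c: "c > 0" using strict by (simp add: c_def)
 have ss: "smooth1 s"
  using smooth1_lincomb[OF smooth1_bump_fun[of 1 0] smooth1_const[of 0], of "1/c" 0]
  by (simp add: s_def[abs_def])
 have d: "(S has_real_derivative s x) (at x)" for x
  unfolding S_def s_def using c by (auto intro!: derivative_eq_intros F)
 have m: "mono S"
  unfolding S_def using c by (intro monoI divide_right_mono diff_right_mono mono) auto
 have S0: "S x = 0" if "x <= -1" for x using left[OF that] by (simp add: S_def)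
 have S1: "S x = 1" if "1 <= x" for x using right[OF that] c by (simp add: S_def c_def)
 have b: "0 <= S x" "S x <= 1" for x
  using monoD[OF m, of "min x (-1)" x] S0[of "min x (-1)"] monoD[OF m, of x "max x 1"] S1[of "max x 1"]
  by auto
 show ?thesis
  by (rule that[OF smooth1_primitive[OF ss d] ss d _ _ S0 S1 m b])
    (use c p0 pz in \<open>auto simp: s_def\<close>)
qed

section \<open>Plateau kernels on the line\<close>

lemma nn_integral_step_deriv:
 assumes "smooth1 s" "!!x. (S has_real_derivative s x) (at x)" "!!x. 0 <= s x"
  "!!x. 1 <= \<bar>x\<bar> ==> s x = 0" "!!x. x <= -1 ==> S x = 0" "!!x. 1 <= x ==> S x = (1::real)"
 shows "(NN x. ennreal (s x)) = 1"
proof -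
 have [measurable]: "s \<in> Borel" using assms(1) by (rule smooth1_measurable)
 have "(NN x. ennreal (s x)) = (NN x. ennreal (s x) * indicator {-1..1} x)"
  by (intro nn_integral_cong) (use assms(4) in \<open>auto simp: indicator_def\<close>)
 also have "... = ennreal (S 1 - S (-1))"
  by (rule nn_integral_FTC_Icc) (use assms in auto)
 finally show ?thesis using assms by simp
qed

text \<open>For h >= 0 the increment is the integral of \<open>s\<close> over an interval of length
  h, and Tonelli applies; for h < 0 the substitution x to x - h reduces to the positive
  case.\<close>

lemma nn_integral_translate_diff:
 fixes s S :: "real => real"
 assumes [measurable]: "s \<in> Borel"
  and d: "!!x. (S has_real_derivative s x) (at x)" and s0: "!!x. 0 <= s x"
 shows "(NN x. ennreal \<bar>S (x + h) - S x\<bar>) <= ennreal \<bar>h\<bar> * (NN x. ennreal (s x))"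
proof -
 have cS: "continuous_on UNIV S" by (rule DERIV_continuous_on[OF DERIV_subset[OF d]]) auto
 then have [measurable]: "S \<in> Borel" by (rule borel_measurable_continuous_onI)
 have pos: "(NN x. ennreal \<bar>S (x + h) - S x\<bar>) <= ennreal h * (NN x. ennreal (s x))"
  if h: "0 <= h" for h
 proof -
  have mono: "S x <= S (x + h)" for x
   using d s0 h by (intro DERIV_nonneg_imp_nondecreasing[of x "x + h" S]) auto
  have "ennreal \<bar>S (x + h) - S x\<bar> = (NN r. ennreal (s (x + r)) * indicator {0..h} r)" for x
  proof -
   have "(NN r. ennreal (s (x + r)) * indicator {0..h} r) = ennreal (S (x + h) - S (x + 0))"
   proof (rule nn_integral_FTC_Icc)
    show "((%a. S (x + a)) has_real_derivative s (x + r)) (at r)" for r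
     using DERIV_shift[THEN iffD1, of S "s (x + r)" r x] d by (simp add: add.commute)
   qed (use h s0 in auto)
   then show ?thesis using mono[of x] by simp
  qed
  then have "(NN x. ennreal \<bar>S (x + h) - S x\<bar>)
    = (NN x. (NN r. ennreal (s (x + r)) * indicator {0..h} r))" by simp
  also have "... = (NN r. (NN x. ennreal (s (r + x)) * indicator {0..h} r))"
   by (subst lborel_pair.Fubini') (auto simp: add.commute)
  also have "... = (NN r. (NN x. ennreal (s x)) * indicator {0..h} r)"
  proof (intro nn_integral_cong)
   fix r
   have "(NN x. ennreal (s (r + x)) * indicator {0..h} r)
     = (NN x. ennreal (s (r + x))) * indicator {0..h} r"
    by (subst nn_integral_multc) auto
   also have "(NN x. ennreal (s (r + x))) = (NN x. ennreal (s x))"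
    using nn_integral_real_affine[of "%x. ennreal (s x)" 1 r] by simp
   finally show "(NN x. ennreal (s (r + x)) * indicator {0..h} r)
     = (NN x. ennreal (s x)) * indicator {0..h} r" .
  qed
  also have "... = (NN x. ennreal (s x)) * ennreal h"
   using h by (subst nn_integral_cmult) auto
  finally show ?thesis by (simp add: mult.commute)
 qed
 show ?thesis
 proof (cases "0 <= h")
  case True then show ?thesis using pos[of h] by simp
 next
  case False
  have "(NN x. ennreal \<bar>S (x + h) - S x\<bar>) = (NN x. ennreal \<bar>S (- h + x + h) - S (- h + x)\<bar>)"
   using nn_integral_real_affine[of "%x. ennreal \<bar>S (x + h) - S x\<bar>" 1 "-h"] by simp
  also have "... = (NN x. ennreal \<bar>S (x + - h) - S x\<bar>)"
   by (simp add: abs_minus_commute add.commute)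
  finally show ?thesis using pos[of "-h"] False by simp
 qed
qed

text \<open>The translation modulus 2 |h| does not see the width e' - e of the transition zones: a
  rising and a falling unit step each have total variation 1, however steep they are.\<close>

lemma plateau_exists:
 assumes e: "0 < e" "e < e'"
 obtains b where "smooth1 b" "!!x. 0 <= b x" "!!x. b x <= 1" "!!x. \<bar>x\<bar> <= e ==> b x = 1"
  "!!x. e' <= \<bar>x\<bar> ==> b x = 0" "!!x. b (- x) = b x"
  "!!h. (NN x. ennreal \<bar>b (x + h) - b x\<bar>) <= ennreal (2 * \<bar>h\<bar>)"
proof -
 obtain S s where S: "smooth1 S" "smooth1 s"
  "!!x. (S has_real_derivative s x) (at x)" "!!x. 0 <= s x" "!!x. 1 <= \<bar>x\<bar> ==> s x = 0"
  "!!x. x <= -1 ==> S x = 0" "!!x. 1 <= x ==> S x = 1" "mono S"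
  "!!x. 0 <= S x" "!!x. S x <= 1"
  by (rule smooth_step_exists) blast
 have [measurable]: "S \<in> Borel" "s \<in> Borel"
  using S by (auto intro: smooth1_measurable)
 define m k where "m = (e + e') / 2" and "k = (e' - e) / 2"
 have k: "0 < k" "k < m" "m - k = e" "m + k = e'" using e by (auto simp: m_def k_def field_simps)
 \<comment> \<open>A sum of two opposite steps minus 1, not their product, so that translation
   differences split additively. With m the midpoint and k half the width, the transitions occupy e
   <= |x| <= e'.\<close>
 define b where "b x = S ((m + x) / k) + S ((m - x) / k) - 1" for x
 have sym: "b (- x) = b x" for x by (simp add: b_def)
 have big: "S ((m + x) / k) = 1" if "0 <= x" for x
  using that k by (intro S(7)) (auto simp: field_simps)
 have b_abs: "b x = S ((m - \<bar>x\<bar>) / k)" for x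
  using big[of "\<bar>x\<bar>"] sym[of x] by (cases "0 <= x") (auto simp: b_def)
 have smS: "smooth1 (%x. S ((m + x) / k))" "smooth1 (%x. S ((m - x) / k))"
  using smooth1_affine[OF S(1), of "1/k" "m/k"] smooth1_affine[OF S(1), of "-1/k" "m/k"]
  by (simp_all add: add_divide_distrib diff_divide_distrib add.commute)
 have smb: "smooth1 b"
  using smooth1_lincomb[OF smooth1_lincomb[OF smS, of 1 1] smooth1_const[of 1], of 1 "-1"]
  by (simp add: b_def[abs_def])
 have int1: "(NN x. ennreal (s x)) = 1"
  by (rule nn_integral_step_deriv[OF S(2-7)])
 have tr: "(NN x. ennreal \<bar>S (x + h) - S x\<bar>) <= ennreal \<bar>h\<bar>" for h
  using nn_integral_translate_diff[of s S h] S int1 by simp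
 have aff: "(NN x. ennreal \<bar>S ((m + c * (x + h)) / k) - S ((m + c * x) / k)\<bar>) <= ennreal \<bar>h\<bar>"
  if c: "\<bar>c\<bar> = 1" for c h
 proof -
  have c0: "c / k \<noteq> 0" using c k by auto
  let ?g = "%y. ennreal \<bar>S (y + c * h / k) - S y\<bar>"
  have "(NN x. ?g (m / k + c / k * x)) = ennreal k * (ennreal \<bar>c / k\<bar> * (NN x. ?g (m / k + c / k * x)))"
   using c k by (simp add: mult.assoc[symmetric] ennreal_mult[symmetric])
  also have "... = ennreal k * (NN y. ?g y)"
   using nn_integral_real_affine[of ?g "c/k" "m/k"] c0 by simp
  also have "... <= ennreal k * ennreal \<bar>c * h / k\<bar>"
   by (intro mult_left_mono tr) auto
  also have "... = ennreal \<bar>h\<bar>"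
   using c k by (simp add: ennreal_mult[symmetric] abs_mult)
  finally show ?thesis by (simp add: add_divide_distrib algebra_simps)
 qed
 have var: "(NN x. ennreal \<bar>b (x + h) - b x\<bar>) <= ennreal (2 * \<bar>h\<bar>)" for h
 proof -
  have "(NN x. ennreal \<bar>b (x + h) - b x\<bar>)
   <= (NN x. ennreal \<bar>S ((m + 1 * (x + h)) / k) - S ((m + 1 * x) / k)\<bar>
      + ennreal \<bar>S ((m + (-1) * (x + h)) / k) - S ((m + (-1) * x) / k)\<bar>)"
  proof (intro nn_integral_mono)
   fix x
   have "\<bar>b (x + h) - b x\<bar> <= \<bar>S ((m + 1 * (x + h)) / k) - S ((m + 1 * x) / k)\<bar>
      + \<bar>S ((m + (-1) * (x + h)) / k) - S ((m + (-1) * x) / k)\<bar>"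
    unfolding b_def by (simp add: algebra_simps)
   then show "ennreal \<bar>b (x + h) - b x\<bar> <= ennreal \<bar>S ((m + 1 * (x + h)) / k) - S ((m + 1 * x) / k)\<bar>
      + ennreal \<bar>S ((m + (-1) * (x + h)) / k) - S ((m + (-1) * x) / k)\<bar>"
    by (subst ennreal_plus[symmetric]) (auto intro!: ennreal_leI simp del: ennreal_plus)
  qed
  also have "... = (NN x. ennreal \<bar>S ((m + 1 * (x + h)) / k) - S ((m + 1 * x) / k)\<bar>)
      + (NN x. ennreal \<bar>S ((m + (-1) * (x + h)) / k) - S ((m + (-1) * x) / k)\<bar>)"
   by (rule nn_integral_add) auto
  also have "... <= ennreal \<bar>h\<bar> + ennreal \<bar>h\<bar>"
   by (intro add_mono aff) auto
  finally show ?thesis by (simp add: ennreal_plus[symmetric] del: ennreal_plus)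
 qed
 show ?thesis
 proof (rule that[OF smb _ _ _ _ sym var])
  show "b x = 1" if "\<bar>x\<bar> <= e" for x
   unfolding b_abs using that k by (intro S(7)) (auto simp: field_simps)
  show "b x = 0" if "e' <= \<bar>x\<bar>" for x
   unfolding b_abs using that k by (intro S(6)) (auto simp: field_simps)
 qed (use S in \<open>auto simp: b_abs\<close>)
qed

text \<open>The plateau has mass I >= 2 e because it equals 1 on [-e, e]; dividing by I gives height
  at most 1 / (2 e) and modulus 2 |h| / I <= |h| / e. The slightly larger support is the price of
  smoothness and disappears when \<open>\<eta>\<close> tends to 0 in
  \<open>optimise_scale\<close>.\<close>

lemma kernel1_exists:
 assumes e: "0 < e" "e < e'"
 obtains b where "smooth1 b" "!!x. 0 <= b x" "!!x. b x <= 1 / (2 * e)"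
  "!!x. e' <= \<bar>x\<bar> ==> b x = 0" "!!x. b (- x) = b x" "(NN x. ennreal (b x)) = 1"
  "!!h. (NN x. ennreal \<bar>b (x + h) - b x\<bar>) <= ennreal (\<bar>h\<bar> / e)"
proof -
 obtain b where b: "smooth1 b" "!!x. 0 <= b x" "!!x. b x <= 1" "!!x. \<bar>x\<bar> <= e ==> b x = 1"
  "!!x. e' <= \<bar>x\<bar> ==> b x = 0" "!!x. b (- x) = b x"
  "!!h. (NN x. ennreal \<bar>b (x + h) - b x\<bar>) <= ennreal (2 * \<bar>h\<bar>)"
  using plateau_exists[OF e] by blast
 have [measurable]: "b \<in> Borel" using b(1) by (rule smooth1_measurable)
 have up: "(NN x. ennreal (b x)) <= ennreal (2 * e')"
 proof -
  have "(NN x. ennreal (b x)) <= (NN x. indicator {-e'..e'} x)"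
   by (intro nn_integral_mono) (use b(3,5) in \<open>auto simp: indicator_def\<close>)
  then show ?thesis using e by simp
 qed
 have lo: "ennreal (2 * e) <= (NN x. ennreal (b x))"
 proof -
  have "(NN x. indicator {-e..e} x) <= (NN x. ennreal (b x))"
   by (intro nn_integral_mono) (use b(4) in \<open>auto simp: indicator_def\<close>)
  then show ?thesis using e by simp
 qed
 obtain I where I: "(NN x. ennreal (b x)) = ennreal I" "0 <= I"
  using up by (cases "(NN x. ennreal (b x))") (auto simp: top_unique)
 have I2: "2 * e <= I" using lo e I by simp
 have sc: "ennreal (y / I) = ennreal (1 / I) * ennreal y" if "0 <= y" for y
  using that I2 e by (simp add: ennreal_mult[symmetric])
 show ?thesis
 proof (rule that[of "%x. b x / I"])
  show "smooth1 (%x. b x / I)"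
   using smooth1_lincomb[OF b(1) smooth1_const[of 0], of "1/I" 0] by simp
  show "b x / I <= 1 / (2 * e)" for x
   using b(2,3)[of x] I2 e by (intro frac_le) auto
  show "(NN x. ennreal (b x / I)) = 1"
   unfolding sc[OF b(2)] using I I2 e by (simp add: nn_integral_cmult ennreal_mult[symmetric])
  show "(NN x. ennreal \<bar>b (x + h) / I - b x / I\<bar>) <= ennreal (\<bar>h\<bar> / e)" for h
  proof -
   have "(NN x. ennreal \<bar>b (x + h) / I - b x / I\<bar>) = ennreal (1 / I) * (NN x. ennreal \<bar>b (x + h) - b x\<bar>)"
    unfolding sc[OF abs_ge_zero, symmetric]
    using I2 e by (subst nn_integral_cmult[symmetric])
     (auto simp: diff_divide_distrib[symmetric] abs_divide ennreal_mult[symmetric])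
   also have "... <= ennreal (1 / I) * ennreal (2 * \<bar>h\<bar>)" by (intro mult_left_mono b(7)) auto
   also have "... = ennreal (2 * \<bar>h\<bar> / I)" using I2 e by (simp add: ennreal_mult[symmetric])
   also have "... <= ennreal (2 * \<bar>h\<bar> / (2 * e))" using I2 e by (intro ennreal_leI frac_le) auto
   finally show ?thesis by simp
  qed
 qed (use b I2 e in auto)
qed


subsection \<open>Products of one-dimensional functions\<close>

text \<open>A partial derivative differentiates a single factor, so this class is closed under
  partial derivatives as soon as \<open>S\<close> is closed under differentiation. \<open>Ck\<close>
  for every order then follows by induction.\<close>

definition coord_prods :: "(real => real) set => ('a::euclidean_space => real) set" where
 "coord_prods S = {%p. \<Prod>b\<in>Basis. G b (p \<bullet> b) | G. \<forall>b\<in>Basis. G b \<in> S}"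

lemma coord_prods_has_derivative:
 assumes "\<phi> \<in> coord_prods S" and S: "!!h. h \<in> S ==> \<exists>h'\<in>S. \<forall>x. (h has_real_derivative h' x) (at x)"
 obtains \<psi> where "!!b. b \<in> Basis ==> \<psi> b \<in> coord_prods S"
  "!!x. (\<phi> has_derivative (%h. \<Sum>b\<in>Basis. (h \<bullet> b) * \<psi> b x)) (at x)"
proof -
 obtain G where G: "\<phi> = (%p. \<Prod>b\<in>Basis. G b (p \<bullet> b))" "!!b. b \<in> Basis ==> G b \<in> S"
  using assms(1) by (auto simp: coord_prods_def)
 obtain D where D: "!!h. h \<in> S ==> D h \<in> S \<and> (\<forall>x. (h has_real_derivative D h x) (at x))"
  using S by metis
 define \<psi> where "\<psi> b = (%p. \<Prod>j\<in>Basis. (if j = b then D (G b) else G j) (p \<bullet> j))" for b :: 'a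
 show ?thesis
 proof (rule that)
  show "\<psi> b \<in> coord_prods S" if "b \<in> Basis" for b
   unfolding \<psi>_def coord_prods_def using G(2) D that
   by (intro CollectI exI[of _ "%j. if j = b then D (G b) else G j"]) auto
  show "(\<phi> has_derivative (%h. \<Sum>b\<in>Basis. (h \<bullet> b) * \<psi> b x)) (at x)" for x
  proof -
   have "((%p. G b (p \<bullet> b)) has_derivative (%h. (h \<bullet> b) * D (G b) (x \<bullet> b))) (at x)" if "b \<in> Basis" for b
   proof (rule DERIV_compose_FDERIV[of "G b"])
    show "((%p. p \<bullet> b) has_derivative (%h. h \<bullet> b)) (at x)"
     by (intro bounded_linear_imp_has_derivative bounded_linear_inner_left)
   qed (use D[OF G(2)[OF that]] in auto)
   then have "(\<phi> has_derivative (%h. \<Sum>b\<in>Basis. (h \<bullet> b) * D (G b) (x \<bullet> b) * (\<Prod>j\<in>Basis - {b}. G j (x \<bullet> j)))) (at x)"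
    unfolding G(1) by (rule has_derivative_prod)
   also have "(%h. \<Sum>b\<in>Basis. (h \<bullet> b) * D (G b) (x \<bullet> b) * (\<Prod>j\<in>Basis - {b}. G j (x \<bullet> j)))
     = (%h. \<Sum>b\<in>Basis. (h \<bullet> b) * \<psi> b x)"
   proof (intro ext sum.cong refl)
    fix h b assume b: "b \<in> (Basis :: 'a set)"
    have "\<psi> b x = D (G b) (x \<bullet> b) * (\<Prod>j\<in>Basis - {b}. (if j = b then D (G b) else G j) (x \<bullet> j))"
     unfolding \<psi>_def using b by (subst prod.remove[of _ b]) auto
    also have "(\<Prod>j\<in>Basis - {b}. (if j = b then D (G b) else G j) (x \<bullet> j)) = (\<Prod>j\<in>Basis - {b}. G j (x \<bullet> j))"
     by (intro prod.cong) auto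
    finally show "(h \<bullet> b) * D (G b) (x \<bullet> b) * (\<Prod>j\<in>Basis - {b}. G j (x \<bullet> j)) = (h \<bullet> b) * \<psi> b x"
     by simp
   qed
   finally show ?thesis .
  qed
 qed
qed

lemma Ck_coord_prods:
 assumes S: "!!h. h \<in> S ==> \<exists>h'\<in>S. \<forall>x. (h has_real_derivative h' x) (at x)"
 shows "\<phi> \<in> coord_prods S ==> Ck k \<phi>"
proof (induction k arbitrary: \<phi>)
 case 0
 obtain \<psi> where d: "!!x. (\<phi> has_derivative (%h. \<Sum>b\<in>Basis. (h \<bullet> b) * \<psi> b x)) (at x)"
  using coord_prods_has_derivative[OF 0 S] by metis
 then show ?case
  by (auto intro!: continuous_at_imp_continuous_on has_derivative_continuous[OF d])
next
 case (Suc k)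
 obtain \<psi> where p: "!!b. b \<in> Basis ==> \<psi> b \<in> coord_prods S"
  and d: "!!x. (\<phi> has_derivative (%h. \<Sum>b\<in>Basis. (h \<bullet> b) * \<psi> b x)) (at x)"
  using coord_prods_has_derivative[OF Suc.prems S] by metis
 have "(%x. frechet_derivative \<phi> (at x) b) = \<psi> b" if "b \<in> Basis" for b
 proof
  fix x
  have "frechet_derivative \<phi> (at x) = (%h. \<Sum>b\<in>Basis. (h \<bullet> b) * \<psi> b x)"
   using d by (rule frechet_derivative_at[symmetric])
  then show "frechet_derivative \<phi> (at x) b = \<psi> b x"
   using that by (simp add: inner_Basis if_distrib if_distribR sum.delta cong: if_cong)
 qed
 then show ?case
  using Suc.IH p by (auto intro!: differentiableI[OF d])
qed

definition smooth_supp :: "real => (real => real) set" where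
 "smooth_supp m = {g. smooth1 g \<and> (\<forall>x. m < \<bar>x\<bar> \<longrightarrow> g x = 0)}"

lemma smooth_supp_closed:
 assumes "h \<in> smooth_supp m" shows "\<exists>h'\<in>smooth_supp m. \<forall>x. (h has_real_derivative h' x) (at x)"
proof -
 obtain h' where h': "smooth1 h'" "!!x. (h has_real_derivative h' x) (at x)"
  using assms by (auto simp: smooth_supp_def elim: smooth1_derivE)
 have "h' x = 0" if "m < \<bar>x\<bar>" for x
 proof -
  have "open {x::real. m < \<bar>x\<bar>}" by (intro open_Collect_less continuous_intros)
  then have "\<forall>\<^sub>F y in nhds x. y \<in> {x. m < \<bar>x\<bar>}" using that by (intro eventually_nhds_in_open) auto
  then have "\<forall>\<^sub>F y in nhds x. h y = 0"
   by eventually_elim (use assms in \<open>auto simp: smooth_supp_def\<close>)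
  then have "((%y. 0) has_real_derivative h' x) (at x)"
   using h'(2) DERIV_cong_ev[of x x h "%_. 0" "h' x" "h' x"] by simp
  then show ?thesis using DERIV_unique DERIV_const by blast
 qed
 then show ?thesis using h' by (auto simp: smooth_supp_def)
qed

lemma smooth_supp_bounded:
 assumes "h \<in> smooth_supp m" obtains C where "!!x. \<bar>h x\<bar> <= C" "1 <= C"
proof -
 have "compact (h ` {-m..m})"
  using assms by (intro compact_continuous_image smooth1_continuous) (auto simp: smooth_supp_def)
 then obtain C where C: "!!x. x \<in> {-m..m} ==> \<bar>h x\<bar> <= C"
  by (metis bounded_iff compact_imp_bounded imageI real_norm_def)
 show ?thesis
 proof (rule that[of "max 1 C"])
  show "\<bar>h x\<bar> <= max 1 C" for x
   using C[of x] assms by (cases "m < \<bar>x\<bar>") (auto simp: smooth_supp_def abs_le_iff not_less le_max_iff_disj)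
 qed simp
qed

lemma coord_prods_bounded:
 assumes "\<phi> \<in> coord_prods (smooth_supp m)" obtains C where "!!x. \<bar>\<phi> x\<bar> <= C" "0 <= C"
proof -
 obtain G where G: "\<phi> = (%p. \<Prod>b\<in>Basis. G b (p \<bullet> b))" "!!b. b \<in> Basis ==> G b \<in> smooth_supp m"
  using assms by (auto simp: coord_prods_def)
 have "\<exists>C. \<forall>x. \<bar>G b x\<bar> <= C" if "b \<in> Basis" for b
  using smooth_supp_bounded[OF G(2)[OF that]] by metis
 then obtain C where C: "!!b x. b \<in> Basis ==> \<bar>G b x\<bar> <= C b" by metis
 have "\<bar>\<phi> x\<bar> <= (\<Prod>b\<in>Basis. C b)" for x
  unfolding G(1) abs_prod using C by (intro prod_mono) auto
 then show ?thesis using that[of "\<Prod>b\<in>Basis. C b"] by (meson abs_ge_zero order_trans)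
qed

lemma coord_prods_support:
 fixes \<phi> :: "'a::euclidean_space => real"
 assumes "\<phi> \<in> coord_prods (smooth_supp m)" "\<phi> x \<noteq> 0" shows "norm x <= real DIM('a) * \<bar>m\<bar>"
proof -
 obtain G where G: "\<phi> = (%p. \<Prod>b\<in>Basis. G b (p \<bullet> b))" "!!b. b \<in> Basis ==> G b \<in> smooth_supp m"
  using assms by (auto simp: coord_prods_def)
 have "\<bar>x \<bullet> b\<bar> <= \<bar>m\<bar>" if "b \<in> Basis" for b
 proof (rule ccontr)
  assume "\<not> \<bar>x \<bullet> b\<bar> <= \<bar>m\<bar>"
  then have "G b (x \<bullet> b) = 0" using G(2)[OF that] by (auto simp: smooth_supp_def)
  then show False using assms(2) that unfolding G(1) by auto
 qed
 then have "(\<Sum>b\<in>Basis. \<bar>x \<bullet> b\<bar>) <= real DIM('a) * \<bar>m\<bar>"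
  using sum_bounded_above[of Basis "%b. \<bar>x \<bullet> b\<bar>" "\<bar>m\<bar>"] by simp
 then show ?thesis using norm_le_l1[of x] by simp
qed

lemma coord_prods_lipschitz:
 fixes \<phi> :: "'a::euclidean_space => real"
 assumes "\<phi> \<in> coord_prods (smooth_supp m)"
 obtains C where "!!x y. \<bar>\<phi> x - \<phi> y\<bar> <= C * norm (x - y)" "0 <= C"
proof -
 obtain \<psi> where p: "!!b. b \<in> Basis ==> \<psi> b \<in> coord_prods (smooth_supp m)"
  and d: "!!x. (\<phi> has_derivative (%h. \<Sum>b\<in>Basis. (h \<bullet> b) * \<psi> b x)) (at x)"
  using coord_prods_has_derivative[OF assms smooth_supp_closed] by metis
 have "\<exists>C. (\<forall>x. \<bar>\<psi> b x\<bar> <= C) \<and> 0 <= C" if "b \<in> Basis" for b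
  using coord_prods_bounded[OF p[OF that]] by metis
 then obtain C where C: "!!b x. b \<in> Basis ==> \<bar>\<psi> b x\<bar> <= C b" "!!b. b \<in> Basis ==> 0 <= C b" by metis
 have "onorm (%h. \<Sum>b\<in>Basis. (h \<bullet> b) * \<psi> b x) <= (\<Sum>b\<in>Basis. C b)" for x
 proof (rule onorm_bound)
  fix h :: 'a
  have "\<bar>\<Sum>b\<in>Basis. (h \<bullet> b) * \<psi> b x\<bar> <= (\<Sum>b\<in>Basis. \<bar>(h \<bullet> b) * \<psi> b x\<bar>)" by (rule sum_abs)
  also have "... <= (\<Sum>b\<in>Basis. norm h * C b)"
   unfolding abs_mult by (intro sum_mono mult_mono C) (auto simp: Basis_le_norm)
  finally show "norm (\<Sum>b\<in>Basis. (h \<bullet> b) * \<psi> b x) <= (\<Sum>b\<in>Basis. C b) * norm h"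
   by (simp add: sum_distrib_left mult.commute)
 qed (use C in \<open>auto intro: sum_nonneg\<close>)
 then have "norm (\<phi> x - \<phi> y) <= (\<Sum>b\<in>Basis. C b) * norm (x - y)" for x y
  using d by (intro differentiable_bound[of UNIV \<phi>]) auto
 then show ?thesis using C by (intro that[of "\<Sum>b\<in>Basis. C b"]) (auto intro: sum_nonneg)
qed

definition kern :: "(real => real) => 'a::euclidean_space => real" where
 "kern b w = (\<Prod>i\<in>Basis. b (w \<bullet> i))"

lemma Cc_infty_kern:
 fixes y :: "'a::euclidean_space"
 assumes b: "b \<in> smooth_supp m" and a: "\<alpha> \<in> smooth_supp l"
 shows "Cc_infty (%p. kern b (fst p - y) * \<alpha> (snd p))"
proof -
 let ?\<phi> = "%p::'a \<times> real. kern b (fst p - y) * \<alpha> (snd p)"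
 define M where "M = \<bar>m\<bar> + norm y + \<bar>l\<bar>"
 \<comment> \<open>A basis vector of the product space is spatial exactly when its second component
   vanishes. Spatial factors carry the shift by \<open>y\<close>, the remaining one is the time
   factor.\<close>
 define G where "G c = (if snd c = 0 then (%x. b (1 * x + - (y \<bullet> fst c))) else \<alpha>)" for c :: "'a \<times> real"
 have G: "G c \<in> smooth_supp M" if "c \<in> Basis" for c
 proof (cases "snd c = 0")
  case True
  have n: "fst c \<in> Basis" using that True by (auto simp: Basis_prod_def)
  have "b (x - y \<bullet> fst c) = 0" if "M < \<bar>x\<bar>" for x
  proof -
   have "m < \<bar>x - y \<bullet> fst c\<bar>" using that Basis_le_norm[OF n, of y] by (auto simp: M_def)
   then show ?thesis using b by (auto simp: smooth_supp_def)
  qed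
  moreover have "smooth1 (%x. b (x - y \<bullet> fst c))"
   using smooth1_affine[of b 1 "- (y \<bullet> fst c)"] b by (simp add: smooth_supp_def)
  ultimately show ?thesis using True by (simp add: G_def smooth_supp_def)
 next
  case False
  have "\<alpha> x = 0" if "M < \<bar>x\<bar>" for x
  proof -
   have "l < \<bar>x\<bar>" using that abs_ge_self[of l] abs_ge_zero[of m] norm_ge_zero[of y] unfolding M_def by linarith
   then show ?thesis using a by (auto simp: smooth_supp_def)
  qed
  then show ?thesis using False a by (auto simp: G_def smooth_supp_def)
 qed
 have eq: "?\<phi> = (%p. \<Prod>c\<in>Basis. G c (p \<bullet> c))"
 proof
  fix p :: "'a \<times> real"
  have "(\<Prod>c\<in>Basis. G c (p \<bullet> c)) = (\<Prod>c\<in>(%u. (u, 0)) ` Basis. G c (p \<bullet> c)) * (\<Prod>c\<in>(%v. (0, v)) ` Basis. G c (p \<bullet> c))"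
   unfolding Basis_prod_def by (rule prod.union_disjoint) auto
  also have "(\<Prod>c\<in>(%u. (u, 0::real)) ` (Basis::'a set). G c (p \<bullet> c)) = kern b (fst p - y)"
   unfolding kern_def by (subst prod.reindex) (auto simp: inj_on_def G_def inner_prod_def inner_diff_left)
  also have "(\<Prod>c\<in>(%v. (0::'a, v::real)) ` Basis. G c (p \<bullet> c)) = \<alpha> (snd p)"
   by (simp add: G_def inner_prod_def)
  finally show "?\<phi> p = (\<Prod>c\<in>Basis. G c (p \<bullet> c))" by simp
 qed
 have mem: "?\<phi> \<in> coord_prods (smooth_supp M)"
  unfolding eq coord_prods_def using G by auto
 have "compact_support ?\<phi>"
  unfolding compact_support_def compact_closure
  by (intro boundedI[of _ "real DIM('a \<times> real) * \<bar>M\<bar>"])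
    (use coord_prods_support[OF mem] in blast)
 then show ?thesis
  unfolding Cc_infty_def using Ck_coord_prods[OF smooth_supp_closed mem] by blast
qed

lemma Cc_infty_smooth_supp:
 assumes b: "b \<in> smooth_supp m" shows "Cc_infty b"
proof -
 have "b = (%p. \<Prod>c\<in>Basis. b (p \<bullet> c))" by auto
 then have mem: "b \<in> coord_prods (smooth_supp m)" using b unfolding coord_prods_def by force
 have "compact_support b"
  unfolding compact_support_def compact_closure
  by (intro boundedI[of _ "real DIM(real) * \<bar>m\<bar>"])
    (use coord_prods_support[OF mem] in blast)
 then show ?thesis
  unfolding Cc_infty_def using Ck_coord_prods[OF smooth_supp_closed mem] by blast
qed

subsection \<open>Smoothing kernels\<close>

lemma nn_integral_lborel_shift:
 fixes f :: "'a::euclidean_space => ennreal"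
 assumes [measurable]: "f \<in> Borel"
 shows "(NN x. f (x + c)) = (NN x. f x)"
proof -
 have "(NN x. f x) = (\<integral>\<^sup>+x. f x \<partial>distr lborel borel ((+) c))"
  by (simp only: lborel_distr_plus)
 also have "... = (NN x. f (c + x))"
  by (rule nn_integral_distr) auto
 finally show ?thesis by (simp add: add.commute)
qed

lemma kern_measurable [measurable]:
 assumes [measurable]: "b \<in> Borel" shows "kern b \<in> Borel"
 unfolding kern_def[abs_def] by (rule borel_measurable_prod) measurable

text \<open>By Tonelli over coordinates, every factor other than the i-th integrates to 1.\<close>

lemma nn_integral_kern_coord:
 fixes g :: "real => ennreal"
 assumes [measurable]: "b \<in> Borel" "g \<in> Borel"
  and b0: "!!x. 0 <= b x" and b1: "(NN x. ennreal (b x)) = 1" and i: "i \<in> Basis"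
 shows "(\<integral>\<^sup>+w. g (w \<bullet> i) * (\<Prod>j\<in>Basis - {i}. ennreal (b (w \<bullet> j))) \<partial>(lborel :: 'a::euclidean_space measure))
   = (NN x. g x)"
proof -
 let ?f = "%j x. if j = i then g x else ennreal (b x)"
 have "(\<integral>\<^sup>+w. g (w \<bullet> i) * (\<Prod>j\<in>Basis - {i}. ennreal (b (w \<bullet> j))) \<partial>(lborel :: 'a measure))
   = (\<integral>\<^sup>+w. (\<Prod>j\<in>Basis. ?f j (w \<bullet> j)) \<partial>(lborel :: 'a measure))"
 proof (intro nn_integral_cong)
  fix w :: 'a
  have "(\<Prod>j\<in>Basis. ?f j (w \<bullet> j)) = g (w \<bullet> i) * (\<Prod>j\<in>Basis - {i}. ?f j (w \<bullet> j))"
   using i by (subst prod.remove[of _ i]) auto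
  also have "(\<Prod>j\<in>Basis - {i}. ?f j (w \<bullet> j)) = (\<Prod>j\<in>Basis - {i}. ennreal (b (w \<bullet> j)))"
   by (intro prod.cong) auto
  finally show "g (w \<bullet> i) * (\<Prod>j\<in>Basis - {i}. ennreal (b (w \<bullet> j))) = (\<Prod>j\<in>Basis. ?f j (w \<bullet> j))" ..
 qed
 also have "... = (\<Prod>j\<in>(Basis::'a set). (NN x. ?f j x))"
  by (rule nn_integral_lborel_prod) auto
 also have "... = (NN x. g x) * (\<Prod>j\<in>(Basis::'a set) - {i}. (NN x. ?f j x))"
  using i by (subst prod.remove[of _ i]) auto
 also have "(\<Prod>j\<in>(Basis::'a set) - {i}. (NN x. ?f j x)) = 1"
  by (intro prod.neutral) (auto simp: b1)
 finally show ?thesis by simp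
qed

lemma kern_remove:
 fixes w :: "'a::euclidean_space"
 assumes "i \<in> Basis" shows "kern b w = b (w \<bullet> i) * (\<Prod>j\<in>Basis - {i}. b (w \<bullet> j))"
 unfolding kern_def using assms by (subst prod.remove[of _ i]) auto

lemma nn_integral_kern_weight:
 fixes g :: "real => ennreal"
 assumes [measurable]: "b \<in> Borel" "g \<in> Borel"
  and b0: "!!x. 0 <= b x" and b1: "(NN x. ennreal (b x)) = 1" and i: "i \<in> Basis"
 shows "(\<integral>\<^sup>+w. g (w \<bullet> i) * ennreal (kern b w) \<partial>(lborel :: 'a::euclidean_space measure))
   = (NN x. g x * ennreal (b x))"
 using nn_integral_kern_coord[of b "%x. g x * ennreal (b x)" i, OF _ _ b0 b1 i]
 by (simp add: kern_remove[OF i] ennreal_mult prod_nonneg b0 prod_ennreal mult.assoc)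

lemma nn_integral_kern_translate_basis:
 assumes [measurable]: "b \<in> Borel"
  and b0: "!!x. 0 <= b x" and b1: "(NN x. ennreal (b x)) = 1" and i: "i \<in> Basis"
 shows "(\<integral>\<^sup>+w. ennreal \<bar>kern b (w + t *\<^sub>R i) - kern b w\<bar> \<partial>(lborel :: 'a::euclidean_space measure))
   = (NN x. ennreal \<bar>b (x + t) - b x\<bar>)"
proof -
 have "\<bar>kern b (w + t *\<^sub>R i) - kern b w\<bar> = \<bar>b (w \<bullet> i + t) - b (w \<bullet> i)\<bar> * (\<Prod>j\<in>Basis - {i}. b (w \<bullet> j))" for w :: 'a
 proof -
  have "(\<Prod>j\<in>Basis - {i}. b ((w + t *\<^sub>R i) \<bullet> j)) = (\<Prod>j\<in>Basis - {i}. b (w \<bullet> j))"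
   by (intro prod.cong) (use i in \<open>auto simp: inner_add_left inner_Basis\<close>)
  then have "kern b (w + t *\<^sub>R i) - kern b w = (b (w \<bullet> i + t) - b (w \<bullet> i)) * (\<Prod>j\<in>Basis - {i}. b (w \<bullet> j))"
   using i by (simp add: kern_remove[OF i] inner_add_left algebra_simps)
  then show ?thesis by (simp add: abs_mult prod_nonneg b0)
 qed
 then show ?thesis
  using nn_integral_kern_coord[of b "%x. ennreal \<bar>b (x + t) - b x\<bar>" i, OF _ _ b0 b1 i]
  by (simp add: ennreal_mult prod_nonneg b0 prod_ennreal)
qed

text \<open>Moving by \<open>z\<close> one coordinate at a time costs |z_i| / e per coordinate, and
  the sum of the |z_i| is at most sqrt d times the Euclidean norm by Cauchy-Schwarz.\<close>

lemma nn_integral_kern_translate: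
 fixes z :: "'a::euclidean_space"
 assumes [measurable]: "b \<in> Borel"
  and b0: "!!x. 0 <= b x" and b1: "(NN x. ennreal (b x)) = 1"
  and tv: "!!h. (NN x. ennreal \<bar>b (x + h) - b x\<bar>) <= ennreal (\<bar>h\<bar> / e)" and e: "0 < e"
 shows "(NN w. ennreal \<bar>kern b (w + z) - kern b w\<bar>) <= ennreal (sqrt (real DIM('a)) * norm z / e)"
proof -
 have step: "(NN w. ennreal \<bar>kern b (w + (\<Sum>i\<in>B. (z \<bullet> i) *\<^sub>R i)) - kern b w\<bar>) <= ennreal (\<Sum>i\<in>B. \<bar>z \<bullet> i\<bar> / e)"
  if "finite B" "B \<subseteq> Basis" for B
  using that
 proof (induction B rule: finite_induct)
  case empty then show ?case by simp
 next
  case (insert i B)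
  let ?s = "\<Sum>i\<in>B. (z \<bullet> i) *\<^sub>R i" and ?t = "(z \<bullet> i) *\<^sub>R i"
  have "(NN w. ennreal \<bar>kern b (w + (\<Sum>i\<in>insert i B. (z \<bullet> i) *\<^sub>R i)) - kern b w\<bar>)
   <= (NN w. ennreal \<bar>kern b (w + ?s + ?t) - kern b (w + ?s)\<bar> + ennreal \<bar>kern b (w + ?s) - kern b w\<bar>)"
   using insert.hyps by (intro nn_integral_mono, subst ennreal_plus[symmetric])
    (auto intro!: ennreal_leI simp: algebra_simps simp del: ennreal_plus)
  also have "... = (NN w. ennreal \<bar>kern b (w + ?s + ?t) - kern b (w + ?s)\<bar>)
    + (NN w. ennreal \<bar>kern b (w + ?s) - kern b w\<bar>)"
   by (rule nn_integral_add) auto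
  also have "(NN w. ennreal \<bar>kern b (w + ?s + ?t) - kern b (w + ?s)\<bar>)
    = (NN w. ennreal \<bar>kern b (w + ?t) - kern b w\<bar>)"
   by (rule nn_integral_lborel_shift[of "%w. ennreal \<bar>kern b (w + ?t) - kern b w\<bar>"]) auto
  also have "... <= ennreal (\<bar>z \<bullet> i\<bar> / e)"
   using insert.prems nn_integral_kern_translate_basis[of b i "z \<bullet> i", OF _ b0 b1] tv by simp
  also have "(NN w. ennreal \<bar>kern b (w + ?s) - kern b w\<bar>) <= ennreal (\<Sum>i\<in>B. \<bar>z \<bullet> i\<bar> / e)"
   using insert by auto
  finally show ?case
   using insert.hyps e by (simp add: ennreal_plus[symmetric] sum_nonneg del: ennreal_plus)
 qed
 have "(\<Sum>i\<in>Basis. \<bar>z \<bullet> i\<bar> / e) <= sqrt (real DIM('a)) * norm z / e"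
 proof -
  have "(\<Sum>i\<in>Basis. \<bar>z \<bullet> i\<bar> * \<bar>1\<bar>) <= L2_set (%i. z \<bullet> i) Basis * L2_set (%i. 1) (Basis :: 'a set)"
   by (rule L2_set_mult_ineq)
  also have "L2_set (%i. z \<bullet> i) Basis = norm z"
   by (simp only: L2_set_def norm_eq_sqrt_inner euclidean_inner[of z z] power2_eq_square)
  also have "L2_set (%i. 1) (Basis :: 'a set) = sqrt (real DIM('a))"
   by (simp add: L2_set_def)
  finally show ?thesis using e by (simp add: sum_divide_distrib[symmetric] divide_right_mono mult.commute)
 qed
 then show ?thesis
  using step[of Basis] order_trans[OF _ ennreal_leI] by (simp add: euclidean_representation)
qed

text \<open>One constant \<open>K\<close> serves for all bounds on the kernel and its gradient. It
  may explode as the kernel concentrates: it only secures integrability and continuity, or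
  multiplies quantities that tend to 0 for a fixed kernel. The scale-sharp facts, translation
  modulus and first moment, are stated separately in \<open>kernel_exists\<close>.
  \<open>test\<close> makes the kernel times a time cutoff admissible in the entropy
  inequality.\<close>

locale kernel =
 fixes \<rho> :: "'a::euclidean_space => real" and D :: "'a => 'a" and K R :: real
 assumes nonneg: "0 <= \<rho> w" and even: "\<rho> (- w) = \<rho> w"
  and mass: "(NN w. ennreal (\<rho> w)) = 1"
  and taylor: "\<bar>\<rho> (w + h) - \<rho> w - h \<bullet> D w\<bar> <= K * (norm h)\<^sup>2"
  and D_lip: "norm (D w - D w') <= K * norm (w - w')"
  and lip: "\<bar>\<rho> w - \<rho> w'\<bar> <= K * norm (w - w')"
  and bound: "\<rho> w <= K" and D_bound: "norm (D w) <= K"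
  and supp: "R < norm w ==> \<rho> w = 0" and D_supp: "R < norm w ==> D w = 0"
  and test: "\<alpha> \<in> smooth_supp l ==> Cc_infty (%p. \<rho> (fst p - y) * \<alpha> (snd p))"
  and R0: "0 <= R"

text \<open>The moment bound is shaped so that d sqrt d / (d + 1), multiplied by the sqrt d of the
  translation modulus, gives d^2 / (d + 1), a quarter of c_d. For d = 1 it is the mean of |x| over a
  box. For d >= 2 it follows from the second moment: up to powers of 1 + \<open>\<eta>\<close> this
  is d e^2 / 3, whose square root is small enough because 1/3 <= (2/3)^2 <= (d / (d + 1))^2.\<close>

theorem kernel_exists:
 assumes e: "0 < e" and \<eta>: "0 < \<eta>"
 obtains \<rho> :: "'a::euclidean_space => real" and D K R
 where "kernel \<rho> D K R" "R <= real DIM('a) * (e * (1 + \<eta>))"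
  "!!z. (NN w. ennreal \<bar>\<rho> (w + z) - \<rho> w\<bar>) <= ennreal (sqrt (real DIM('a)) * norm z / e)"
  "(NN w. ennreal (norm w) * ennreal (\<rho> w))
    <= ennreal (e * (1 + \<eta>)\<^sup>2 * (real DIM('a) * sqrt (real DIM('a)) / (real DIM('a) + 1)))"
proof -
 define e' where "e' = e * (1 + \<eta>)"
 have e': "0 < e" "e < e'" using e \<eta> by (auto simp: e'_def field_simps)
 obtain b where b: "smooth1 b" "!!x. 0 <= b x" "!!x. b x <= 1 / (2 * e)"
  "!!x. e' <= \<bar>x\<bar> ==> b x = 0" "!!x. b (- x) = b x" "(NN x. ennreal (b x)) = 1"
  "!!h. (NN x. ennreal \<bar>b (x + h) - b x\<bar>) <= ennreal (\<bar>h\<bar> / e)"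
  using kernel1_exists[OF e'] by blast
 have [measurable]: "b \<in> Borel" using b(1) by (rule smooth1_measurable)
 have bs: "b \<in> smooth_supp e'" using b by (auto simp: smooth_supp_def)
 let ?\<rho> = "kern b :: 'a => real"
 have mem: "?\<rho> \<in> coord_prods (smooth_supp e')"
  unfolding coord_prods_def kern_def[abs_def] using bs by (intro CollectI exI[of _ "%_. b"]) auto
 obtain \<psi> where p: "!!i. i \<in> Basis ==> \<psi> i \<in> coord_prods (smooth_supp e')"
  and d: "!!x. (?\<rho> has_derivative (%h. \<Sum>i\<in>Basis. (h \<bullet> i) * \<psi> i x)) (at x)"
  by (rule coord_prods_has_derivative[OF mem smooth_supp_closed]) (blast intro: that)+
 define D where "D w = (\<Sum>i\<in>Basis. \<psi> i w *\<^sub>R i)" for w :: 'a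
 have inD: "h \<bullet> D x = (\<Sum>i\<in>Basis. (h \<bullet> i) * \<psi> i x)" for h x
  by (simp add: D_def inner_sum_right mult.commute)
 have dD: "(?\<rho> has_derivative (%h. h \<bullet> D x)) (at x)" for x
  using d by (simp add: inD)
 have "\<exists>C. (\<forall>x. \<bar>\<psi> i x\<bar> <= C) \<and> 0 <= C" if "i \<in> Basis" for i
  using coord_prods_bounded[OF p[OF that]] by metis
 then obtain C where C: "!!i x. i \<in> Basis ==> \<bar>\<psi> i x\<bar> <= C i" "!!i. i \<in> Basis ==> 0 <= C i" by metis
 have "\<exists>C. (\<forall>x y. \<bar>\<psi> i x - \<psi> i y\<bar> <= C * norm (x - y)) \<and> 0 <= C" if "i \<in> Basis" for i
  using coord_prods_lipschitz[OF p[OF that]] by metis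
 then obtain L where L: "!!i x y. i \<in> Basis ==> \<bar>\<psi> i x - \<psi> i y\<bar> <= L i * norm (x - y)"
  "!!i. i \<in> Basis ==> 0 <= L i" by metis
 obtain B where B: "!!x. \<bar>?\<rho> x\<bar> <= B" "0 <= B" using coord_prods_bounded[OF mem] by blast
 define cC cL where "cC = (\<Sum>i\<in>(Basis::'a set). C i)" and "cL = (\<Sum>i\<in>(Basis::'a set). L i)"
 have c0: "0 <= cC" "0 <= cL" using C L by (auto simp: cC_def cL_def sum_nonneg)
 have Db: "norm (D w) <= cC" for w
  unfolding D_def cC_def by (rule sum_norm_le) (use C in auto)
 have Dl: "norm (D w - D w') <= cL * norm (w - w')" for w w'
  unfolding D_def cL_def sum_subtractf[symmetric] sum_distrib_right
  by (rule sum_norm_le) (use L in \<open>auto simp: scaleR_diff_left[symmetric]\<close>)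
 have lip: "\<bar>?\<rho> w - ?\<rho> w'\<bar> <= cC * norm (w - w')" for w w'
 proof -
  have "onorm (%h. h \<bullet> D x) <= cC" for x
  proof (rule onorm_bound[OF c0(1)])
   show "norm (h \<bullet> D x) <= cC * norm h" for h
    using Cauchy_Schwarz_ineq2[of h "D x"] mult_left_mono[OF Db[of x] norm_ge_zero[of h]]
    by (simp add: mult.commute)
  qed
  then show ?thesis
   using differentiable_bound[of UNIV ?\<rho> "%x h. h \<bullet> D x" cC w w'] dD by auto
 qed
 have tay: "\<bar>?\<rho> (w + h) - ?\<rho> w - h \<bullet> D w\<bar> <= cL * (norm h)\<^sup>2" for w h
 proof -
  define g where "g t = ?\<rho> (w + t *\<^sub>R h) - t * (h \<bullet> D w)" for t :: real
  have g': "(g has_real_derivative h \<bullet> D (w + t *\<^sub>R h) - h \<bullet> D w) (at t)" for t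
  proof -
   have "((%t. ?\<rho> (w + t *\<^sub>R h)) has_derivative (%s. (s *\<^sub>R h) \<bullet> D (w + t *\<^sub>R h))) (at t)"
    by (rule has_derivative_compose[OF _ dD]) (auto intro!: derivative_eq_intros)
   then have "((%t. ?\<rho> (w + t *\<^sub>R h)) has_real_derivative h \<bullet> D (w + t *\<^sub>R h)) (at t)"
    by (rule has_derivative_imp_has_field_derivative) simp
   then show ?thesis unfolding g_def by (auto intro!: derivative_eq_intros)
  qed
  obtain t where t: "0 < t" "t < 1" "g 1 - g 0 = (1 - 0) * (h \<bullet> D (w + t *\<^sub>R h) - h \<bullet> D w)"
   using MVT2[of 0 1 g] g' by force
  have "\<bar>h \<bullet> (D (w + t *\<^sub>R h) - D w)\<bar> <= norm h * (cL * norm (t *\<^sub>R h))"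
   using Cauchy_Schwarz_ineq2[of h "D (w + t *\<^sub>R h) - D w"] mult_left_mono[OF Dl[of "w + t *\<^sub>R h" w] norm_ge_zero[of h]]
   by simp
  also have "... <= norm h * (cL * norm h)"
   using t c0 by (intro mult_left_mono) (auto simp: mult_left_le_one_le)
  finally show ?thesis
   using t(3) by (simp add: g_def inner_diff_right power2_eq_square mult_ac algebra_simps)
 qed
 define R where "R = real DIM('a) * e'"
 have e'0: "\<bar>e'\<bar> = e'" using e' by simp
 define M where "M = max B (max cC cL)"
 have M: "B <= M" "cC <= M" "cL <= M" by (auto simp: M_def)
 have mass: "(NN w. ennreal (?\<rho> w)) = 1"
  using nn_integral_kern_weight[of b "%_. 1" "SOME i::'a. i \<in> Basis", OF _ _ b(2,6) SOME_Basis] b(6) by simp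
 have ker: "kernel ?\<rho> D M R"
 proof
  show "0 <= ?\<rho> w" for w by (simp add: kern_def prod_nonneg b(2))
  show "?\<rho> (- w) = ?\<rho> w" for w by (simp add: kern_def b(5))
  show "(NN w. ennreal (?\<rho> w)) = 1" by (rule mass)
  show "\<bar>?\<rho> (w + h) - ?\<rho> w - h \<bullet> D w\<bar> <= M * (norm h)\<^sup>2" for w h
   using order_trans[OF tay mult_right_mono[OF M(3)]] by simp
  show "norm (D w - D w') <= M * norm (w - w')" for w w'
   using order_trans[OF Dl mult_right_mono[OF M(3)]] by simp
  show "\<bar>?\<rho> w - ?\<rho> w'\<bar> <= M * norm (w - w')" for w w'
   using order_trans[OF lip mult_right_mono[OF M(2)]] by simp
  show "?\<rho> w <= M" for w using B(1)[of w] M by simp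
  show "norm (D w) <= M" for w using Db[of w] M by simp
  show "?\<rho> w = 0" if "R < norm w" for w
   using coord_prods_support[OF mem, of w] that by (auto simp: R_def e'0)
  show "D w = 0" if "R < norm w" for w
  proof -
   have "\<psi> i w = 0" if i: "i \<in> Basis" for i
    using coord_prods_support[OF p[OF i], of w] \<open>R < norm w\<close> by (auto simp: R_def e'0)
   then show ?thesis by (simp add: D_def)
  qed
  show "Cc_infty (%p. ?\<rho> (fst p - y) * \<alpha> (snd p))" if "\<alpha> \<in> smooth_supp l" for \<alpha> l y
   by (rule Cc_infty_kern[OF bs that])
  show "0 <= R" using e' by (simp add: R_def)
 qed
 \<comment> \<open>Since the height is at most 1 / (2 e) and the support lies in [-e', e'], the
   moment is at most twice the integral of x^k / (2 e) over [0, e'].\<close>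
 have mom: "(NN x. ennreal (\<bar>x\<bar> ^ k) * ennreal (b x)) <= ennreal (e' ^ (k + 1) / (real (k + 1) * e))"
  if "0 < k" for k
 proof -
  have "(NN x. ennreal (\<bar>x\<bar> ^ k) * ennreal (b x))
   <= (NN x. ennreal (\<bar>x\<bar> ^ k / (2 * e)) * indicator {0..e'} x + ennreal (\<bar>x\<bar> ^ k / (2 * e)) * indicator {-e'..0} x)"
  proof (intro nn_integral_mono)
   fix x
   have "\<bar>x\<bar> ^ k * b x <= \<bar>x\<bar> ^ k / (2 * e)"
    using mult_left_mono[OF b(3)[of x], of "\<bar>x\<bar> ^ k"] by simp
   then show "ennreal (\<bar>x\<bar> ^ k) * ennreal (b x) <= ennreal (\<bar>x\<bar> ^ k / (2 * e)) * indicator {0..e'} x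
     + ennreal (\<bar>x\<bar> ^ k / (2 * e)) * indicator {-e'..0} x"
    using b(4)[of x] b(2)[of x] that
    by (cases "x < -e'"; cases "e' < x"; cases "x = 0"; cases "0 < x")
      (auto simp: ennreal_mult[symmetric] indicator_def zero_power intro!: ennreal_leI)
  qed
  also have "... = (NN x. ennreal (\<bar>x\<bar> ^ k / (2 * e)) * indicator {0..e'} x)
    + (NN x. ennreal (\<bar>x\<bar> ^ k / (2 * e)) * indicator {-e'..0} x)"
   by (rule nn_integral_add) auto
  also have "(NN x. ennreal (\<bar>x\<bar> ^ k / (2 * e)) * indicator {-e'..0} x)
    = (NN x. ennreal (\<bar>x\<bar> ^ k / (2 * e)) * indicator {0..e'} x)"
   by (subst nn_integral_real_affine[of _ "-1" 0]) (auto intro!: nn_integral_cong simp: indicator_def)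
  also have "(NN x. ennreal (\<bar>x\<bar> ^ k / (2 * e)) * indicator {0..e'} x)
    = (NN x. ennreal (x ^ k / (2 * e)) * indicator {0..e'} x)"
   by (intro nn_integral_cong) (auto simp: indicator_def)
  also have "... = ennreal (e' ^ (k + 1) / (real (k + 1) * 2 * e) - 0 ^ (k + 1) / (real (k + 1) * 2 * e))"
  proof (rule nn_integral_FTC_Icc)
   show "((%x. x ^ (k + 1) / (real (k + 1) * 2 * e)) has_real_derivative x ^ k / (2 * e)) (at x)" for x
    by (rule DERIV_cong[OF DERIV_cdivide[OF DERIV_pow]])
      (simp only: add_diff_cancel_right' One_nat_def[symmetric] mult.assoc, simp del: of_nat_Suc of_nat_add)
  qed (use e' in auto)
  finally have le: "(NN x. ennreal (\<bar>x\<bar> ^ k) * ennreal (b x))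
    <= ennreal (e' ^ (k + 1) / (real (k + 1) * 2 * e)) + ennreal (e' ^ (k + 1) / (real (k + 1) * 2 * e))"
   by (simp del: of_nat_Suc of_nat_add)
  have half: "a / (c * 2 * e) + a / (c * 2 * e) = a / (c * e)" for a c :: real
   using e by (cases "c = 0") (auto simp: field_simps)
  have "0 <= e' ^ (k + 1) / (real (k + 1) * 2 * e)" using e' by (intro divide_nonneg_nonneg) auto
  then show ?thesis using le by (simp only: ennreal_plus[symmetric] half)
 qed
 define d where "d = real DIM('a)"
 have d1: "1 <= d" using DIM_positive[where 'a='a] by (simp add: d_def Suc_le_eq)
 have moment: "(NN w. ennreal (norm w) * ennreal (?\<rho> w)) <= ennreal (e * (1 + \<eta>)\<^sup>2 * (d * sqrt d / (d + 1)))"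
 proof (cases "DIM('a) = 1")
  case True
  then obtain i :: 'a where i: "Basis = {i}" using card_1_singletonE by blast
  then have iB: "i \<in> Basis" by blast
  have "norm w = \<bar>w \<bullet> i\<bar>" for w :: 'a
   using euclidean_representation[of w] i by (metis norm_scaleR norm_Basis insertI1 mult.right_neutral sum.empty
     sum.insert add.right_neutral finite.emptyI empty_iff)
  then have "(NN w. ennreal (norm w) * ennreal (?\<rho> w)) = (NN x. ennreal (\<bar>x\<bar> ^ 1) * ennreal (b x))"
   using nn_integral_kern_weight[of b "%x. ennreal (\<bar>x\<bar> ^ 1)" i, OF _ _ b(2,6) iB] by simp
  also have "... <= ennreal (e' ^ 2 / (2 * e))" using mom[of 1] by (simp add: power2_eq_square)
  also have "e' ^ 2 / (2 * e) = e * (1 + \<eta>)\<^sup>2 * (d * sqrt d / (d + 1))"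
   using e True by (simp add: e'_def d_def power2_eq_square field_simps)
  finally show ?thesis .
 next
  case False
  then have "2 <= DIM('a)" using DIM_positive[where 'a='a] by linarith
  then have d2: "2 <= d" by (simp add: d_def)
  define m where "m = d * (e' ^ 3 / (3 * e))"
  define l where "l = sqrt m"
  have m0: "0 < m" using d1 e' by (simp add: m_def)
  then have l0: "0 < l" "l * l = m" by (auto simp: l_def)
  have sq: "(NN w. ennreal ((norm w)\<^sup>2) * ennreal (?\<rho> w)) <= ennreal m"
  proof -
   have "(NN w. ennreal ((norm w)\<^sup>2) * ennreal (?\<rho> w))
    = (NN w. (\<Sum>i\<in>Basis. ennreal (\<bar>w \<bullet> i\<bar> ^ 2) * ennreal (?\<rho> w)))"
   proof (intro nn_integral_cong)
    fix w :: 'a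
    have "(norm w)\<^sup>2 = (\<Sum>i\<in>Basis. \<bar>w \<bullet> i\<bar> ^ 2)"
     by (simp only: power2_norm_eq_inner euclidean_inner[of w w] power2_abs power2_eq_square[of "w \<bullet> _"])
    then show "ennreal ((norm w)\<^sup>2) * ennreal (?\<rho> w) = (\<Sum>i\<in>Basis. ennreal (\<bar>w \<bullet> i\<bar> ^ 2) * ennreal (?\<rho> w))"
     by (simp add: sum_distrib_right[symmetric] sum_ennreal)
   qed
   also have "... = (\<Sum>i\<in>Basis. (NN w. ennreal (\<bar>(w::'a) \<bullet> i\<bar> ^ 2) * ennreal (?\<rho> w)))"
    by (rule nn_integral_sum) auto
   also have "... <= (\<Sum>i\<in>(Basis::'a set). ennreal (e' ^ 3 / (3 * e)))"
   proof (rule sum_mono)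
    fix i :: 'a assume i: "i \<in> Basis"
    show "(NN w. ennreal (\<bar>(w::'a) \<bullet> i\<bar> ^ 2) * ennreal (?\<rho> w)) <= ennreal (e' ^ 3 / (3 * e))"
     using nn_integral_kern_weight[of b "%x. ennreal (\<bar>x\<bar> ^ 2)" i, OF _ _ b(2,6) i] mom[of 2]
     by (simp add: numeral_3_eq_3)
   qed
   also have "... = ennreal m"
    using e' by (subst sum_ennreal) (auto simp: m_def d_def)
   finally show ?thesis .
  qed
  \<comment> \<open>Cauchy-Schwarz in the form |w| <= |w|^2 / (2 l) + l / 2, with the optimal l, the
    square root of the bound on the second moment.\<close>
  have "(NN w. ennreal (norm w) * ennreal (?\<rho> w))
   <= (NN w. ennreal (1 / (2 * l)) * (ennreal ((norm w)\<^sup>2) * ennreal (?\<rho> w)) + ennreal (l / 2) * ennreal (?\<rho> w))"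
  proof (intro nn_integral_mono)
   fix w :: 'a
   have "0 <= (norm w - l)\<^sup>2" by simp
   then have "norm w <= 1 / (2 * l) * (norm w)\<^sup>2 + l / 2"
    using l0(1) by (simp add: field_simps power2_eq_square)
   then have "norm w * ?\<rho> w <= (1 / (2 * l) * (norm w)\<^sup>2 + l / 2) * ?\<rho> w"
    by (rule mult_right_mono) (rule kernel.nonneg[OF ker])
   then show "ennreal (norm w) * ennreal (?\<rho> w)
     <= ennreal (1 / (2 * l)) * (ennreal ((norm w)\<^sup>2) * ennreal (?\<rho> w)) + ennreal (l / 2) * ennreal (?\<rho> w)"
    using l0(1) kernel.nonneg[OF ker, of w]
    by (simp add: ennreal_mult[symmetric] ennreal_plus[symmetric] distrib_right del: ennreal_plus)
  qed
  also have "... = ennreal (1 / (2 * l)) * (NN w. ennreal ((norm w)\<^sup>2) * ennreal (?\<rho> w)) + ennreal (l / 2)"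
   using mass by (subst nn_integral_add) (auto simp: nn_integral_cmult)
  also have "... <= ennreal (1 / (2 * l)) * ennreal m + ennreal (l / 2)"
   by (intro add_right_mono mult_left_mono sq) auto
  also have "... = ennreal (1 / (2 * l) * m + l / 2)"
   using l0 m0 by (simp add: ennreal_mult[symmetric] ennreal_plus[symmetric] del: ennreal_plus)
  also have "1 / (2 * l) * m + l / 2 = l"
   using l0 by (simp add: l0(2)[symmetric] field_simps)
  also have "ennreal l <= ennreal (e * (1 + \<eta>)\<^sup>2 * (d * sqrt d / (d + 1)))"
  proof (intro ennreal_leI)
   have "m = d / 3 * (e\<^sup>2 * (1 + \<eta>) ^ 3)"
    using e by (simp add: m_def e'_def power_mult_distrib power2_eq_square power3_eq_cube)
   also have "... <= (d * (d / (d + 1))\<^sup>2) * (e\<^sup>2 * (1 + \<eta>) ^ 4)"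
   proof (intro mult_mono mult_left_mono)
    have "(2/3)\<^sup>2 <= (d / (d + 1))\<^sup>2" using d2 by (intro power_mono) (auto simp: field_simps)
    moreover have "1 / 3 <= (2 / 3 :: real)\<^sup>2" by (simp add: power2_eq_square)
    ultimately have "1 / 3 <= (d / (d + 1))\<^sup>2" by (rule order_trans[rotated])
    then show "d / 3 <= d * (d / (d + 1))\<^sup>2" using d1 mult_left_mono[of "1/3" _ d] by simp
    show "(1 + \<eta>) ^ 3 <= (1 + \<eta>) ^ 4" using \<eta> by (intro power_increasing) auto
   qed (use d1 \<eta> in auto)
   also have "... = (e * (1 + \<eta>)\<^sup>2 * (d * sqrt d / (d + 1)))\<^sup>2"
    using d1 by (simp add: power_mult_distrib power_divide power2_eq_square power4_eq_xxxx)
   finally show "l <= e * (1 + \<eta>)\<^sup>2 * (d * sqrt d / (d + 1))"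
    unfolding l_def using d1 e by (intro real_le_lsqrt) auto
  qed
  finally show ?thesis .
 qed
 show ?thesis
  by (rule that[OF ker _ nn_integral_kern_translate[OF _ b(2,6,7) e]])
    (use moment in \<open>auto simp: R_def e'_def d_def\<close>)
qed

subsection \<open>Translations in \<open>L\<^sup>1\<close>\<close>

lemma cball_borel [measurable]: "cball a (r::real) \<in> sets borel"
 by (intro borel_closed closed_cball)

lemma emeasure_cball_lt_top [simp]: "emeasure lborel (cball (c::'a::euclidean_space) r) < top"
 using emeasure_lborel_cball_finite[of c r] by simp

lemma nn_integral_lborel_reflect:
 fixes f :: "'a::euclidean_space => ennreal"
 assumes [measurable]: "f \<in> Borel"
 shows "(NN x. f (c - x)) = (NN x. f x)"
proof -
 have "(lborel :: 'a measure) = density (distr lborel borel (%x. c + (-1) *\<^sub>R x)) (%_. \<bar>-1::real\<bar> ^ DIM('a))"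
  by (rule lborel_affine) simp
 then have "(lborel :: 'a measure) = distr lborel borel (%x. c - x)"
  by (simp add: density_1)
 then have "(NN x. f x) = (\<integral>\<^sup>+x. f x \<partial>distr lborel borel (%x. c - x))" by simp
 also have "... = (NN x. f (c - x))" by (rule nn_integral_distr) auto
 finally show ?thesis ..
qed

lemma
 fixes f :: "'a::euclidean_space => 'b::{banach, second_countable_topology}"
 shows integrable_lborel_shift: "L1 f ==> L1 (%x. f (x + c))"
  and integral_lborel_shift: "f \<in> Borel ==> (LB x. f (x + c)) = (LB x. f x)"
proof -
 assume i: "L1 f"
 then have [measurable]: "f \<in> Borel" by auto
 from i have "integrable (distr lborel borel ((+) c)) f" by (simp only: lborel_distr_plus)
 then show "L1 (%x. f (x + c))"
  by (subst (asm) integrable_distr_eq) (auto simp: add.commute)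
next
 assume [measurable]: "f \<in> Borel"
 have "integral\<^sup>L (distr lborel borel ((+) c)) f = (LB x. f (x + c))"
  by (subst integral_distr) (auto simp: add.commute)
 then show "(LB x. f (x + c)) = (LB x. f x)" by (simp only: lborel_distr_plus)
qed

lemma
 fixes f :: "'a::euclidean_space => 'b::{banach, second_countable_topology}"
 shows integrable_lborel_reflect: "L1 f ==> L1 (%x. f (c - x))"
  and integral_lborel_reflect: "f \<in> Borel ==> (LB x. f (c - x)) = (LB x. f x)"
proof -
 have "(lborel :: 'a measure) = density (distr lborel borel (%x. c + (-1) *\<^sub>R x)) (%_. \<bar>-1::real\<bar> ^ DIM('a))"
  by (rule lborel_affine) simp
 then have eq: "distr lborel borel (%x. c - x) = (lborel :: 'a measure)"
  by (simp add: density_1)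
 {
  assume i: "L1 f"
  then have [measurable]: "f \<in> Borel" by auto
  from i have "integrable (distr lborel borel (%x. c - x)) f" by (simp only: eq)
  then show "L1 (%x. f (c - x))"
   by (subst (asm) integrable_distr_eq) auto
 next
  assume [measurable]: "f \<in> Borel"
  have "integral\<^sup>L (distr lborel borel (%x. c - x)) f = (LB x. f (c - x))"
   by (subst integral_distr) auto
  then show "(LB x. f (c - x)) = (LB x. f x)" by (simp only: eq)
 }
qed

text \<open>The L1 modulus of translation. Spatial regularity of a solution is carried in this form,
  because comparison with translates bounds it directly by the modulus of the datum.\<close>

definition osc :: "('a::euclidean_space => real) => 'a => real" where
 "osc p z = (LB x. \<bar>p (x + z) - p x\<bar>)"

lemma osc_integrable:
 fixes p :: "'a::euclidean_space => real"
 shows "L1 p ==> L1 (%x. \<bar>p (x + z) - p x\<bar>)"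
 using integrable_lborel_shift[of p z] by auto

lemma osc_nonneg: "0 <= osc p z"
 unfolding osc_def by (intro integral_nonneg_AE) auto

lemma osc_nn_integral: "L1 p ==> (NN x. ennreal \<bar>p (x + z) - p x\<bar>) = ennreal (osc p z)"
 unfolding osc_def by (intro nn_integral_eq_integral osc_integrable) auto

lemma osc_le: "L1 p ==> osc p z <= 2 * (LB x. \<bar>p x\<bar>)"
proof -
 assume i: "L1 p"
 then have [measurable]: "p \<in> Borel" by auto
 have "osc p z <= (LB x. \<bar>p (x + z)\<bar> + \<bar>p x\<bar>)"
  unfolding osc_def using i integrable_lborel_shift[OF i, of z] osc_integrable[OF i]
  by (intro integral_mono) auto
 also have "... = (LB x. \<bar>p (x + z)\<bar>) + (LB x. \<bar>p x\<bar>)"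
  using i integrable_lborel_shift[OF i, of z] by (intro integral_add) auto
 also have "(LB x. \<bar>p (x + z)\<bar>) = (LB x. \<bar>p x\<bar>)"
  by (rule integral_lborel_shift[of "%x. \<bar>p x\<bar>"]) auto
 finally show ?thesis by simp
qed

lemma osc_add:
 assumes i: "L1 p" shows "osc p (z + w) <= osc p z + osc p w"
proof -
 have [measurable]: "p \<in> Borel" using i by auto
 have "osc p (z + w) <= (LB x. \<bar>p (x + w + z) - p (x + w)\<bar> + \<bar>p (x + w) - p x\<bar>)"
  unfolding osc_def
 proof (rule integral_mono)
  show "L1 (%x. \<bar>p (x + (z + w)) - p x\<bar>)" by (rule osc_integrable[OF i])
  show "L1 (%x. \<bar>p (x + w + z) - p (x + w)\<bar> + \<bar>p (x + w) - p x\<bar>)"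
   by (intro integrable_add integrable_lborel_shift[OF osc_integrable[OF i, of z], of w] osc_integrable i)
  show "\<bar>p (x + (z + w)) - p x\<bar> <= \<bar>p (x + w + z) - p (x + w)\<bar> + \<bar>p (x + w) - p x\<bar>" for x
   by (simp add: ac_simps)
 qed
 also have "... = (LB x. \<bar>p (x + w + z) - p (x + w)\<bar>) + osc p w"
  unfolding osc_def using osc_integrable[OF i, of w]
   integrable_lborel_shift[OF osc_integrable[OF i, of z], of w]
  by (intro integral_add) auto
 also have "(LB x. \<bar>p (x + w + z) - p (x + w)\<bar>) = osc p z"
  unfolding osc_def by (rule integral_lborel_shift[of "%x. \<bar>p (x + z) - p x\<bar>"]) auto
 finally show ?thesis .
qed

lemma osc_scale:
 assumes i: "L1 p" shows "osc p (real n *\<^sub>R z) <= real n * osc p z"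
proof (induction n)
 case 0 show ?case by (simp add: osc_def)
next
 case (Suc n)
 have "osc p (z + real n *\<^sub>R z) <= osc p z + osc p (real n *\<^sub>R z)" by (rule osc_add[OF i])
 then show ?case using Suc by (simp add: algebra_simps)
qed

lemma osc_minus:
 assumes i: "L1 p" shows "osc p (- z) = osc p z"
proof -
 have [measurable]: "p \<in> Borel" using i by auto
 have "osc p (- z) = (LB x. \<bar>p (x + z + - z) - p (x + z)\<bar>)"
  unfolding osc_def using integral_lborel_shift[of "%x. \<bar>p (x + - z) - p x\<bar>" z] by simp
 then show ?thesis by (simp add: osc_def abs_minus_commute)
qed

lemma osc_mono_lipschitz:
 assumes i: "L1 p" and L: "!!s t. \<bar>A s - A t\<bar> <= L * \<bar>s - t\<bar>" and iA: "L1 (%x. A (p x))"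
 shows "osc (%x. A (p x)) z <= L * osc p z"
proof -
 have "osc (%x. A (p x)) z <= (LB x. L * \<bar>p (x + z) - p x\<bar>)"
  unfolding osc_def by (intro integral_mono osc_integrable[OF iA] integrable_mult_right osc_integrable[OF i] L)
 then show ?thesis by (simp add: osc_def)
qed

text \<open>Truncate \<open>f\<close> in value and in space; take continuous functions converging to
  the truncation off a null set; clip these at the same height and cut them off outside the ball of
  radius n + 1. Dominated convergence covers both passages to the limit.\<close>

lemma L1_continuous_approx:
 fixes f :: "'a::euclidean_space => real"
 assumes f: "L1 f" and e: "0 < e"
 obtains g m where "continuous_on UNIV g" "!!x. m < norm x ==> g x = 0" "L1 g" "0 <= m"
  "(LB x. \<bar>f x - g x\<bar>) < e"
proof -
 have [measurable]: "f \<in> Borel" using f by auto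
 define c where "c n t = max (- real n) (min (real n) t)" for n :: nat and t :: real
 have [measurable]: "c n \<in> Borel" for n unfolding c_def by measurable
 define F where "F n x = c n (f x) * indicator (cball 0 (real n)) x" for n and x :: 'a
 have [measurable]: "F n \<in> Borel" for n unfolding F_def by measurable
 have cb: "\<bar>c n t\<bar> <= \<bar>t\<bar>" "\<bar>c n t\<bar> <= real n" for n t by (auto simp: c_def)
 have "(%n. LB x. \<bar>f x - F n x\<bar>) \<longlonglongrightarrow> (LINT x|(lborel::'a measure). 0)"
 proof (rule integral_dominated_convergence[where w="%x. 2 * \<bar>f x\<bar>"])
  show "AE x in lborel. (%n. \<bar>f x - F n x\<bar>) \<longlonglongrightarrow> 0"
  proof (intro AE_I2 tendsto_eventually)
   fix x
   obtain N :: nat where N: "\<bar>f x\<bar> + norm x <= real N" using real_arch_simple by blast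
   show "\<forall>\<^sub>F n in sequentially. \<bar>f x - F n x\<bar> = 0"
    using eventually_ge_at_top[of N]
   proof eventually_elim
    case (elim n)
    then have "\<bar>f x\<bar> + norm x <= real n" using N by linarith
    then have "\<bar>f x\<bar> <= real n" "norm x <= real n" using norm_ge_zero[of x] abs_ge_zero[of "f x"] by linarith+
    then show ?case by (simp add: F_def c_def)
   qed
  qed
  show "AE x in lborel. norm \<bar>f x - F n x\<bar> <= 2 * \<bar>f x\<bar>" for n
  proof (intro AE_I2)
   fix x show "norm \<bar>f x - F n x\<bar> <= 2 * \<bar>f x\<bar>"
    using cb(1)[of n "f x"] by (auto simp: F_def indicator_def)
  qed
 qed (use f in auto)
 then have "\<forall>\<^sub>F n in sequentially. (LB x. \<bar>f x - F n x\<bar>) < e / 2"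
  using e by (intro order_tendstoD(2)[of _ 0]) auto
 then obtain n where n: "(LB x. \<bar>f x - F n x\<bar>) < e / 2"
  using eventually_happens'[OF sequentially_bot] by blast
 have iF: "L1 (F n)"
  by (rule integrable_bound[OF f]) (use cb(1) in \<open>auto simp: F_def indicator_def\<close>)
 have "F n measurable_on UNIV"
  by (intro lebesgue_measurable_imp_measurable_on_real measurable_completion) auto
 then obtain N g where N: "negligible N" and g: "!!k. continuous_on UNIV (g k)"
  and lim: "!!x. x \<notin> N ==> (%k. g k x) \<longlonglongrightarrow> F n x"
  unfolding measurable_on_def by auto
 define h where "h k x = c n (g k x) * max 0 (min 1 (real n + 1 - norm x))" for k :: nat and x :: 'a
 have hc: "continuous_on UNIV (h k)" for k
  unfolding h_def c_def by (intro continuous_intros g)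
 then have [measurable]: "h k \<in> Borel" for k by (intro borel_measurable_continuous_onI)
 have hb: "\<bar>h k x\<bar> <= real n * indicator (cball 0 (real n + 1)) x" for k x
 proof -
  have "\<bar>c n (g k x) * max 0 (min 1 (real n + 1 - norm x))\<bar> <= real n * 1"
   unfolding abs_mult by (intro mult_mono cb) auto
  then show ?thesis by (auto simp: h_def indicator_def)
 qed
 have ib: "L1 (%x::'a. real n * indicator (cball 0 (real n + 1)) x)"
  by (intro integrable_mult_right integrable_real_indicator) auto
 have ih: "L1 (h k)" for k
  by (rule integrable_bound[OF ib]) (use hb in \<open>auto intro: order_trans[OF hb]\<close>)
 have "(%k. LINT x|lebesgue. \<bar>F n x - h k x\<bar>) \<longlonglongrightarrow> (LINT x|(lebesgue::'a measure). 0)"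
 proof (rule integral_dominated_convergence[where w="%x. \<bar>F n x\<bar> + real n * indicator (cball 0 (real n + 1)) x"])
  have "AE x in lebesgue. x \<notin> N"
   using N by (simp add: negligible_iff_null_sets AE_not_in)
  then show "AE x in lebesgue. (%k. \<bar>F n x - h k x\<bar>) \<longlonglongrightarrow> 0"
  proof eventually_elim
   case (elim x)
   have "(%k. h k x) \<longlonglongrightarrow> c n (F n x) * max 0 (min 1 (real n + 1 - norm x))"
    unfolding h_def c_def by (intro tendsto_intros lim elim)
   also have "c n (F n x) * max 0 (min 1 (real n + 1 - norm x)) = F n x"
    using cb(2)[of n "f x"] by (auto simp: F_def indicator_def c_def)
   finally have "(%k. \<bar>F n x - h k x\<bar>) \<longlonglongrightarrow> \<bar>F n x - F n x\<bar>" by (intro tendsto_intros)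
   then show ?case by simp
  qed
  show "AE x in lebesgue. norm \<bar>F n x - h k x\<bar> <= \<bar>F n x\<bar> + real n * indicator (cball 0 (real n + 1)) x" for k
  proof (intro AE_I2)
   fix x show "norm \<bar>F n x - h k x\<bar> <= \<bar>F n x\<bar> + real n * indicator (cball 0 (real n + 1)) x"
    using hb[of k x] by (simp add: abs_le_iff) linarith
  qed
  show "integrable lebesgue (%x. \<bar>F n x\<bar> + real n * indicator (cball 0 (real n + 1)) x)"
   using iF ib by (subst integrable_completion) auto
 qed (auto intro!: measurable_completion)
 then have "(%k. LB x. \<bar>F n x - h k x\<bar>) \<longlonglongrightarrow> 0"
  by (simp add: integral_completion)
 then have "\<forall>\<^sub>F k in sequentially. (LB x. \<bar>F n x - h k x\<bar>) < e / 2"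
  using e by (intro order_tendstoD(2)[of _ 0]) auto
 then obtain k where k: "(LB x. \<bar>F n x - h k x\<bar>) < e / 2"
  using eventually_happens'[OF sequentially_bot] by blast
 have "(LB x. \<bar>f x - h k x\<bar>) <= (LB x. \<bar>f x - F n x\<bar> + \<bar>F n x - h k x\<bar>)"
  using f iF ih[of k] by (intro integral_mono) auto
 also have "... = (LB x. \<bar>f x - F n x\<bar>) + (LB x. \<bar>F n x - h k x\<bar>)"
  using f iF ih[of k] by (intro integral_add) auto
 also have "... < e" using n k by simp
 finally have fin: "(LB x. \<bar>f x - h k x\<bar>) < e" .
 show ?thesis
  by (rule that[OF hc[of k] _ ih _ fin, of "real n + 1"]) (auto simp: h_def)
qed

theorem osc_tendsto_0:
 fixes f :: "'a::euclidean_space => real"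
 assumes f: "L1 f" and e: "0 < e"
 obtains d where "0 < d" "!!z. norm z < d ==> osc f z < e"
proof -
 obtain g m where g: "continuous_on UNIV g" "!!x. m < norm x ==> g x = 0" "L1 g" "0 <= m"
  "(LB x. \<bar>f x - g x\<bar>) < e / 4"
  using L1_continuous_approx[OF f, of "e / 4"] e by auto
 define M where "M = measure lborel (cball (0::'a) (m + 1))"
 have [measurable]: "f \<in> Borel" "g \<in> Borel" using f g by auto
 have "uniformly_continuous_on (cball 0 (m + 2)) g"
  by (intro compact_uniformly_continuous continuous_on_subset[OF g(1)]) auto
 moreover have eM: "0 < e / (2 * (M + 1))" using e by (auto simp: M_def intro!: divide_pos_pos add_nonneg_pos)
 ultimately obtain d where d: "0 < d" "!!x y. x \<in> cball 0 (m + 2) ==> y \<in> cball 0 (m + 2) ==> dist y x < d ==> dist (g y) (g x) < e / (2 * (M + 1))"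
  unfolding uniformly_continuous_on_def by metis
 have gz: "osc g z <= e / 2" if z: "norm z < d" "norm z < 1" for z
 proof -
  have "\<bar>g (x + z) - g x\<bar> <= e / (2 * (M + 1)) * indicator (cball 0 (m + 1)) x" for x
  proof (cases "norm x <= m + 1")
   case True
   have "norm (x + z) <= norm x + norm z" by (rule norm_triangle_ineq)
   then have "x + z \<in> cball 0 (m + 2)" "x \<in> cball 0 (m + 2)"
    using True z unfolding mem_cball_0 by linarith+
   then have "dist (g (x + z)) (g x) < e / (2 * (M + 1))"
    using z by (intro d) (auto simp: dist_norm)
   then show ?thesis using True by (simp add: dist_real_def)
  next
   case False
   have "norm x <= norm (x + z) + norm z" using norm_triangle_ineq4[of "x + z" z] by simp
   then show ?thesis using False z g(2)[of x] g(2)[of "x + z"] by (simp add: indicator_def)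
  qed
  then have "osc g z <= (LB x. e / (2 * (M + 1)) * indicator (cball (0::'a) (m + 1)) x)"
   unfolding osc_def
   by (intro integral_mono osc_integrable g integrable_mult_right integrable_real_indicator)
     auto
  also have "... = e / (2 * (M + 1)) * M"
   by (simp add: M_def)
  also have "... <= e / 2"
  proof -
   have "0 <= M" by (simp add: M_def)
   then show ?thesis using e by (simp add: field_simps)
  qed
  finally show ?thesis .
 qed
 have "osc f z < e" if z: "norm z < min d 1" for z
 proof -
  let ?i = "%x. \<bar>f x - g x\<bar>"
  have ii: "L1 ?i" "L1 (%x. ?i (x + z))" "L1 (%x. \<bar>g (x + z) - g x\<bar>)"
   using f g integrable_lborel_shift[of ?i z] osc_integrable[OF g(3)] by auto
  have "osc f z <= (LB x. (?i (x + z) + \<bar>g (x + z) - g x\<bar>) + ?i x)"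
   unfolding osc_def
   by (intro integral_mono osc_integrable f integrable_add ii) auto
  also have "... = (LB x. ?i (x + z)) + osc g z + (LB x. ?i x)"
   unfolding osc_def using ii by simp
  also have "(LB x. ?i (x + z)) = (LB x. ?i x)"
   by (rule integral_lborel_shift[of ?i]) auto
  finally show ?thesis using g(5) gz[of z] z by simp
 qed
 then show ?thesis using d(1) by (intro that[of "min d 1"]) auto
qed

section \<open>Integrals over pairs of points weighted by a function of x - y\<close>

lemma young_x:
 fixes p m :: "'a::euclidean_space => ennreal"
 assumes [measurable]: "p \<in> Borel" "m \<in> Borel"
 shows "(NN y. (NN x. p x * m (x - y))) = (NN x. p x) * (NN x. m x)"
proof -
 have "(NN y. (NN x. p x * m (x - y))) = (NN x. (NN y. p x * m (x - y)))"
  by (rule lborel_pair.Fubini') measurable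
 also have "... = (NN x. p x * (NN y. m y))"
  using nn_integral_lborel_reflect[of m] by (simp add: nn_integral_cmult)
 finally show ?thesis by (simp add: nn_integral_multc)
qed

lemma young_y:
 fixes p m :: "'a::euclidean_space => ennreal"
 assumes [measurable]: "p \<in> Borel" "m \<in> Borel"
 shows "(NN y. (NN x. p y * m (x - y))) = (NN x. p x) * (NN x. m x)"
proof -
 have "(NN x. m (x - y)) = (NN x. m x)" for y
  using nn_integral_lborel_shift[of m "- y"] by simp
 then show ?thesis by (simp add: nn_integral_cmult nn_integral_multc)
qed

text \<open>Points of the product are ordered as \<open>(y, x)\<close>, matching the iterated integrals above.\<close>

lemma integrable_pair_x:
 fixes p m :: "'a::euclidean_space => real"
 assumes p: "L1 p" and m: "L1 m"
 shows "integrable lborel2 (%(y, x). p x * m (x - y))"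
proof -
 have [measurable]: "p \<in> Borel" "m \<in> Borel" using p m by auto
 have "(\<integral>\<^sup>+z. ennreal (norm (case z of (y, x) => p x * m (x - y))) \<partial>lborel2)
   = (NN y. (NN x. ennreal \<bar>p x\<bar> * ennreal \<bar>m (x - y)\<bar>))"
  by (subst lborel.nn_integral_fst[symmetric]) (auto simp: abs_mult ennreal_mult)
 also have "... = (NN x. ennreal \<bar>p x\<bar>) * (NN x. ennreal \<bar>m x\<bar>)"
  by (rule young_x) auto
 also have "... < \<infinity>"
  using p m by (auto simp: integrable_iff_bounded ennreal_mult_less_top)
 finally show ?thesis by (simp add: integrable_iff_bounded)
qed

lemma integrable_pair_y:
 fixes p m :: "'a::euclidean_space => real"
 assumes p: "L1 p" and m: "L1 m"
 shows "integrable lborel2 (%(y, x). p y * m (x - y))"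
proof -
 have [measurable]: "p \<in> Borel" "m \<in> Borel" using p m by auto
 have "(\<integral>\<^sup>+z. ennreal (norm (case z of (y, x) => p y * m (x - y))) \<partial>lborel2)
   = (NN y. (NN x. ennreal \<bar>p y\<bar> * ennreal \<bar>m (x - y)\<bar>))"
  by (subst lborel.nn_integral_fst[symmetric]) (auto simp: abs_mult ennreal_mult)
 also have "... = (NN x. ennreal \<bar>p x\<bar>) * (NN x. ennreal \<bar>m x\<bar>)"
  by (rule young_y) auto
 also have "... < \<infinity>"
  using p m by (auto simp: integrable_iff_bounded ennreal_mult_less_top)
 finally show ?thesis by (simp add: integrable_iff_bounded)
qed

subsection \<open>Mollification\<close>

context kernel
begin

lemma K0: "0 <= K" using bound[of 0] nonneg[of 0] by linarith

lemma has_derivative_rho: "(\<rho> has_derivative (%h. h \<bullet> D x)) (at x)"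
 by (rule has_derivative_quadI[OF bounded_linear_inner_left]) (use taylor in auto)

lemma continuous_rho: "continuous_on S \<rho>"
 by (meson continuous_at_imp_continuous_on has_derivative_continuous has_derivative_rho)

lemma continuous_D: "continuous_on S D"
proof -
 have "K-lipschitz_on S D"
  by (rule lipschitz_onI) (use D_lip K0 in \<open>auto simp: dist_norm\<close>)
 then show ?thesis by (rule lipschitz_on_continuous_on)
qed

lemma rho_measurable [measurable]: "\<rho> \<in> Borel"
 and D_measurable [measurable]: "D \<in> Borel"
 by (auto intro: borel_measurable_continuous_onI continuous_rho continuous_D)

text \<open>Evenness of the kernel and uniqueness of derivatives. Oddness makes the gradient terms
  of the doubled integrand antisymmetric under exchange of the two functions
  (\<open>FL_swap\<close>, \<open>VV_swap\<close>).\<close>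

lemma D_odd: "D (- w) = - D w"
proof -
 have "((%x. \<rho> (- x)) has_derivative (%h. (- h) \<bullet> D (- w))) (at w)"
  by (rule has_derivative_compose[OF _ has_derivative_rho]) (auto intro!: derivative_eq_intros)
 then have "(\<rho> has_derivative (%h. (- h) \<bullet> D (- w))) (at w)"
  by (simp add: even)
 from has_derivative_unique[OF this has_derivative_rho] have "(- h) \<bullet> D (- w) = h \<bullet> D w" for h
  by meson
 then have "h \<bullet> (D (- w) + D w) = 0" for h
  by (simp add: inner_add_right) (metis add.inverse_inverse add.right_inverse)
 then have "D (- w) + D w = 0" by (metis inner_eq_zero_iff)
 then show ?thesis by (simp add: eq_neg_iff_add_eq_0)
qed

lemma D_swap: "D (x - y) = - D (y - x)" using D_odd[of "y - x"] by simp

lemma rho_swap: "\<rho> (x - y) = \<rho> (y - x)" using even[of "y - x"] by simp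

lemma integrable_ball_bound:
 fixes f :: "'a => 'b::{banach, second_countable_topology}"
 assumes [measurable]: "f \<in> Borel" and "!!w. norm (f w) <= C" "!!w. m < norm w ==> f w = 0"
 shows "L1 f"
proof (rule integrable_bound)
 show "L1 (%x::'a. C * indicator (cball 0 m) x)"
  by (intro integrable_mult_right integrable_real_indicator) auto
 show "AE x in lborel. norm (f x) <= norm (C * indicator (cball 0 m) x)"
  using assms(2,3) by (intro AE_I2) (auto simp: indicator_def intro: order_trans[OF _ abs_ge_self])
qed simp

lemma integrable_rho: "L1 \<rho>"
 by (rule integrable_ball_bound[of _ K R]) (use bound nonneg supp in auto)

lemma integrable_D: "L1 D"
 by (rule integrable_ball_bound[of _ K R]) (use D_bound D_supp in auto)

lemma integral_rho: "(LB w. \<rho> w) = 1"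
 using mass nonneg by (subst integral_eq_nn_integral) auto

lemma integral_rho_shift: "(LB x. \<rho> (x - y)) = 1" "(LB y. \<rho> (x - y)) = 1"
 using integral_lborel_shift[of \<rho> "- y"] integral_lborel_reflect[of \<rho> x] integral_rho by auto

definition mol :: "('a => 'b::euclidean_space) => 'a => 'b" where
 "mol p x = (LB y. \<rho> (x - y) *\<^sub>R p y)"

definition dmol :: "('a => 'b::euclidean_space) => 'a => 'a => 'b" where
 "dmol p x h = (LB y. (h \<bullet> D (x - y)) *\<^sub>R p y)"

lemma integrable_mol_bound:
 fixes p :: "'a => 'b::euclidean_space"
 assumes p: "L1 p" and [measurable]: "k \<in> Borel" and "!!y. \<bar>k y\<bar> <= C"
 shows "L1 (%y. k y *\<^sub>R p y)" "norm (LB y. k y *\<^sub>R p y) <= C * (LB y. norm (p y))"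
proof -
 have [measurable]: "p \<in> Borel" using p by auto
 show i: "L1 (%y. k y *\<^sub>R p y)"
 proof (rule integrable_bound)
  show "L1 (%y. C * norm (p y))" using p by simp
  show "AE y in lborel. norm (k y *\<^sub>R p y) <= norm (C * norm (p y))"
  proof (intro AE_I2)
   fix y
   have "\<bar>k y\<bar> * norm (p y) <= C * norm (p y)" using assms(3) by (intro mult_right_mono) auto
   then show "norm (k y *\<^sub>R p y) <= norm (C * norm (p y))" by simp
  qed
 qed simp
 have "norm (LB y. k y *\<^sub>R p y) <= (LB y. norm (k y *\<^sub>R p y))"
  by (rule integral_norm_bound)
 also have "... <= (LB y. C * norm (p y))"
  using integrable_norm[OF i] p assms(3) by (intro integral_mono) (auto intro!: mult_right_mono)
 finally show "norm (LB y. k y *\<^sub>R p y) <= C * (LB y. norm (p y))" by simp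
qed

lemma inner_D_le: "\<bar>h \<bullet> D w\<bar> <= K * norm h"
 using Cauchy_Schwarz_ineq2[of h "D w"] mult_left_mono[OF D_bound[of w] norm_ge_zero[of h]]
 by (simp add: mult.commute)

lemma inner_D_diff_le: "\<bar>h \<bullet> D w - h \<bullet> D w'\<bar> <= K * norm h * norm (w - w')"
 using Cauchy_Schwarz_ineq2[of h "D w - D w'"] mult_left_mono[OF D_lip[of w w'] norm_ge_zero[of h]]
 by (simp add: inner_diff_right mult_ac)

lemma
 fixes p :: "'a => 'b::euclidean_space"
 assumes p: "L1 p"
 shows mol_integrable: "L1 (%y. \<rho> (x - y) *\<^sub>R p y)"
  and dmol_integrable: "L1 (%y. (h \<bullet> D (x - y)) *\<^sub>R p y)"
  and has_derivative_mol: "(mol p has_derivative dmol p x) (at x)"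
  and dmol_lipschitz: "norm (dmol p x h - dmol p x' h) <= K * norm h * norm (x - x') * (LB y. norm (p y))"
  and dmol_bound: "norm (dmol p x h) <= K * norm h * (LB y. norm (p y))"
  and mol_lipschitz: "norm (mol p x - mol p x') <= K * norm (x - x') * (LB y. norm (p y))"
  and mol_bound: "norm (mol p x) <= K * (LB y. norm (p y))"
proof -
 have [measurable]: "p \<in> Borel" using p by auto
 have \<rho>b: "\<bar>\<rho> w\<bar> <= K" for w using bound nonneg by simp
 show im: "L1 (%y. \<rho> (x - y) *\<^sub>R p y)" for x
  by (rule integrable_mol_bound[OF p]) (use \<rho>b in auto)
 show id: "L1 (%y. (h \<bullet> D (x - y)) *\<^sub>R p y)" for x h
  by (rule integrable_mol_bound[OF p]) (use inner_D_le in auto)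
 show "norm (dmol p x h) <= K * norm h * (LB y. norm (p y))" for x h
  unfolding dmol_def by (rule integrable_mol_bound[OF p]) (use inner_D_le in auto)
 then have db: "norm (dmol p x h) <= norm h * (K * (LB y. norm (p y)))" for x h
  by (simp add: mult_ac)
 show "norm (mol p x) <= K * (LB y. norm (p y))"
  unfolding mol_def by (rule integrable_mol_bound[OF p]) (use \<rho>b in auto)
 have "dmol p x h - dmol p x' h = (LB y. (h \<bullet> D (x - y) - h \<bullet> D (x' - y)) *\<^sub>R p y)"
  unfolding dmol_def by (subst integral_diff[symmetric]) (auto simp: id scaleR_diff_left)
 also have "norm ... <= K * norm h * norm (x - x') * (LB y. norm (p y))"
 proof (rule integrable_mol_bound[OF p])
  show "\<bar>h \<bullet> D (x - y) - h \<bullet> D (x' - y)\<bar> <= K * norm h * norm (x - x')" for y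
   using inner_D_diff_le[of h "x - y" "x' - y"] by simp
 qed simp
 finally show "norm (dmol p x h - dmol p x' h) <= K * norm h * norm (x - x') * (LB y. norm (p y))" .
 have "mol p x - mol p x' = (LB y. (\<rho> (x - y) - \<rho> (x' - y)) *\<^sub>R p y)"
  unfolding mol_def by (subst integral_diff[symmetric]) (auto simp: im scaleR_diff_left)
 also have "norm ... <= K * norm (x - x') * (LB y. norm (p y))"
 proof (rule integrable_mol_bound[OF p])
  show "\<bar>\<rho> (x - y) - \<rho> (x' - y)\<bar> <= K * norm (x - x')" for y
   using lip[of "x - y" "x' - y"] by simp
 qed simp
 finally show "norm (mol p x - mol p x') <= K * norm (x - x') * (LB y. norm (p y))" .
 show "(mol p has_derivative dmol p x) (at x)"
 proof (rule has_derivative_quadI)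
  show "bounded_linear (dmol p x)"
  proof (rule bounded_linear_intro)
   show "dmol p x (a + b) = dmol p x a + dmol p x b" for a b
    unfolding dmol_def by (subst integral_add[symmetric]) (auto simp: id inner_add_left scaleR_add_left)
   show "dmol p x (r *\<^sub>R a) = r *\<^sub>R dmol p x a" for r a
    unfolding dmol_def by (subst integral_scaleR_right[symmetric]) (simp add: mult_ac)
  qed (rule db)
  fix h
  have "mol p (x + h) - mol p x - dmol p x h = (LB y. (\<rho> (x + h - y) - \<rho> (x - y) - h \<bullet> D (x - y)) *\<^sub>R p y)"
   unfolding mol_def dmol_def using im[of x] im[of "x + h"] id[of h x]
   by (simp add: scaleR_diff_left)
  also have "norm ... <= K * (norm h)\<^sup>2 * (LB y. norm (p y))"
  proof (rule integrable_mol_bound[OF p])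
   show "\<bar>\<rho> (x + h - y) - \<rho> (x - y) - h \<bullet> D (x - y)\<bar> <= K * (norm h)\<^sup>2" for y
    using taylor[of "x - y" h] by (simp add: algebra_simps)
  qed simp
  finally show "norm (mol p (x + h) - mol p x - dmol p x h) <= K * (LB y. norm (p y)) * (norm h)\<^sup>2"
   by (simp add: mult_ac)
 qed
qed

lemma continuous_dmol:
 assumes "L1 p" shows "continuous_on S (%x. dmol p x h)"
proof -
 let ?C = "K * norm h * (LB y. norm (p y))"
 have "?C-lipschitz_on S (%x. dmol p x h)"
  by (rule lipschitz_onI) (use dmol_lipschitz[OF assms] K0 in \<open>auto simp: dist_norm mult_ac\<close>)
 then show ?thesis by (rule lipschitz_on_continuous_on)
qed

text \<open>The gradient of \<open>mol p\<close> for real-valued \<open>p\<close>: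
  \<open>inner_gmol\<close> identifies its components with \<open>dmol\<close>, which also covers
  the vector fields needed for \<open>total_variation\<close>.\<close>

definition gmol :: "('a => real) => 'a => 'a" where
 "gmol p x = (LB y. p y *\<^sub>R D (x - y))"

lemma gmol_integrable:
 assumes p: "L1 p" shows "L1 (%y. p y *\<^sub>R D (x - y))"
proof (rule integrable_bound)
 show "L1 (%y. K * \<bar>p y\<bar>)" using p by simp
 have [measurable]: "p \<in> Borel" using p by auto
 show "(%y. p y *\<^sub>R D (x - y)) \<in> borel_measurable lborel" by simp
 show "AE y in lborel. norm (p y *\<^sub>R D (x - y)) <= norm (K * \<bar>p y\<bar>)"
  using mult_left_mono[OF D_bound abs_ge_zero] K0 by (intro AE_I2) (auto simp: abs_mult mult.commute[of K])
qed

lemma inner_gmol: "L1 p ==> h \<bullet> gmol p x = dmol p x h"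
 unfolding gmol_def dmol_def
 by (subst integral_inner_right[symmetric]) (auto simp: gmol_integrable mult.commute)

lemma gmol_measurable:
 assumes [measurable]: "p \<in> Borel" shows "gmol p \<in> Borel"
 unfolding gmol_def[abs_def] by measurable

lemma mol_measurable: 
 fixes p :: "'a => real"
 assumes [measurable]: "p \<in> Borel" shows "mol p \<in> Borel"
 unfolding mol_def[abs_def] by measurable

lemma integrable_norm_gmol:
 assumes p: "L1 p" shows "L1 (%x. norm (gmol p x))"
proof -
 have [measurable]: "p \<in> Borel" using p by auto
 have [measurable]: "gmol p \<in> Borel" by (rule gmol_measurable) simp
 have "(NN x. ennreal (norm (gmol p x))) <= (NN x. (NN y. ennreal \<bar>p y\<bar> * ennreal (norm (D (x - y)))))"
 proof (intro nn_integral_mono)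
  fix x
  have "ennreal (norm (gmol p x)) <= (NN y. ennreal (norm (p y *\<^sub>R D (x - y))))"
   unfolding gmol_def by (rule integral_norm_bound_ennreal[OF gmol_integrable[OF p]])
  then show "ennreal (norm (gmol p x)) <= (NN y. ennreal \<bar>p y\<bar> * ennreal (norm (D (x - y))))"
   by (simp add: ennreal_mult)
 qed
 also have "... = (NN y. (NN x. ennreal \<bar>p y\<bar> * ennreal (norm (D (x - y)))))"
  by (rule lborel_pair.Fubini') measurable
 also have "... = (NN x. ennreal \<bar>p x\<bar>) * (NN x. ennreal (norm (D x)))"
  by (rule young_y) auto
 also have "... < \<infinity>"
  using p integrable_D by (auto simp: integrable_iff_bounded ennreal_mult_less_top)
 finally show ?thesis by (simp add: integrable_iff_bounded)
qed

lemma integrable_mol: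
 fixes p :: "'a => real"
 assumes p: "L1 p" shows "L1 (mol p)"
proof -
 have [measurable]: "p \<in> Borel" using p by auto
 have [measurable]: "mol p \<in> Borel" by (rule mol_measurable) simp
 have "(NN x. ennreal (norm (mol p x))) <= (NN x. (NN y. ennreal \<bar>p y\<bar> * ennreal (\<rho> (x - y))))"
 proof (intro nn_integral_mono)
  fix x
  have "ennreal (norm (mol p x)) <= (NN y. ennreal (norm (\<rho> (x - y) *\<^sub>R p y)))"
   unfolding mol_def by (rule integral_norm_bound_ennreal[OF mol_integrable[OF p]])
  then show "ennreal (norm (mol p x)) <= (NN y. ennreal \<bar>p y\<bar> * ennreal (\<rho> (x - y)))"
   by (simp add: abs_mult nonneg ennreal_mult mult.commute)
 qed
 also have "... = (NN y. (NN x. ennreal \<bar>p y\<bar> * ennreal (\<rho> (x - y))))"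
  by (rule lborel_pair.Fubini') measurable
 also have "... = (NN x. ennreal \<bar>p x\<bar>) * (NN x. ennreal (\<rho> x))"
  by (rule young_y) auto
 also have "... < \<infinity>"
  using p mass by (auto simp: integrable_iff_bounded ennreal_mult_less_top)
 finally show ?thesis by (simp add: integrable_iff_bounded)
qed

end

section \<open>Translation modulus and variation of mollified functions\<close>

context kernel
begin

lemma scale_diff:
 fixes a b :: real
 shows "ennreal (norm (\<rho> y *\<^sub>R a - \<rho> y *\<^sub>R b)) = ennreal (\<rho> y) * ennreal \<bar>a - b\<bar>"
 by (simp only: scaleR_diff_right[symmetric] norm_scaleR) (simp add: nonneg ennreal_mult)

text \<open>A mollification is an average of translates, and each translate has the same modulus;
  averaging with mass 1 cannot increase it.\<close>

lemma mol_diff_le: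
 fixes p :: "'a => real"
 assumes p: "L1 p"
 shows "(LB x. \<bar>mol p (x + z) - mol p x\<bar>) <= osc p z"
proof -
 have [measurable]: "p \<in> Borel" using p by auto
 have [measurable]: "mol p \<in> Borel" by (rule mol_measurable) simp
 have eq: "mol p x = (LB y. \<rho> y *\<^sub>R p (x - y))" for x
  unfolding mol_def using integral_lborel_reflect[of "%y. \<rho> (x - y) *\<^sub>R p y" x] by simp
 have int: "L1 (%y. \<rho> y *\<^sub>R p (x - y))" for x
  using integrable_lborel_reflect[OF mol_integrable[OF p, of x], of x] by simp
 have "(NN x. ennreal \<bar>mol p (x + z) - mol p x\<bar>)
  <= (NN x. (NN y. ennreal (\<rho> y) * ennreal \<bar>p (x - y + z) - p (x - y)\<bar>))"
 proof (intro nn_integral_mono)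
  fix x
  have "mol p (x + z) - mol p x = (LB y. \<rho> y *\<^sub>R p (x + z - y) - \<rho> y *\<^sub>R p (x - y))"
   unfolding eq by (subst integral_diff[OF int int]) simp
  then have "ennreal (norm (mol p (x + z) - mol p x)) <= (NN y. ennreal (norm (\<rho> y *\<^sub>R p (x + z - y) - \<rho> y *\<^sub>R p (x - y))))"
   using integral_norm_bound_ennreal[OF integrable_diff[OF int int], of "x + z" x] by simp
  also have "... = (NN y. ennreal (\<rho> y) * ennreal \<bar>p (x - y + z) - p (x - y)\<bar>)"
   by (simp only: scale_diff diff_add_eq)
  finally show "ennreal \<bar>mol p (x + z) - mol p x\<bar> <= (NN y. ennreal (\<rho> y) * ennreal \<bar>p (x - y + z) - p (x - y)\<bar>)"
   by simp
 qed
 also have "... = (NN y. (NN x. ennreal (\<rho> y) * ennreal \<bar>p (x - y + z) - p (x - y)\<bar>))"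
  by (rule lborel_pair.Fubini') measurable
 also have "... = (NN y. ennreal (\<rho> y) * ennreal (osc p z))"
 proof (intro nn_integral_cong)
  fix y
  have "(NN x. ennreal (\<rho> y) * ennreal \<bar>p (x - y + z) - p (x - y)\<bar>)
    = ennreal (\<rho> y) * (NN x. ennreal \<bar>p (x - y + z) - p (x - y)\<bar>)"
   by (rule nn_integral_cmult) auto
  also have "(NN x. ennreal \<bar>p (x - y + z) - p (x - y)\<bar>) = ennreal (osc p z)"
   using nn_integral_lborel_shift[of "%x. ennreal \<bar>p (x + z) - p x\<bar>" "- y"] osc_nn_integral[OF p, of z] by simp
  finally show "(NN x. ennreal (\<rho> y) * ennreal \<bar>p (x - y + z) - p (x - y)\<bar>) = ennreal (\<rho> y) * ennreal (osc p z)" .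
 qed
 also have "... = ennreal (osc p z)"
  by (simp add: nn_integral_multc mass)
 finally have "(NN x. ennreal \<bar>mol p (x + z) - mol p x\<bar>) <= ennreal (osc p z)" .
 then show ?thesis
  using nn_integral_eq_integral[OF osc_integrable[OF integrable_mol[OF p], of z]] osc_nonneg[of p z] by simp
qed

lemma osc_mol_le: "L1 p ==> osc (mol p) z <= osc p z"
 using mol_diff_le[of p z] by (simp add: osc_def)

lemma mol_approx:
 fixes p :: "'a => real"
 assumes p: "L1 p" and e: "!!w. norm w <= R ==> osc p w <= e" and e0: "0 <= e"
 shows "(LB x. \<bar>mol p x - p x\<bar>) <= e"
proof -
 have [measurable]: "p \<in> Borel" using p by auto
 have [measurable]: "mol p \<in> Borel" by (rule mol_measurable) simp
 have eq: "mol p x = (LB y. \<rho> y *\<^sub>R p (x - y))" for x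
  unfolding mol_def using integral_lborel_reflect[of "%y. \<rho> (x - y) *\<^sub>R p y" x] by simp
 have int: "L1 (%y. \<rho> y *\<^sub>R p (x - y))" "L1 (%y. \<rho> y *\<^sub>R p x)" for x
  using integrable_lborel_reflect[OF mol_integrable[OF p, of x], of x] integrable_rho by simp_all
 have "(NN x. ennreal \<bar>mol p x - p x\<bar>)
  <= (NN x. (NN y. ennreal (\<rho> y) * ennreal \<bar>p (x + (- y)) - p x\<bar>))"
 proof (intro nn_integral_mono)
  fix x
  have "p x = (LB y. \<rho> y *\<^sub>R p x)" by (simp add: integral_rho)
  then have "mol p x - p x = (LB y. \<rho> y *\<^sub>R p (x - y) - \<rho> y *\<^sub>R p x)"
   unfolding eq using integral_diff[OF int, of x x] by simp
  then have "ennreal (norm (mol p x - p x)) <= (NN y. ennreal (norm (\<rho> y *\<^sub>R p (x - y) - \<rho> y *\<^sub>R p x)))"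
   using integral_norm_bound_ennreal[OF integrable_diff[OF int, of x x]] by simp
  also have "... = (NN y. ennreal (\<rho> y) * ennreal \<bar>p (x + (- y)) - p x\<bar>)"
   by (simp only: scale_diff add_uminus_conv_diff)
  finally show "ennreal \<bar>mol p x - p x\<bar> <= (NN y. ennreal (\<rho> y) * ennreal \<bar>p (x + (- y)) - p x\<bar>)"
   by simp
 qed
 also have "... = (NN y. (NN x. ennreal (\<rho> y) * ennreal \<bar>p (x + (- y)) - p x\<bar>))"
  by (rule lborel_pair.Fubini') measurable
 also have "... = (NN y. ennreal (\<rho> y) * ennreal (osc p (- y)))"
  by (simp add: nn_integral_cmult osc_nn_integral[OF p, symmetric])
 also have "... <= (NN y. ennreal (\<rho> y) * ennreal e)"
 proof (intro nn_integral_mono)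
  fix y show "ennreal (\<rho> y) * ennreal (osc p (- y)) <= ennreal (\<rho> y) * ennreal e"
   using supp[of y] e[of "- y"] by (cases "R < norm y") (auto intro!: mult_left_mono ennreal_leI)
 qed
 also have "... = ennreal e"
  by (simp add: nn_integral_multc mass)
 finally have "(NN x. ennreal \<bar>mol p x - p x\<bar>) <= ennreal e" .
 moreover have "L1 (%x. \<bar>mol p x - p x\<bar>)" using integrable_mol[OF p] p by auto
 ultimately show ?thesis
  using nn_integral_eq_integral[of lborel "%x. \<bar>mol p x - p x\<bar>"] e0 by simp
qed

text \<open>Difference quotients of the smooth \<open>mol p\<close> converge pointwise. As the steps
  are at most 1, the Lipschitz bound and the support of the kernel dominate them by the convolution
  of |p| with a multiple of the indicator of the ball of radius R + |z|.\<close>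

lemma osc_mol_tendsto:
 fixes p :: "'a => real"
 assumes p: "L1 p"
 shows "(%n. real (Suc n) * osc (mol p) ((1 / real (Suc n)) *\<^sub>R z)) \<longlonglongrightarrow> (LB x. \<bar>z \<bullet> gmol p x\<bar>)"
proof -
 have [measurable]: "p \<in> Borel" using p by auto
 have [measurable]: "mol p \<in> Borel" by (rule mol_measurable) simp
 have [measurable]: "gmol p \<in> Borel" by (rule gmol_measurable) simp
 define h where "h n = (1 / real (Suc n))" for n
 have h: "0 < h n" "h n <= 1" for n by (auto simp: h_def)
 define B where "B w = K * norm z * indicator (cball 0 (R + norm z)) w" for w :: 'a
 define G where "G x = (LB y. \<bar>p y\<bar> * B (x - y))" for x
 have iB: "L1 B"
  unfolding B_def by (intro integrable_mult_right integrable_real_indicator) auto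
 have [measurable]: "B \<in> Borel" using iB by auto
 have iG0: "integrable lborel2 (%(y, x). \<bar>p y\<bar> * B (x - y))"
  by (rule integrable_pair_y) (use p iB in auto)
 have iG: "L1 G"
  using lborel_pair.integrable_snd[OF iG0] by (simp add: G_def[abs_def])
 have "AE x in lborel. \<bar>(mol p (x + h n *\<^sub>R z) - mol p x) / h n\<bar> <= G x" for n
 proof (intro AE_I2)
  fix x
  have iBx: "L1 (%y. \<bar>p y\<bar> * B (x - y))"
  proof (rule integrable_bound)
   show "L1 (%y. K * norm z * \<bar>p y\<bar>)" using p by simp
   show "AE y in lborel. norm (\<bar>p y\<bar> * B (x - y)) <= norm (K * norm z * \<bar>p y\<bar>)"
    using K0 by (intro AE_I2) (auto simp: B_def indicator_def)
  qed auto
  have b: "\<bar>(\<rho> (x + h n *\<^sub>R z - y) - \<rho> (x - y)) / h n\<bar> <= B (x - y)" for y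
  proof (cases "norm (x - y) <= R + norm z")
   case True
   have "\<bar>\<rho> (x - y + h n *\<^sub>R z) - \<rho> (x - y)\<bar> <= K * norm (h n *\<^sub>R z)"
    using lip[of "x - y + h n *\<^sub>R z" "x - y"] by simp
   then show ?thesis using True h[of n] by (simp add: B_def field_simps)
  next
   case False
   have "norm (x - y) <= norm (x - y + h n *\<^sub>R z) + norm (h n *\<^sub>R z)"
    using norm_triangle_ineq4[of "x - y + h n *\<^sub>R z" "h n *\<^sub>R z"] by simp
   moreover have "norm (h n *\<^sub>R z) <= norm z" using h[of n] by (simp add: mult_left_le_one_le)
   ultimately have "R < norm (x - y + h n *\<^sub>R z)" "R < norm (x - y)" using False norm_ge_zero[of z] by linarith+
   then show ?thesis using False supp by (simp add: B_def algebra_simps)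
  qed
  have "(mol p (x + h n *\<^sub>R z) - mol p x) / h n = (LB y. ((\<rho> (x + h n *\<^sub>R z - y) - \<rho> (x - y)) / h n) *\<^sub>R p y)"
   unfolding mol_def using mol_integrable[OF p, of x] mol_integrable[OF p, of "x + h n *\<^sub>R z"]
   by (simp add: diff_divide_distrib left_diff_distrib)
  also have "\<bar>...\<bar> <= (LB y. \<bar>((\<rho> (x + h n *\<^sub>R z - y) - \<rho> (x - y)) / h n) *\<^sub>R p y\<bar>)"
   using integral_norm_bound[of lborel "%y. ((\<rho> (x + h n *\<^sub>R z - y) - \<rho> (x - y)) / h n) *\<^sub>R p y"] by simp
  also have "... <= G x"
   unfolding G_def
  proof (rule integral_mono')
   show "\<bar>((\<rho> (x + h n *\<^sub>R z - y) - \<rho> (x - y)) / h n) *\<^sub>R p y\<bar> <= \<bar>p y\<bar> * B (x - y)" for y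
    using mult_right_mono[OF b[of y] abs_ge_zero[of "p y"]] by (simp add: abs_mult mult.commute)
  qed (use iBx K0 in \<open>auto simp: B_def\<close>)
  finally show "\<bar>(mol p (x + h n *\<^sub>R z) - mol p x) / h n\<bar> <= G x" .
 qed
 note dom = this
 have lim: "AE x in lborel. (%n. \<bar>(mol p (x + h n *\<^sub>R z) - mol p x) / h n\<bar>) \<longlonglongrightarrow> \<bar>z \<bullet> gmol p x\<bar>"
 proof (intro AE_I2 tendsto_rabs)
  fix x
  have "((%t. x + t *\<^sub>R z) has_derivative (%s. s *\<^sub>R z)) (at (0::real))"
   by (auto intro!: derivative_eq_intros)
  from has_derivative_compose[OF this, of "mol p" "dmol p x"]
  have "((%t. mol p (x + t *\<^sub>R z)) has_derivative (%s. dmol p x (s *\<^sub>R z))) (at 0)"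
   using has_derivative_mol[OF p, of x] by simp
  then have "((%t. mol p (x + t *\<^sub>R z)) has_real_derivative dmol p x z) (at 0)"
   by (rule has_derivative_imp_has_field_derivative)
     (simp add: inner_gmol[OF p, symmetric])
  then have dq: "(%t. (mol p (x + t *\<^sub>R z) - mol p x) / t) \<midarrow>0\<rightarrow> dmol p x z"
   by (simp add: DERIV_def)
  have "h \<longlonglongrightarrow> 0"
   unfolding h_def using LIMSEQ_inverse_real_of_nat by (simp add: inverse_eq_divide)
  moreover have "\<forall>\<^sub>F n in sequentially. h n \<noteq> 0"
   using h(1) by (intro always_eventually allI) (metis less_irrefl)
  ultimately have "filterlim h (at 0) sequentially" by (simp add: filterlim_at)
  with dq have "(%n. (mol p (x + h n *\<^sub>R z) - mol p x) / h n) \<longlonglongrightarrow> dmol p x z"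
   by (rule filterlim_compose)
  then show "(%n. (mol p (x + h n *\<^sub>R z) - mol p x) / h n) \<longlonglongrightarrow> z \<bullet> gmol p x"
   by (simp add: inner_gmol[OF p])
 qed
 have "(%n. LB x. \<bar>(mol p (x + h n *\<^sub>R z) - mol p x) / h n\<bar>) \<longlonglongrightarrow> (LB x. \<bar>z \<bullet> gmol p x\<bar>)"
  by (rule integral_dominated_convergence[OF _ _ iG lim]) (use dom in auto)
 moreover have "(LB x. \<bar>(mol p (x + h n *\<^sub>R z) - mol p x) / h n\<bar>) = real (Suc n) * osc (mol p) ((1 / real (Suc n)) *\<^sub>R z)" for n
  unfolding osc_def using h(1)[of n]
  by (subst integral_mult_right_zero[symmetric])
    (intro integral_cong refl, simp add: abs_divide, simp add: h_def)
 ultimately show ?thesis by simp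
qed

lemma integrable_inner_gmol:
 assumes p: "L1 p" shows "L1 (%x. \<bar>z \<bullet> gmol p x\<bar>)"
proof (rule integrable_bound)
 show "L1 (%x. norm z * norm (gmol p x))" using integrable_norm_gmol[OF p] by simp
 have [measurable]: "gmol p \<in> Borel" by (rule gmol_measurable) (use p in auto)
 show "(%x. \<bar>z \<bullet> gmol p x\<bar>) \<in> borel_measurable lborel" by simp
qed (auto simp: Cauchy_Schwarz_ineq2)

text \<open>Subadditivity of the modulus gives osc (z) <= n osc (z / n), and the right-hand side
  converges to the directional variation.\<close>

lemma osc_mol_le_gmol:
 assumes p: "L1 p" shows "osc (mol p) z <= (LB x. \<bar>z \<bullet> gmol p x\<bar>)"
proof (rule LIMSEQ_le_const[OF osc_mol_tendsto[OF p]], intro exI allI impI)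
 fix n
 have "real (Suc n) *\<^sub>R ((1 / real (Suc n)) *\<^sub>R z) = z" by (simp del: of_nat_Suc)
 then show "osc (mol p) z <= real (Suc n) * osc (mol p) ((1 / real (Suc n)) *\<^sub>R z)"
  using osc_scale[OF integrable_mol[OF p], of "Suc n" "(1 / real (Suc n)) *\<^sub>R z"] by (simp del: of_nat_Suc)
qed

text \<open>Duality: the test field is the mollification of the negative direction of
  \<open>gmol w\<close>, cut to a ball. It is C^1 with compact support and norm at most 1, and
  Fubini moves the kernel from the field back to \<open>w\<close>, which reproduces the integral of
  |gmol w| over the ball. The radius then tends to infinity.\<close>

lemma gmol_mass_le_BV:
 fixes w :: "'a => real"
 assumes w: "BV w"
 shows "(LB x. norm (gmol w x)) <= BV_seminorm w"
proof -
 have iw: "L1 w" and fin: "total_variation w < \<infinity>" using w by (auto simp: BV_def)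
 have [measurable]: "w \<in> Borel" using iw by auto
 have [measurable]: "gmol w \<in> Borel" by (rule gmol_measurable) simp
 have nn: "0 <= total_variation w"
 proof -
  have z: "Ck 1 (%x::'a. 0::'a)"
   by (simp add: frechet_derivative_const)
  have "ereal (LB x. w x * divergence (%x. 0) x) <= total_variation w"
   unfolding total_variation_def
   by (rule SUP_upper) (use z in \<open>auto simp: compact_support_def\<close>)
  then show ?thesis by (simp add: divergence_def frechet_derivative_const zero_ereal_def)
 qed
 have tv: "(LB x. w x * divergence \<Phi> x) <= BV_seminorm w"
  if "Ck 1 \<Phi>" "compact_support \<Phi>" "!!x. norm (\<Phi> x) <= 1" for \<Phi>
 proof -
  have "ereal (LB x. w x * divergence \<Phi> x) <= total_variation w"
   unfolding total_variation_def by (rule SUP_upper) (use that in auto)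
  then show ?thesis using fin nn unfolding BV_seminorm_def
   by (cases "total_variation w") auto
 qed
 have cut: "(LB x. norm (gmol w x) * indicator (cball 0 m) x) <= BV_seminorm w" for m :: real
 proof -
  \<comment> \<open>The minus sign offsets the one from \<open>D_swap\<close> when the derivative of
    the kernel passes from the field to \<open>w\<close>.\<close>
  define \<Phi> where "\<Phi> y = - (indicator (cball 0 m) y *\<^sub>R sgn (gmol w y))" for y :: 'a
  have [measurable]: "\<Phi> \<in> Borel" unfolding \<Phi>_def sgn_div_norm by measurable
  have \<Phi>b: "norm (\<Phi> y) <= 1" for y by (auto simp: \<Phi>_def indicator_def norm_sgn)
  have i\<Phi>: "L1 \<Phi>"
   by (rule integrable_ball_bound[of _ 1 m]) (use \<Phi>b in \<open>auto simp: \<Phi>_def\<close>)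
  have fd: "frechet_derivative (mol \<Phi>) (at x) = dmol \<Phi> x" for x
   by (rule frechet_derivative_at[OF has_derivative_mol[OF i\<Phi>], symmetric])
  have c1: "Ck 1 (mol \<Phi>)"
   using continuous_dmol[OF i\<Phi>] has_derivative_mol[OF i\<Phi>] by (auto simp: fd differentiable_def)
  have cs: "compact_support (mol \<Phi>)"
   unfolding compact_support_def compact_closure
  proof (rule boundedI[of _ "R + m"], rule ccontr)
   fix x assume x: "x \<in> {x. mol \<Phi> x \<noteq> 0}" "\<not> norm x <= R + m"
   have "\<rho> (x - y) *\<^sub>R \<Phi> y = 0" for y
   proof (cases "norm y <= m")
    case True
    have "norm x <= norm (x - y) + norm y" using norm_triangle_ineq[of "x - y" y] by simp
    then show ?thesis using True x supp[of "x - y"] by simp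
   qed (simp add: \<Phi>_def)
   then have "(%y. \<rho> (x - y) *\<^sub>R \<Phi> y) = (%_. 0)" by blast
   then have "mol \<Phi> x = 0" unfolding mol_def by simp
   then show False using x by simp
  qed
  have nb: "norm (mol \<Phi> x) <= 1" for x
  proof -
   have "norm (mol \<Phi> x) <= (LB y. norm (\<rho> (x - y) *\<^sub>R \<Phi> y))"
    unfolding mol_def by (rule integral_norm_bound)
   also have "... <= (LB y. \<rho> (x - y))"
    using integrable_norm[OF mol_integrable[OF i\<Phi>, of x]] \<Phi>b nonneg
    by (intro integral_mono integrable_lborel_reflect integrable_rho) (auto intro: mult_left_le)
   finally show ?thesis by (simp add: integral_rho_shift)
  qed
  have div: "divergence (mol \<Phi>) x = (LB y. D (x - y) \<bullet> \<Phi> y)" for x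
  proof -
   have "divergence (mol \<Phi>) x = (\<Sum>b\<in>Basis. (LB y. (b \<bullet> D (x - y)) *\<^sub>R \<Phi> y) \<bullet> b)"
    by (simp add: divergence_def fd dmol_def)
   also have "... = (\<Sum>b\<in>Basis. LB y. ((b \<bullet> D (x - y)) *\<^sub>R \<Phi> y) \<bullet> b)"
    by (intro sum.cong refl integral_inner_left[symmetric] dmol_integrable i\<Phi>)
   also have "... = (LB y. (\<Sum>b\<in>Basis. ((b \<bullet> D (x - y)) *\<^sub>R \<Phi> y) \<bullet> b))"
    by (rule integral_sum[symmetric]) (intro integrable_inner_left dmol_integrable i\<Phi>)
   also have "(%y. \<Sum>b\<in>Basis. ((b \<bullet> D (x - y)) *\<^sub>R \<Phi> y) \<bullet> b) = (%y. D (x - y) \<bullet> \<Phi> y)"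
    by (subst euclidean_inner) (simp add: inner_commute)
   finally show ?thesis .
  qed
  have "BV_seminorm w \<ge> (LB x. w x * divergence (mol \<Phi>) x)"
   by (rule tv[OF c1 cs nb])
  also have "(LB x. w x * divergence (mol \<Phi>) x) = (LB x. LB y. w x * (D (x - y) \<bullet> \<Phi> y))"
   by (simp add: div)
  also have "... = (LB y. LB x. w x * (D (x - y) \<bullet> \<Phi> y))"
  proof (rule lborel_pair.Fubini_integral)
   have i: "integrable lborel2 (%(y, x). w x * norm (D (x - y)))"
    using integrable_pair_x[OF iw, of "%w. norm (D w)"] integrable_D by auto
   show "integrable lborel2 (%(y, x). w x * (D (x - y) \<bullet> \<Phi> y))"
   proof (rule integrable_bound[OF i])
    show "AE z in lborel2. norm (case z of (y, x) => w x * (D (x - y) \<bullet> \<Phi> y)) <= norm (case z of (y, x) => w x * norm (D (x - y)))"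
    proof (intro AE_I2, clarsimp simp: abs_mult)
     fix y x
     have "\<bar>D (x - y) \<bullet> \<Phi> y\<bar> <= norm (D (x - y)) * 1"
      using Cauchy_Schwarz_ineq2[of "D (x - y)" "\<Phi> y"] mult_left_mono[OF \<Phi>b[of y] norm_ge_zero[of "D (x - y)"]] by linarith
     then show "\<bar>w x\<bar> * \<bar>D (x - y) \<bullet> \<Phi> y\<bar> <= \<bar>w x\<bar> * norm (D (x - y))" by (intro mult_left_mono) auto
    qed
   qed measurable
  qed
  also have "... = (LB y. norm (gmol w y) * indicator (cball 0 m) y)"
  proof (intro integral_cong refl)
   fix y
   have "(LB x. w x * (D (x - y) \<bullet> \<Phi> y)) = (LB x. - (w x *\<^sub>R D (y - x)) \<bullet> \<Phi> y)"
    by (subst D_swap) simp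
   also have "... = (LB x. - (w x *\<^sub>R D (y - x))) \<bullet> \<Phi> y"
    using gmol_integrable[OF iw, of y] by (intro integral_inner_left) auto
   also have "... = - gmol w y \<bullet> \<Phi> y" by (simp add: gmol_def)
   also have "... = norm (gmol w y) * indicator (cball 0 m) y"
    by (cases "gmol w y = 0") (auto simp: \<Phi>_def indicator_def sgn_div_norm dot_square_norm power2_eq_square)
   finally show "(LB x. w x * (D (x - y) \<bullet> \<Phi> y)) = norm (gmol w y) * indicator (cball 0 m) y" .
  qed
  finally show ?thesis .
 qed
 have "(%n. LB x. norm (gmol w x) * indicator (cball 0 (real n)) x) \<longlonglongrightarrow> (LB x. norm (gmol w x))"
 proof (rule integral_dominated_convergence[where w="%x. norm (gmol w x)"])
  show "AE x in lborel. (%n. norm (gmol w x) * indicator (cball 0 (real n)) x) \<longlonglongrightarrow> norm (gmol w x)"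
  proof (intro AE_I2 tendsto_eventually)
   fix x :: 'a
   obtain N :: nat where N: "norm x <= real N" using real_arch_simple by blast
   show "\<forall>\<^sub>F n in sequentially. norm (gmol w x) * indicator (cball 0 (real n)) x = norm (gmol w x)"
    using eventually_ge_at_top[of N]
   proof eventually_elim
    case (elim n)
    then have "norm x <= real n" using N by linarith
    then show ?case by simp
   qed
  qed
 qed (use integrable_norm_gmol[OF iw] in \<open>auto simp: indicator_def\<close>)
 then show ?thesis
  by (rule LIMSEQ_le_const2) (use cut in auto)
qed

end

lemma exists_small_kernel:
 assumes "0 < d"
 obtains \<rho> :: "'a::euclidean_space => real" and D K R where "kernel \<rho> D K R" "R <= d"
proof -
 define e where "e = d / (2 * real DIM('a))"
 have e: "0 < e" "real DIM('a) * (e * (1 + 1)) = d" using assms by (auto simp: e_def)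
 show ?thesis
  by (rule kernel_exists[OF e(1), of 1, where 'a='a]) (use that e in \<open>auto\<close>)
qed

lemma mol_eventually_close:
 fixes p :: "'a::euclidean_space => real"
 assumes p: "L1 p" and e: "0 < e"
 obtains \<rho> :: "'a => real" and D K R
 where "kernel \<rho> D K R" "(LB x. \<bar>kernel.mol \<rho> p x - p x\<bar>) <= e"
proof -
 obtain d where d: "0 < d" "!!z. norm z < d ==> osc p z < e" using osc_tendsto_0[OF p e] by blast
 obtain \<rho> :: "'a => real" and D K R where k: "kernel \<rho> D K R" "R <= d / 2"
  using exists_small_kernel[OF half_gt_zero[OF d(1)], where 'a='a] by blast
 have "(LB x. \<bar>kernel.mol \<rho> p x - p x\<bar>) <= e"
 proof (rule kernel.mol_approx[OF k(1) p])
  show "osc p w <= e" if "norm w <= R" for w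
   using that k(2) d(1) d(2)[of w] by linarith
 qed (use e in auto)
 then show ?thesis using that k(1) by blast
qed

lemma osc_close:
 assumes p: "L1 p" and q: "L1 q" and e: "(LB x. \<bar>q x - p x\<bar>) <= e"
 shows "osc p z <= osc q z + 2 * e"
proof -
 let ?r = "%x. q x - p x"
 have i: "L1 ?r" using p q by auto
 have "osc p z <= (LB x. \<bar>q (x + z) - q x\<bar> + \<bar>?r (x + z) - ?r x\<bar>)"
  unfolding osc_def
 proof (rule integral_mono)
  show "L1 (%x. \<bar>q (x + z) - q x\<bar> + \<bar>?r (x + z) - ?r x\<bar>)"
   by (intro integrable_add osc_integrable[OF q] osc_integrable[OF i])
 qed (auto intro: osc_integrable[OF p])
 also have "... = osc q z + osc ?r z"
  unfolding osc_def by (intro integral_add osc_integrable[OF q] osc_integrable[OF i])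
 also have "osc ?r z <= 2 * e" using osc_le[OF i, of z] e by simp
 finally show ?thesis by simp
qed

text \<open>For a mollification this combines \<open>osc_mol_le_gmol\<close> with
  \<open>gmol_mass_le_BV\<close>. The general case follows by approximation in L1, whose error
  enters \<open>osc\<close> twice.\<close>

lemma osc_le_BV:
 assumes w: "BV w" shows "osc w z <= norm z * BV_seminorm w"
proof (rule field_le_epsilon)
 fix e :: real assume e: "0 < e"
 have iw: "L1 w" using w by (auto simp: BV_def)
 obtain \<rho> :: "'a => real" and D K R
  where k: "kernel \<rho> D K R" and c: "(LB x. \<bar>kernel.mol \<rho> w x - w x\<bar>) <= e / 2"
  using mol_eventually_close[OF iw half_gt_zero[OF e]] by blast
 interpret kernel \<rho> D K R by (rule k)
 have "osc w z <= osc (mol w) z + 2 * (e / 2)"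
  by (rule osc_close[OF iw integrable_mol[OF iw] c])
 also have "osc (mol w) z <= (LB x. \<bar>z \<bullet> gmol w x\<bar>)" by (rule osc_mol_le_gmol[OF iw])
 also have "... <= (LB x. norm z * norm (gmol w x))"
  using integrable_norm_gmol[OF iw] integrable_inner_gmol[OF iw]
  by (intro integral_mono) (auto simp: Cauchy_Schwarz_ineq2)
 also have "... <= norm z * BV_seminorm w"
  using gmol_mass_le_BV[OF w] by (simp add: mult_left_mono)
 finally show "osc w z <= norm z * BV_seminorm w + e" by simp
qed

lemma BV_seminorm_nonneg: "BV (w :: 'a::euclidean_space => real) ==> 0 <= BV_seminorm w"
proof -
 assume w: "BV w"
 obtain b :: 'a where "b \<in> Basis" using nonempty_Basis by blast
 then show ?thesis
  using osc_le_BV[OF w, of b] osc_nonneg[of w b] by simp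
qed

subsection \<open>Isotropic total variation\<close>

text \<open>Expectation of \<open>g\<close> under the centred normal law of deviation
  \<open>\<sigma>\<close>. The value 0 means a Dirac mass and must be included, because coordinates
  of the fixed vector, or all of it, may vanish.\<close>

definition normal_law :: "real => (real => ennreal) => ennreal" where
 "normal_law \<sigma> g = (if \<sigma> = 0 then g 0 else (NN s. g s * ennreal (normal_density 0 \<sigma> s)))"

lemma nn_integral_std_normal_affine:
 fixes g :: "real => ennreal"
 assumes [measurable]: "g \<in> Borel" and a: "a \<noteq> 0"
 shows "(NN y. g (s + a * y) * ennreal (std_normal_density y))
  = (NN t. g t * ennreal (normal_density 0 \<bar>a\<bar> (t - s)))"
proof -
 have dens: "\<bar>a\<bar> * normal_density 0 \<bar>a\<bar> (a * y) = std_normal_density y" for y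
  using a by (simp add: normal_density_def real_sqrt_mult power_mult_distrib field_simps)
 have "(NN t. g t * ennreal (normal_density 0 \<bar>a\<bar> (t - s)))
   = ennreal \<bar>a\<bar> * (NN y. g (s + a * y) * ennreal (normal_density 0 \<bar>a\<bar> (s + a * y - s)))"
  by (rule nn_integral_real_affine[OF _ a]) simp
 also have "... = (NN y. ennreal \<bar>a\<bar> * (g (s + a * y) * ennreal (normal_density 0 \<bar>a\<bar> (a * y))))"
  by (subst nn_integral_cmult) auto
 also have "... = (NN y. g (s + a * y) * ennreal (std_normal_density y))"
  by (intro nn_integral_cong) (simp add: dens[symmetric] ennreal_mult mult_ac)
 finally show ?thesis ..
qed

lemma normal_law_step:
 fixes g :: "real => ennreal"
 assumes [measurable]: "g \<in> Borel" and \<sigma>: "0 <= \<sigma>"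
 shows "normal_law \<sigma> (%s. (NN y. g (s + a * y) * ennreal (std_normal_density y))) = normal_law (sqrt (a\<^sup>2 + \<sigma>\<^sup>2)) g"
proof (cases "a = 0")
 case True
 have one: "(NN y. ennreal (std_normal_density y)) = 1"
  by (subst nn_integral_eq_integral) auto
 show ?thesis
  using True \<sigma> by (simp add: nn_integral_cmult one)
next
 case a: False
 note aff = nn_integral_std_normal_affine[OF assms(1) a]
 show ?thesis
 proof (cases "\<sigma> = 0")
  case True then show ?thesis using a by (simp add: normal_law_def aff[of 0, simplified])
 next
  case False
  then have \<sigma>0: "0 < \<sigma>" using \<sigma> by simp
  have "normal_law \<sigma> (%s. (NN y. g (s + a * y) * ennreal (std_normal_density y)))
   = (NN s. (NN t. g t * ennreal (normal_density 0 \<bar>a\<bar> (t - s) * normal_density 0 \<sigma> s)))"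
   using False by (simp add: normal_law_def aff nn_integral_multc[symmetric] ennreal_mult mult.assoc)
  also have "... = (NN t. (NN s. g t * ennreal (normal_density 0 \<bar>a\<bar> (t - s) * normal_density 0 \<sigma> s)))"
   by (rule lborel_pair.Fubini') measurable
  also have "... = (NN t. g t * (NN s. ennreal (normal_density 0 \<bar>a\<bar> (t - s) * normal_density 0 \<sigma> s)))"
   by (intro nn_integral_cong nn_integral_cmult) measurable
  also have "... = normal_law (sqrt (a\<^sup>2 + \<sigma>\<^sup>2)) g"
  proof -
   have "sqrt (a\<^sup>2 + \<sigma>\<^sup>2) \<noteq> 0" using a by (simp add: add_nonneg_eq_0_iff)
   then show ?thesis
    using fun_cong[OF conv_normal_density_zero_mean[of "\<bar>a\<bar>" \<sigma>]] a \<sigma>0 by (simp add: normal_law_def)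
  qed
  finally show ?thesis .
 qed
qed

lemma nn_integral_normal_sum:
 fixes g :: "real => ennreal" and a :: "'i => real"
 assumes "finite B"
 shows "g \<in> Borel ==>
  (\<integral>\<^sup>+x. g (\<Sum>b\<in>B. a b * x b) * (\<Prod>b\<in>B. ennreal (std_normal_density (x b))) \<partial>(\<Pi>\<^sub>M b\<in>B. lborel))
   = normal_law (sqrt (\<Sum>b\<in>B. (a b)\<^sup>2)) g"
 using assms
proof (induction B arbitrary: g rule: finite_induct)
 case empty
 show ?case by (simp add: normal_law_def PiM_empty nn_integral_count_space_finite)
next
 case (insert i B)
 note [measurable] = insert.prems
 interpret product_sigma_finite "%_::'i. lborel :: real measure" ..
 let ?P = "%x. \<Prod>b\<in>B. ennreal (std_normal_density (x b))"
 let ?h = "%s. (NN y. g (s + a i * y) * ennreal (std_normal_density y))"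
 have "(\<integral>\<^sup>+x. g (\<Sum>b\<in>insert i B. a b * x b) * (\<Prod>b\<in>insert i B. ennreal (std_normal_density (x b))) \<partial>(\<Pi>\<^sub>M b\<in>insert i B. lborel))
  = (\<integral>\<^sup>+x. (NN y. g (\<Sum>b\<in>insert i B. a b * (x(i := y)) b) * (\<Prod>b\<in>insert i B. ennreal (std_normal_density ((x(i := y)) b)))) \<partial>(\<Pi>\<^sub>M b\<in>B. lborel))"
  using insert.hyps by (intro product_nn_integral_insert) auto
 also have "... = (\<integral>\<^sup>+x. ?h (\<Sum>b\<in>B. a b * x b) * ?P x \<partial>(\<Pi>\<^sub>M b\<in>B. lborel))"
 proof (intro nn_integral_cong)
  fix x :: "'i => real"
  have s: "(\<Sum>b\<in>insert i B. a b * (x(i := y)) b) = (\<Sum>b\<in>B. a b * x b) + a i * y" for y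
  proof -
   have "(\<Sum>b\<in>B. a b * (x(i := y)) b) = (\<Sum>b\<in>B. a b * x b)"
    by (intro sum.cong) (use insert.hyps in auto)
   then show ?thesis using insert.hyps by simp
  qed
  have p: "(\<Prod>b\<in>insert i B. ennreal (std_normal_density ((x(i := y)) b))) = ennreal (std_normal_density y) * ?P x" for y
  proof -
   have "(\<Prod>b\<in>B. ennreal (std_normal_density ((x(i := y)) b))) = ?P x"
    by (intro prod.cong) (use insert.hyps in auto)
   then show ?thesis using insert.hyps by simp
  qed
  show "(NN y. g (\<Sum>b\<in>insert i B. a b * (x(i := y)) b) * (\<Prod>b\<in>insert i B. ennreal (std_normal_density ((x(i := y)) b))))
   = ?h (\<Sum>b\<in>B. a b * x b) * ?P x"
   unfolding s p mult.assoc[symmetric] by (rule nn_integral_multc) measurable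
 qed
 also have "... = normal_law (sqrt (\<Sum>b\<in>B. (a b)\<^sup>2)) ?h"
  by (rule insert.IH) measurable
 also have "... = normal_law (sqrt ((a i)\<^sup>2 + (\<Sum>b\<in>B. (a b)\<^sup>2))) g"
  by (subst normal_law_step) (auto intro!: real_sqrt_ge_zero sum_nonneg simp: sum_nonneg)
 finally show ?case using insert.hyps by simp
qed

text \<open>The law of the inner product of a fixed vector with a standard Gaussian vector depends only on the
 norm of the fixed vector, so Gaussian averages of directional variations give the isotropic one.\<close>

lemma isotropic_weight:
 obtains W :: "'a::euclidean_space => real" and c :: real where "0 < c" "!!w. 0 <= W w" "L1 W"
  "L1 (%w. norm w * W w)"
  "!!\<xi>. (NN w. ennreal (\<bar>w \<bullet> \<xi>\<bar> * W w)) = ennreal (c * norm \<xi>)"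
proof -
 define W :: "'a => real" where "W = kern std_normal_density"
 have [measurable]: "W \<in> Borel" unfolding W_def by measurable
 have W0: "0 <= W w" for w by (simp add: W_def kern_def prod_nonneg)
 have one: "(NN y. ennreal (std_normal_density y)) = 1"
  by (subst nn_integral_eq_integral) auto
 \<comment> \<open>The mean of |s| under the standard normal law. Its value is immaterial later: it
   appears on both sides in \<open>gmol_mass_le_BV_aux\<close> and cancels.\<close>
 define c where "c = sqrt (2 / pi)"
 have c0: "0 < c" by (simp add: c_def)
 have abs1: "(NN s. ennreal \<bar>s\<bar> * ennreal (std_normal_density s)) = ennreal c"
 proof -
  have "(NN s. ennreal \<bar>s\<bar> * ennreal (std_normal_density s)) = (NN s. ennreal (std_normal_density s * \<bar>s\<bar> ^ (2 * 0 + 1)))"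
   by (intro nn_integral_cong) (simp add: ennreal_mult mult.commute)
  also have "... = ennreal (LB s. std_normal_density s * \<bar>s\<bar> ^ (2 * 0 + 1))"
   by (intro nn_integral_eq_integral integrable_std_normal_moment_abs) auto
  also have "... = ennreal c" unfolding integral_std_normal_moment_abs_odd by (simp add: c_def)
  finally show ?thesis .
 qed
 have law: "normal_law \<sigma> (%s. ennreal \<bar>s\<bar>) = ennreal (c * \<sigma>)" if \<sigma>: "0 <= \<sigma>" for \<sigma>
 proof (cases "\<sigma> = 0")
  case False
  then have "normal_law \<sigma> (%s. ennreal \<bar>s\<bar>) = (NN y. ennreal \<bar>0 + \<sigma> * y\<bar> * ennreal (std_normal_density y))"
   using nn_integral_std_normal_affine[of "%s. ennreal \<bar>s\<bar>" \<sigma> 0] \<sigma> by (simp add: normal_law_def)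
  also have "... = (NN y. ennreal \<sigma> * (ennreal \<bar>y\<bar> * ennreal (std_normal_density y)))"
   using \<sigma> by (intro nn_integral_cong) (simp add: abs_mult ennreal_mult mult.assoc)
  also have "... = ennreal \<sigma> * ennreal c" by (subst nn_integral_cmult) (auto simp: abs1)
  finally show ?thesis using \<sigma> c0 by (simp add: ennreal_mult mult.commute)
 qed (simp add: normal_law_def)
 have main: "(NN w. ennreal (\<bar>w \<bullet> \<xi>\<bar> * W w)) = ennreal (c * norm \<xi>)" for \<xi> :: 'a
 proof -
  let ?T = "%f. \<Sum>b\<in>Basis. f b *\<^sub>R (b::'a)"
  have "(NN w. ennreal (\<bar>w \<bullet> \<xi>\<bar> * W w)) = (\<integral>\<^sup>+w. ennreal (\<bar>w \<bullet> \<xi>\<bar> * W w) \<partial>distr (\<Pi>\<^sub>M b\<in>Basis. lborel) borel ?T)"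
   by (simp only: lborel_eq[symmetric])
  also have "... = (\<integral>\<^sup>+x. ennreal (\<bar>?T x \<bullet> \<xi>\<bar> * W (?T x)) \<partial>(\<Pi>\<^sub>M b\<in>(Basis::'a set). lborel))"
   by (rule nn_integral_distr) auto
  also have "... = (\<integral>\<^sup>+x. ennreal \<bar>\<Sum>b\<in>Basis. (\<xi> \<bullet> b) * x b\<bar> * (\<Prod>b\<in>Basis. ennreal (std_normal_density (x b))) \<partial>(\<Pi>\<^sub>M b\<in>(Basis::'a set). lborel))"
  proof (intro nn_integral_cong)
   fix x :: "'a => real"
   have "?T x \<bullet> \<xi> = (\<Sum>b\<in>Basis. (\<xi> \<bullet> b) * x b)"
    by (simp add: inner_sum_left inner_commute[of \<xi>] mult.commute)
   moreover have "W (?T x) = (\<Prod>b\<in>Basis. std_normal_density (x b))"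
    unfolding W_def kern_def by (intro prod.cong) auto
   ultimately show "ennreal (\<bar>?T x \<bullet> \<xi>\<bar> * W (?T x)) = ennreal \<bar>\<Sum>b\<in>Basis. (\<xi> \<bullet> b) * x b\<bar> * (\<Prod>b\<in>Basis. ennreal (std_normal_density (x b)))"
    by (simp add: ennreal_mult prod_nonneg prod_ennreal)
  qed
  also have "... = normal_law (sqrt (\<Sum>b\<in>Basis. (\<xi> \<bullet> b)\<^sup>2)) (%s. ennreal \<bar>s\<bar>)"
   by (rule nn_integral_normal_sum) auto
  also have "... = ennreal (c * sqrt (\<Sum>b\<in>Basis. (\<xi> \<bullet> b)\<^sup>2))"
   by (rule law) (auto intro!: real_sqrt_ge_zero sum_nonneg)
  also have "sqrt (\<Sum>b\<in>Basis. (\<xi> \<bullet> b)\<^sup>2) = norm \<xi>"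
   by (simp only: norm_eq_sqrt_inner euclidean_inner[of \<xi> \<xi>] power2_eq_square)
  finally show ?thesis .
 qed
 have iW: "L1 W"
 proof (rule integrableI_nonneg)
  have "(NN w. ennreal (W w)) = 1"
   using nn_integral_kern_weight[of std_normal_density "%_. 1" "SOME i::'a. i \<in> Basis", OF _ _ normal_density_nonneg one SOME_Basis] one
   by (simp add: W_def)
  then show "(NN w. ennreal (W w)) < \<infinity>" by simp
 qed (use W0 in auto)
 have iW2: "L1 (%w. \<bar>w \<bullet> b\<bar> * W w)" for b
  by (rule integrableI_nonneg) (use W0 main[of b] in auto)
 have "L1 (%w. norm w * W w)"
 proof (rule integrable_bound)
  show "L1 (%w. \<Sum>b\<in>Basis. \<bar>w \<bullet> b\<bar> * W w)" using iW2 by auto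
  show "AE w in lborel. norm (norm w * W w) <= norm (\<Sum>b\<in>Basis. \<bar>w \<bullet> b\<bar> * W w)"
  proof (intro AE_I2)
   fix w :: 'a
   have "norm w * W w <= (\<Sum>b\<in>Basis. \<bar>w \<bullet> b\<bar>) * W w" by (intro mult_right_mono norm_le_l1 W0)
   then show "norm (norm w * W w) <= norm (\<Sum>b\<in>Basis. \<bar>w \<bullet> b\<bar> * W w)"
    using W0[of w] by (simp add: sum_distrib_right)
  qed
 qed auto
 then show ?thesis using that[OF c0 W0 iW _ main] by blast
qed

lemma (in kernel) isotropic_gmol:
 assumes c: "!!\<xi>. (NN w. ennreal (\<bar>w \<bullet> \<xi>\<bar> * W w)) = ennreal (c * norm (\<xi>::'a))" "0 < c"
  and W0: "!!w. 0 <= W w" and iW: "L1 W"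
  and p: "L1 p"
 shows "L1 (%z. W z * (LB x. \<bar>z \<bullet> gmol p x\<bar>))"
  "(LB z. W z * (LB x. \<bar>z \<bullet> gmol p x\<bar>)) = c * (LB x. norm (gmol p x))"
proof -
 have [measurable]: "p \<in> Borel" using p by auto
 have [measurable]: "gmol p \<in> Borel" by (rule gmol_measurable) simp
 let ?F = "%z. W z * (LB x. \<bar>z \<bullet> gmol p x\<bar>)"
 have [measurable]: "W \<in> Borel" using iW by auto
 have F0: "0 <= ?F z" for z using W0 by (intro mult_nonneg_nonneg integral_nonneg_AE) auto
 have "(NN z. ennreal (?F z)) = (NN z. (NN x. ennreal (\<bar>z \<bullet> gmol p x\<bar> * W z)))"
 proof (intro nn_integral_cong)
  fix z :: 'a
  have "(NN x. ennreal (\<bar>z \<bullet> gmol p x\<bar> * W z)) = (NN x. ennreal \<bar>z \<bullet> gmol p x\<bar> * ennreal (W z))"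
   by (intro nn_integral_cong) (simp add: ennreal_mult W0)
  also have "... = (NN x. ennreal \<bar>z \<bullet> gmol p x\<bar>) * ennreal (W z)"
   by (rule nn_integral_multc) simp
  also have "(NN x. ennreal \<bar>z \<bullet> gmol p x\<bar>) = ennreal (LB x. \<bar>z \<bullet> gmol p x\<bar>)"
   by (intro nn_integral_eq_integral integrable_inner_gmol p) auto
  finally show "ennreal (?F z) = (NN x. ennreal (\<bar>z \<bullet> gmol p x\<bar> * W z))"
   using W0[of z] by (simp add: ennreal_mult integral_nonneg_AE mult.commute)
 qed
 also have "... = (NN x. (NN z. ennreal (\<bar>z \<bullet> gmol p x\<bar> * W z)))"
  by (rule lborel_pair.Fubini') measurable
 also have "... = (NN x. ennreal (c * norm (gmol p x)))" by (simp add: c)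
 also have "... = ennreal (LB x. c * norm (gmol p x))"
  using integrable_norm_gmol[OF p] c(2) by (intro nn_integral_eq_integral) auto
 finally have eq: "(NN z. ennreal (?F z)) = ennreal (c * (LB x. norm (gmol p x)))" by simp
 have m: "?F \<in> borel_measurable lborel" by measurable
 show i: "L1 ?F"
  using eq F0 m by (intro integrableI_nonneg) auto
 have "ennreal (LB z. ?F z) = (NN z. ennreal (?F z))"
  using i F0 by (intro nn_integral_eq_integral[symmetric]) auto
 then show "(LB z. ?F z) = c * (LB x. norm (gmol p x))"
  unfolding eq using c(2) F0 by (subst (asm) ennreal_inj) (auto intro!: integral_nonneg_AE mult_nonneg_nonneg)
qed

text \<open>The inequality between the moduli passes to the rescaled quantities \<open>a n\<close>,
  whose Gaussian averages tend to c times the mass of \<open>gmol p\<close>. To bound these averages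
  for fixed n, \<open>u0\<close> is replaced by a mollification so close in L1 that the error
  survives the factor 2 (n + 1). Its modulus is at most a directional variation, whose Gaussian
  average is c times an isotropic mass, at most c times the BV seminorm.\<close>

lemma (in kernel) gmol_mass_le_BV_aux:
 fixes u0 :: "'a => real"
 assumes c: "!!\<xi>. (NN w. ennreal (\<bar>w \<bullet> \<xi>\<bar> * W w)) = ennreal (c * norm (\<xi>::'a))" "0 < c"
  and W0: "!!w. 0 <= W w" and iW: "L1 W"
  and iW1: "L1 (%w. norm w * W w)"
  and p: "L1 p" and u0: "BV u0" and le: "!!z. osc p z <= osc u0 z"
 shows "(LB x. norm (gmol p x)) <= BV_seminorm u0"
proof -
 have iu: "L1 u0" using u0 by (auto simp: BV_def)
 have [measurable]: "p \<in> Borel" using p by auto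
 have [measurable]: "mol p \<in> Borel" by (rule mol_measurable) simp
 have [measurable]: "gmol p \<in> Borel" by (rule gmol_measurable) simp
 define a where "a n z = real (Suc n) * osc (mol p) ((1 / real (Suc n)) *\<^sub>R z)" for n z
 have a0: "0 <= a n z" for n z unfolding a_def by (intro mult_nonneg_nonneg osc_nonneg) auto
 have [measurable]: "a n \<in> Borel" for n
  unfolding a_def osc_def by measurable
 have au: "a n z <= real (Suc n) * osc u0 ((1 / real (Suc n)) *\<^sub>R z)" for n z
  unfolding a_def by (intro mult_left_mono order_trans[OF osc_mol_le[OF p] le]) auto
 have ab: "a n z <= norm z * BV_seminorm u0" for n z
 proof -
  have "a n z <= real (Suc n) * (norm ((1 / real (Suc n)) *\<^sub>R z) * BV_seminorm u0)"
   by (rule order_trans[OF au]) (intro mult_left_mono osc_le_BV u0, simp)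
  also have "... = norm z * BV_seminorm u0" by (simp add: mult.assoc[symmetric] del: of_nat_Suc)
  finally show ?thesis .
 qed
 have [measurable]: "W \<in> Borel" using iW by auto
 have Wab: "norm (W z * a n z) <= BV_seminorm u0 * (norm z * W z)" for n z
  using mult_left_mono[OF ab[of n z] W0[of z]] a0[of n z] W0[of z] by (simp add: abs_mult mult_ac)
 have ia: "L1 (%z. W z * a n z)" for n
  by (rule integrable_bound[OF integrable_mult_right[OF iW1, of "BV_seminorm u0"]])
    (use Wab W0 BV_seminorm_nonneg[OF u0] in \<open>auto simp: abs_mult\<close>)
 have bound: "(LB z. W z * a n z) <= c * BV_seminorm u0" for n
 proof (rule field_le_epsilon)
  fix e :: real assume e: "0 < e"
  define V where "V = (LB z. W z)"
  \<comment> \<open>Chosen so that the averaged error (n + 1) * 2 * e' * V is at most e; V + 1 in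
    place of V keeps the denominator positive.\<close>
  define e' where "e' = e / (2 * real (Suc n) * (V + 1))"
  have V: "0 <= V" unfolding V_def using W0 by (intro integral_nonneg_AE) auto
  have e': "0 < e'" using e V unfolding e'_def by (intro divide_pos_pos mult_pos_pos) auto
  have "2 * real (Suc n) * (V + 1) \<noteq> 0" using V by auto
  then have "e' * (2 * real (Suc n) * (V + 1)) = e"
   unfolding e'_def times_divide_eq_left by (rule nonzero_mult_div_cancel_right)
  then have "real (Suc n) * 2 * e' * (V + 1) = e" by (simp add: mult_ac del: of_nat_Suc)
  moreover have "0 <= real (Suc n) * 2 * e'" using e' by simp
  ultimately have e'2: "real (Suc n) * 2 * e' * V <= e" unfolding distrib_left mult_1_right by linarith
  obtain \<rho>' :: "'a => real" and D' K' R'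
   where k: "kernel \<rho>' D' K' R'" and cl: "(LB x. \<bar>kernel.mol \<rho>' u0 x - u0 x\<bar>) <= e'"
   using mol_eventually_close[OF iu e'] by blast
  interpret k': kernel \<rho>' D' K' R' by (rule k)
  let ?N = "%z. LB x. \<bar>z \<bullet> k'.gmol u0 x\<bar>"
  have aN: "a n z <= ?N z + real (Suc n) * 2 * e'" for z
  proof -
   let ?w = "(1 / real (Suc n)) *\<^sub>R z"
   have "osc u0 ?w <= osc (k'.mol u0) ?w + 2 * e'" by (rule osc_close[OF iu k'.integrable_mol[OF iu] cl])
   also have "osc (k'.mol u0) ?w <= ?N ?w" by (rule k'.osc_mol_le_gmol[OF iu])
   also have "?N ?w = (1 / real (Suc n)) * ?N z"
    by (simp add: abs_mult del: of_nat_Suc)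
   finally have "real (Suc n) * osc u0 ?w <= real (Suc n) * ((1 / real (Suc n)) * ?N z + 2 * e')"
    by (intro mult_left_mono) auto
   also have "... = ?N z + real (Suc n) * 2 * e'" by (simp add: distrib_left del: of_nat_Suc)
   finally show ?thesis using au[of n z] by linarith
  qed
  have iN: "L1 (%z. W z * ?N z)"
   and eN: "(LB z. W z * ?N z) = c * (LB x. norm (k'.gmol u0 x))"
   by (rule k'.isotropic_gmol[OF c W0 iW iu])+
  have iI: "L1 (%z::'a. real (Suc n) * 2 * e' * W z)"
   using iW by simp
  have "(LB z. W z * a n z)
    <= (LB z. W z * ?N z + real (Suc n) * 2 * e' * W z)"
  proof (rule integral_mono[OF ia integrable_add[OF iN iI]])
   fix z
   show "W z * a n z <= W z * ?N z + real (Suc n) * 2 * e' * W z"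
    using mult_left_mono[OF aN[of z] W0[of z]] by (simp add: distrib_left mult_ac del: of_nat_Suc)
  qed
  also have "... = (LB z. W z * ?N z) + (LB z. real (Suc n) * 2 * e' * W z)"
   by (rule integral_add[OF iN iI])
  also have "(LB z. real (Suc n) * 2 * e' * W z) = real (Suc n) * 2 * e' * V"
   by (simp add: V_def del: of_nat_Suc)
  also have "... <= e" by (rule e'2)
  also have "(LB z. W z * ?N z) <= c * BV_seminorm u0"
   unfolding eN using k'.gmol_mass_le_BV[OF u0] c(2) by (intro mult_left_mono) auto
  finally show "(LB z. W z * a n z) <= c * BV_seminorm u0 + e" by simp
 qed
 have "(%n. LB z. W z * a n z)
   \<longlonglongrightarrow> (LB z. W z * (LB x. \<bar>z \<bullet> gmol p x\<bar>))"
 proof (rule integral_dominated_convergence[where w="%z. BV_seminorm u0 * (norm z * W z)"])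
  show "AE z in lborel. (%n. W z * a n z) \<longlonglongrightarrow> W z * (LB x. \<bar>z \<bullet> gmol p x\<bar>)"
   unfolding a_def by (intro AE_I2 tendsto_mult_left osc_mol_tendsto p)
  show "AE z in lborel. norm (W z * a n z) <= BV_seminorm u0 * (norm z * W z)" for n
   by (intro AE_I2 Wab)
  show "L1 (%z::'a. BV_seminorm u0 * (norm z * W z))" using iW1 by simp
 qed measurable
 then have "(LB z. W z * (LB x. \<bar>z \<bullet> gmol p x\<bar>)) <= c * BV_seminorm u0"
  by (rule LIMSEQ_le_const2) (use bound in auto)
 then show ?thesis
  using isotropic_gmol(2)[OF c W0 iW p] c(2) by simp
qed

lemma (in kernel) gmol_mass_le_BV_of_osc:
 fixes u0 :: "'a => real"
 assumes p: "L1 p" and u0: "BV u0" and le: "!!z. osc p z <= osc u0 z"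
 shows "(LB x. norm (gmol p x)) <= BV_seminorm u0"
proof -
 obtain W :: "'a => real" and c :: real where W: "0 < c" "!!w. 0 <= W w" "L1 W"
  "L1 (%w. norm w * W w)"
  "!!\<xi>. (NN w. ennreal (\<bar>w \<bullet> \<xi>\<bar> * W w)) = ennreal (c * norm \<xi>)"
  by (rule isotropic_weight[where 'a='a]) blast
 show ?thesis by (rule gmol_mass_le_BV_aux[OF W(5,1,2,3,4) p u0 le])
qed

subsection \<open>The convective term\<close>

text \<open>Difference quotients have integral zero by translation invariance, and the Lipschitz
  bound with the bounded support dominates them. This is the integration by parts behind the
  convective term.\<close>

lemma integral_directional_derivative_eq_0:
 fixes \<phi> :: "'a::euclidean_space => real"
 assumes L: "!!x y. \<bar>\<phi> x - \<phi> y\<bar> <= C * norm (x - y)" and supp: "!!x. m < norm x ==> \<phi> x = 0"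
  and d: "!!x. ((%t. \<phi> (x + t *\<^sub>R b)) has_real_derivative \<phi>' x) (at 0)"
  and [measurable]: "\<phi>' \<in> Borel"
 shows "L1 \<phi>'" "(LB x. \<phi>' x) = 0"
proof -
 have C0: "0 <= C * norm b" using L[of b 0] by (simp add: order_trans[OF abs_ge_zero])
 define h where "h n = (1 / real (Suc n))" for n
 have h: "0 < h n" "h n <= 1" for n by (auto simp: h_def)
 have "h \<longlonglongrightarrow> 0"
  unfolding h_def using LIMSEQ_inverse_real_of_nat by (simp add: inverse_eq_divide)
 moreover have "\<forall>\<^sub>F n in sequentially. h n \<noteq> 0"
  using h(1) by (intro always_eventually allI) (metis less_irrefl)
 ultimately have hl: "filterlim h (at 0) sequentially" by (simp add: filterlim_at)
 have lim: "(%n. (\<phi> (x + h n *\<^sub>R b) - \<phi> x) / h n) \<longlonglongrightarrow> \<phi>' x" for x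
 proof -
  have "(%t. (\<phi> (x + t *\<^sub>R b) - \<phi> x) / t) \<midarrow>0\<rightarrow> \<phi>' x"
   using d[of x] by (simp add: DERIV_def)
  then show ?thesis using hl by (rule filterlim_compose)
 qed
 have "continuous_on UNIV \<phi>"
 proof (rule lipschitz_on_continuous_on)
  show "(\<bar>C\<bar>)-lipschitz_on UNIV \<phi>"
  proof (rule lipschitz_onI)
   show "dist (\<phi> x) (\<phi> y) <= \<bar>C\<bar> * dist x y" for x y
    using order_trans[OF L[of x y] mult_right_mono[OF abs_ge_self norm_ge_zero]] by (simp add: dist_norm)
  qed simp
 qed
 then have [measurable]: "\<phi> \<in> Borel" by (rule borel_measurable_continuous_onI)
 let ?B = "%x::'a. C * norm b * indicator (cball 0 (m + norm b)) x"
 have iB: "L1 ?B" by (intro integrable_mult_right integrable_real_indicator) auto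
 have dom: "\<bar>(\<phi> (x + h n *\<^sub>R b) - \<phi> x) / h n\<bar> <= ?B x" for n x
 proof (cases "norm x <= m + norm b")
  case True
  then show ?thesis using L[of "x + h n *\<^sub>R b" x] h[of n] by (simp add: field_simps)
 next
  case False
  have "norm x <= norm (x + h n *\<^sub>R b) + norm (h n *\<^sub>R b)"
   using norm_triangle_ineq4[of "x + h n *\<^sub>R b" "h n *\<^sub>R b"] by simp
  moreover have "norm (h n *\<^sub>R b) <= norm b" using h[of n] by (simp add: mult_left_le_one_le)
  ultimately have "m < norm (x + h n *\<^sub>R b)" "m < norm x" using False norm_ge_zero[of b] by linarith+
  then show ?thesis using False supp by simp
 qed
 have "(%n. LB x. (\<phi> (x + h n *\<^sub>R b) - \<phi> x) / h n) \<longlonglongrightarrow> (LB x. \<phi>' x)"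
  by (rule integral_dominated_convergence[OF _ _ iB]) (use lim dom in auto)
 moreover have "(LB x. (\<phi> (x + h n *\<^sub>R b) - \<phi> x) / h n) = 0" for n
 proof -
  have i: "L1 \<phi>"
  proof (rule integrable_bound)
   show "L1 (%x::'a. \<bar>C\<bar> * (m + m + norm b + 2) * indicator (cball 0 m) x + 0)"
    by (intro integrable_add integrable_mult_right integrable_real_indicator) auto
   \<comment> \<open>A point outside the support, where \<open>\<phi>\<close> vanishes, turns the
     Lipschitz bound into a bound on \<open>\<phi>\<close> itself.\<close>
   obtain z :: 'a where z: "norm z = \<bar>m\<bar> + 1" using vector_choose_size[of "\<bar>m\<bar> + 1"] by auto
   show "AE x in lborel. norm (\<phi> x) <= norm (\<bar>C\<bar> * (m + m + norm b + 2) * indicator (cball 0 m) x + 0)"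
   proof (intro AE_I2)
    fix x :: 'a
    show "norm (\<phi> x) <= norm (\<bar>C\<bar> * (m + m + norm b + 2) * indicator (cball 0 m) x + 0)"
    proof (cases "norm x <= m")
     case True
     then have m0: "0 <= m" using norm_ge_zero[of x] by linarith
     have "\<bar>\<phi> x\<bar> <= C * norm (x - z)" using L[of x z] supp[of z] z by simp
     also have "... <= \<bar>C\<bar> * (m + m + norm b + 2)"
      proof (intro mult_mono)
      show "norm (x - z) <= m + m + norm b + 2"
       using norm_triangle_ineq4[of x z] z True abs_of_nonneg[OF m0] norm_ge_zero[of b] by linarith
     qed (use m0 in auto)
     finally show ?thesis using True by simp
    qed (use supp in simp)
   qed
  qed simp
  then show ?thesis
   using integrable_lborel_shift[OF i, of "h n *\<^sub>R b"] integral_lborel_shift[of \<phi> "h n *\<^sub>R b"] by simp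
 qed
 ultimately have "(%n. 0) \<longlonglongrightarrow> (LB x. \<phi>' x)" by (simp only:)
 then show "(LB x. \<phi>' x) = 0" by (simp add: LIMSEQ_const_iff)
 show "L1 \<phi>'"
 proof (rule integrable_bound[OF iB])
  show "AE x in lborel. norm (\<phi>' x) <= norm (?B x)"
  proof (intro AE_I2)
   fix x
   have "(%n. \<bar>(\<phi> (x + h n *\<^sub>R b) - \<phi> x) / h n\<bar>) \<longlonglongrightarrow> \<bar>\<phi>' x\<bar>" by (intro tendsto_rabs lim)
   then have "\<bar>\<phi>' x\<bar> <= ?B x" by (rule LIMSEQ_le_const2) (use dom in auto)
   then show "norm (\<phi>' x) <= norm (?B x)" by simp
  qed
 qed simp
qed

text \<open>\<open>G\<close> is the mean of \<open>\<Gamma>\<close> over [s, s + \<sigma>], written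
  through an antiderivative \<open>H\<close>. Its derivative is a difference quotient of
  \<open>\<Gamma>\<close>, so the Lipschitz constant F is kept without loss.\<close>

lemma lipschitz_mean_smoothing:
 fixes \<Gamma> :: "real => 'a::euclidean_space"
 assumes L: "!!s t. norm (\<Gamma> s - \<Gamma> t) <= F * \<bar>s - t\<bar>" and \<sigma>: "0 < \<sigma>"
 obtains G G' where "!!s. (G has_vector_derivative G' s) (at s)" "!!s. norm (G' s) <= F"
  "!!s. norm (G s - \<Gamma> s) <= F * \<sigma>" "continuous_on UNIV G'" "!!s t. norm (G s - G t) <= F * \<bar>s - t\<bar>"
proof -
 have F0: "0 <= F" using order_trans[OF norm_ge_zero L[of 1 0]] by simp
 have cont: "continuous_on S \<Gamma>" for S
  by (rule lipschitz_on_continuous_on[of F]) (use L F0 in \<open>auto intro!: lipschitz_onI simp: dist_norm\<close>)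
 obtain H where H: "!!s. (H has_vector_derivative \<Gamma> s) (at s)"
  using einterval_antiderivative[of "-\<infinity>" \<infinity> \<Gamma>] cont[of UNIV]
  by (auto simp: continuous_on_eq_continuous_at)
 define G where "G s = (1 / \<sigma>) *\<^sub>R (H (s + \<sigma>) - H s)" for s
 define G' where "G' s = (1 / \<sigma>) *\<^sub>R (\<Gamma> (s + \<sigma>) - \<Gamma> s)" for s
 have dG: "(G has_vector_derivative G' s) (at s)" for s
 proof -
  have "((%s. H (s + \<sigma>)) has_vector_derivative 1 *\<^sub>R \<Gamma> (s + \<sigma>)) (at s)"
   by (rule vector_diff_chain_at[of "%s. s + \<sigma>" 1 s H "\<Gamma> (s + \<sigma>)", unfolded comp_def])
     (auto intro!: derivative_eq_intros H)
  then show ?thesis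
   unfolding G_def G'_def by (auto intro!: derivative_eq_intros H)
 qed
 have G'F: "norm (G' s) <= F" for s
  using L[of "s + \<sigma>" s] \<sigma> by (simp add: G'_def pos_divide_le_eq)
 have lipG: "norm (G s - G t) <= F * \<bar>s - t\<bar>" for s t
 proof -
  have "norm (G s - G t) <= F * norm (s - t)"
  proof (rule differentiable_bound[of UNIV G])
   show "(G has_derivative (%h. h *\<^sub>R G' x)) (at x within UNIV)" for x
    using dG[of x] by (simp add: has_vector_derivative_def)
   show "onorm (%h. h *\<^sub>R G' x) <= F" for x
    by (rule onorm_bound[OF F0]) (use mult_left_mono[OF G'F[of x]] in \<open>auto simp: mult.commute[of F]\<close>)
  qed auto
  then show ?thesis by simp
 qed
 have close: "norm (G s - \<Gamma> s) <= F * \<sigma>" for s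
 proof -
  let ?f = "%\<tau>. H (s + \<tau>) - \<tau> *\<^sub>R \<Gamma> s"
  have df: "(?f has_derivative (%h. h *\<^sub>R (\<Gamma> (s + \<tau>) - \<Gamma> s))) (at \<tau> within {0..\<sigma>})" for \<tau>
  proof -
   have "((%\<tau>. H (s + \<tau>)) has_vector_derivative 1 *\<^sub>R \<Gamma> (s + \<tau>)) (at \<tau>)"
    by (rule vector_diff_chain_at[of "%\<tau>. s + \<tau>" 1 \<tau> H "\<Gamma> (s + \<tau>)", unfolded comp_def])
      (auto intro!: derivative_eq_intros H)
   then have "(?f has_vector_derivative \<Gamma> (s + \<tau>) - \<Gamma> s) (at \<tau>)"
    by (auto intro!: derivative_eq_intros)
   then show ?thesis
    by (simp add: has_vector_derivative_def has_derivative_at_withinI)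
  qed
  have "norm (?f \<sigma> - ?f 0) <= (F * \<sigma>) * norm (\<sigma> - 0)"
  proof (rule differentiable_bound[OF _ df])
   show "onorm (%h. h *\<^sub>R (\<Gamma> (s + \<tau>) - \<Gamma> s)) <= F * \<sigma>" if "\<tau> \<in> {0..\<sigma>}" for \<tau>
   proof (rule onorm_bound)
    fix h :: real
    have "F * \<bar>\<tau>\<bar> <= F * \<sigma>" using that F0 by (intro mult_left_mono) auto
    then have n: "norm (\<Gamma> (s + \<tau>) - \<Gamma> s) <= F * \<sigma>"
     using L[of "s + \<tau>" s] by simp
    show "norm (h *\<^sub>R (\<Gamma> (s + \<tau>) - \<Gamma> s)) <= F * \<sigma> * norm h"
     using mult_left_mono[OF n abs_ge_zero[of h]] by (simp add: mult_ac)
   qed (use F0 \<sigma> in auto)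
  qed (use \<sigma> in auto)
  then have "norm ((1 / \<sigma>) *\<^sub>R (?f \<sigma> - ?f 0)) <= F * \<sigma>"
   using \<sigma> by (simp add: pos_divide_le_eq)
  moreover have "(1 / \<sigma>) *\<^sub>R (?f \<sigma> - ?f 0) = G s - \<Gamma> s"
   using \<sigma> by (simp add: G_def scaleR_diff_right)
  ultimately show ?thesis by (simp only:)
 qed
 have cG': "continuous_on UNIV G'"
  unfolding G'_def
  by (intro continuous_intros continuous_on_compose2[OF cont[of UNIV]]) auto
 show ?thesis by (rule that[OF dG G'F close cG' lipG])
qed

text \<open>The divergence of G (P x) times the shifted kernel has integral zero, so the derivative
  passes from the kernel to \<open>P\<close>, where the chain rule costs |G'| <= F. As
  \<open>\<Gamma>\<close> is merely Lipschitz it is first replaced by its mean smoothing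
  \<open>G\<close>, with an error F \<open>\<sigma>\<close> times the mass of |D| that is made at
  most e.\<close>

lemma (in kernel) smooth_flux_bound:
 fixes \<Gamma> :: "real => 'a"
 assumes L: "!!s t. norm (\<Gamma> s - \<Gamma> t) <= F * \<bar>s - t\<bar>"
  and dP: "!!x. (P has_derivative (%h. h \<bullet> g x)) (at x)"
  and PL: "!!x y. \<bar>P x - P y\<bar> <= CP * norm (x - y)" and PB: "!!x. \<bar>P x\<bar> <= CB"
  and g: "L1 (%x. norm (g x))" and gm[measurable]: "g \<in> Borel"
 shows "(LB x. \<Gamma> (P x) \<bullet> D (x - y)) <= F * (LB x. norm (g x) * \<rho> (x - y))"
proof (rule field_le_epsilon)
 fix e :: real assume e: "0 < e"
 have F0: "0 <= F" using order_trans[OF norm_ge_zero L[of 1 0]] by simp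
 have CP0: "0 <= CP" 
 proof -
  obtain b :: 'a where "b \<in> Basis" using nonempty_Basis by blast
  then show ?thesis using order_trans[OF abs_ge_zero PL[of b 0]] by simp
 qed
 have CB0: "0 <= CB" using order_trans[OF abs_ge_zero PB] .
 have Pc: "continuous_on UNIV P"
  by (intro continuous_at_imp_continuous_on ballI has_derivative_continuous[OF dP])
 then have [measurable]: "P \<in> Borel" by (rule borel_measurable_continuous_onI)
 define I where "I = (LB x. norm (D x))"
 have I0: "0 <= I" unfolding I_def by (rule integral_nonneg_AE) auto
 define \<sigma> where "\<sigma> = e / (F * I + 1)"
 have \<sigma>: "0 < \<sigma>" using e F0 I0 by (simp add: \<sigma>_def add_nonneg_pos)
 obtain G G' where dG: "!!s. (G has_vector_derivative G' s) (at s)" and G'F: "!!s. norm (G' s) <= F"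
  and cl: "!!s. norm (G s - \<Gamma> s) <= F * \<sigma>" and cG': "continuous_on UNIV G'"
  and lG: "!!s t. norm (G s - G t) <= F * \<bar>s - t\<bar>"
  by (rule lipschitz_mean_smoothing[OF L \<sigma>]) blast
 have cl': "norm (\<Gamma> s - G s) <= F * \<sigma>" for s using cl by (simp add: norm_minus_commute)
 have cG: "continuous_on UNIV G" 
  by (intro continuous_at_imp_continuous_on ballI has_vector_derivative_continuous[OF dG])
 have c\<Gamma>: "continuous_on UNIV \<Gamma>"
  by (rule lipschitz_on_continuous_on[of F]) (use L F0 in \<open>auto intro!: lipschitz_onI simp: dist_norm\<close>)
 have [measurable]: "G \<in> Borel" "G' \<in> Borel" "\<Gamma> \<in> Borel"
  using cG cG' c\<Gamma> by (auto intro: borel_measurable_continuous_onI)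
 define CG where "CG = norm (G 0) + F * CB"
 have GB: "norm (G (P x)) <= CG" for x
 proof -
  have "norm (G (P x)) <= norm (G 0) + norm (G (P x) - G 0)" by (rule norm_triangle_sub)
  also have "... <= norm (G 0) + F * CB"
   using order_trans[OF lG[of "P x" 0, simplified] mult_left_mono[OF PB[of x] F0]] by simp
  finally show ?thesis by (simp add: CG_def)
 qed
 have CG0: "0 <= CG" using order_trans[OF norm_ge_zero GB] .
 let ?\<psi> = "%x. \<rho> (x - y)"
 \<comment> \<open>The b-th summand of the divergence of G (P x) times the kernel centred at
   \<open>y\<close>.\<close>
 let ?d = "%b x. (G' (P x) \<bullet> b) * (b \<bullet> g x) * ?\<psi> x + (G (P x) \<bullet> b) * (b \<bullet> D (x - y))"
 have zero: "L1 (?d b)" "(LB x. ?d b x) = 0" if b: "b \<in> Basis" for b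
 proof -
  let ?\<phi> = "%x. (G (P x) \<bullet> b) * ?\<psi> x"
  have lip\<phi>: "\<bar>?\<phi> x - ?\<phi> z\<bar> <= (F * CP * K + CG * K) * norm (x - z)" for x z
  proof -
   have "?\<phi> x - ?\<phi> z = ((G (P x) - G (P z)) \<bullet> b) * ?\<psi> x + (G (P z) \<bullet> b) * (?\<psi> x - ?\<psi> z)"
    by (simp add: inner_diff_left algebra_simps)
   moreover have "\<bar>((G (P x) - G (P z)) \<bullet> b) * ?\<psi> x\<bar> <= (F * (CP * norm (x - z))) * K"
    unfolding abs_mult
   proof (intro mult_mono)
    have "\<bar>(G (P x) - G (P z)) \<bullet> b\<bar> <= norm (G (P x) - G (P z))" using b by (simp add: Basis_le_norm)
    also have "... <= F * (CP * norm (x - z))"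
     using order_trans[OF lG[of "P x" "P z"] mult_left_mono[OF PL[of x z] F0]] .
    finally show "\<bar>(G (P x) - G (P z)) \<bullet> b\<bar> <= F * (CP * norm (x - z))" .
   qed (use bound nonneg F0 CP0 in auto)
   moreover have "\<bar>(G (P z) \<bullet> b) * (?\<psi> x - ?\<psi> z)\<bar> <= CG * (K * norm (x - z))"
    unfolding abs_mult
   proof (intro mult_mono)
    show "\<bar>G (P z) \<bullet> b\<bar> <= CG" using b by (rule order_trans[OF Basis_le_norm GB])
    show "\<bar>?\<psi> x - ?\<psi> z\<bar> <= K * norm (x - z)" using lip[of "x - y" "z - y"] by simp
   qed (use CG0 in auto)
   ultimately show ?thesis by (simp add: algebra_simps)
  qed
  have supp\<phi>: "?\<phi> x = 0" if "R + norm y < norm x" for x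
  proof -
   have "norm x <= norm (x - y) + norm y" using norm_triangle_ineq[of "x - y" y] by simp
   then show ?thesis using supp[of "x - y"] that by simp
  qed
  have d\<phi>: "((%t. ?\<phi> (x + t *\<^sub>R b)) has_real_derivative ?d b x) (at 0)" for x
  proof -
   have l: "((%t. x + t *\<^sub>R b) has_derivative (%s. s *\<^sub>R b)) (at (0::real))"
    by (auto intro!: derivative_eq_intros)
   have l2: "((%t. x + t *\<^sub>R b - y) has_derivative (%s. s *\<^sub>R b)) (at (0::real))"
    by (auto intro!: derivative_eq_intros)
   have "((%t. P (x + t *\<^sub>R b)) has_derivative (%s. (s *\<^sub>R b) \<bullet> g x)) (at 0)"
    using has_derivative_compose[OF l, of P "%h. h \<bullet> g x"] dP[of x] by simp
   then have 1: "((%t. P (x + t *\<^sub>R b)) has_vector_derivative (b \<bullet> g x)) (at 0)"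
    by (simp add: has_vector_derivative_def)
   have "((%t. G (P (x + t *\<^sub>R b))) has_vector_derivative (b \<bullet> g x) *\<^sub>R G' (P x)) (at 0)"
    using vector_diff_chain_at[OF 1, of G "G' (P x)"] dG by (simp add: comp_def)
   then have "((%t. G (P (x + t *\<^sub>R b)) \<bullet> b) has_derivative (%s. (s *\<^sub>R ((b \<bullet> g x) *\<^sub>R G' (P x))) \<bullet> b)) (at 0)"
    unfolding has_vector_derivative_def by (rule has_derivative_inner_left)
   then have 2: "((%t. G (P (x + t *\<^sub>R b)) \<bullet> b) has_real_derivative (G' (P x) \<bullet> b) * (b \<bullet> g x)) (at 0)"
    by (rule has_derivative_imp_has_field_derivative) (simp add: mult_ac)
   have "((%t. ?\<psi> (x + t *\<^sub>R b)) has_derivative (%s. (s *\<^sub>R b) \<bullet> D (x - y))) (at 0)"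
    using has_derivative_compose[OF l2, of \<rho> "%h. h \<bullet> D (x - y)"] has_derivative_rho[of "x - y"] by simp
   then have 3: "((%t. ?\<psi> (x + t *\<^sub>R b)) has_real_derivative (b \<bullet> D (x - y))) (at 0)"
    by (rule has_derivative_imp_has_field_derivative) simp
   show ?thesis using DERIV_mult[OF 2 3] by (simp add: mult_ac add.commute)
  qed
  show "L1 (?d b)" "(LB x. ?d b x) = 0"
   by (rule integral_directional_derivative_eq_0[OF lip\<phi> supp\<phi> d\<phi>], auto)+
 qed
 have sumd: "(\<Sum>b\<in>Basis. ?d b x) = (G' (P x) \<bullet> g x) * ?\<psi> x + G (P x) \<bullet> D (x - y)" for x
  by (simp add: sum.distrib euclidean_inner[of "G' (P x)" "g x"] euclidean_inner[of "G (P x)" "D (x - y)"]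
    sum_distrib_right inner_commute[of "g x"] inner_commute[of "D (x - y)"])
 have int1: "L1 (%x. norm (g x) * ?\<psi> x)"
 proof (rule integrable_bound)
  show "L1 (%x. K * norm (g x))" using g by simp
  show "AE x in lborel. norm (norm (g x) * ?\<psi> x) <= norm (K * norm (g x))"
   using mult_left_mono[OF bound norm_ge_zero] nonneg K0 by (intro AE_I2) (auto simp: abs_mult mult.commute[of K])
 qed simp
 have b1: "\<bar>(G' (P x) \<bullet> g x) * ?\<psi> x\<bar> <= F * (norm (g x) * ?\<psi> x)" for x
 proof -
  have "\<bar>G' (P x) \<bullet> g x\<bar> <= F * norm (g x)"
   using order_trans[OF Cauchy_Schwarz_ineq2 mult_right_mono[OF G'F norm_ge_zero]] .
  then have "\<bar>G' (P x) \<bullet> g x\<bar> * ?\<psi> x <= F * norm (g x) * ?\<psi> x" by (rule mult_right_mono) (rule nonneg)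
  then show ?thesis by (simp add: abs_mult nonneg mult.assoc)
 qed
 have i1: "L1 (%x. (G' (P x) \<bullet> g x) * ?\<psi> x)"
  by (rule integrable_bound[OF integrable_mult_right[OF int1, of F]])
    (use b1 F0 nonneg in \<open>auto simp: abs_mult\<close>)
 have iD: "L1 (%x. norm (D (x - y)))"
  using integrable_lborel_shift[OF integrable_norm[OF integrable_D], of "- y"] by simp
 have intD: "(LB x. norm (D (x - y))) = I"
  unfolding I_def using integral_lborel_shift[of "%x. norm (D x)" "- y"] by simp
 have i2: "L1 (%x. G (P x) \<bullet> D (x - y))"
 proof (rule integrable_bound[OF integrable_mult_right[OF iD, of CG]])
  show "AE x in lborel. norm (G (P x) \<bullet> D (x - y)) <= norm (CG * norm (D (x - y)))"
   using order_trans[OF Cauchy_Schwarz_ineq2 mult_right_mono[OF GB norm_ge_zero]] CG0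
   by (intro AE_I2) (simp add: abs_mult)
 qed simp
 have b3: "\<bar>(\<Gamma> (P x) - G (P x)) \<bullet> D (x - y)\<bar> <= F * \<sigma> * norm (D (x - y))" for x
  using order_trans[OF Cauchy_Schwarz_ineq2 mult_right_mono[OF cl' norm_ge_zero]] .
 have i3: "L1 (%x. (\<Gamma> (P x) - G (P x)) \<bullet> D (x - y))"
  by (rule integrable_bound[OF integrable_mult_right[OF iD, of "F * \<sigma>"]])
    (use b3 F0 \<sigma> in \<open>auto simp: abs_mult\<close>)
 have "0 = (LB x. (\<Sum>b\<in>Basis. ?d b x))"
  using zero by (subst integral_sum) auto
 also have "... = (LB x. (G' (P x) \<bullet> g x) * ?\<psi> x) + (LB x. G (P x) \<bullet> D (x - y))"
  unfolding sumd by (rule integral_add[OF i1 i2])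
 finally have "(LB x. G (P x) \<bullet> D (x - y)) = (LB x. - ((G' (P x) \<bullet> g x) * ?\<psi> x))" by simp
 also have "... <= (LB x. F * (norm (g x) * ?\<psi> x))"
  by (rule integral_mono) (use i1 int1 b1 in \<open>auto simp: abs_le_iff\<close>)
 finally have m: "(LB x. G (P x) \<bullet> D (x - y)) <= F * (LB x. norm (g x) * ?\<psi> x)" by simp
 have "(LB x. (\<Gamma> (P x) - G (P x)) \<bullet> D (x - y)) <= (LB x. F * \<sigma> * norm (D (x - y)))"
  by (rule integral_mono[OF i3 integrable_mult_right[OF iD]]) (use b3 in \<open>auto simp: abs_le_iff\<close>)
 also have "... = F * \<sigma> * I" by (simp add: intD)
 also have "... <= e"
 proof -
  have "(F * I + 1) * \<sigma> = e" using F0 I0 by (simp add: \<sigma>_def add_nonneg_eq_0_iff)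
  then show ?thesis using \<sigma> by (simp add: algebra_simps)
 qed
 finally have n: "(LB x. (\<Gamma> (P x) - G (P x)) \<bullet> D (x - y)) <= e" .
 have "(LB x. \<Gamma> (P x) \<bullet> D (x - y)) = (LB x. G (P x) \<bullet> D (x - y) + (\<Gamma> (P x) - G (P x)) \<bullet> D (x - y))"
  by (simp add: inner_diff_left)
 also have "... = (LB x. G (P x) \<bullet> D (x - y)) + (LB x. (\<Gamma> (P x) - G (P x)) \<bullet> D (x - y))"
  by (rule integral_add[OF i2 i3])
 finally show "(LB x. \<Gamma> (P x) \<bullet> D (x - y)) <= F * (LB x. norm (g x) * \<rho> (x - y)) + e"
  using m n by linarith
qed

text \<open>If s and t lie on the same side of k the sign is constant. On opposite sides |s - k| +
  |t - k| = |s - t|, so the change of sign costs nothing and the constant stays F.\<close>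

lemma entropy_flux_lipschitz:
 fixes G :: "real => 'a::euclidean_space"
 assumes L: "!!s t. norm (G s - G t) <= F * \<bar>s - t\<bar>"
 shows "norm (entropy_flux G s k - entropy_flux G t k) <= F * \<bar>s - t\<bar>"
proof -
 have F0: "0 <= F" using order_trans[OF norm_ge_zero L[of 1 0]] by simp
 have opp: "norm (entropy_flux G s k - entropy_flux G t k) <= F * \<bar>s - t\<bar>" if "s <= k" "k <= t" for s t
 proof -
  have "norm (entropy_flux G s k - entropy_flux G t k) <= norm (entropy_flux G s k) + norm (entropy_flux G t k)"
   by (rule norm_triangle_ineq4)
  also have "... <= norm (G s - G k) + norm (G t - G k)"
   by (intro add_mono) (auto simp: entropy_flux_def sgn_real_def)
  also have "... <= F * \<bar>s - k\<bar> + F * \<bar>t - k\<bar>" by (intro add_mono L)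
  also have "... = F * \<bar>s - t\<bar>" using that by (simp add: distrib_left[symmetric])
  finally show ?thesis .
 qed
 consider "s <= k" "k <= t" | "t <= k" "k <= s" | "s < k" "t < k" | "k < s" "k < t" by linarith
 then show ?thesis
 proof cases
  case 2 then show ?thesis using opp[of t s] by (simp add: norm_minus_commute abs_minus_commute)
 next
  case 3 then show ?thesis using L[of t s] by (simp add: entropy_flux_def abs_minus_commute)
 next
  case 4 then show ?thesis using L[of s t] by (simp add: entropy_flux_def)
 qed (rule opp)
qed

lemma entropy_flux_sym: "entropy_flux G s k = entropy_flux G k s"
proof -
 have "sgn (s - k) = - sgn (k - s)" by (simp add: sgn_real_def)
 then show ?thesis by (simp add: entropy_flux_def scaleR_diff_right)
qed

lemma entropy_flux_bound:
 fixes G :: "real => 'a::euclidean_space"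
 assumes L: "!!s t. norm (G s - G t) <= F * \<bar>s - t\<bar>"
 shows "norm (entropy_flux G s k) <= F * \<bar>s - k\<bar>"
 using entropy_flux_lipschitz[OF L, of s k k] by (simp add: entropy_flux_def)

lemma lipschitz_measurable:
 fixes G :: "real => 'a::euclidean_space"
 assumes L: "!!s t. norm (G s - G t) <= F * \<bar>s - t\<bar>"
 shows "G \<in> Borel"
proof -
 have F0: "0 <= F" using order_trans[OF norm_ge_zero L[of 1 0]] by simp
 have "continuous_on UNIV G"
  by (rule lipschitz_on_continuous_on[of F]) (use L F0 in \<open>auto intro!: lipschitz_onI simp: dist_norm\<close>)
 then show ?thesis by (rule borel_measurable_continuous_onI)
qed

context kernel
begin

lemma integrable_pair_diff:
 assumes p: "L1 p" and q: "L1 q" and m: "L1 (m :: 'a => real)"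
 shows "integrable lborel2 (%(y, x). (\<bar>p x\<bar> + \<bar>q y\<bar>) * \<bar>m (x - y)\<bar>)"
 using integrable_add[OF
   integrable_pair_x[OF integrable_abs[OF p] integrable_abs[OF m]]
   integrable_pair_y[OF integrable_abs[OF q] integrable_abs[OF m]]]
 by (simp add: split_beta' distrib_right)

text \<open>For each y the value \<open>q y\<close> is a frozen parameter of the flux, so only
  \<open>p\<close> is differentiated. It is replaced by a mollification, whose gradient has mass at
  most the seminorm of \<open>u0\<close> by comparison of moduli; integrating the kernel over y then
  gives 1. The replacement costs F times the L1 error times the mass of |D|.\<close>

theorem flux_BV_bound:
 fixes G :: "real => 'a"
 assumes L: "!!s t. norm (G s - G t) <= F * \<bar>s - t\<bar>"
  and p: "L1 p" and q: "L1 q" and u0: "BV u0" and le: "!!z. osc p z <= osc u0 z"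
 shows "integrable lborel2 (%(y, x). entropy_flux G (p x) (q y) \<bullet> D (x - y))"
  and "(LB y. LB x. entropy_flux G (p x) (q y) \<bullet> D (x - y)) <= F * BV_seminorm u0"
proof -
 have F0: "0 <= F" using order_trans[OF norm_ge_zero L[of 1 0]] by simp
 have [measurable]: "p \<in> Borel" "q \<in> Borel" using p q by auto
 have [measurable]: "G \<in> Borel" by (rule lipschitz_measurable[OF L])
 have iD: "L1 (%w. norm (D w))" using integrable_D by simp
 define I where "I = (LB w. norm (D w))"
 have I0: "0 <= I" unfolding I_def by (rule integral_nonneg_AE) auto
 have int: "integrable lborel2 (%(y, x). entropy_flux G (P x) (q y) \<bullet> D (x - y))"
  if P: "L1 P" for P
 proof (rule integrable_bound[OF integrable_mult_right[OF integrable_pair_diff[OF P q iD], of F]])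
  have [measurable]: "P \<in> Borel" using P by auto
  show "(%(y, x). entropy_flux G (P x) (q y) \<bullet> D (x - y)) \<in> borel_measurable lborel2"
   unfolding split_beta' entropy_flux_def sgn_real_def by measurable
  show "AE z in lborel2. norm (case z of (y, x) => entropy_flux G (P x) (q y) \<bullet> D (x - y))
    <= norm (F * (case z of (y, x) => (\<bar>P x\<bar> + \<bar>q y\<bar>) * \<bar>norm (D (x - y))\<bar>))"
  proof (intro AE_I2, clarify)
   fix y x
   have "\<bar>entropy_flux G (P x) (q y) \<bullet> D (x - y)\<bar> <= (F * \<bar>P x - q y\<bar>) * norm (D (x - y))"
    using order_trans[OF Cauchy_Schwarz_ineq2 mult_right_mono[OF entropy_flux_bound[OF L] norm_ge_zero]] .
   also have "... <= (F * (\<bar>P x\<bar> + \<bar>q y\<bar>)) * norm (D (x - y))"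
    using F0 by (intro mult_right_mono mult_left_mono) auto
   finally show "norm (entropy_flux G (P x) (q y) \<bullet> D (x - y)) <= norm (F * ((\<bar>P x\<bar> + \<bar>q y\<bar>) * \<bar>norm (D (x - y))\<bar>))"
    using F0 by (simp add: abs_mult mult.assoc)
  qed
 qed
 show "integrable lborel2 (%(y, x). entropy_flux G (p x) (q y) \<bullet> D (x - y))" by (rule int[OF p])
 show "(LB y. LB x. entropy_flux G (p x) (q y) \<bullet> D (x - y)) <= F * BV_seminorm u0"
 proof (rule field_le_epsilon)
  fix e :: real assume e: "0 < e"
  define \<delta> where "\<delta> = e / (F * I + 1)"
  have FI: "0 < F * I + 1" using F0 I0 by (simp add: add_nonneg_pos)
  have \<delta>: "0 < \<delta>" using e FI by (simp add: \<delta>_def)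
  have \<delta>2: "F * \<delta> * I <= e"
  proof -
   have "\<delta> * (F * I + 1) = e" using FI by (simp add: \<delta>_def)
   then show ?thesis using \<delta> by (simp add: distrib_left mult_ac)
  qed
  obtain \<rho>' :: "'a => real" and D' K' R'
   where k: "kernel \<rho>' D' K' R'" and cl: "(LB x. \<bar>kernel.mol \<rho>' p x - p x\<bar>) <= \<delta>"
   using mol_eventually_close[OF p \<delta>] by blast
  interpret k': kernel \<rho>' D' K' R' by (rule k)
  let ?P = "k'.mol p" and ?g = "k'.gmol p"
  have iP: "L1 ?P" by (rule k'.integrable_mol[OF p])
  have [measurable]: "?P \<in> Borel" using iP by auto
  have [measurable]: "?g \<in> Borel" by (rule k'.gmol_measurable) simp
  have ig: "L1 (%x. norm (?g x))" by (rule k'.integrable_norm_gmol[OF p])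
  have ie: "L1 (%x. \<bar>?P x - p x\<bar>)" using iP p by auto
  have sm: "(LB x. entropy_flux G (?P x) (q y) \<bullet> D (x - y)) <= F * (LB x. norm (?g x) * \<rho> (x - y))" for y
  proof (rule smooth_flux_bound)
   show "norm (entropy_flux G s (q y) - entropy_flux G t (q y)) <= F * \<bar>s - t\<bar>" for s t
    by (rule entropy_flux_lipschitz[OF L])
   show "(?P has_derivative (%h. h \<bullet> ?g x)) (at x)" for x
    using k'.has_derivative_mol[OF p, of x] by (simp add: k'.inner_gmol[OF p])
   show "\<bar>?P x - ?P z\<bar> <= (K' * (LB y. norm (p y))) * norm (x - z)" for x z
    using k'.mol_lipschitz[OF p, of x z] by (simp add: mult_ac)
   show "\<bar>?P x\<bar> <= K' * (LB y. norm (p y))" for x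
    using k'.mol_bound[OF p, of x] by simp
  qed (use ig in auto)
  have i\<rho>: "integrable lborel2 (%(y, x). norm (?g x) * \<rho> (x - y))"
   by (rule integrable_pair_x[OF ig integrable_rho])
  have m\<rho>: "(LB y. LB x. norm (?g x) * \<rho> (x - y)) = (LB x. norm (?g x))"
  proof -
   have "(LB y. LB x. norm (?g x) * \<rho> (x - y)) = (LB x. LB y. norm (?g x) * \<rho> (x - y))"
    by (rule lborel_pair.Fubini_integral[symmetric]) (rule i\<rho>)
   also have "... = (LB x. norm (?g x))"
    by (simp add: integral_rho_shift)
   finally show ?thesis .
  qed
  have A: "(LB y. LB x. entropy_flux G (?P x) (q y) \<bullet> D (x - y)) <= F * BV_seminorm u0"
  proof -
   have "(LB y. LB x. entropy_flux G (?P x) (q y) \<bullet> D (x - y))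
     <= (LB y. F * (LB x. norm (?g x) * \<rho> (x - y)))"
    by (rule integral_mono[OF lborel_pair.integrable_fst[OF int[OF iP]] integrable_mult_right[OF lborel_pair.integrable_fst[OF i\<rho>]]])
      (rule sm)
   also have "... = F * (LB x. norm (?g x))" by (simp add: m\<rho>)
   also have "... <= F * BV_seminorm u0"
    by (intro mult_left_mono F0 k'.gmol_mass_le_BV_of_osc p u0 le)
   finally show ?thesis .
  qed
  have iE: "integrable lborel2 (%(y, x). \<bar>?P x - p x\<bar> * norm (D (x - y)))"
   by (rule integrable_pair_x[OF ie iD])
  have mE: "(LB y. LB x. \<bar>?P x - p x\<bar> * norm (D (x - y))) = (LB x. \<bar>?P x - p x\<bar>) * I"
  proof -
   have "(LB y. LB x. \<bar>?P x - p x\<bar> * norm (D (x - y))) = (LB x. LB y. \<bar>?P x - p x\<bar> * norm (D (x - y)))"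
    by (rule lborel_pair.Fubini_integral[symmetric]) (rule iE)
   also have "... = (LB x. \<bar>?P x - p x\<bar>) * I"
    using integral_lborel_reflect[of "%w. norm (D w)"] by (simp add: I_def)
   finally show ?thesis .
  qed
  have "(LB y. LB x. entropy_flux G (p x) (q y) \<bullet> D (x - y))
    - (LB y. LB x. entropy_flux G (?P x) (q y) \<bullet> D (x - y))
    = (\<integral>z. (case z of (y, x) => entropy_flux G (p x) (q y) \<bullet> D (x - y))
      - (case z of (y, x) => entropy_flux G (?P x) (q y) \<bullet> D (x - y)) \<partial>lborel2)"
   unfolding integral_diff[OF int[OF p] int[OF iP]]
   using lborel_pair.integral_fst[OF int[OF p]] lborel_pair.integral_fst[OF int[OF iP]] by simp
  also have "... <= (\<integral>z. F * (case z of (y, x) => \<bar>?P x - p x\<bar> * norm (D (x - y))) \<partial>lborel2)"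
  proof (rule integral_mono[OF integrable_diff[OF int[OF p] int[OF iP]] integrable_mult_right[OF iE]], clarify)
   fix y x
   have "entropy_flux G (p x) (q y) \<bullet> D (x - y) - entropy_flux G (?P x) (q y) \<bullet> D (x - y)
    <= \<bar>(entropy_flux G (p x) (q y) - entropy_flux G (?P x) (q y)) \<bullet> D (x - y)\<bar>"
    by (simp add: inner_diff_left)
   also have "... <= (F * \<bar>p x - ?P x\<bar>) * norm (D (x - y))"
    using order_trans[OF Cauchy_Schwarz_ineq2 mult_right_mono[OF entropy_flux_lipschitz[OF L] norm_ge_zero]] .
   finally show "entropy_flux G (p x) (q y) \<bullet> D (x - y) - entropy_flux G (?P x) (q y) \<bullet> D (x - y)
    <= F * (\<bar>?P x - p x\<bar> * norm (D (x - y)))"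
    by (simp add: abs_minus_commute mult.assoc)
  qed
  also have "... = F * ((LB x. \<bar>?P x - p x\<bar>) * I)"
   using lborel_pair.integral_fst[OF iE] mE by simp
  also have "... <= F * (\<delta> * I)"
   by (intro mult_left_mono mult_right_mono cl I0 F0)
  also have "... <= e" using \<delta>2 by (simp add: mult.assoc)
  finally show "(LB y. LB x. entropy_flux G (p x) (q y) \<bullet> D (x - y)) <= F * BV_seminorm u0 + e"
   using A by linarith
 qed
qed

end

subsection \<open>Lipschitz constants of \<open>W\<^sup>1\<^sup>,\<^sup>\<infinity>\<close> functions\<close>

lemma Linf_AE_le:
 fixes h :: "real => 'b::euclidean_space"
 assumes "Linf lborel h" shows "AE x in lborel. norm (h x) <= Linf_norm lborel h"
proof -
 let ?e = "esssup lborel (%x. ereal (norm (h x)))"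
 have ae: "AE x in lborel. ereal (norm (h x)) <= ?e" by (rule esssup_AE)
 show ?thesis
 proof (cases ?e)
  case (real r)
  then show ?thesis using ae by (simp add: Linf_norm_def)
 next
  case PInf then show ?thesis using assms by (simp add: Linf_def)
 next
  case MInf
  show ?thesis using ae by eventually_elim (simp add: MInf)
 qed
qed

lemma Linf_diff:
 fixes h k :: "real => 'b::euclidean_space"
 assumes h: "Linf lborel h" and k: "Linf lborel k" shows "Linf lborel (%x. h x - k x)"
proof -
 have [measurable]: "h \<in> Borel" "k \<in> Borel" using h k by (auto simp: Linf_def)
 have "AE x in lborel. ereal (norm (h x - k x)) <= ereal (Linf_norm lborel h + Linf_norm lborel k)"
  using Linf_AE_le[OF h] Linf_AE_le[OF k]
 proof eventually_elim
  case (elim x)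
  then show ?case using norm_triangle_ineq4[of "h x" "k x"] by simp
 qed
 then have "esssup lborel (%x. ereal (norm (h x - k x))) <= ereal (Linf_norm lborel h + Linf_norm lborel k)"
  by (intro esssup_I) auto
 then show ?thesis by (auto simp: Linf_def less_top[symmetric] top_ereal_def)
qed

lemma Linf_norm_nonneg: "Linf lborel (h :: real => 'b::euclidean_space) ==> 0 <= Linf_norm lborel h"
proof (rule ccontr)
 assume h: "Linf lborel h" and n: "\<not> 0 <= Linf_norm lborel h"
 have "AE x in (lborel::real measure). False"
  using Linf_AE_le[OF h] by eventually_elim (use n norm_ge_zero in \<open>meson order_trans\<close>)
 then show False
  using ae_filter_eq_bot_iff[of "lborel::real measure"] by (simp add: trivial_limit_def)
qed

lemma integrable_test_Linf:
 fixes h :: "real => 'b::euclidean_space"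
 assumes h: "Linf lborel h" and \<phi>: "L1 \<phi>"
 shows "L1 (%x. \<phi> x *\<^sub>R h x)" "norm (LB x. \<phi> x *\<^sub>R h x) <= (LB x. \<bar>\<phi> x\<bar>) * Linf_norm lborel h"
proof -
 have [measurable]: "h \<in> Borel" "\<phi> \<in> Borel" using h \<phi> by (auto simp: Linf_def)
 have b: "AE x in lborel. norm (\<phi> x *\<^sub>R h x) <= \<bar>\<phi> x\<bar> * Linf_norm lborel h"
  using Linf_AE_le[OF h] by eventually_elim (simp add: mult_left_mono)
 have i: "L1 (%x. \<bar>\<phi> x\<bar> * Linf_norm lborel h)" using \<phi> by auto
 show iR: "L1 (%x. \<phi> x *\<^sub>R h x)"
  by (rule integrable_bound[OF i])
    (use b Linf_norm_nonneg[OF h] in auto)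
 have "norm (LB x. \<phi> x *\<^sub>R h x) <= (LB x. norm (\<phi> x *\<^sub>R h x))" by (rule integral_norm_bound)
 also have "... <= (LB x. \<bar>\<phi> x\<bar> * Linf_norm lborel h)"
  by (rule integral_mono_AE[OF integrable_norm[OF iR] i b])
 finally show "norm (LB x. \<phi> x *\<^sub>R h x) <= (LB x. \<bar>\<phi> x\<bar>) * Linf_norm lborel h" by simp
qed

text \<open>The substitution x = a + h n y turns the concentrating weights into the fixed weight
  \<open>s\<close>, and continuity of \<open>W\<close> at \<open>a\<close> does the rest.\<close>

lemma mean_tendsto:
 fixes W :: "real => 'b::euclidean_space" and s :: "real => real"
 assumes W: "continuous_on UNIV W" and s: "continuous_on UNIV s" "!!x. 1 <= \<bar>x\<bar> ==> s x = 0" "(LB x. s x) = 1"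
  and h: "h \<longlonglongrightarrow> 0" "!!n. 0 < h n" "!!n. h n <= (1::real)"
 shows "(%n. LB x. (s ((x - a) / h n) / h n) *\<^sub>R W x) \<longlonglongrightarrow> W a"
proof -
 have [measurable]: "W \<in> Borel" "s \<in> Borel"
  using W s by (auto intro: borel_measurable_continuous_onI)
 have eq: "(LB x. (s ((x - a) / h n) / h n) *\<^sub>R W x) = (LB y. s y *\<^sub>R W (a + h n * y))" for n
 proof -
  have "(LB x. (s ((x - a) / h n) / h n) *\<^sub>R W x) = \<bar>h n\<bar> *\<^sub>R (LB y. (s ((a + h n * y - a) / h n) / h n) *\<^sub>R W (a + h n * y))"
   using h(2)[of n] by (intro lborel_integral_real_affine) auto
  also have "... = (LB y. s y *\<^sub>R W (a + h n * y))"
   using h(2)[of n] by (subst integral_scaleR_right[symmetric]) (simp del: integral_scaleR_right)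
  finally show ?thesis .
 qed
 obtain C where C: "!!x. x \<in> {a - 1..a + 1} ==> norm (W x) <= C"
 proof -
  have "compact (W ` {a - 1..a + 1})"
   by (intro compact_continuous_image continuous_on_subset[OF W]) auto
  then show ?thesis using that by (metis bounded_iff compact_imp_bounded imageI)
 qed
 obtain B where B: "!!x. x \<in> {-1..1} ==> \<bar>s x\<bar> <= B"
 proof -
  have "compact (s ` {-1..1})"
   by (intro compact_continuous_image continuous_on_subset[OF s(1)]) auto
  then show ?thesis using that by (metis bounded_iff compact_imp_bounded imageI real_norm_def)
 qed
 have C0: "0 <= C" "0 <= B" using order_trans[OF norm_ge_zero C[of a]] order_trans[OF abs_ge_zero B[of 0]] by auto
 have ib: "L1 (%y::real. B * C * indicator {-1..1} y)"
  by (intro integrable_mult_right integrable_real_indicator) auto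
 have "(%n. LB y. s y *\<^sub>R W (a + h n * y)) \<longlonglongrightarrow> (LB y. s y *\<^sub>R W a)"
 proof (rule integral_dominated_convergence[OF _ _ ib])
  show "AE y in lborel. (%n. s y *\<^sub>R W (a + h n * y)) \<longlonglongrightarrow> s y *\<^sub>R W a"
  proof (intro AE_I2 tendsto_scaleR tendsto_const)
   fix y
   have "(%n. a + h n * y) \<longlonglongrightarrow> a + 0 * y" by (intro tendsto_intros h)
   then show "(%n. W (a + h n * y)) \<longlonglongrightarrow> W a"
    using continuous_on_tendsto_compose[OF W, of "%n. a + h n * y" a] by simp
  qed
  show "AE y in lborel. norm (s y *\<^sub>R W (a + h n * y)) <= B * C * indicator {-1..1} y" for n
  proof (intro AE_I2)
   fix y :: real
   show "norm (s y *\<^sub>R W (a + h n * y)) <= B * C * indicator {-1..1} y"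
   proof (cases "\<bar>y\<bar> <= 1")
    case True
    have "\<bar>h n * y\<bar> <= 1" using True h(2,3)[of n] by (simp add: abs_mult mult_le_one)
    then have "norm (W (a + h n * y)) <= C" by (intro C) (auto simp: abs_le_iff)
    moreover have "\<bar>s y\<bar> <= B" using True by (intro B) (auto simp: abs_le_iff)
    ultimately have "\<bar>s y\<bar> * norm (W (a + h n * y)) <= B * C" using C0 by (intro mult_mono) auto
    then show ?thesis using True by (auto simp: indicator_def abs_le_iff)
   qed (use s(2)[of y] C0 in simp)
  qed
 qed auto
 also have "(LB y. s y *\<^sub>R W a) = W a"
  using s(3) by (cases "L1 s") (auto simp: not_integrable_integral_eq)
 finally show ?thesis unfolding eq .
qed

text \<open>The weak derivatives are tested with a smoothed indicator of [a, b]: its derivative is a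
  difference of two approximate Dirac masses at a and b, and its L1 norm is at most b - a. Testing f
  and g together makes the norm of f' - g' appear, not a sum of norms.\<close>

lemma W1inf_diff_lipschitz:
 fixes f g f' g' :: "real => 'b::euclidean_space"
 assumes f: "W1inf f f'" and g: "W1inf g g'"
 shows "norm ((f a - g a) - (f b - g b)) <= Linf_norm lborel (%s. f' s - g' s) * \<bar>a - b\<bar>"
proof -
 have le: "norm ((f a - g a) - (f b - g b)) <= Linf_norm lborel (%s. f' s - g' s) * (b - a)" if ab: "a < b" for a b
 proof -
  obtain S s where S: "smooth1 S" "smooth1 s"
   "!!x. (S has_real_derivative s x) (at x)" "!!x. 0 <= s x" "!!x. 1 <= \<bar>x\<bar> ==> s x = 0"
   "!!x. x <= -1 ==> S x = 0" "!!x. 1 <= x ==> S x = 1" "mono S"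
   by (rule smooth_step_exists) blast
  have cs: "continuous_on UNIV s" by (rule smooth1_continuous[OF S(2)])
  have [measurable]: "S \<in> Borel" "s \<in> Borel" using S by (auto intro: smooth1_measurable)
  have nn1: "(NN x. ennreal (s x)) = 1" by (rule nn_integral_step_deriv[OF S(2-7)])
  have is1: "(LB x. s x) = 1" using S(4) nn1 by (subst integral_eq_nn_integral) auto
  define W where "W x = f x - g x" for x
  have cf: "continuous_on UNIV f" "continuous_on UNIV g" using f g by (auto simp: W1inf_def)
  have cW: "continuous_on UNIV W" unfolding W_def by (intro continuous_intros cf)
  define h where "h n = 1 / real (Suc n)" for n
  have h: "h \<longlonglongrightarrow> 0" "!!n. 0 < h n" "!!n. h n <= 1"
   unfolding h_def using LIMSEQ_inverse_real_of_nat by (auto simp: inverse_eq_divide)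
  have key: "norm ((LB x. (s ((x - a) / h n) / h n) *\<^sub>R W x) - (LB x. (s ((x - b) / h n) / h n) *\<^sub>R W x))
    <= Linf_norm lborel (%s. f' s - g' s) * (b - a)" for n
  proof -
   note hn = h(2,3)[of n]
   define \<phi> where "\<phi> x = S ((x - a) / h n) - S ((x - b) / h n)" for x
   define \<phi>' where "\<phi>' x = s ((x - a) / h n) / h n - s ((x - b) / h n) / h n" for x
   have sm: "smooth1 \<phi>"
    using smooth1_lincomb[OF smooth1_affine[OF S(1), of "1 / h n" "- a / h n"] smooth1_affine[OF S(1), of "1 / h n" "- b / h n"], of 1 "-1"]
    by (simp add: \<phi>_def[abs_def] diff_divide_distrib)
   define m where "m = \<bar>a\<bar> + \<bar>b\<bar> + 1"
   have supp: "\<phi> x = 0" "\<phi>' x = 0" if "m < \<bar>x\<bar>" for x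
   proof -
    have c: "(x - a \<ge> 1 \<and> x - b \<ge> 1) \<or> (x - a <= -1 \<and> x - b <= -1)" using that by (auto simp: m_def)
    have "(x - a) / h n \<ge> 1 \<and> (x - b) / h n \<ge> 1 \<or> (x - a) / h n <= -1 \<and> (x - b) / h n <= -1"
     using c hn by (auto simp: pos_le_divide_eq pos_divide_le_eq)
    moreover from this have "s ((x - a) / h n) = 0" "s ((x - b) / h n) = 0"
     by (auto intro!: S(5) simp: abs_if)
    ultimately show "\<phi> x = 0" "\<phi>' x = 0"
     using S(6,7) by (auto simp: \<phi>_def \<phi>'_def)
   qed
   have mem: "\<phi> \<in> smooth_supp m" using sm supp by (auto simp: smooth_supp_def)
   have Cc: "Cc_infty \<phi>" by (rule Cc_infty_smooth_supp[OF mem])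
   have dS: "((%x. S ((x - c) / h n)) has_real_derivative s ((x - c) / h n) / h n) (at x)" for c x
   proof -
    have "((%x. (x - c) / h n) has_real_derivative 1 / h n) (at x)"
     using hn by (auto intro!: derivative_eq_intros)
    from DERIV_chain2[OF S(3) this] show ?thesis by simp
   qed
   have d\<phi>: "deriv \<phi> x = \<phi>' x" for x
    unfolding \<phi>_def[abs_def] \<phi>'_def by (intro DERIV_imp_deriv DERIV_diff dS)
   have [measurable]: "\<phi> \<in> Borel" by (rule smooth1_measurable[OF sm])
   have \<phi>0: "0 <= \<phi> x" for x
    using monoD[OF S(8), of "(x - b) / h n" "(x - a) / h n"] ab hn by (simp add: \<phi>_def divide_right_mono)
   \<comment> \<open>After rescaling by h n, \<open>\<phi>\<close> is a translation difference of
     the step \<open>S\<close> with displacement (b - a) / h n, so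
     \<open>nn_integral_translate_diff\<close> gives b - a with no excess from the
     smoothing.\<close>
   have nn\<phi>: "(NN x. ennreal \<bar>\<phi> x\<bar>) <= ennreal (b - a)"
   proof -
    have "(NN x. ennreal \<bar>\<phi> x\<bar>) = (NN x. ennreal \<bar>S ((b + x * 1 - a) / h n) - S ((b + x * 1 - b) / h n)\<bar>)"
     using nn_integral_real_affine[of "%x. ennreal \<bar>\<phi> x\<bar>" 1 b] by (simp add: \<phi>_def)
    also have "... = ennreal (h n) * (NN y. ennreal \<bar>S ((b + (0 + h n * y) * 1 - a) / h n) - S ((b + (0 + h n * y) * 1 - b) / h n)\<bar>)"
     using nn_integral_real_affine[of "%x. ennreal \<bar>S ((b + x * 1 - a) / h n) - S ((b + x * 1 - b) / h n)\<bar>" "h n" 0] hn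
     by simp
    also have "(NN y. ennreal \<bar>S ((b + (0 + h n * y) * 1 - a) / h n) - S ((b + (0 + h n * y) * 1 - b) / h n)\<bar>)
      = (NN y. ennreal \<bar>S (y + (b - a) / h n) - S y\<bar>)"
    proof (intro nn_integral_cong)
     fix y
     have "(b + (0 + h n * y) * 1 - a) / h n = y + (b - a) / h n" "(b + (0 + h n * y) * 1 - b) / h n = y"
      using hn by (auto simp: field_simps)
     then show "ennreal \<bar>S ((b + (0 + h n * y) * 1 - a) / h n) - S ((b + (0 + h n * y) * 1 - b) / h n)\<bar> = ennreal \<bar>S (y + (b - a) / h n) - S y\<bar>"
      by (simp only:)
    qed
    also have "... <= ennreal \<bar>(b - a) / h n\<bar> * (NN x. ennreal (s x))"
     by (rule nn_integral_translate_diff) (use S in auto)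
    also have "ennreal (h n) * (ennreal \<bar>(b - a) / h n\<bar> * (NN x. ennreal (s x))) = ennreal (b - a)"
     using hn ab nn1 by (simp add: ennreal_mult[symmetric])
    finally show ?thesis by (simp add: mult_left_mono)
   qed
   have i\<phi>: "L1 \<phi>"
    using nn\<phi> by (intro integrableI_bounded) (auto simp: order_le_less_trans[OF _ ennreal_less_top])
   have I\<phi>: "(LB x. \<bar>\<phi> x\<bar>) <= b - a"
    using nn\<phi> ab nn_integral_eq_integral[OF integrable_abs[OF i\<phi>]] by simp
   have Lf: "Linf lborel f" "Linf lborel g" "Linf lborel f'" "Linf lborel g'" using f g by (auto simp: W1inf_def)
   have c\<phi>': "continuous_on UNIV \<phi>'"
    unfolding \<phi>'_def by (intro continuous_intros continuous_on_compose2[OF cs]) (use hn in auto)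
   then have [measurable]: "\<phi>' \<in> Borel" by (rule borel_measurable_continuous_onI)
   have i\<phi>': "L1 \<phi>'"
   proof -
    have "compact (\<phi>' ` {-m..m})" by (intro compact_continuous_image continuous_on_subset[OF c\<phi>']) auto
    then obtain B where B: "!!x. x \<in> {-m..m} ==> \<bar>\<phi>' x\<bar> <= B"
     by (metis bounded_iff compact_imp_bounded imageI real_norm_def)
    show ?thesis
    proof (rule integrable_bound)
     show "L1 (%x::real. B * indicator {-m..m} x)"
      by (intro integrable_mult_right integrable_real_indicator) (auto simp: emeasure_lborel_Icc_eq)
     show "AE x in lborel. norm (\<phi>' x) <= norm (B * indicator {-m..m} x)"
     proof (intro AE_I2)
      fix x show "norm (\<phi>' x) <= norm (B * indicator {-m..m} x)"
       using B[of x] supp(2)[of x] by (cases "x \<in> {-m..m}") (auto simp: abs_le_iff not_le)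
     qed
    qed simp
   qed
   have wf: "(LB x. \<phi>' x *\<^sub>R f x) = - (LB x. \<phi> x *\<^sub>R f' x)"
    and wg: "(LB x. \<phi>' x *\<^sub>R g x) = - (LB x. \<phi> x *\<^sub>R g' x)"
    using f g Cc by (auto simp: W1inf_def weak_derivative_def d\<phi>)
   have isc: "L1 (%x. (s ((x - c) / h n) / h n) *\<^sub>R W x)" if "c = a \<or> c = b" for c
   proof -
    have "L1 (%x. s ((x - c) / h n) / h n)"
    proof -
     have "L1 s" using nn1 S(4) by (intro integrableI_nonneg) auto
     then have "L1 (%x. s (- c / h n + (1 / h n) * x))"
      using hn by (intro lborel_integrable_real_affine) auto
     then show ?thesis using hn by (simp add: diff_divide_distrib)
    qed
    then show ?thesis
     unfolding W_def scaleR_diff_right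
     by (intro integrable_diff integrable_test_Linf Lf)
   qed
   have "(LB x. (s ((x - a) / h n) / h n) *\<^sub>R W x) - (LB x. (s ((x - b) / h n) / h n) *\<^sub>R W x)
     = (LB x. (s ((x - a) / h n) / h n) *\<^sub>R W x - (s ((x - b) / h n) / h n) *\<^sub>R W x)"
    by (rule integral_diff[symmetric]) (rule isc, simp)+
   also have "... = (LB x. \<phi>' x *\<^sub>R W x)"
    by (simp only: \<phi>'_def scaleR_diff_left)
   also have "... = (LB x. \<phi>' x *\<^sub>R f x) - (LB x. \<phi>' x *\<^sub>R g x)"
    unfolding W_def scaleR_diff_right
    by (intro integral_diff integrable_test_Linf Lf i\<phi>')
   also have "... = - (LB x. \<phi> x *\<^sub>R (f' x - g' x))"
    unfolding wf wg scaleR_diff_right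
    by (subst integral_diff) (auto intro!: integrable_test_Linf Lf i\<phi>)
   finally have eq: "norm ((LB x. (s ((x - a) / h n) / h n) *\<^sub>R W x) - (LB x. (s ((x - b) / h n) / h n) *\<^sub>R W x))
     = norm (LB x. \<phi> x *\<^sub>R (f' x - g' x))" by simp
   also have "... <= (LB x. \<bar>\<phi> x\<bar>) * Linf_norm lborel (%s. f' s - g' s)"
    by (rule integrable_test_Linf[OF Linf_diff[OF Lf(3,4)] i\<phi>])
   also have "... <= (b - a) * Linf_norm lborel (%s. f' s - g' s)"
    by (intro mult_right_mono I\<phi> Linf_norm_nonneg Linf_diff Lf)
   finally show ?thesis by (simp add: mult.commute)
  qed
  have "(%n. norm ((LB x. (s ((x - a) / h n) / h n) *\<^sub>R W x) - (LB x. (s ((x - b) / h n) / h n) *\<^sub>R W x)))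
   \<longlonglongrightarrow> norm (W a - W b)"
   by (intro tendsto_norm tendsto_diff mean_tendsto[OF cW cs S(5) is1 h])
  then show ?thesis
   unfolding W_def by (rule LIMSEQ_le_const2) (use key in \<open>auto simp: W_def\<close>)
 qed
 consider "a < b" | "a = b" | "b < a" by linarith
 then show ?thesis
 proof cases
  case 3
  then show ?thesis using le[OF 3] by (simp add: norm_minus_commute)
 qed (use le in auto)
qed

lemma W1inf_lipschitz:
 fixes f f' :: "real => 'b::euclidean_space"
 assumes f: "W1inf f f'"
 shows "norm (f a - f b) <= Linf_norm lborel f' * \<bar>a - b\<bar>"
proof -
 have "esssup lborel (%x::real. ereal 0) <= 0" by (rule esssup_I) (auto simp: zero_ereal_def)
 then have "Linf lborel (%x::real. 0::'b)" by (auto simp: Linf_def zero_ereal_def)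
 then have "W1inf (%x. 0) (%x. 0::'b)" by (simp add: W1inf_def weak_derivative_def)
 from W1inf_diff_lipschitz[OF f this, of a b] show ?thesis by simp
qed

subsection \<open>Measures on the punctured space\<close>

lemma nn_integral_le_add_measure:
 assumes s: "sets M2 = sets M1" "sets M3 = sets M1"
  and le: "!!E. E \<in> sets M1 ==> emeasure M1 E <= emeasure M2 E + emeasure M3 E"
  and g: "g \<in> borel_measurable M1"
 shows "nn_integral M1 g <= nn_integral M2 g + nn_integral M3 g"
 using g
proof (induction rule: borel_measurable_induct)
 case (cong f g)
 have "space M2 = space M1" "space M3 = space M1" using s by (auto dest: sets_eq_imp_space_eq)
 then show ?case using cong by (simp cong: nn_integral_cong_simp)
next
 case (set A) then show ?case using le s by simp
next
 case (mult u c)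
 have "nn_integral M1 (%x. c * u x) = c * nn_integral M1 u" using mult by (intro nn_integral_cmult)
 also have "... <= c * (nn_integral M2 u + nn_integral M3 u)" by (intro mult_left_mono mult) auto
 also have "... = nn_integral M2 (%x. c * u x) + nn_integral M3 (%x. c * u x)"
  using mult s by (simp add: nn_integral_cmult distrib_left measurable_cong_sets[of M2 M1 borel borel] measurable_cong_sets[of M3 M1 borel borel])
 finally show ?case .
next
 case (add u v)
 have m: "u \<in> borel_measurable M2" "v \<in> borel_measurable M2" "u \<in> borel_measurable M3" "v \<in> borel_measurable M3"
  using add s by (auto simp: measurable_cong_sets[of M2 M1 borel borel] measurable_cong_sets[of M3 M1 borel borel])
 have "nn_integral M1 (%x. v x + u x) = nn_integral M1 v + nn_integral M1 u" using add by (intro nn_integral_add)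
 also have "... <= (nn_integral M2 v + nn_integral M3 v) + (nn_integral M2 u + nn_integral M3 u)" by (intro add_mono add)
 also have "... = nn_integral M2 (%x. v x + u x) + nn_integral M3 (%x. v x + u x)"
  using m by (simp add: nn_integral_add ac_simps)
 finally show ?case .
next
 case (seq U)
 have m: "U i \<in> borel_measurable M2" "U i \<in> borel_measurable M3" for i
  using seq s by (auto simp: measurable_cong_sets[of M2 M1 borel borel] measurable_cong_sets[of M3 M1 borel borel])
 have "nn_integral M1 (%x. SUP i. U i x) = (SUP i. nn_integral M1 (U i))"
  by (rule nn_integral_monotone_convergence_SUP) (use seq in auto)
 also have "... <= (SUP i. nn_integral M2 (U i)) + (SUP i. nn_integral M3 (U i))"
  by (intro SUP_least order_trans[OF seq.IH] add_mono SUP_upper) auto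
 also have "... = nn_integral M2 (%x. SUP i. U i x) + nn_integral M3 (%x. SUP i. U i x)"
  by (subst (1 2) nn_integral_monotone_convergence_SUP) (use seq m in auto)
 finally have "nn_integral M1 (%x. SUP i. U i x) <= nn_integral M2 (%x. SUP i. U i x) + nn_integral M3 (%x. SUP i. U i x)" .
 moreover have "(SUP i. U i) = (%x. SUP i. U i x)" by (auto simp: fun_eq_iff image_image)
 ultimately show ?case by simp
qed

lemma finite_integrable_bounded:
 fixes X :: "'a => real"
 assumes "finite_measure M" "X \<in> borel_measurable M" "!!z. \<bar>X z\<bar> <= C"
 shows "integrable M X"
proof -
 interpret finite_measure M by fact
 show ?thesis by (rule integrable_const_bound[of _ C]) (use assms in auto)
qed

lemma integral_le_add_measure:
 fixes g :: "'a => real"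
 assumes f: "finite_measure M1" "finite_measure M2" "finite_measure M3"
  and s: "sets M2 = sets M1" "sets M3 = sets M1"
  and le: "!!E. E \<in> sets M1 ==> emeasure M1 E <= emeasure M2 E + emeasure M3 E"
  and g: "g \<in> borel_measurable M1" "!!z. 0 <= g z" "!!z. g z <= C"
 shows "(LINT z|M1. g z) <= (LINT z|M2. g z) + (LINT z|M3. g z)"
proof -
 have m: "g \<in> borel_measurable M2" "g \<in> borel_measurable M3"
  using g s by (auto simp: measurable_cong_sets[of M2 M1 borel borel] measurable_cong_sets[of M3 M1 borel borel])
 have i: "integrable M1 g" "integrable M2 g" "integrable M3 g"
  using finite_integrable_bounded[OF f(1) g(1), of C] finite_integrable_bounded[OF f(2) m(1), of C]
   finite_integrable_bounded[OF f(3) m(2), of C] g by auto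
 have "nn_integral M1 (%z. ennreal (g z)) <= nn_integral M2 (%z. ennreal (g z)) + nn_integral M3 (%z. ennreal (g z))"
  by (rule nn_integral_le_add_measure[OF s le]) (use g in auto)
 then have "ennreal (LINT z|M1. g z) <= ennreal (LINT z|M2. g z) + ennreal (LINT z|M3. g z)"
  using i g(2) by (simp add: nn_integral_eq_integral)
 then show ?thesis
  using g(2) by (simp add: ennreal_plus[symmetric] integral_nonneg_AE del: ennreal_plus)
qed

text \<open>A Hahn decomposition turns the two one-sided estimates \<open>X <= \<xi>\<close>, \<open>Y <= \<xi>\<close> and the cancellation
 \<open>X + Y <= 0\<close> on the common part into a bound by the total variation of the difference.\<close>

lemma integral_cancellation:
 fixes X Y \<xi> :: "'a => real"
 assumes f: "finite_measure M1" "finite_measure M2" "finite_measure M3"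
  and s: "sets M2 = sets M1" "sets M3 = sets M1"
  and le1: "!!E. E \<in> sets M1 ==> emeasure M1 E <= emeasure M2 E + emeasure M3 E"
  and le2: "!!E. E \<in> sets M1 ==> emeasure M2 E <= emeasure M1 E + emeasure M3 E"
  and m: "X \<in> borel_measurable M1" "Y \<in> borel_measurable M1" "\<xi> \<in> borel_measurable M1"
  and b: "!!z. \<bar>X z\<bar> <= C" "!!z. \<bar>Y z\<bar> <= C" "!!z. 0 <= \<xi> z" "!!z. \<xi> z <= C"
  and XY: "!!z. X z + Y z <= 0" and X: "!!z. X z <= \<xi> z" and Y: "!!z. Y z <= \<xi> z"
 shows "(LINT z|M1. X z) + (LINT z|M2. Y z) <= (LINT z|M3. \<xi> z)"
proof -
 have sp: "space M2 = space M1" "space M3 = space M1" using s by (auto dest: sets_eq_imp_space_eq)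
 have ms: "h \<in> borel_measurable M2 \<longleftrightarrow> h \<in> borel_measurable M1" "h \<in> borel_measurable M3 \<longleftrightarrow> h \<in> borel_measurable M1" for h :: "'a => real"
  using s by (auto simp: measurable_cong_sets[of M2 M1 borel borel] measurable_cong_sets[of M3 M1 borel borel])
 from finite_unsigned_Hahn_decomposition[OF f(1,2) s(1)]
 obtain S where S1: "S \<in> sets M1"
  and S2: "\<forall>E\<in>sets M1. E \<subseteq> S \<longrightarrow> emeasure M2 E <= emeasure M1 E"
  and S3: "\<forall>E\<in>sets M1. E \<inter> S = {} \<longrightarrow> emeasure M1 E <= emeasure M2 E"
  by (elim bexE conjE) (rule that)
 have S: "S \<in> sets M1" "!!E. E \<in> sets M1 ==> E \<subseteq> S ==> emeasure M2 E <= emeasure M1 E"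
  "!!E. E \<in> sets M1 ==> E \<subseteq> space M1 - S ==> emeasure M1 E <= emeasure M2 E"
  using S1 S2 S3 by auto
 have C0: "0 <= C" using order_trans[OF abs_ge_zero b(1)] .
 have int: "integrable N (%z. indicator A z * h z)" if "N \<in> {M1, M2, M3}" "A \<in> sets M1" "h \<in> borel_measurable M1" "!!z. \<bar>h z\<bar> <= B" for N A and h :: "'a => real" and B :: real
 proof (rule finite_integrable_bounded[where C=B])
  have "0 <= B" using order_trans[OF abs_ge_zero that(4)] .
  then show "\<bar>indicator A z * h z\<bar> <= B" for z using that(4)[of z] by (auto simp: indicator_def)
  have "(%z. indicator A z * h z) \<in> borel_measurable M1" using that(2,3) by simp
  then show "(%z. indicator A z * h z) \<in> borel_measurable N" using that(1) ms by auto
 qed (use that(1) f in auto)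
 have dom: "(LINT z|N. indicator A z * h z) <= (LINT z|N'. indicator A z * h z)"
  if N: "N \<in> {M1, M2, M3}" "N' \<in> {M1, M2, M3}" and A: "A \<in> sets M1" and h: "h \<in> borel_measurable M1" "!!z. 0 <= h z" "!!z. h z <= B"
   and le: "!!E. E \<in> sets M1 ==> E \<subseteq> A ==> emeasure N E <= emeasure N' E" for N N' A and h :: "'a => real" and B :: real
 proof -
  have i: "integrable N (%z. indicator A z * h z)" "integrable N' (%z. indicator A z * h z)"
   by (rule int[of _ _ _ B]; use N A h in \<open>auto simp: abs_le_iff intro: order_trans[of _ 0]\<close>)+
  have sN: "sets N = sets M1" "sets N' = sets M1" using N s by auto
  have "nn_integral N (%z. indicator A z * ennreal (h z)) = nn_integral (density N (indicator A)) (%z. ennreal (h z))"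
   using A h sN by (intro nn_integral_density[symmetric]) (auto simp: measurable_cong_sets[OF sN(1) refl])
  also have "... <= nn_integral (density N' (indicator A)) (%z. ennreal (h z))"
  proof (rule nn_integral_mono_measure)
   show "sets (density N (indicator A)) = sets (density N' (indicator A))" using sN by simp
   show "density N (indicator A) <= density N' (indicator A)"
   proof (subst le_measure)
    show "\<forall>E\<in>sets (density N (indicator A)). emeasure (density N (indicator A)) E <= emeasure (density N' (indicator A)) E"
    proof
     fix E assume "E \<in> sets (density N (indicator A))"
     then have E: "E \<in> sets M1" using sN by simp
     have "emeasure (density N (indicator A)) E = emeasure N (A \<inter> E)" "emeasure (density N' (indicator A)) E = emeasure N' (A \<inter> E)"
      using E A sN by (auto simp: emeasure_density indicator_inter_arith[symmetric])
     then show "emeasure (density N (indicator A)) E <= emeasure (density N' (indicator A)) E"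
      using le[of "A \<inter> E"] E A by auto
    qed
   qed (use sN in auto)
  qed
  also have "... = nn_integral N' (%z. indicator A z * ennreal (h z))"
   using A h sN by (intro nn_integral_density) (auto simp: measurable_cong_sets[OF sN(2) refl])
  finally have "nn_integral N (%z. ennreal (indicator A z * h z)) <= nn_integral N' (%z. ennreal (indicator A z * h z))"
  proof -
   have "ennreal (indicator A z * h z) = indicator A z * ennreal (h z)" for z by (auto simp: indicator_def)
   then show "?thesis" if "nn_integral N (%z. indicator A z * ennreal (h z)) <= nn_integral N' (%z. indicator A z * ennreal (h z))"
    using that by simp
  qed
  then show ?thesis using i h(2) by (simp add: nn_integral_eq_integral integral_nonneg_AE)
 qed
 \<comment> \<open>Where N' <= N: write P as \<open>\<xi>\<close> minus the nonnegative
   \<open>\<xi> - P\<close>, whose integral only decreases when N is replaced by N'. What is left is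
   \<open>\<xi>\<close> against N - N', bounded by M3, plus P + Q <= 0 against N'. On the complement
   of S the roles of the two measures are exchanged.\<close>
 have half: "(LINT z|N. indicator A z * P z) + (LINT z|N'. indicator A z * Q z) <= (LINT z|M3. indicator A z * \<xi> z)"
  if N: "N \<in> {M1, M2}" "N' \<in> {M1, M2}" and A: "A \<in> sets M1"
   and PQ: "P \<in> borel_measurable M1" "Q \<in> borel_measurable M1" "!!z. \<bar>P z\<bar> <= C" "!!z. \<bar>Q z\<bar> <= C" "!!z. P z + Q z <= 0" "!!z. P z <= \<xi> z"
   and le: "!!E. E \<in> sets M1 ==> E \<subseteq> A ==> emeasure N' E <= emeasure N E"
   and sub: "!!E. E \<in> sets M1 ==> emeasure N E <= emeasure N' E + emeasure M3 E" for N N' A P Q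
 proof -
  have N3: "N \<in> {M1, M2, M3}" "N' \<in> {M1, M2, M3}" using N by auto
  have sN: "sets N = sets M1" "sets N' = sets M1" "finite_measure N" "finite_measure N'" using N s f by auto
  have x: "\<bar>\<xi> z\<bar> <= C" for z using b(3,4)[of z] by simp
  have xp: "\<bar>\<xi> z - P z\<bar> <= 2 * C" for z using x[of z] PQ(3)[of z] by (simp add: abs_le_iff)
  have i\<xi>: "integrable N (%z. indicator A z * \<xi> z)" "integrable N' (%z. indicator A z * \<xi> z)"
   by (rule int[OF N3(1) A m(3) x], rule int[OF N3(2) A m(3) x])
  have iP: "integrable N (%z. indicator A z * P z)" "integrable N' (%z. indicator A z * P z)" "integrable N' (%z. indicator A z * Q z)"
   by (rule int[OF N3(1) A PQ(1,3)], rule int[OF N3(2) A PQ(1,3)], rule int[OF N3(2) A PQ(2,4)])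
  have mm: "(%z. \<xi> z - P z) \<in> borel_measurable M1" using m PQ by simp
  have 1: "(LINT z|N'. indicator A z * (\<xi> z - P z)) <= (LINT z|N. indicator A z * (\<xi> z - P z))"
   by (rule dom[OF N3(2,1) A mm, of "2 * C"]) (use PQ(6) xp le in \<open>auto simp: abs_le_iff\<close>)
  have 2: "(LINT z|N. indicator A z * \<xi> z) <= (LINT z|N'. indicator A z * \<xi> z) + (LINT z|M3. indicator A z * \<xi> z)"
  proof (rule integral_le_add_measure[where C=C])
   show "(%z. indicator A z * \<xi> z) \<in> borel_measurable N"
    using A m by (simp add: measurable_cong_sets[OF sN(1) refl])
  qed (use sN f s sub b C0 in \<open>auto simp: indicator_def\<close>)
  have 3: "(LINT z|N'. indicator A z * P z) + (LINT z|N'. indicator A z * Q z) <= 0"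
  proof -
   have "(LINT z|N'. indicator A z * P z) + (LINT z|N'. indicator A z * Q z) = (LINT z|N'. indicator A z * P z + indicator A z * Q z)"
    using iP by simp
   also have "... <= (LINT z|N'. 0)"
    by (rule integral_mono) (use iP PQ(5) in \<open>auto simp: indicator_def\<close>)
   finally show ?thesis by simp
  qed
  have 4: "(LINT z|N. indicator A z * (\<xi> z - P z)) = (LINT z|N. indicator A z * \<xi> z) - (LINT z|N. indicator A z * P z)"
   "(LINT z|N'. indicator A z * (\<xi> z - P z)) = (LINT z|N'. indicator A z * \<xi> z) - (LINT z|N'. indicator A z * P z)"
   using i\<xi> iP by (simp_all add: right_diff_distrib)
  show ?thesis using 1 2 3 4 by linarith
 qed
 let ?T = "space M1 - S"
 have T: "?T \<in> sets M1" using S by auto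
 have spl: "(LINT z|N. h z) = (LINT z|N. indicator S z * h z) + (LINT z|N. indicator ?T z * h z)"
  if N: "N \<in> {M1, M2, M3}" and h: "h \<in> borel_measurable M1" "!!z. \<bar>h z\<bar> <= C" for N h
 proof -
  have spN: "space N = space M1" using N sp by auto
  have "(LINT z|N. h z) = (LINT z|N. indicator S z * h z + indicator ?T z * h z)"
   by (rule integral_cong) (auto simp: spN indicator_def)
  also have "... = (LINT z|N. indicator S z * h z) + (LINT z|N. indicator ?T z * h z)"
   by (rule integral_add[OF int[OF N S(1) h] int[OF N T h]])
  finally show ?thesis .
 qed
 have h1: "(LINT z|M1. indicator S z * X z) + (LINT z|M2. indicator S z * Y z) <= (LINT z|M3. indicator S z * \<xi> z)"
  by (rule half[OF _ _ S(1) m(1,2) b(1,2) XY X S(2) le1]) auto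
 have h2: "(LINT z|M2. indicator ?T z * Y z) + (LINT z|M1. indicator ?T z * X z) <= (LINT z|M3. indicator ?T z * \<xi> z)"
  by (rule half[OF _ _ T m(2,1) b(2,1) _ Y S(3) le2]) (use XY in \<open>auto simp: add.commute\<close>)
 show ?thesis
  using h1 h2 spl[of M1 X] spl[of M2 Y] spl[of M3 \<xi>] m b by (simp add: abs_le_iff)
qed

section \<open>Levy measures away from the origin\<close>

lemma punctured_measurable:
 assumes "sets M = sets (restrict_space borel (- {0::'a::euclidean_space}))" "f \<in> Borel"
 shows "f \<in> borel_measurable M"
 using measurable_restrict_space1[OF assms(2), of "- {0}"]
 by (simp only: measurable_cong_sets[OF assms(1) refl])

text \<open>The restriction to |z| > \<kappa>, carried over to the Borel sets of the whole space.
  For a Levy measure it is finite, and ordinary Borel functions of \<open>z\<close> can be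
  integrated without reference to the punctured space.\<close>

definition outm :: "real => 'a::euclidean_space measure => 'a measure" where
 "outm \<kappa> M = density (distr M borel (%z. z)) (indicator {z. \<kappa> < norm z})"

lemma sets_outm [simp, measurable_cong]: "sets (outm \<kappa> M) = sets borel" by (simp add: outm_def)
lemma space_outm [simp]: "space (outm \<kappa> M) = UNIV" by (simp add: outm_def)

lemma norm_gt_borel [measurable]: "{z::'a::euclidean_space. \<kappa> < norm z} \<in> sets borel" by measurable

lemma emeasure_outm:
 fixes M :: "'a::euclidean_space measure"
 assumes M: "sets M = sets (restrict_space borel (- {0}))" and \<kappa>: "0 <= \<kappa>" and E: "E \<in> sets borel"
 shows "emeasure (outm \<kappa> M) E = emeasure M (E \<inter> {z. \<kappa> < norm z})" "E \<inter> {z. \<kappa> < norm z} \<in> sets M"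
proof -
 have sp: "space M = - {0}" using sets_eq_imp_space_eq[OF M] by (simp add: space_restrict_space)
 have id: "(%z. z) \<in> measurable M borel" by (rule punctured_measurable[OF M]) simp
 have "E \<inter> {z. \<kappa> < norm z} \<in> sets borel" by (intro sets.Int E norm_gt_borel)
 moreover have "E \<inter> {z. \<kappa> < norm z} \<subseteq> - {0}" using \<kappa> by auto
 ultimately show *: "E \<inter> {z. \<kappa> < norm z} \<in> sets M"
  unfolding M by (subst sets_restrict_space_iff) auto
 have "emeasure (outm \<kappa> M) E = emeasure (distr M borel (%z. z)) ({z. \<kappa> < norm z} \<inter> E)"
  unfolding outm_def using E by (subst emeasure_density) (auto simp: indicator_inter_arith[symmetric])
 also have "... = emeasure M ({z. \<kappa> < norm z} \<inter> E \<inter> space M)"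
  using id E by (subst emeasure_distr) auto
 also have "{z. \<kappa> < norm z} \<inter> E \<inter> space M = E \<inter> {z. \<kappa> < norm z}" using \<kappa> by (auto simp: sp)
 finally show "emeasure (outm \<kappa> M) E = emeasure M (E \<inter> {z. \<kappa> < norm z})" .
qed

lemma integral_outm:
 fixes f :: "'a::euclidean_space => 'b::{banach, second_countable_topology}"
 assumes M: "sets M = sets (restrict_space borel (- {0}))" and [measurable]: "f \<in> Borel"
 shows "(LINT z:{z. \<kappa> < norm z}|M. f z) = (LINT z|outm \<kappa> M. f z)"
proof -
 have id: "(%z. z) \<in> measurable M borel" by (rule punctured_measurable[OF M]) simp
 have "(LINT z|outm \<kappa> M. f z) = (LINT z|density (distr M borel (%z. z)) (%z. ennreal (indicator {z. \<kappa> < norm z} z)). f z)"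
  by (simp add: outm_def ennreal_indicator)
 also have "... = (LINT z|distr M borel (%z. z). indicator {z. \<kappa> < norm z} z *\<^sub>R f z)"
  by (rule integral_density) auto
 also have "... = (LINT z|M. indicator {z. \<kappa> < norm z} z *\<^sub>R f z)"
  by (rule integral_distr[OF id]) auto
 finally show ?thesis by (simp add: set_lebesgue_integral_def)
qed

lemma levy_sets: "levy_measure \<mu> ==> sets \<mu> = sets (restrict_space borel (- {0}))"
 by (simp add: levy_measure_def radon_punctured_def)

text \<open>Chebyshev's inequality: on |z| > \<kappa> the integrand min (|z|^2) 1 is at least min
  (\<kappa>^2) 1.\<close>

lemma finite_outm_levy:
 assumes \<mu>: "levy_measure \<mu>" and \<kappa>: "0 < \<kappa>"
 shows "finite_measure (outm \<kappa> \<mu>)"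
proof
 note s = levy_sets[OF \<mu>]
 let ?A = "{z. \<kappa> < norm z}" and ?c = "min (\<kappa>\<^sup>2) 1"
 have A: "?A \<in> sets \<mu>" using emeasure_outm(2)[OF s, of \<kappa> UNIV] \<kappa> by simp
 have "ennreal ?c * emeasure \<mu> ?A = (\<integral>\<^sup>+z. ennreal ?c * indicator ?A z \<partial>\<mu>)"
  using A by (simp add: nn_integral_cmult)
 also have "... <= (\<integral>\<^sup>+z. ennreal (min ((norm z)\<^sup>2) 1) \<partial>\<mu>)"
 proof (intro nn_integral_mono)
  fix z
  show "ennreal ?c * indicator ?A z <= ennreal (min ((norm z)\<^sup>2) 1)"
   using \<kappa> power_mono[of \<kappa> "norm z" 2] by (auto simp: indicator_def min_le_iff_disj intro!: ennreal_leI)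
 qed
 also have "... < \<infinity>" using \<mu> by (simp add: levy_measure_def)
 finally have "emeasure \<mu> ?A \<noteq> top"
 proof -
  have "0 < ?c" using \<kappa> by simp
  then show "emeasure \<mu> ?A \<noteq> top" if "ennreal ?c * emeasure \<mu> ?A < \<infinity>"
   using that by (auto simp: ennreal_mult_less_top simp del: min_less_iff_conj)
 qed
 then show "emeasure (outm \<kappa> \<mu>) (space (outm \<kappa> \<mu>)) \<noteq> \<infinity>"
  using emeasure_outm(1)[OF s, of \<kappa> UNIV] \<kappa> by simp
qed

lemma tv_value_le_add:
 assumes \<mu>: "radon_punctured \<mu>" and \<nu>: "radon_punctured \<nu>" and B: "B \<in> sets \<mu>"
 shows "tv_value \<mu> \<nu> B <= emeasure \<mu> B + emeasure \<nu> B"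
 unfolding tv_value_def
proof (rule SUP_least)
 fix P assume P: "P \<in> tv_families \<mu> B"
 have s: "sets \<nu> = sets \<mu>" using \<mu> \<nu> by (simp add: radon_punctured_def)
 have fP: "finite P" "disjoint P" "!!E. E \<in> P ==> E \<in> sets \<mu>" "\<Union>P \<subseteq> B" using P by (auto simp: tv_families_def)
 have "(\<Sum>E\<in>P. ennreal \<bar>measure \<mu> E - measure \<nu> E\<bar>) <= (\<Sum>E\<in>P. emeasure \<mu> E + emeasure \<nu> E)"
 proof (rule sum_mono)
  fix E
  have "ennreal \<bar>measure \<mu> E - measure \<nu> E\<bar> <= ennreal (measure \<mu> E + measure \<nu> E)"
   using measure_nonneg[of \<mu> E] measure_nonneg[of \<nu> E] by (intro ennreal_leI) linarith
  also have "... = ennreal (measure \<mu> E) + ennreal (measure \<nu> E)" by simp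
  also have "... <= emeasure \<mu> E + emeasure \<nu> E"
   by (intro add_mono) (simp_all add: measure_def ennreal_enn2real_if)
  finally show "ennreal \<bar>measure \<mu> E - measure \<nu> E\<bar> <= emeasure \<mu> E + emeasure \<nu> E" .
 qed
 also have "... = (\<Sum>E\<in>P. emeasure \<mu> E) + (\<Sum>E\<in>P. emeasure \<nu> E)" by (rule sum.distrib)
 also have "(\<Sum>E\<in>P. emeasure M E) = emeasure M (\<Union>P)" if "sets M = sets \<mu>" for M
 proof -
  have "P \<subseteq> sets M" using fP(3) that by auto
  then show ?thesis
   using sum_emeasure[of "%E. E" P M] fP(1,2) by (auto simp: disjoint_family_on_def disjoint_def)
 qed
 then have "(\<Sum>E\<in>P. emeasure \<mu> E) + (\<Sum>E\<in>P. emeasure \<nu> E) = emeasure \<mu> (\<Union>P) + emeasure \<nu> (\<Union>P)"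
  using s by simp
 also have "... <= emeasure \<mu> B + emeasure \<nu> B"
  using fP(4) B s by (intro add_mono emeasure_mono) auto
 finally show "(\<Sum>E\<in>P. ennreal \<bar>measure \<mu> E - measure \<nu> E\<bar>) <= emeasure \<mu> B + emeasure \<nu> B" .
qed

lemma tv_measure_swap:
 assumes "sets \<nu> = sets \<mu>" shows "tv_value \<nu> \<mu> = tv_value \<mu> \<nu>"
 unfolding tv_value_def tv_families_def using assms by (simp add: abs_minus_commute)

text \<open>The supremum in \<open>tv_value\<close> admits only sets that are relatively compact
  away from 0. The cutoff keeps the set away from 0, and intersecting with balls makes it bounded;
  on each piece \<open>B n\<close> the one-element family gives the inequality, and continuity from
  below the rest.\<close>

lemma outm_le_add_tv:
 assumes \<mu>: "levy_measure \<mu>" and \<nu>: "levy_measure \<nu>" and \<kappa>: "0 < \<kappa>" and E: "E \<in> sets borel"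
 shows "emeasure (outm \<kappa> \<mu>) E <= emeasure (outm \<kappa> \<nu>) E + emeasure (outm \<kappa> (tv_measure \<mu> \<nu>)) E"
proof -
 have r: "radon_punctured \<mu>" "radon_punctured \<nu>" using \<mu> \<nu> by (auto simp: levy_measure_def)
 note s = levy_sets[OF \<mu>] levy_sets[OF \<nu>]
 have st: "sets (tv_measure \<mu> \<nu>) = sets (restrict_space borel (- {0}))" using s by simp
 define B where "B n = E \<inter> {z. \<kappa> < norm z} \<inter> cball 0 (real n)" for n
 let ?B = "E \<inter> {z. \<kappa> < norm z}"
 have Bs: "B n \<in> sets \<mu>" for n
  using emeasure_outm(2)[OF s(1), of \<kappa> "E \<inter> cball 0 (real n)"] E \<kappa> by (simp add: B_def Int_ac)
 have UB: "(\<Union>n. B n) = ?B"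
  using real_arch_simple by (auto simp: B_def)
 have step: "emeasure \<mu> (B n) <= emeasure \<nu> ?B + emeasure (tv_measure \<mu> \<nu>) ?B" for n
 proof -
  have cl: "closure (B n) \<subseteq> {z. \<kappa> <= norm z}"
   by (intro closure_minimal closed_Collect_le continuous_intros) (auto simp: B_def)
  then have z: "0 \<notin> closure (B n)" using \<kappa> by auto
  have bd: "bounded (B n)" unfolding B_def by (intro bounded_Int disjI2) auto
  have fin: "emeasure M (B n) \<noteq> top" if M: "radon_punctured M" for M
  proof -
   have "closure (B n) \<in> sets M"
    using M z by (auto simp: radon_punctured_def sets_restrict_space image_iff)
   then have "emeasure M (B n) <= emeasure M (closure (B n))" by (intro emeasure_mono closure_subset)
   also have "... < \<infinity>"
    using M z bd by (auto simp: radon_punctured_def compact_closure)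
   finally show ?thesis by simp
  qed
  have "ennreal \<bar>measure \<mu> (B n) - measure \<nu> (B n)\<bar> <= tv_value \<mu> \<nu> (B n)"
  proof -
   have "{B n} \<in> tv_families \<mu> (B n)"
    using Bs z bd by (auto simp: tv_families_def compact_closure)
   then have "(\<Sum>E\<in>{B n}. ennreal \<bar>measure \<mu> E - measure \<nu> E\<bar>) <= tv_value \<mu> \<nu> (B n)"
    unfolding tv_value_def by (rule SUP_upper)
   then show ?thesis by simp
  qed
  also have "tv_value \<mu> \<nu> (B n) = emeasure (tv_measure \<mu> \<nu>) (B n)"
   by (rule emeasure_tv_measure[OF r Bs, symmetric])
  finally have d: "ennreal \<bar>measure \<mu> (B n) - measure \<nu> (B n)\<bar> <= emeasure (tv_measure \<mu> \<nu>) (B n)" .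
  have "emeasure \<mu> (B n) = ennreal (measure \<mu> (B n))"
   using fin[OF r(1)] by (rule emeasure_eq_ennreal_measure)
  also have "... <= ennreal (measure \<nu> (B n) + \<bar>measure \<mu> (B n) - measure \<nu> (B n)\<bar>)"
   by (intro ennreal_leI) auto
  also have "... = emeasure \<nu> (B n) + ennreal \<bar>measure \<mu> (B n) - measure \<nu> (B n)\<bar>"
   using emeasure_eq_ennreal_measure[OF fin[OF r(2)]] by simp
  also have "... <= emeasure \<nu> (B n) + emeasure (tv_measure \<mu> \<nu>) (B n)" by (intro add_left_mono d)
  also have "... <= emeasure \<nu> ?B + emeasure (tv_measure \<mu> \<nu>) ?B"
   using emeasure_outm(2)[OF s(1), of \<kappa> E] E \<kappa> s by (intro add_mono emeasure_mono) (auto simp: B_def)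
  finally show ?thesis .
 qed
 have "emeasure \<mu> ?B = (SUP n. emeasure \<mu> (B n))"
  unfolding UB[symmetric]
  by (rule SUP_emeasure_incseq[symmetric]) (use Bs in \<open>auto simp: incseq_def B_def\<close>)
 also have "... <= emeasure \<nu> ?B + emeasure (tv_measure \<mu> \<nu>) ?B"
  by (rule SUP_least) (rule step)
 finally show ?thesis
  using emeasure_outm(1)[OF s(1) _ E] emeasure_outm(1)[OF s(2) _ E] emeasure_outm(1)[OF st _ E] \<kappa> by simp
qed

lemma tv_measure_commute:
 assumes \<mu>: "levy_measure \<mu>" and \<nu>: "levy_measure \<nu>"
 shows "tv_measure \<nu> \<mu> = tv_measure \<mu> \<nu>"
proof -
 have s: "sets \<nu> = sets \<mu>" using levy_sets[OF \<mu>] levy_sets[OF \<nu>] by simp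
 show ?thesis unfolding tv_measure_def tv_measure_swap[OF s] using s by (simp add: sets_eq_imp_space_eq[OF s])
qed

lemma finite_outm_tv:
 assumes \<mu>: "levy_measure \<mu>" and \<nu>: "levy_measure \<nu>" and \<kappa>: "0 < \<kappa>"
 shows "finite_measure (outm \<kappa> (tv_measure \<mu> \<nu>))"
proof
 have r: "radon_punctured \<mu>" "radon_punctured \<nu>" using \<mu> \<nu> by (auto simp: levy_measure_def)
 note s = levy_sets[OF \<mu>] levy_sets[OF \<nu>]
 have st: "sets (tv_measure \<mu> \<nu>) = sets (restrict_space borel (- {0}))" using s by simp
 let ?A = "{z. \<kappa> < norm z}"
 have A: "?A \<in> sets \<mu>" using emeasure_outm(2)[OF s(1), of \<kappa> UNIV] \<kappa> by simp
 have "emeasure (tv_measure \<mu> \<nu>) ?A <= emeasure \<mu> ?A + emeasure \<nu> ?A"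
  unfolding emeasure_tv_measure[OF r A] by (rule tv_value_le_add[OF r A])
 also have "... < top"
  using finite_measure.emeasure_finite[OF finite_outm_levy[OF \<mu> \<kappa>], of UNIV]
   finite_measure.emeasure_finite[OF finite_outm_levy[OF \<nu> \<kappa>], of UNIV]
   emeasure_outm(1)[OF s(1), of \<kappa> UNIV] emeasure_outm(1)[OF s(2), of \<kappa> UNIV] \<kappa> by (simp add: less_top)
 finally show "emeasure (outm \<kappa> (tv_measure \<mu> \<nu>)) (space (outm \<kappa> (tv_measure \<mu> \<nu>))) \<noteq> \<infinity>"
  using emeasure_outm(1)[OF st, of \<kappa> UNIV] \<kappa> by simp
qed

theorem levy_cancellation:
 fixes X Y \<xi> :: "'a::euclidean_space => real"
 assumes \<mu>: "levy_measure \<mu>" and \<nu>: "levy_measure \<nu>" and \<kappa>: "0 < \<kappa>"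
  and m: "X \<in> Borel" "Y \<in> Borel" "\<xi> \<in> Borel"
  and b: "!!z. \<bar>X z\<bar> <= C" "!!z. \<bar>Y z\<bar> <= C" "!!z. 0 <= \<xi> z" "!!z. \<xi> z <= C"
  and XY: "!!z. X z + Y z <= 0" and X: "!!z. X z <= \<xi> z" and Y: "!!z. Y z <= \<xi> z"
 shows "(LINT z|outm \<kappa> \<mu>. X z) + (LINT z|outm \<kappa> \<nu>. Y z) <= (LINT z|outm \<kappa> (tv_measure \<mu> \<nu>). \<xi> z)"
proof (rule integral_cancellation[where C=C])
 show "emeasure (outm \<kappa> \<mu>) E <= emeasure (outm \<kappa> \<nu>) E + emeasure (outm \<kappa> (tv_measure \<mu> \<nu>)) E"
  if "E \<in> sets (outm \<kappa> \<mu>)" for E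
  using that by (intro outm_le_add_tv \<mu> \<nu> \<kappa>) auto
 show "emeasure (outm \<kappa> \<nu>) E <= emeasure (outm \<kappa> \<mu>) E + emeasure (outm \<kappa> (tv_measure \<mu> \<nu>)) E"
  if "E \<in> sets (outm \<kappa> \<mu>)" for E
  using outm_le_add_tv[OF \<nu> \<mu> \<kappa>, of E] that tv_measure_commute[OF \<mu> \<nu>] by simp
qed (use assms finite_outm_levy finite_outm_tv in auto)

subsection \<open>The doubled integrand\<close>

definition small_moment :: "real => 'a::euclidean_space measure => real" where
 "small_moment \<kappa> \<mu> = (LINT z:{z. 0 < norm z \<and> norm z <= \<kappa>}|\<mu>. (norm z)\<^sup>2)"

lemma integrable_small:
 fixes \<mu> :: "'a::euclidean_space measure"
 assumes \<mu>: "levy_measure \<mu>" and \<kappa>: "\<kappa> <= 1"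
 shows "integrable \<mu> (%z. indicator {z. 0 < norm z \<and> norm z <= \<kappa>} z * (norm z)\<^sup>2)"
proof (rule integrableI_nonneg)
 have "(\<integral>\<^sup>+z. ennreal (indicator {z. 0 < norm z \<and> norm z <= \<kappa>} z * (norm z)\<^sup>2) \<partial>\<mu>) <= (\<integral>\<^sup>+z. ennreal (min ((norm z)\<^sup>2) 1) \<partial>\<mu>)"
 proof (intro nn_integral_mono ennreal_leI)
  fix z :: 'a
  show "indicator {z. 0 < norm z \<and> norm z <= \<kappa>} z * (norm z)\<^sup>2 <= min ((norm z)\<^sup>2) 1"
   using \<kappa> power_mono[of "norm z" 1 2] by (auto simp: indicator_def)
 qed
 also have "... < \<infinity>" using \<mu> by (simp add: levy_measure_def)
 finally show "(\<integral>\<^sup>+z. ennreal (indicator {z. 0 < norm z \<and> norm z <= \<kappa>} z * (norm z)\<^sup>2) \<partial>\<mu>) < \<infinity>" .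
 show "(%z. indicator {z. 0 < norm z \<and> norm z <= \<kappa>} z * (norm z)\<^sup>2) \<in> borel_measurable \<mu>"
  by (rule punctured_measurable[OF levy_sets[OF \<mu>]]) measurable
qed auto

lemma small_moment_tendsto:
 fixes \<mu> :: "'a::euclidean_space measure"
 assumes \<mu>: "levy_measure \<mu>"
 shows "(%n. small_moment (1 / real (Suc n)) \<mu>) \<longlonglongrightarrow> 0"
proof -
 have "(%n. LINT z|\<mu>. indicator {z. 0 < norm z \<and> norm z <= 1 / real (Suc n)} z * (norm z)\<^sup>2) \<longlonglongrightarrow> (LINT z|\<mu>. 0)"
 proof (rule integral_dominated_convergence[OF _ _ integrable_small[OF \<mu> order_refl]])
  show "AE z in \<mu>. (%n. indicator {z. 0 < norm z \<and> norm z <= 1 / real (Suc n)} z * (norm z)\<^sup>2) \<longlonglongrightarrow> 0"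
  proof (intro AE_I2 tendsto_eventually)
   fix z :: 'a
   show "\<forall>\<^sub>F n in sequentially. indicator {z. 0 < norm z \<and> norm z <= 1 / real (Suc n)} z * (norm z)\<^sup>2 = 0"
   proof (cases "z = 0")
    case False
    then obtain N where N: "inverse (real (Suc N)) < norm z" using reals_Archimedean[of "norm z"] by auto
    show ?thesis using eventually_ge_at_top[of N]
    proof eventually_elim
     case (elim n)
     have "1 / real (Suc n) <= inverse (real (Suc N))" using elim by (simp add: field_simps)
     then show ?case using N by (simp add: indicator_def)
    qed
   qed simp
  qed
  show "AE z in \<mu>. norm (indicator {z. 0 < norm z \<and> norm z <= 1 / real (Suc n)} z * (norm z)\<^sup>2)
    <= indicator {z. 0 < norm z \<and> norm z <= 1} z * (norm z)\<^sup>2" for n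
  proof (intro AE_I2)
   fix z :: 'a
   have le: "1 / real (Suc n) <= 1" by simp
   show "norm (indicator {z. 0 < norm z \<and> norm z <= 1 / real (Suc n)} z * (norm z)\<^sup>2)
    <= indicator {z. 0 < norm z \<and> norm z <= 1} z * (norm z)\<^sup>2"
    by (auto simp: indicator_def simp del: of_nat_Suc intro: order_trans[OF _ le])
  qed
  show "(%z. indicator {z. 0 < norm z \<and> norm z <= 1 / real (Suc n)} z * (norm z)\<^sup>2) \<in> borel_measurable \<mu>" for n
   by (rule punctured_measurable[OF levy_sets[OF \<mu>]]) measurable
 qed auto
 then show ?thesis by (simp add: small_moment_def set_lebesgue_integral_def)
qed

text \<open>The static data of one equation for a fixed kernel and cutoff. Since \<kappa> <= 1, the
  indicator of the unit ball equals 1 on all jumps below the cutoff, and \<open>Lin\<close> has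
  support in the ball of radius R + 1.\<close>

locale entropy_data = kernel +
 fixes f :: "real => 'a" and F :: real and A :: "real => real" and L B :: real and \<mu> :: "'a measure" and \<kappa> :: real
 assumes f_lip: "norm (f s - f t) <= F * \<bar>s - t\<bar>"
  and A_lip: "\<bar>A s - A t\<bar> <= L * \<bar>s - t\<bar>" and A_mono: "mono A" and A_0: "A 0 = 0" and A_bd: "\<bar>A s\<bar> <= B"
  and levy: "levy_measure \<mu>" and \<kappa>0: "0 < \<kappa>" and \<kappa>1: "\<kappa> <= 1"
begin

lemma F0: "0 <= F" using order_trans[OF norm_ge_zero f_lip[of 1 0]] by simp
lemma L0: "0 <= L" using order_trans[OF abs_ge_zero A_lip[of 1 0]] by simp
lemma f_measurable [measurable]: "f \<in> Borel" by (rule lipschitz_measurable[OF f_lip])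
lemma A_measurable [measurable]: "A \<in> Borel"
 by (rule lipschitz_measurable[where F=L]) (use A_lip in simp)

lemma A_le: "\<bar>A s\<bar> <= L * \<bar>s\<bar>" using A_lip[of s 0] A_0 by simp

lemma A_integrable: "L1 w ==> L1 (%x. A (w x))"
 by (rule integrable_bound[where f="%x. L * \<bar>w x\<bar>"]) (use A_le L0 in auto)

sublocale out: finite_measure "outm \<kappa> \<mu>" by (rule finite_outm_levy[OF levy \<kappa>0])

definition drift :: 'a where
 "drift = (LINT z|outm \<kappa> \<mu>. indicator {z. norm z <= 1} z *\<^sub>R z)"

text \<open>The operator \<open>levy_op_in\<close> of the dual measure applied to the kernel, with
  the reflection from z to -z carried out (see \<open>levy_op_in_test\<close>).\<close>

definition Lin :: "'a => real" where
 "Lin v = (LINT z:{z. 0 < norm z \<and> norm z <= \<kappa>}|\<mu>. \<rho> (v - z) - \<rho> v + z \<bullet> D v)"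

definition outer :: "('a => real) => 'a => real" where
 "outer w x = (LINT z|outm \<kappa> \<mu>. A (w (x + z)) - A (w x))"

text \<open>The coefficient of \<alpha> (t) in the entropy integrand for the test function \<rho> (x
  - y) \<alpha> (t), taken with cutoff r = \<kappa>. The coefficient of \<alpha>' (t) is |w x - k|
  \<rho> (x - y).\<close>

definition ent :: "('a => real) => real => 'a => 'a => real" where
 "ent w k y x = (entropy_flux f (w x) k + \<bar>A (w x) - A k\<bar> *\<^sub>R drift) \<bullet> D (x - y)
   + (\<bar>A (w x) - A k\<bar> * Lin (x - y) + sgn (w x - k) * outer w x * \<rho> (x - y))"

definition mm :: "'a => real" where
 "mm v = \<rho> v + (F + L * norm drift) * norm (D v) + L * \<bar>Lin v\<bar>"

definition outer_abs :: "('a => real) => 'a => real" where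
 "outer_abs w x = (LINT z|outm \<kappa> \<mu>. \<bar>A (w (x + z)) - A (w x)\<bar>)"

text \<open>A common majorant of both coefficients (\<open>ent_le_dom\<close>). It is integrable in
  x for fixed k, and in the pair (y, x) when k = q y, with bounds depending only on L1 norms and
  hence uniform in time; this justifies the exchanges with the time integral.\<close>

definition dom :: "('a => real) => real => 'a => 'a => real" where
 "dom w k y x = (\<bar>w x\<bar> + \<bar>k\<bar>) * mm (x - y) + outer_abs w x * \<rho> (x - y)"

lemma small0: "0 <= small_moment \<kappa> \<mu>"
 unfolding small_moment_def set_lebesgue_integral_def by (intro integral_nonneg_AE) auto

lemma Lin_integrand: "\<bar>indicator {z. 0 < norm z \<and> norm z <= \<kappa>} z * (\<rho> (v - z) - \<rho> v + z \<bullet> D v)\<bar>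
  <= K * (indicator {z. 0 < norm z \<and> norm z <= \<kappa>} z * (norm z)\<^sup>2)"
 using taylor[of v "- z"] by (auto simp: indicator_def)

lemma Lin_bound: "\<bar>Lin v\<bar> <= K * small_moment \<kappa> \<mu>"
proof -
 have "\<bar>Lin v\<bar> <= (LINT z|\<mu>. K * (indicator {z. 0 < norm z \<and> norm z <= \<kappa>} z * (norm z)\<^sup>2))"
  unfolding Lin_def set_lebesgue_integral_def real_scaleR_def real_norm_def[symmetric]
 proof -
  have i: "integrable \<mu> (%z. K * (indicator {z. 0 < norm z \<and> norm z <= \<kappa>} z * (norm z)\<^sup>2))"
   by (intro integrable_mult_right integrable_small levy \<kappa>1)
  have le: "norm (indicator {z. 0 < norm z \<and> norm z <= \<kappa>} z * (\<rho> (v - z) - \<rho> v + z \<bullet> D v))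
    <= K * (indicator {z. 0 < norm z \<and> norm z <= \<kappa>} z * (norm z)\<^sup>2)" for z
   using Lin_integrand by simp
  have j: "integrable \<mu> (%z. indicator {z. 0 < norm z \<and> norm z <= \<kappa>} z * (\<rho> (v - z) - \<rho> v + z \<bullet> D v))"
  proof (rule integrable_bound[OF i])
   show "(%z. indicator {z. 0 < norm z \<and> norm z <= \<kappa>} z * (\<rho> (v - z) - \<rho> v + z \<bullet> D v)) \<in> borel_measurable \<mu>"
    by (rule punctured_measurable[OF levy_sets[OF levy]]) measurable
   show "AE z in \<mu>. norm (indicator {z. 0 < norm z \<and> norm z <= \<kappa>} z * (\<rho> (v - z) - \<rho> v + z \<bullet> D v))
     <= norm (K * (indicator {z. 0 < norm z \<and> norm z <= \<kappa>} z * (norm z)\<^sup>2))"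
    using order_trans[OF le abs_ge_self] by (intro AE_I2) simp
  qed
  show "norm (LINT z|\<mu>. indicator {z. 0 < norm z \<and> norm z <= \<kappa>} z * (\<rho> (v - z) - \<rho> v + z \<bullet> D v))
   <= (LINT z|\<mu>. K * (indicator {z. 0 < norm z \<and> norm z <= \<kappa>} z * (norm z)\<^sup>2))"
   by (rule order_trans[OF integral_norm_bound integral_mono[OF integrable_norm[OF j] i le]])
 qed
 then show ?thesis by (simp add: small_moment_def set_lebesgue_integral_def)
qed

lemma Lin_supp: "R + 1 < norm v ==> Lin v = 0"
proof -
 assume v: "R + 1 < norm v"
 have "indicator {z. 0 < norm z \<and> norm z <= \<kappa>} z * (\<rho> (v - z) - \<rho> v + z \<bullet> D v) = 0" for z
 proof (cases "norm z <= \<kappa>")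
  case True
  have "norm v <= norm (v - z) + norm z" using norm_triangle_ineq[of "v - z" z] by simp
  then show ?thesis using True \<kappa>1 v supp[of "v - z"] supp[of v] D_supp[of v] by simp
 qed (simp add: indicator_def)
 note z = this
 show "Lin v = 0" unfolding Lin_def set_lebesgue_integral_def real_scaleR_def z by simp
qed

lemma Lin_measurable [measurable]: "Lin \<in> Borel"
proof (rule borel_measurable_continuous_onI, unfold continuous_on_sequentially comp_def, intro allI ballI impI)
 fix x :: "nat => 'a" and v assume "(\<forall>n. x n \<in> UNIV) \<and> x \<longlonglongrightarrow> v"
 then have x: "x \<longlonglongrightarrow> v" by simp
 have c\<rho>: "(%n. \<rho> (x n - z)) \<longlonglongrightarrow> \<rho> (v - z)" for z
  by (rule continuous_on_tendsto_compose[OF continuous_rho[of UNIV]]) (auto intro!: tendsto_intros x)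
 have cD: "(%n. D (x n)) \<longlonglongrightarrow> D v"
  by (rule continuous_on_tendsto_compose[OF continuous_D[of UNIV]]) (auto intro!: x)
 show "(%n. Lin (x n)) \<longlonglongrightarrow> Lin v"
  unfolding Lin_def set_lebesgue_integral_def real_scaleR_def
 proof (rule integral_dominated_convergence[OF _ _ integrable_mult_right[OF integrable_small[OF levy \<kappa>1], of K]])
  show "AE z in \<mu>. (%n. indicator {z. 0 < norm z \<and> norm z <= \<kappa>} z * (\<rho> (x n - z) - \<rho> (x n) + z \<bullet> D (x n)))
    \<longlonglongrightarrow> indicator {z. 0 < norm z \<and> norm z <= \<kappa>} z * (\<rho> (v - z) - \<rho> v + z \<bullet> D v)"
   using c\<rho>[of 0] by (intro AE_I2 tendsto_intros c\<rho> cD) simp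
  show "AE z in \<mu>. norm (indicator {z. 0 < norm z \<and> norm z <= \<kappa>} z * (\<rho> (x n - z) - \<rho> (x n) + z \<bullet> D (x n)))
    <= K * (indicator {z. 0 < norm z \<and> norm z <= \<kappa>} z * (norm z)\<^sup>2)" for n
   using Lin_integrand by (intro AE_I2) simp
 qed (rule punctured_measurable[OF levy_sets[OF levy]], measurable)+
qed

lemma Lin_integrable: "L1 Lin"
 by (rule integrable_ball_bound[of _ "K * small_moment \<kappa> \<mu>" "R + 1"]) (use Lin_bound Lin_supp in auto)

lemma mm_nonneg: "0 <= mm v"
 unfolding mm_def using nonneg F0 L0 by (intro add_nonneg_nonneg mult_nonneg_nonneg) auto

lemma mm_measurable [measurable]: "mm \<in> Borel"
 unfolding mm_def[abs_def] by measurable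

lemma mm_integrable: "L1 mm"
 unfolding mm_def[abs_def]
 using integrable_rho integrable_norm[OF integrable_D] integrable_abs[OF Lin_integrable]
 by (intro integrable_add integrable_mult_right) auto

definition Kmm :: real where "Kmm = K + (F + L * norm drift) * K + L * (K * small_moment \<kappa> \<mu>)"

lemma mm_bound: "mm v <= Kmm"
 unfolding mm_def Kmm_def using F0 L0 bound D_bound Lin_bound
 by (intro add_mono mult_left_mono) auto

lemma Kmm0: "0 <= Kmm" using order_trans[OF mm_nonneg mm_bound] .

lemma outer_integrable:
 assumes [measurable]: "w \<in> Borel"
 shows "integrable (outm \<kappa> \<mu>) (%z. A (w (x + z)) - A (w x))"
proof (rule finite_integrable_bounded[where C="2 * B"])
 show "\<bar>A (w (x + z)) - A (w x)\<bar> <= 2 * B" for z using A_bd[of "w (x + z)"] A_bd[of "w x"] by (simp add: abs_le_iff)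
qed (auto intro: out.finite_measure_axioms)

lemma outer_abs_nonneg: "0 <= outer_abs w x" unfolding outer_abs_def by (intro integral_nonneg_AE) auto

lemma outer_le: "\<bar>outer w x\<bar> <= outer_abs w x"
 using integral_norm_bound[of "outm \<kappa> \<mu>" "%z. A (w (x + z)) - A (w x)"] by (simp add: outer_def outer_abs_def)

lemma outer_measurable [measurable]:
 assumes [measurable]: "w \<in> Borel"
 shows "outer w \<in> Borel" "outer_abs w \<in> Borel"
 unfolding outer_def[abs_def] outer_abs_def[abs_def] by measurable

definition mass_out :: real where "mass_out = measure (outm \<kappa> \<mu>) UNIV"

text \<open>Tonelli over the finite measure \<open>outm \<kappa> \<mu>\<close>: each jump costs the
  translation modulus of A (w), at most 2 L times the L1 norm of \<open>w\<close>.\<close>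

lemma outer_abs_L1:
 assumes w: "L1 w"
 shows "(NN x. ennreal (outer_abs w x)) <= ennreal (2 * L * mass_out * (LB x. \<bar>w x\<bar>))"
proof -
 have [measurable]: "w \<in> Borel" using w by auto
 interpret P: pair_sigma_finite "outm \<kappa> \<mu>" "lborel :: 'a measure" ..
 have "(NN x. ennreal (outer_abs w x)) = (NN x. \<integral>\<^sup>+z. ennreal \<bar>A (w (x + z)) - A (w x)\<bar> \<partial>outm \<kappa> \<mu>)"
  unfolding outer_abs_def
  by (intro nn_integral_cong nn_integral_eq_integral[symmetric] integrable_abs outer_integrable) auto
 also have "... = (\<integral>\<^sup>+z. (NN x. ennreal \<bar>A (w (x + z)) - A (w x)\<bar>) \<partial>outm \<kappa> \<mu>)"
  by (rule P.Fubini') measurable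
 also have "... <= (\<integral>\<^sup>+z. ennreal (L * (2 * (LB x. \<bar>w x\<bar>))) \<partial>outm \<kappa> \<mu>)"
 proof (intro nn_integral_mono)
  fix z
  have "(NN x. ennreal \<bar>A (w (x + z)) - A (w x)\<bar>) = ennreal (osc (%x. A (w x)) z)"
   by (rule osc_nn_integral[OF A_integrable[OF w]])
  also have "... <= ennreal (L * (2 * (LB x. \<bar>w x\<bar>)))"
   using order_trans[OF osc_mono_lipschitz[OF w A_lip A_integrable[OF w]] mult_left_mono[OF osc_le[OF w] L0]]
   by (intro ennreal_leI)
  finally show "(NN x. ennreal \<bar>A (w (x + z)) - A (w x)\<bar>) <= ennreal (L * (2 * (LB x. \<bar>w x\<bar>)))" .
 qed
 also have "... = ennreal (2 * L * mass_out * (LB x. \<bar>w x\<bar>))"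
  using L0 by (simp add: out.emeasure_eq_measure mass_out_def ennreal_mult[symmetric] integral_nonneg_AE mult_ac)
 finally show ?thesis .
qed

lemma dom_nonneg: "0 <= dom w k y x"
 unfolding dom_def using mm_nonneg nonneg outer_abs_nonneg by (intro add_nonneg_nonneg mult_nonneg_nonneg) auto

lemma ent_le_dom:
 shows "\<bar>ent w k y x\<bar> <= dom w k y x" "\<bar>w x - k\<bar> * \<rho> (x - y) <= dom w k y x"
proof -
 let ?v = "x - y" and ?d = "\<bar>w x - k\<bar>"
 have dk: "?d <= \<bar>w x\<bar> + \<bar>k\<bar>" by linarith
 have 1: "\<bar>entropy_flux f (w x) k \<bullet> D ?v\<bar> <= (F * ?d) * norm (D ?v)"
  using order_trans[OF Cauchy_Schwarz_ineq2 mult_right_mono[OF entropy_flux_bound[OF f_lip] norm_ge_zero]] .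
 have 2: "\<bar>(\<bar>A (w x) - A k\<bar> *\<^sub>R drift) \<bullet> D ?v\<bar> <= (L * ?d) * (norm drift * norm (D ?v))"
  unfolding inner_scaleR_left abs_mult using A_lip[of "w x" k] Cauchy_Schwarz_ineq2[of drift "D ?v"] L0
  by (intro mult_mono) auto
 have 3: "\<bar>\<bar>A (w x) - A k\<bar> * Lin ?v\<bar> <= (L * ?d) * \<bar>Lin ?v\<bar>"
  unfolding abs_mult using A_lip[of "w x" k] by (intro mult_right_mono) auto
 have 4: "\<bar>sgn (w x - k) * outer w x * \<rho> ?v\<bar> <= outer_abs w x * \<rho> ?v"
  unfolding abs_mult using outer_le[of w x] nonneg[of ?v] outer_abs_nonneg[of w x]
  by (intro mult_mono) (auto simp: sgn_real_def)
 have "\<bar>ent w k y x\<bar> <= \<bar>entropy_flux f (w x) k \<bullet> D ?v\<bar> + \<bar>(\<bar>A (w x) - A k\<bar> *\<^sub>R drift) \<bullet> D ?v\<bar>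
   + \<bar>\<bar>A (w x) - A k\<bar> * Lin ?v\<bar> + \<bar>sgn (w x - k) * outer w x * \<rho> ?v\<bar>"
  unfolding ent_def inner_add_left by linarith
 also have "... <= ?d * ((F + L * norm drift) * norm (D ?v) + L * \<bar>Lin ?v\<bar>) + outer_abs w x * \<rho> ?v"
  using 1 2 3 4 by (simp add: algebra_simps)
 also have "... <= ?d * mm ?v + outer_abs w x * \<rho> ?v"
  unfolding mm_def using nonneg[of ?v] by (intro add_right_mono mult_left_mono) auto
 also have "... <= (\<bar>w x\<bar> + \<bar>k\<bar>) * mm ?v + outer_abs w x * \<rho> ?v"
  using dk mm_nonneg by (intro add_right_mono mult_right_mono) auto
 finally show "\<bar>ent w k y x\<bar> <= dom w k y x" by (simp add: dom_def)
 have "?d * \<rho> ?v <= (\<bar>w x\<bar> + \<bar>k\<bar>) * mm ?v"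
 proof (intro mult_mono dk)
  show "\<rho> ?v <= mm ?v" unfolding mm_def using F0 L0 by simp
 qed (use nonneg in auto)
 moreover have "0 <= outer_abs w x * \<rho> ?v" using nonneg outer_abs_nonneg by simp
 ultimately show "?d * \<rho> ?v <= dom w k y x" unfolding dom_def by linarith
qed

lemma dom_x_L1:
 assumes w: "L1 w"
 shows "(NN x. ennreal (dom w k y x))
   <= ennreal (Kmm * (LB x. \<bar>w x\<bar>) + \<bar>k\<bar> * (LB v. mm v) + K * (2 * L * mass_out * (LB x. \<bar>w x\<bar>)))"
proof -
 have [measurable]: "w \<in> Borel" using w by auto
 have imm: "0 <= (LB v. mm v)" using mm_nonneg by (intro integral_nonneg_AE) auto
 have iw: "0 <= (LB x. \<bar>w x\<bar>)" by (intro integral_nonneg_AE) auto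
 have mo: "0 <= mass_out" by (simp add: mass_out_def)
 have "(NN x. ennreal (dom w k y x))
   <= (NN x. ennreal Kmm * ennreal \<bar>w x\<bar> + (ennreal \<bar>k\<bar> * ennreal (mm (x - y)) + ennreal K * ennreal (outer_abs w x)))"
 proof (intro nn_integral_mono)
  fix x
  have "\<bar>w x\<bar> * mm (x - y) <= Kmm * \<bar>w x\<bar>" using mult_right_mono[OF mm_bound, of "\<bar>w x\<bar>"] by (simp add: mult.commute)
  moreover have "outer_abs w x * \<rho> (x - y) <= K * outer_abs w x"
   using mult_right_mono[OF bound outer_abs_nonneg] by (simp add: mult.commute)
  ultimately have "dom w k y x <= Kmm * \<bar>w x\<bar> + (\<bar>k\<bar> * mm (x - y) + K * outer_abs w x)"
   by (simp add: dom_def distrib_right)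
  then show "ennreal (dom w k y x) <= ennreal Kmm * ennreal \<bar>w x\<bar> + (ennreal \<bar>k\<bar> * ennreal (mm (x - y)) + ennreal K * ennreal (outer_abs w x))"
   using Kmm0 K0 mm_nonneg outer_abs_nonneg
   by (simp add: ennreal_mult[symmetric] ennreal_plus[symmetric] ennreal_leI del: ennreal_plus)
 qed
 also have "... = ennreal Kmm * (NN x. ennreal \<bar>w x\<bar>) + (ennreal \<bar>k\<bar> * (NN x. ennreal (mm (x - y)))
   + ennreal K * (NN x. ennreal (outer_abs w x)))"
  by (simp add: nn_integral_add nn_integral_cmult)
 also have "(NN x. ennreal (mm (x - y))) = ennreal (LB v. mm v)"
  using nn_integral_lborel_shift[of "%v. ennreal (mm v)" "- y"] nn_integral_eq_integral[OF mm_integrable] mm_nonneg by simp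
 also have "(NN x. ennreal \<bar>w x\<bar>) = ennreal (LB x. \<bar>w x\<bar>)"
  using w by (intro nn_integral_eq_integral) auto
 also have "ennreal K * (NN x. ennreal (outer_abs w x)) <= ennreal K * ennreal (2 * L * mass_out * (LB x. \<bar>w x\<bar>))"
  by (intro mult_left_mono outer_abs_L1 w) auto
 finally show ?thesis
  using Kmm0 K0 imm iw mo L0 by (simp add: ennreal_mult[symmetric] ennreal_plus[symmetric] add_left_mono add.assoc del: ennreal_plus)
qed

definition domC :: "real => real => real" where
 "domC Nw Nq = (Nw + Nq) * (LB v. mm v) + 2 * L * mass_out * Nw"

lemma dom_pair_L1:
 assumes w: "L1 w" and q: "L1 q"
 shows "(NN y. (NN x. ennreal (dom w (q y) y x))) <= ennreal (domC (LB x. \<bar>w x\<bar>) (LB x. \<bar>q x\<bar>))"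
proof -
 have [measurable]: "w \<in> Borel" "q \<in> Borel" using w q by auto
 have imm: "0 <= (LB v. mm v)" using mm_nonneg by (intro integral_nonneg_AE) auto
 have iw: "0 <= (LB x. \<bar>w x\<bar>)" "0 <= (LB x. \<bar>q x\<bar>)" by (intro integral_nonneg_AE; auto)+
 have mo: "0 <= mass_out" by (simp add: mass_out_def)
 have nm: "(NN v. ennreal (mm v)) = ennreal (LB v. mm v)"
  using nn_integral_eq_integral[OF mm_integrable] mm_nonneg by simp
 have nw: "(NN x. ennreal \<bar>w x\<bar>) = ennreal (LB x. \<bar>w x\<bar>)" "(NN x. ennreal \<bar>q x\<bar>) = ennreal (LB x. \<bar>q x\<bar>)"
  using w q by (intro nn_integral_eq_integral; auto)+
 have "(NN y. (NN x. ennreal (dom w (q y) y x)))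
   = (NN y. (NN x. ennreal \<bar>w x\<bar> * ennreal (mm (x - y))) + ((NN x. ennreal \<bar>q y\<bar> * ennreal (mm (x - y)))
      + (NN x. ennreal (outer_abs w x) * ennreal (\<rho> (x - y)))))"
  by (subst nn_integral_add[symmetric], measurable)+
    (simp add: dom_def distrib_right mm_nonneg nonneg outer_abs_nonneg ennreal_mult[symmetric] ennreal_plus[symmetric] add.assoc del: ennreal_plus)
 also have "... = (NN y. (NN x. ennreal \<bar>w x\<bar> * ennreal (mm (x - y)))) + ((NN y. (NN x. ennreal \<bar>q y\<bar> * ennreal (mm (x - y))))
      + (NN y. (NN x. ennreal (outer_abs w x) * ennreal (\<rho> (x - y)))))"
  by (subst nn_integral_add, measurable)+
 also have "... = ennreal (LB x. \<bar>w x\<bar>) * ennreal (LB v. mm v) + (ennreal (LB x. \<bar>q x\<bar>) * ennreal (LB v. mm v)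
   + (NN x. ennreal (outer_abs w x)) * 1)"
  by (subst young_x, measurable, subst young_y, measurable, subst young_x, measurable) (simp add: nm nw mass)
 also have "... <= ennreal (LB x. \<bar>w x\<bar>) * ennreal (LB v. mm v) + (ennreal (LB x. \<bar>q x\<bar>) * ennreal (LB v. mm v)
   + ennreal (2 * L * mass_out * (LB x. \<bar>w x\<bar>)) * 1)"
  by (intro add_left_mono mult_right_mono outer_abs_L1 w) auto
 also have "... = ennreal (domC (LB x. \<bar>w x\<bar>) (LB x. \<bar>q x\<bar>))"
  unfolding domC_def using imm iw mo L0
  by (simp add: ennreal_mult[symmetric] ennreal_plus[symmetric] distrib_right add.assoc del: ennreal_plus)
 finally show ?thesis .
qed

lemma domC_mono: "0 <= Nw ==> Nw <= Nw' ==> Nq <= Nq' ==> domC Nw Nq <= domC Nw' Nq'"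
proof -
 assume a: "0 <= Nw" "Nw <= Nw'" "Nq <= Nq'"
 have imm: "0 <= (LB v. mm v)" using mm_nonneg by (intro integral_nonneg_AE) auto
 have mo: "0 <= mass_out" by (simp add: mass_out_def)
 show ?thesis unfolding domC_def using a imm mo L0
  by (intro add_mono mult_right_mono mult_left_mono) auto
qed

lemma ent_pair_measurable:
 assumes [measurable]: "w \<in> Borel" "q \<in> Borel"
 shows "(%(y, x). ent w (q y) y x) \<in> borel_measurable lborel2"
  "(%(y, x). dom w (q y) y x) \<in> borel_measurable lborel2"
 unfolding ent_def dom_def entropy_flux_def sgn_real_def split_beta' by measurable

lemma dom_pair_integrable:
 assumes w: "L1 w" and q: "L1 q"
 shows "integrable lborel2 (%(y, x). dom w (q y) y x)"
proof (rule integrableI_nonneg)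
 have [measurable]: "w \<in> Borel" "q \<in> Borel" using w q by auto
 show m: "(%(y, x). dom w (q y) y x) \<in> borel_measurable lborel2" by (rule ent_pair_measurable) auto
 have "(\<integral>\<^sup>+z. ennreal (case z of (y, x) => dom w (q y) y x) \<partial>lborel2) = (NN y. (NN x. ennreal (dom w (q y) y x)))"
  using m by (subst lborel.nn_integral_fst[symmetric]) auto
 also have "... < \<infinity>" using dom_pair_L1[OF w q] by (auto intro: order_le_less_trans[OF _ ennreal_less_top])
 finally show "(\<integral>\<^sup>+z. ennreal (case z of (y, x) => dom w (q y) y x) \<partial>lborel2) < \<infinity>" .
qed (auto simp: dom_nonneg)

lemma ent_pair_integrable:
 assumes w: "L1 w" and q: "L1 q"
 shows "integrable lborel2 (%(y, x). ent w (q y) y x)"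
  "integrable lborel2 (%(y, x). \<bar>w x - q y\<bar> * \<rho> (x - y))"
proof -
 have [measurable]: "w \<in> Borel" "q \<in> Borel" using w q by auto
 show "integrable lborel2 (%(y, x). ent w (q y) y x)"
  by (rule integrable_bound[OF dom_pair_integrable[OF w q]])
    (use ent_le_dom(1) dom_nonneg ent_pair_measurable in auto)
 show "integrable lborel2 (%(y, x). \<bar>w x - q y\<bar> * \<rho> (x - y))"
  by (rule integrable_bound[OF dom_pair_integrable[OF w q]])
    (use ent_le_dom(2) dom_nonneg nonneg in \<open>auto simp: abs_mult\<close>)
qed

end

section \<open>The entropy inequality for product test functions\<close>

lemma dual_integral:
 fixes h :: "'a::euclidean_space => 'b::{banach, second_countable_topology}"
 assumes \<mu>: "levy_measure \<mu>" and [measurable]: "h \<in> Borel" and S: "S \<in> sets borel"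
 shows "(LINT z:S|dual_measure \<mu>. h z) = (LINT z|\<mu>. indicator S (- z) *\<^sub>R h (- z))"
proof -
 note s = levy_sets[OF \<mu>]
 have "uminus \<in> measurable (restrict_space borel (- {0::'a})) (restrict_space borel (- {0}))"
  by (rule measurable_restrict_space3) auto
 then have um: "uminus \<in> measurable \<mu> \<mu>" by (simp only: measurable_cong_sets[OF s s])
 have "(%z. indicator S z *\<^sub>R h z) \<in> borel_measurable \<mu>"
  by (rule punctured_measurable[OF s]) (use S in measurable)
 then show ?thesis
  unfolding set_lebesgue_integral_def dual_measure_def by (rule integral_distr[OF um])
qed

context entropy_data
begin

text \<open>Two signs cancel: the minus in \<open>levy_drift\<close> and the reflection in
  \<open>dual_measure\<close>.\<close>

lemma levy_drift_dual: "levy_drift (dual_measure \<mu>) \<kappa> = drift"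
proof -
 have "(LINT z:{z. \<kappa> < norm z}|dual_measure \<mu>. indicator {z. norm z <= 1} z *\<^sub>R z)
   = (LINT z|\<mu>. - (indicator {z. \<kappa> < norm z} z *\<^sub>R (indicator {z. norm z <= 1} z *\<^sub>R z)))"
  by (subst dual_integral[OF levy]) (auto intro!: integral_cong simp: indicator_def)
 also have "... = - (LINT z:{z. \<kappa> < norm z}|\<mu>. indicator {z. norm z <= 1} z *\<^sub>R z)"
  by (simp add: set_lebesgue_integral_def)
 also have "(LINT z:{z. \<kappa> < norm z}|\<mu>. indicator {z. norm z <= 1} z *\<^sub>R z) = drift"
  unfolding drift_def by (rule integral_outm[OF levy_sets[OF levy]]) measurable
 finally show ?thesis by (simp add: levy_drift_def)
qed

lemma grad_test: "grad (%x'. \<rho> (x' - y) * c) x = c *\<^sub>R D (x - y)"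
proof -
 have "((%x'. x' - y) has_derivative (%h. h)) (at x)" by (auto intro!: derivative_eq_intros)
 from has_derivative_compose[OF this, of \<rho> "%h. h \<bullet> D (x - y)"]
 have "((%x'. \<rho> (x' - y)) has_derivative (%h. h \<bullet> D (x - y))) (at x)"
  using has_derivative_rho[of "x - y"] by simp
 then have "((%x'. \<rho> (x' - y) * c) has_derivative (%h. (h \<bullet> D (x - y)) * c)) (at x)"
  by (rule has_derivative_mult_left)
 from frechet_derivative_at[OF this, symmetric]
 have fd: "frechet_derivative (%x'. \<rho> (x' - y) * c) (at x) = (%h. (h \<bullet> D (x - y)) * c)" .
 have "(\<Sum>b\<in>Basis. ((b \<bullet> D (x - y)) * c) *\<^sub>R b) = c *\<^sub>R (\<Sum>b\<in>Basis. (D (x - y) \<bullet> b) *\<^sub>R b)"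
  by (simp add: scaleR_right.sum inner_commute mult.commute)
 then show ?thesis by (simp add: grad_def fd euclidean_representation)
qed

lemma levy_op_in_test: "levy_op_in (dual_measure \<mu>) \<kappa> (%x'. \<rho> (x' - y) * c) x = c * Lin (x - y)"
proof -
 have dr: "x - z - y = x - y - z" for z by simp
 have "levy_op_in (dual_measure \<mu>) \<kappa> (%x'. \<rho> (x' - y) * c) x
   = (LINT z:{z. 0 < norm z \<and> norm z <= \<kappa>}|dual_measure \<mu>.
     c * (\<rho> (x + z - y) - \<rho> (x - y) - (z \<bullet> D (x - y)) * indicator {z. norm z <= 1} z))"
  unfolding levy_op_in_def grad_test by (simp add: algebra_simps)
 also have "... = (LINT z|\<mu>. indicator {z. 0 < norm z \<and> norm z <= \<kappa>} (- z) *\<^sub>R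
   (c * (\<rho> (x + - z - y) - \<rho> (x - y) - (- z \<bullet> D (x - y)) * indicator {z. norm z <= 1} (- z))))"
  by (rule dual_integral[OF levy]) measurable
 also have "... = (LINT z|\<mu>. c * (indicator {z. 0 < norm z \<and> norm z <= \<kappa>} z * (\<rho> (x - y - z) - \<rho> (x - y) + z \<bullet> D (x - y))))"
  by (intro integral_cong refl)
    (use \<kappa>1 in \<open>auto simp: indicator_def dr\<close>)
 also have "... = c * Lin (x - y)"
  by (simp add: Lin_def set_lebesgue_integral_def)
 finally show ?thesis .
qed

lemma levy_op_out_slice:
 assumes [measurable]: "w \<in> Borel"
 shows "levy_op_out \<mu> \<kappa> (%y. A (w y)) x = outer w x"
 unfolding levy_op_out_def outer_def by (rule integral_outm[OF levy_sets[OF levy]]) measurable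

end

locale curve_data = entropy_data +
 fixes T N :: real and u0 :: "'a => real" and U :: "'a \<times> real => real"
 assumes T0: "0 < T" and U_meas: "U \<in> borel_measurable (borel \<Otimes>\<^sub>M borel)"
  and U_int: "t \<in> {0..T} ==> L1 (%x. U (x, t))"
  and U_bd: "t \<in> {0..T} ==> (LB x. \<bar>U (x, t)\<bar>) <= N"
  and u0_int: "L1 u0"
begin

declare U_meas [measurable]

abbreviation sl :: "real => 'a => real" where "sl t \<equiv> %x. U (x, t)"

lemma outer_sl_measurable [measurable]:
 "(%(x, t). outer (sl t) x) \<in> borel_measurable lborel2"
 "(%(x, t). outer_abs (sl t) x) \<in> borel_measurable lborel2"
 unfolding outer_def outer_abs_def split_beta' by measurable

definition test_integrand :: "(real => real) => (real => real) => real => 'a => 'a => real => real" where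
 "test_integrand \<alpha> \<alpha>' k y x t = \<alpha>' t * (\<bar>U (x, t) - k\<bar> * \<rho> (x - y)) + \<alpha> t * ent (sl t) k y x"

lemma test_integrand_le:
 assumes "!!t. \<bar>\<alpha> t\<bar> <= C" "!!t. \<bar>\<alpha>' t\<bar> <= C"
 shows "\<bar>test_integrand \<alpha> \<alpha>' k y x t\<bar> <= 2 * C * dom (sl t) k y x"
proof -
 have C0: "0 <= C" using order_trans[OF abs_ge_zero assms(1)] .
 have "\<bar>\<alpha>' t * (\<bar>U (x, t) - k\<bar> * \<rho> (x - y))\<bar> <= C * dom (sl t) k y x"
  unfolding abs_mult using assms(2)[of t] ent_le_dom(2)[of "sl t" x k y] nonneg C0 by (intro mult_mono) (auto simp: abs_mult)
 moreover have "\<bar>\<alpha> t * ent (sl t) k y x\<bar> <= C * dom (sl t) k y x"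
  unfolding abs_mult using assms(1)[of t] ent_le_dom(1)[of "sl t" k y x] C0 by (intro mult_mono) auto
 ultimately show ?thesis unfolding test_integrand_def by linarith
qed

lemma dom_time_integrable:
 "integrable lborel2 (%(x, t). ind T t * dom (sl t) k y x)"
proof (rule integrableI_nonneg)
 let ?C = "Kmm * N + \<bar>k\<bar> * (LB v. mm v) + K * (2 * L * mass_out * N)"
 show m: "(%(x, t). ind T t * dom (sl t) k y x) \<in> borel_measurable lborel2"
  unfolding dom_def split_beta' by measurable
 have "(\<integral>\<^sup>+z. ennreal (case z of (x, t) => ind T t * dom (sl t) k y x) \<partial>lborel2)
   = (NN t. (NN x. ennreal (ind T t * dom (sl t) k y x)))"
  using m by (subst lborel_pair.nn_integral_snd[symmetric]) auto
 also have "... <= (NN t. ennreal ?C * ind T t)"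
 proof (intro nn_integral_mono)
  fix t :: real
  show "(NN x. ennreal (ind T t * dom (sl t) k y x)) <= ennreal ?C * ind T t"
  proof (cases "t \<in> {0<..<T}")
   case True
   then have t: "t \<in> {0..T}" by auto
   have mo: "0 <= mass_out" by (simp add: mass_out_def)
   have "(NN x. ennreal (dom (sl t) k y x)) <= ennreal ?C"
    by (rule order_trans[OF dom_x_L1[OF U_int[OF t]]], intro ennreal_leI add_mono mult_left_mono U_bd[OF t])
      (use Kmm0 K0 L0 mo in auto)
   then show ?thesis using True by simp
  qed simp
 qed
 also have "... < \<infinity>" using T0 by (simp add: nn_integral_cmult ennreal_mult_less_top)
 finally show "(\<integral>\<^sup>+z. ennreal (case z of (x, t) => ind T t * dom (sl t) k y x) \<partial>lborel2) < \<infinity>" .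
qed (auto simp: dom_nonneg)

text \<open>The doubled functional. It depends on the kernel alone, so values from different cutoffs
  are comparable through \<open>curve_data.HH \<rho>\<close>.\<close>

definition HH :: "('a => real) => ('a => real) => real" where
 "HH w q = (LB y. LB x. \<bar>w x - q y\<bar> * \<rho> (x - y))"

text \<open>The rate that bounds the growth of t -> HH (U(t)) q: the spatial entropy terms with k =
  q y, integrated over y.\<close>

definition PP :: "('a => real) => ('a => real) => real" where
 "PP w q = (LB y. LB x. ent w (q y) y x)"

end

locale entropy_curve = curve_data +
 fixes u :: "'a \<times> real => real"
 assumes sol: "entropy_solution T f A \<mu> u0 u" and U_eq: "t \<in> {0..T} ==> U (x, t) = u (x, t)"
begin

text \<open>The entropy inequality for r = \<kappa> and the test function \<rho> (x - y) \<alpha>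
  (t). Its two space-time integrals can be merged only if both integrands are integrable, so
  \<open>h2\<close> gets a majorant of its own and \<open>h1\<close> is recovered as a
  difference.\<close>

lemma slice_inequality:
 assumes \<alpha>: "\<alpha> \<in> smooth_supp l" "!!t. 0 <= \<alpha> t" and d: "!!t. (\<alpha> has_real_derivative \<alpha>' t) (at t)"
  and C: "!!t. \<bar>\<alpha> t\<bar> <= C" "!!t. \<bar>\<alpha>' t\<bar> <= C" and [measurable]: "\<alpha>' \<in> Borel"
 shows "0 <= (LB t. ind T t * (LB x. test_integrand \<alpha> \<alpha>' k y x t))
   - \<alpha> T * (LB x. \<bar>U (x, T) - k\<bar> * \<rho> (x - y)) + \<alpha> 0 * (LB x. \<bar>u0 x - k\<bar> * \<rho> (x - y))"
proof -
 have [measurable]: "\<alpha> \<in> Borel" using \<alpha>(1) by (auto simp: smooth_supp_def intro: smooth1_measurable)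
 let ?\<phi> = "%p. \<rho> (fst p - y) * \<alpha> (snd p)"
 have Cc: "Cc_infty ?\<phi>" by (rule test[OF \<alpha>(1)])
 have nn: "\<forall>p. 0 <= ?\<phi> p" using nonneg \<alpha>(2) by simp
 let ?g1 = "%x t. \<bar>u (x, t) - k\<bar> * deriv (%s. ?\<phi> (x, s)) t
      + (entropy_flux f (u (x, t)) k + \<bar>A (u (x, t)) - A k\<bar> *\<^sub>R levy_drift (dual_measure \<mu>) \<kappa>)
       \<bullet> grad (%y. ?\<phi> (y, t)) x"
 let ?g2 = "%x t. \<bar>A (u (x, t)) - A k\<bar> * levy_op_in (dual_measure \<mu>) \<kappa> (%y. ?\<phi> (y, t)) x
      + sgn (u (x, t) - k) * levy_op_out \<mu> \<kappa> (%y. A (u (y, t))) x * ?\<phi> (x, t)"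
 from sol have "\<forall>k r \<phi>. r > 0 \<and> Cc_infty \<phi> \<and> (\<forall>p. \<phi> p \<ge> 0) \<longrightarrow>
    (LINT (x, t):Q T|lborel.
      \<bar>u (x, t) - k\<bar> * deriv (%s. \<phi> (x, s)) t
      + (entropy_flux f (u (x, t)) k
         + \<bar>A (u (x, t)) - A k\<bar> *\<^sub>R levy_drift (dual_measure \<mu>) r)
       \<bullet> grad (%y. \<phi> (y, t)) x)
    + (LINT (x, t):Q T|lborel.
      \<bar>A (u (x, t)) - A k\<bar> * levy_op_in (dual_measure \<mu>) r (%y. \<phi> (y, t)) x
      + sgn (u (x, t) - k) * levy_op_out \<mu> r (%y. A (u (y, t))) x * \<phi> (x, t))
    - (LB x. \<bar>u (x, T) - k\<bar> * \<phi> (x, T))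
    + (LB x. \<bar>u0 x - k\<bar> * \<phi> (x, 0)) \<ge> 0"
  unfolding entropy_solution_def by (elim conjE)
 from this[rule_format, of \<kappa> ?\<phi> k, OF conjI[OF \<kappa>0 conjI[OF Cc nn]]]
 have main: "(LINT (x, t):Q T|lborel. ?g1 x t) + (LINT (x, t):Q T|lborel. ?g2 x t)
   - (LB x. \<bar>u (x, T) - k\<bar> * ?\<phi> (x, T)) + (LB x. \<bar>u0 x - k\<bar> * ?\<phi> (x, 0)) \<ge> 0" .
 define h1 where "h1 x t = \<alpha>' t * (\<bar>U (x, t) - k\<bar> * \<rho> (x - y))
   + \<alpha> t * ((entropy_flux f (U (x, t)) k + \<bar>A (U (x, t)) - A k\<bar> *\<^sub>R drift) \<bullet> D (x - y))" for x t
 define h2 where "h2 x t = \<alpha> t * (\<bar>A (U (x, t)) - A k\<bar> * Lin (x - y) + sgn (U (x, t) - k) * outer (sl t) x * \<rho> (x - y))" for x t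
 have h12: "h1 x t + h2 x t = test_integrand \<alpha> \<alpha>' k y x t" for x t
  by (simp add: h1_def h2_def test_integrand_def ent_def algebra_simps)
 have g1: "?g1 x t = h1 x t" and g2: "?g2 x t = h2 x t" if t: "t \<in> {0<..<T}" for x t
 proof -
  have ut: "u (x', t) = U (x', t)" for x' using t by (intro U_eq[symmetric]) auto
  have "((%s. \<rho> (x - y) * \<alpha> s) has_real_derivative \<rho> (x - y) * \<alpha>' t) (at t)"
   by (intro DERIV_cmult d)
  then have de: "deriv (%s. \<rho> (x - y) * \<alpha> s) t = \<rho> (x - y) * \<alpha>' t" by (rule DERIV_imp_deriv)
  show "?g1 x t = h1 x t"
   unfolding h1_def ut levy_drift_dual grad_test fst_conv snd_conv de inner_scaleR_right by (simp only: mult_ac)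
  have "levy_op_out \<mu> \<kappa> (%y. A (u (y, t))) x = outer (sl t) x"
   unfolding ut by (rule levy_op_out_slice) measurable
  then show "?g2 x t = h2 x t"
   unfolding h2_def fst_conv snd_conv levy_op_in_test ut by (simp add: algebra_simps)
 qed
 have conv: "(LINT (x, t):Q T|lborel. g x t) = (\<integral>p. (case p of (x, t) => ind T t * h x t) \<partial>lborel2)"
  if "!!x t. t \<in> {0<..<T} ==> g x t = h x t" for g h :: "'a => real => real"
  unfolding set_lebesgue_integral_def lborel_prod
  by (intro integral_cong refl) (use that in \<open>auto simp: Q_def indicator_def\<close>)
 have C0: "0 <= C" using order_trans[OF abs_ge_zero C(1)] .
 have meas: "(%(x, t). ind T t * h1 x t) \<in> borel_measurable lborel2"
  "(%(x, t). ind T t * h2 x t) \<in> borel_measurable lborel2"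
  "(%(x, t). ind T t * test_integrand \<alpha> \<alpha>' k y x t) \<in> borel_measurable lborel2"
  unfolding h1_def h2_def test_integrand_def ent_def entropy_flux_def sgn_real_def split_beta' by measurable
 have i12: "integrable lborel2 (%(x, t). ind T t * test_integrand \<alpha> \<alpha>' k y x t)"
 proof (rule integrable_bound[OF integrable_mult_right[OF dom_time_integrable[of k y], of "2 * C"] meas(3)])
  show "AE z in lborel2. norm (case z of (x, t) => ind T t * test_integrand \<alpha> \<alpha>' k y x t)
    <= norm (2 * C * (case z of (x, t) => ind T t * dom (sl t) k y x))"
   using test_integrand_le[OF C] dom_nonneg C0 by (intro AE_I2) (auto simp: indicator_def)
 qed
 have i2: "integrable lborel2 (%(x, t). ind T t * h2 x t)"
 proof (rule integrable_bound[OF integrable_mult_right[OF dom_time_integrable[of k y], of C] meas(2)])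
  have "\<bar>h2 x t\<bar> <= C * dom (sl t) k y x" for x t
  proof -
   have 1: "\<bar>\<bar>A (U (x, t)) - A k\<bar> * Lin (x - y)\<bar> <= (\<bar>U (x, t)\<bar> + \<bar>k\<bar>) * mm (x - y)"
   proof -
    have "\<bar>\<bar>A (U (x, t)) - A k\<bar> * Lin (x - y)\<bar> <= (L * \<bar>U (x, t) - k\<bar>) * \<bar>Lin (x - y)\<bar>"
     unfolding abs_mult using A_lip[of "U (x, t)" k] by (intro mult_right_mono) auto
    also have "... = \<bar>U (x, t) - k\<bar> * (L * \<bar>Lin (x - y)\<bar>)" by simp
    also have "... <= (\<bar>U (x, t)\<bar> + \<bar>k\<bar>) * mm (x - y)"
     unfolding mm_def using nonneg F0 L0 by (intro mult_mono) auto
    finally show ?thesis .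
   qed
   have 2: "\<bar>sgn (U (x, t) - k) * outer (sl t) x * \<rho> (x - y)\<bar> <= outer_abs (sl t) x * \<rho> (x - y)"
    unfolding abs_mult using outer_le[of "sl t" x] nonneg[of "x - y"] outer_abs_nonneg[of "sl t" x]
    by (intro mult_mono) (auto simp: sgn_real_def)
   have "\<bar>h2 x t\<bar> <= C * \<bar>\<bar>A (U (x, t)) - A k\<bar> * Lin (x - y) + sgn (U (x, t) - k) * outer (sl t) x * \<rho> (x - y)\<bar>"
    unfolding h2_def abs_mult[of "\<alpha> t"] by (intro mult_right_mono C) auto
   also have "... <= C * dom (sl t) k y x"
    unfolding dom_def using 1 2 by (intro mult_left_mono C0) linarith
   finally show ?thesis .
  qed
  then show "AE z in lborel2. norm (case z of (x, t) => ind T t * h2 x t)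
    <= norm (C * (case z of (x, t) => ind T t * dom (sl t) k y x))"
   using dom_nonneg C0 by (intro AE_I2) (auto simp: indicator_def)
 qed
 \<comment> \<open>\<open>test_integrand\<close> and \<open>h2\<close> are both dominated by
   multiples of \<open>dom\<close>, so their difference \<open>h1\<close> needs no separate
   estimate.\<close>
 have i1: "integrable lborel2 (%(x, t). ind T t * h1 x t)"
 proof -
  have "(%(x, t). ind T t * h1 x t)
   = (%z. (case z of (x, t) => ind T t * test_integrand \<alpha> \<alpha>' k y x t) - (case z of (x, t) => ind T t * h2 x t))"
   by (auto simp: h12[symmetric] algebra_simps)
  then show ?thesis using integrable_diff[OF i12 i2] by simp
 qed
 have "(LINT (x, t):Q T|lborel. ?g1 x t) + (LINT (x, t):Q T|lborel. ?g2 x t)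
   = (\<integral>p. (case p of (x, t) => ind T t * h1 x t) \<partial>lborel2)
   + (\<integral>p. (case p of (x, t) => ind T t * h2 x t) \<partial>lborel2)"
  by (intro arg_cong2[where f="(+)"] conv g1 g2)
 also have "... = (\<integral>p. (case p of (x, t) => ind T t * test_integrand \<alpha> \<alpha>' k y x t) \<partial>lborel2)"
  by (subst integral_add[OF i1 i2, symmetric])
    (intro integral_cong refl, auto simp: h12[symmetric] algebra_simps)
 also have "... = (LB t. LB x. ind T t * test_integrand \<alpha> \<alpha>' k y x t)"
  by (rule lborel_pair.integral_snd[OF i12, symmetric])
 finally have e1: "(LINT (x, t):Q T|lborel. ?g1 x t) + (LINT (x, t):Q T|lborel. ?g2 x t)
   = (LB t. ind T t * (LB x. test_integrand \<alpha> \<alpha>' k y x t))" by simp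
 have e2: "(LB x. \<bar>u (x, T) - k\<bar> * ?\<phi> (x, T)) = \<alpha> T * (LB x. \<bar>U (x, T) - k\<bar> * \<rho> (x - y))"
 proof -
  have "(%x. \<bar>u (x, T) - k\<bar> * ?\<phi> (x, T)) = (%x. \<alpha> T * (\<bar>U (x, T) - k\<bar> * \<rho> (x - y)))"
   using U_eq[of T] T0 by (auto simp: fun_eq_iff)
  then show ?thesis by simp
 qed
 have e3: "(LB x. \<bar>u0 x - k\<bar> * ?\<phi> (x, 0)) = \<alpha> 0 * (LB x. \<bar>u0 x - k\<bar> * \<rho> (x - y))"
 proof -
  have "(%x. \<bar>u0 x - k\<bar> * ?\<phi> (x, 0)) = (%x. \<alpha> 0 * (\<bar>u0 x - k\<bar> * \<rho> (x - y)))"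
   by (auto simp: fun_eq_iff)
  then show ?thesis by simp
 qed
 show ?thesis using main unfolding e1 e2 e3 by simp
qed

lemma sl_continuous_solution:
 assumes s: "s \<in> {0..T}" and e: "0 < e"
 shows "\<exists>d>0. \<forall>t\<in>{0..T}. \<bar>t - s\<bar> < d \<longrightarrow> (LB x. \<bar>U (x, t) - U (x, s)\<bar>) < e"
proof -
 have "((%t. LB x. \<bar>u (x, t) - u (x, s)\<bar>) \<longlongrightarrow> 0) (at s within {0..T})"
  using sol s by (simp add: entropy_solution_def C_L1_def)
 from tendstoD[OF this e] obtain d where d: "0 < d"
  "!!t. t \<in> {0..T} ==> t \<noteq> s ==> dist t s < d ==> dist (LB x. \<bar>u (x, t) - u (x, s)\<bar>) 0 < e"
  unfolding eventually_at by blast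
 show ?thesis
 proof (intro exI[of _ d] conjI d(1) ballI impI)
  fix t assume t: "t \<in> {0..T}" "\<bar>t - s\<bar> < d"
  show "(LB x. \<bar>U (x, t) - U (x, s)\<bar>) < e"
  proof (cases "t = s")
   case False
   have "(LB x. \<bar>u (x, t) - u (x, s)\<bar>) < e" using d(2)[OF t(1) False] t(2) by (auto simp: dist_real_def)
   then show ?thesis using t(1) s by (simp add: U_eq)
  qed (simp add: e)
 qed
qed

end

text \<open>Retains the inequality for the product test functions and the continuity in L1, which is
  all that doubling consumes. Both properties pass to translates (\<open>translate\<close>), so a
  translate need not be shown to be an entropy solution.\<close>

locale slice_curve = curve_data +
 assumes slice: "\<alpha> \<in> smooth_supp l ==> (!!t. 0 <= \<alpha> t) ==> (!!t. (\<alpha> has_real_derivative \<alpha>' t) (at t)) ==>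
   (!!t. \<bar>\<alpha> t\<bar> <= C) ==> (!!t. \<bar>\<alpha>' t\<bar> <= C) ==> \<alpha>' \<in> Borel ==>
   0 <= (LB t. ind T t * (LB x. test_integrand \<alpha> \<alpha>' k y x t))
    - \<alpha> T * (LB x. \<bar>U (x, T) - k\<bar> * \<rho> (x - y)) + \<alpha> 0 * (LB x. \<bar>u0 x - k\<bar> * \<rho> (x - y))"
  and sl_cont: "s \<in> {0..T} ==> 0 < e ==> \<exists>d>0. \<forall>t\<in>{0..T}. \<bar>t - s\<bar> < d \<longrightarrow> (LB x. \<bar>U (x, t) - U (x, s)\<bar>) < e"

sublocale entropy_curve \<subseteq> slice_curve
 by unfold_locales (rule slice_inequality, assumption+, rule sl_continuous_solution)

context slice_curve
begin

text \<open>The constant k is set to q y and the inequality integrated over y. The bound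
  \<open>domC\<close> depends on t only through the uniform L1 bound \<open>N\<close>, which permits
  exchanging the integrals over y and t.\<close>

lemma double_inequality:
 assumes q: "L1 q"
  and \<alpha>: "\<alpha> \<in> smooth_supp l" "!!t. 0 <= \<alpha> t" and d: "!!t. (\<alpha> has_real_derivative \<alpha>' t) (at t)"
  and C: "!!t. \<bar>\<alpha> t\<bar> <= C" "!!t. \<bar>\<alpha>' t\<bar> <= C" and [measurable]: "\<alpha>' \<in> Borel"
 shows "0 <= (LB t. ind T t * (\<alpha>' t * HH (sl t) q + \<alpha> t * PP (sl t) q))
   - \<alpha> T * HH (sl T) q + \<alpha> 0 * HH u0 q"
proof -
 have [measurable]: "\<alpha> \<in> Borel" using \<alpha>(1) by (auto simp: smooth_supp_def intro: smooth1_measurable)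
 have [measurable]: "q \<in> Borel" using q by auto
 have C0: "0 <= C" using order_trans[OF abs_ge_zero C(1)] .
 let ?\<Psi> = "%y t. ind T t * (LB x. test_integrand \<alpha> \<alpha>' (q y) y x t)"
 let ?Nq = "LB x. \<bar>q x\<bar>"
 have m\<Psi>: "(%(y, t). ?\<Psi> y t) \<in> borel_measurable lborel2"
  unfolding test_integrand_def ent_def outer_def entropy_flux_def sgn_real_def split_beta' by measurable
 have b\<Psi>: "ennreal \<bar>?\<Psi> y t\<bar> <= ennreal (2 * C) * (NN x. ennreal (dom (sl t) (q y) y x)) * ind T t" for y t
 proof (cases "t \<in> {0<..<T}")
  case True
  have "ennreal \<bar>LB x. test_integrand \<alpha> \<alpha>' (q y) y x t\<bar> <= (NN x. ennreal \<bar>test_integrand \<alpha> \<alpha>' (q y) y x t\<bar>)"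
  proof (cases "L1 (%x. test_integrand \<alpha> \<alpha>' (q y) y x t)")
   case True
   from integral_norm_bound_ennreal[OF this] show ?thesis by simp
  qed (simp add: not_integrable_integral_eq)
  also have "... <= (NN x. ennreal (2 * C) * ennreal (dom (sl t) (q y) y x))"
   using test_integrand_le[OF C] C0 dom_nonneg by (intro nn_integral_mono) (simp add: ennreal_mult[symmetric] ennreal_leI)
  also have "... = ennreal (2 * C) * (NN x. ennreal (dom (sl t) (q y) y x))"
   unfolding dom_def by (rule nn_integral_cmult) measurable
  finally show ?thesis using True by simp
 qed simp
 have i\<Psi>: "integrable lborel2 (%(y, t). ?\<Psi> y t)"
 proof (rule integrableI_bounded[OF m\<Psi>])
  have "(\<integral>\<^sup>+z. ennreal (norm (case z of (y, t) => ?\<Psi> y t)) \<partial>lborel2) = (NN t. (NN y. ennreal \<bar>?\<Psi> y t\<bar>))"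
   using m\<Psi> by (subst lborel_pair.nn_integral_snd[symmetric]) (auto simp: split_beta')
  also have "... <= (NN t. ennreal (2 * C) * ennreal (domC N ?Nq) * ind T t)"
  proof (intro nn_integral_mono)
   fix t :: real
   show "(NN y. ennreal \<bar>?\<Psi> y t\<bar>) <= ennreal (2 * C) * ennreal (domC N ?Nq) * ind T t"
   proof (cases "t \<in> {0<..<T}")
    case True
    then have t: "t \<in> {0..T}" by auto
    have "(NN y. ennreal \<bar>?\<Psi> y t\<bar>) <= (NN y. ennreal (2 * C) * (NN x. ennreal (dom (sl t) (q y) y x)))"
     using b\<Psi>[of t] True by (intro nn_integral_mono) simp
    also have "... = ennreal (2 * C) * (NN y. (NN x. ennreal (dom (sl t) (q y) y x)))"
     unfolding dom_def by (rule nn_integral_cmult) measurable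
    also have "... <= ennreal (2 * C) * ennreal (domC N ?Nq)"
     by (intro mult_left_mono order_trans[OF dom_pair_L1[OF U_int[OF t] q]] ennreal_leI domC_mono U_bd[OF t] order_refl)
       (auto intro: integral_nonneg_AE)
    finally show ?thesis using True by simp
   qed simp
  qed
  also have "... < \<infinity>" using T0 by (simp add: nn_integral_cmult ennreal_mult_less_top)
  finally show "(\<integral>\<^sup>+z. ennreal (norm (case z of (y, t) => ?\<Psi> y t)) \<partial>lborel2) < \<infinity>" .
 qed
 have TT: "T \<in> {0..T}" using T0 by auto
 let ?J1 = "%y. LB t. ?\<Psi> y t"
 let ?J2 = "%y. LB x. \<bar>U (x, T) - q y\<bar> * \<rho> (x - y)"
 let ?J3 = "%y. LB x. \<bar>u0 x - q y\<bar> * \<rho> (x - y)"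
 have i1: "L1 ?J1" by (rule lborel_pair.integrable_fst[OF i\<Psi>])
 have i2: "L1 ?J2" by (rule lborel_pair.integrable_fst[OF ent_pair_integrable(2)[OF U_int[OF TT] q]])
 have i3: "L1 ?J3" by (rule lborel_pair.integrable_fst[OF ent_pair_integrable(2)[OF u0_int q]])
 have "0 <= (LB y. ?J1 y - \<alpha> T * ?J2 y + \<alpha> 0 * ?J3 y)"
  by (rule integral_nonneg_AE, rule AE_I2, rule slice[OF \<alpha> d C]) measurable
 also have "... = (LB y. ?J1 y) - \<alpha> T * HH (sl T) q + \<alpha> 0 * HH u0 q"
  unfolding HH_def using i1 i2 i3 by simp
 also have "(LB y. ?J1 y) = (LB t. LB y. ?\<Psi> y t)"
  by (rule lborel_pair.Fubini_integral[OF i\<Psi>, symmetric])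
 also have "... = (LB t. ind T t * (\<alpha>' t * HH (sl t) q + \<alpha> t * PP (sl t) q))"
 proof (intro integral_cong refl)
  fix t :: real
  show "(LB y. ?\<Psi> y t) = ind T t * (\<alpha>' t * HH (sl t) q + \<alpha> t * PP (sl t) q)"
  proof (cases "t \<in> {0<..<T}")
   case True
   then have t: "t \<in> {0..T}" by auto
   note ia = ent_pair_integrable(2)[OF U_int[OF t] q] and ib = ent_pair_integrable(1)[OF U_int[OF t] q]
   have "(LB y. LB x. test_integrand \<alpha> \<alpha>' (q y) y x t)
    = (\<integral>z. \<alpha>' t * (case z of (y, x) => \<bar>sl t x - q y\<bar> * \<rho> (x - y)) + \<alpha> t * (case z of (y, x) => ent (sl t) (q y) y x) \<partial>lborel2)"
   proof -
    have "integrable lborel2 (%(y, x). test_integrand \<alpha> \<alpha>' (q y) y x t)"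
     using integrable_add[OF integrable_mult_right[OF ia, of "\<alpha>' t"] integrable_mult_right[OF ib, of "\<alpha> t"]]
     by (simp add: test_integrand_def split_beta')
    from lborel_pair.integral_fst[OF this] show ?thesis by (simp add: test_integrand_def split_beta')
   qed
   also have "... = \<alpha>' t * (\<integral>z. (case z of (y, x) => \<bar>sl t x - q y\<bar> * \<rho> (x - y)) \<partial>lborel2)
     + \<alpha> t * (\<integral>z. (case z of (y, x) => ent (sl t) (q y) y x) \<partial>lborel2)"
    by (subst integral_add[OF integrable_mult_right[OF ia, of "\<alpha>' t"] integrable_mult_right[OF ib, of "\<alpha> t"]]) simp
   also have "... = \<alpha>' t * HH (sl t) q + \<alpha> t * PP (sl t) q"
    unfolding HH_def PP_def lborel_pair.integral_fst[OF ia] lborel_pair.integral_fst[OF ib] ..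
   finally show ?thesis using True by simp
  qed simp
 qed
 finally show ?thesis .
qed

end

subsection \<open>Doubling in time\<close>

lemma continuous_Icc_bounded:
 fixes H :: "real => real"
 assumes "continuous_on {a..b} H" obtains M where "!!t. t \<in> {a..b} ==> \<bar>H t\<bar> <= M"
proof -
 have "bounded (H ` {a..b})" by (intro compact_imp_bounded compact_continuous_image assms compact_Icc)
 then obtain M where "\<forall>x\<in>H ` {a..b}. norm x <= M" unfolding bounded_iff by blast
 then show thesis by (intro that[of M]) simp
qed

lemma continuous_Icc_indicator_measurable:
 fixes H :: "real => real"
 assumes "continuous_on {0..T} H" shows "(%t. ind T t * H t) \<in> Borel"
proof -
 have "continuous_on {0<..<T} H" by (rule continuous_on_subset[OF assms]) auto
 from borel_measurable_continuous_on_indicator[OF _ this] show ?thesis by simp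
qed

text \<open>The step rises on [b, b + h], to the right of b, so its derivative approximates a
  one-sided Dirac mass. Hence b = 0 is admissible, while b = T is not.\<close>

lemma step_integral_tendsto:
 fixes H s :: "real => real"
 assumes H: "continuous_on {0..T} H" and b: "0 <= b" "b < T"
  and s: "continuous_on UNIV s" "!!x. 1 <= \<bar>x\<bar> ==> s x = 0" "!!x. (S has_real_derivative s x) (at x)"
  "!!x. x <= -1 ==> S x = 0" "!!x. 1 <= x ==> S x = 1"
  and h: "h \<longlonglongrightarrow> 0" "!!n. 0 < h n"
 shows "(%n. LB t. ind T t * ((2 / h n) * s (2 / h n * t + (- 1 - 2 * b / h n)) * H t)) \<longlonglongrightarrow> H b"
proof -
 have T0: "0 < T" using b by simp
 obtain M where M: "!!t. t \<in> {0..T} ==> \<bar>H t\<bar> <= M"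
  by (rule continuous_Icc_bounded[OF H]) blast
 obtain Ms where Ms: "!!t. t \<in> {-1..1} ==> \<bar>s t\<bar> <= Ms"
  by (rule continuous_Icc_bounded[OF continuous_on_subset[OF s(1) subset_UNIV]]) blast
 have sb: "\<bar>s x\<bar> <= Ms * indicator {-1..1} x" for x
  using Ms[of x] s(2)[of x] by (cases "x \<in> {-1..1}") (auto simp: indicator_def abs_real_def split: if_splits)
 have Ms0: "0 <= Ms" using order_trans[OF abs_ge_zero Ms[of 0]] by simp
 have M0: "0 <= M" using order_trans[OF abs_ge_zero M[of 0]] T0 by simp
 have [measurable]: "s \<in> Borel" using s(1) by (rule borel_measurable_continuous_onI)
 let ?H = "%t. ind T t * H t"
 have [measurable]: "?H \<in> Borel"
  by (rule continuous_Icc_indicator_measurable[OF H])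
 have eq: "(LB t. ind T t * ((2 / h n) * s (2 / h n * t + (- 1 - 2 * b / h n)) * H t))
   = (LB x. s x * ?H (b + h n / 2 * (x + 1)))" for n
 proof -
  have hn: "h n \<noteq> 0" "0 < h n" using h(2)[of n] by auto
  have a1: "2 / h n * (b + h n / 2 + h n / 2 * x) + (- 1 - 2 * b / h n) = x" for x
   using hn by (simp add: field_simps)
  have a2: "b + h n / 2 + h n / 2 * x = b + h n / 2 * (x + 1)" for x by (simp add: algebra_simps)
  have "(LB t. ind T t * ((2 / h n) * s (2 / h n * t + (- 1 - 2 * b / h n)) * H t))
   = \<bar>h n / 2\<bar> *\<^sub>R (LB x. indicator {0<..<T} (b + h n / 2 + h n / 2 * x) * ((2 / h n) * s (2 / h n * (b + h n / 2 + h n / 2 * x) + (- 1 - 2 * b / h n)) * H (b + h n / 2 + h n / 2 * x)))"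
   by (rule lborel_integral_real_affine) (use hn in simp)
  also have "... = (LB x. \<bar>h n / 2\<bar> * (indicator {0<..<T} (b + h n / 2 + h n / 2 * x) * ((2 / h n) * s (2 / h n * (b + h n / 2 + h n / 2 * x) + (- 1 - 2 * b / h n)) * H (b + h n / 2 + h n / 2 * x))))"
   by (simp only: integral_mult_right_zero real_scaleR_def)
  also have "... = (LB x. s x * ?H (b + h n / 2 * (x + 1)))"
   unfolding a1 unfolding a2 by (rule integral_cong[OF refl]) (use hn in \<open>simp add: field_simps\<close>)
  finally show ?thesis .
 qed
 have lim: "(%n. LB x. s x * ?H (b + h n / 2 * (x + 1))) \<longlonglongrightarrow> (LB x. s x * H b)"
 proof (rule integral_dominated_convergence[where w="%x. M * (Ms * indicator {-1..1} x)"])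
  show "AE x in lborel. (%n. s x * ?H (b + h n / 2 * (x + 1))) \<longlonglongrightarrow> s x * H b"
  proof (rule AE_I2)
   fix x :: real
   show "(%n. s x * ?H (b + h n / 2 * (x + 1))) \<longlonglongrightarrow> s x * H b"
   proof (cases "1 <= \<bar>x\<bar>")
    case False
    let ?c = "%n. b + h n / 2 * (x + 1)"
    have c: "?c \<longlonglongrightarrow> b" using tendsto_add[OF tendsto_const tendsto_mult_right[OF tendsto_divide[OF h(1) tendsto_const, of 2], of "x + 1"], of b] by simp
    have cb: "b < ?c n" for n using h(2)[of n] False by simp
    have ev: "\<forall>\<^sub>F n in sequentially. ?c n \<in> {0<..<T}"
     using order_tendstoD(2)[OF c b(2)] unfolding greaterThanLessThan_iff
     by eventually_elim (rule conjI[OF le_less_trans[OF b(1) cb]])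
    have "(H \<longlongrightarrow> H b) (at b within {0..T})" using H b by (auto simp: continuous_on_def)
    then have "(%n. H (?c n)) \<longlonglongrightarrow> H b"
    proof (rule filterlim_compose)
     show "filterlim ?c (at b within {0..T}) sequentially"
      unfolding filterlim_at
     proof (intro conjI c)
      show "\<forall>\<^sub>F n in sequentially. ?c n \<in> {0..T} \<and> ?c n \<noteq> b"
       using ev
      proof eventually_elim
       case (elim n)
       then show ?case using cb[of n] by (metis greaterThanLessThan_iff atLeastAtMost_iff less_imp_le less_irrefl)
      qed
     qed
    qed
    then have "(%n. ?H (?c n)) \<longlonglongrightarrow> H b"
     by (rule Lim_transform_eventually) (use ev in eventually_elim, simp)
    then show ?thesis by (rule tendsto_mult_left)
   qed (simp add: s(2))
  qed
  show "AE x in lborel. norm (s x * ?H (b + h n / 2 * (x + 1))) <= M * (Ms * indicator {-1..1} x)" for n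
  proof (rule AE_I2)
   fix x
   have "\<bar>?H (b + h n / 2 * (x + 1))\<bar> <= M" using M M0 by (auto simp: indicator_def)
   then have "\<bar>s x\<bar> * \<bar>?H (b + h n / 2 * (x + 1))\<bar> <= (Ms * indicator {-1..1} x) * M" using sb[of x] by (intro mult_mono) auto
   then show "norm (s x * ?H (b + h n / 2 * (x + 1))) <= M * (Ms * indicator {-1..1} x)" by (simp add: abs_mult mult_ac)
  qed
  show "L1 (%x::real. M * (Ms * indicator {-1..1} x))"
   by (intro integrable_mult_right integrable_real_indicator) auto
 qed auto
 have "(LB x. s x) = (LB x. indicator {-1..1} x *\<^sub>R s x)"
 proof (rule integral_cong[OF refl])
  fix x show "s x = indicator {-1..1} x *\<^sub>R s x" using s(2)[of x] by (cases "x \<in> {-1..1}") auto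
 qed
 also have "... = S 1 - S (-1)"
  by (rule integral_FTC_atLeastAtMost)
    (use s in \<open>auto simp: has_real_derivative_iff_has_vector_derivative[symmetric] intro: DERIV_subset has_field_derivative_at_within continuous_on_subset\<close>)
 also have "... = 1" using s(4)[of "-1"] s(5)[of 1] by simp
 finally have "(LB x. s x * H b) = H b" by simp
 with lim show ?thesis unfolding eq by (simp only:)
qed

text \<open>For two times the test function is a smoothed indicator of [a, b], whose two steps are
  sharpened simultaneously. For the initial value the left step is placed at -2 with width 1: it
  equals 1 on [0, T], so \<alpha> (0) = 1 brings in \<open>h0\<close>, and its derivative vanishes
  there; only the step at 0 is sharpened.\<close>

lemma time_inequality:
 fixes H P :: "real => real"
 assumes H: "continuous_on {0..T} H" and T0: "0 < T" and [measurable]: "P \<in> Borel"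
  and M: "!!t. t \<in> {0..T} ==> \<bar>P t\<bar> <= M"
  and ineq: "!!\<alpha> \<alpha>' C l. \<alpha> \<in> smooth_supp l ==> (!!t. 0 <= \<alpha> t) ==> (!!t. (\<alpha> has_real_derivative \<alpha>' t) (at t)) ==>
    (!!t. \<bar>\<alpha> t\<bar> <= C) ==> (!!t. \<bar>\<alpha>' t\<bar> <= C) ==> \<alpha>' \<in> Borel ==>
    0 <= (LB t. ind T t * (\<alpha>' t * H t + \<alpha> t * P t)) - \<alpha> T * H T + \<alpha> 0 * h0"
 shows "0 <= a ==> a < b ==> b < T ==> H b - H a <= (LB t. indicator {a..b} t * P t)"
  and "H 0 <= h0"
proof -
 obtain S s where S: "smooth1 S" "smooth1 s"
  "!!x. (S has_real_derivative s x) (at x)" "!!x. 0 <= s x" "!!x. 1 <= \<bar>x\<bar> ==> s x = 0"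
  "!!x. x <= -1 ==> S x = 0" "!!x. 1 <= x ==> S x = 1" "mono S"
  "!!x. 0 <= S x" "!!x. S x <= 1" by (rule smooth_step_exists) blast
 have sc: "continuous_on UNIV s" by (rule smooth1_continuous[OF S(2)])
 have [measurable]: "s \<in> Borel" "S \<in> Borel" using S(1,2) by measurable
 have [measurable]: "(%t. ind T t * H t) \<in> Borel"
  by (rule continuous_Icc_indicator_measurable[OF H])
 obtain MH where MH: "!!t. t \<in> {0..T} ==> \<bar>H t\<bar> <= MH"
  by (rule continuous_Icc_bounded[OF H]) blast
 have M0: "0 <= M" using order_trans[OF abs_ge_zero M[of 0]] T0 by simp
 define st where "st h c t = S (2 / h * t + (- 1 - 2 * c / h))" for h c t :: real
 define ds where "ds h c t = (2 / h) * s (2 / h * t + (- 1 - 2 * c / h))" for h c t :: real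
 have st_deriv: "(st h c has_real_derivative ds h c t) (at t)" for h c t
  unfolding st_def ds_def by (rule DERIV_chain2[OF S(3) DERIV_add[OF DERIV_cmult_Id DERIV_const], THEN DERIV_cong]) simp
 have st_smooth: "smooth1 (st h c)" for h c unfolding st_def by (rule smooth1_affine[OF S(1)])
 have st0: "st h c t = 0" if "0 < h" "t <= c" for h c t
  unfolding st_def by (rule S(6)) (use that in \<open>simp add: field_simps\<close>)
 have st1: "st h c t = 1" if "0 < h" "c + h <= t" for h c t
  unfolding st_def by (rule S(7)) (use that in \<open>simp add: field_simps\<close>)
 have st_range: "0 <= st h c t" "st h c t <= 1" for h c t using S(9,10) by (auto simp: st_def)
 have st_meas [measurable]: "st h c \<in> Borel" "ds h c \<in> Borel" for h c
  unfolding st_def[abs_def] ds_def[abs_def] by measurable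
 have ds_bd: "\<exists>C. \<forall>t. \<bar>ds h c t\<bar> <= C" for h c
 proof -
  obtain Ms where Ms: "!!t. t \<in> {-1..1} ==> \<bar>s t\<bar> <= Ms"
   by (rule continuous_Icc_bounded[OF continuous_on_subset[OF sc subset_UNIV]]) blast
  have "0 <= Ms" using order_trans[OF abs_ge_zero Ms[of 0]] by simp
  then have "\<bar>s t\<bar> <= Ms" for t using Ms[of t] S(5)[of t] by (cases "1 <= \<bar>t\<bar>") (auto simp: abs_real_def split: if_splits)
  then show ?thesis unfolding ds_def abs_mult by (intro exI[of _ "\<bar>2 / h\<bar> * Ms"] allI mult_left_mono) auto
 qed
 \<comment> \<open>one step on at \<open>a\<close> with width \<open>k\<close>, one step off at \<open>b\<close> with width \<open>h\<close>\<close>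
 have step: "0 <= (LB t. ind T t * ((ds k a t - ds h b t) * H t + (st k a t - st h b t) * P t)) + st k a 0 * h0"
  if kh: "0 < k" "0 < h" "a + k <= b" "0 <= b" "b + h <= T" for k h a b
 proof -
  let ?\<alpha> = "%t. st k a t - st h b t" and ?\<alpha>' = "%t. ds k a t - ds h b t"
  obtain C1 C2 where C12: "!!t. \<bar>ds k a t\<bar> <= C1" "!!t. \<bar>ds h b t\<bar> <= C2" using ds_bd by metis
  have "C1 \<ge> 0" "C2 \<ge> 0" using order_trans[OF abs_ge_zero C12(1)] order_trans[OF abs_ge_zero C12(2)] by auto
  then have C: "\<bar>?\<alpha> t\<bar> <= 1 + C1 + C2" "\<bar>?\<alpha>' t\<bar> <= 1 + C1 + C2" for t
   using C12[of t] st_range[of k a t] st_range[of h b t] by linarith+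
  have nn: "0 <= ?\<alpha> t" for t using st0[OF kh(2), of t b] st1[OF kh(1), of a t] st_range[of k a t] st_range[of h b t] kh by (cases "t <= b") auto
  have supp: "?\<alpha> \<in> smooth_supp (\<bar>a\<bar> + T)"
  proof -
   have "smooth1 ?\<alpha>" using smooth1_lincomb[OF st_smooth st_smooth, of 1 k a "-1" h b] by simp
   moreover have "?\<alpha> x = 0" if "\<bar>a\<bar> + T < \<bar>x\<bar>" for x
   proof (cases "x < 0")
    case True
    then have "x <= a" "x <= b" using that kh T0 by auto
    then show ?thesis using st0 kh by simp
   next
    case False
    then have "b + h <= x" "a + k <= x" using that kh T0 by auto
    then show ?thesis using st1 kh by simp
   qed
   ultimately show ?thesis by (simp add: smooth_supp_def)
  qed
  have "0 <= (LB t. ind T t * (?\<alpha>' t * H t + ?\<alpha> t * P t)) - ?\<alpha> T * H T + ?\<alpha> 0 * h0"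
   by (rule ineq[OF supp nn _ C]) (auto intro!: derivative_eq_intros st_deriv)
  moreover have "?\<alpha> T = 0" using st1[OF kh(1), of a T] st1[OF kh(2), of b T] kh by simp
  moreover have "st h b 0 = 0" using st0[OF kh(2), of 0 b] kh by simp
  ultimately show ?thesis by simp
 qed
 have iT: "L1 (indicator {0<..<T} :: real => real)"
  by (rule integrable_real_indicator) (use T0 in \<open>auto simp: less_top\<close>)
 have bdd: "L1 (%t. ind T t * \<phi> t)"
  if "(%t. ind T t * \<phi> t) \<in> Borel" "!!t. t \<in> {0<..<T} ==> \<bar>\<phi> t\<bar> <= B" for \<phi> :: "real => real" and B
 proof (rule integrable_bound)
  show "L1 (%t. B * ind T t)"
   by (intro integrable_mult_right iT)
  show "AE t in lborel. norm (ind T t * \<phi> t) <= norm (B * ind T t)"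
  proof (rule AE_I2)
   fix t show "norm (ind T t * \<phi> t) <= norm (B * ind T t)"
    using that(2)[of t] by (cases "t \<in> {0<..<T}") auto
  qed
 qed (use that in simp)
 have ids: "L1 (%t. ind T t * (ds h c t * H t))" for h c
 proof -
  obtain C where C: "!!t. \<bar>ds h c t\<bar> <= C" using ds_bd by metis
  have C0: "0 <= C" using order_trans[OF abs_ge_zero C] .
  have "(%t. ds h c t * (ind T t * H t)) \<in> Borel" by measurable
  then have "(%t. ind T t * (ds h c t * H t)) \<in> Borel" by (simp add: mult_ac)
  then show ?thesis
   by (rule bdd[where B="C * MH"]) (use C MH C0 in \<open>auto simp: abs_mult intro!: mult_mono\<close>)
 qed
 have ist: "L1 (%t. ind T t * ((st k a t - st h b t) * P t))" for k a h b
 proof (rule bdd[where B="M"])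
  fix t assume "t \<in> {0<..<T}"
  then have "\<bar>P t\<bar> <= M" using M[of t] by simp
  moreover have "\<bar>st k a t - st h b t\<bar> <= 1" using st_range[of k a t] st_range[of h b t] by linarith
  ultimately show "\<bar>(st k a t - st h b t) * P t\<bar> <= M" unfolding abs_mult using mult_mono[of "\<bar>st k a t - st h b t\<bar>" 1 "\<bar>P t\<bar>" M] by simp
 qed measurable
 have split: "(LB t. ind T t * ((ds k a t - ds h b t) * H t + (st k a t - st h b t) * P t))
   = (LB t. ind T t * (ds k a t * H t)) - (LB t. ind T t * (ds h b t * H t))
    + (LB t. ind T t * ((st k a t - st h b t) * P t))" for k h a b
 proof -
  have "(LB t. ind T t * ((ds k a t - ds h b t) * H t + (st k a t - st h b t) * P t))
   = (LB t. ind T t * (ds k a t * H t) - ind T t * (ds h b t * H t) + ind T t * ((st k a t - st h b t) * P t))"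
   by (simp add: algebra_simps)
  also have "... = (LB t. ind T t * (ds k a t * H t)) - (LB t. ind T t * (ds h b t * H t))
    + (LB t. ind T t * ((st k a t - st h b t) * P t))"
   by (subst integral_add, intro integrable_diff ids, rule ist, subst integral_diff, rule ids, rule ids, rule refl)
  finally show ?thesis .
 qed
 let ?h = "%n::nat. inverse (real (Suc n))"
 have h: "?h \<longlonglongrightarrow> 0" "!!n. 0 < ?h n" using LIMSEQ_inverse_real_of_nat by auto
 have lim_ds: "(%n. LB t. ind T t * (ds (?h n) b t * H t)) \<longlonglongrightarrow> H b" if "0 <= b" "b < T" for b
  unfolding ds_def using step_integral_tendsto[OF H that sc S(5) S(3) S(6) S(7) h] by (simp add: mult.assoc del: of_nat_Suc)
 have lim_st: "(%n. st (?h n) b t) \<longlonglongrightarrow> indicator {b<..} t" for b t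
 proof (cases "t <= b")
  case True then show ?thesis using st0 h(2) by (simp del: of_nat_Suc)
 next
  case False
  then have "\<forall>\<^sub>F n in sequentially. ?h n < t - b" by (intro order_tendstoD(2)[OF h(1)]) simp
  then have "\<forall>\<^sub>F n in sequentially. st (?h n) b t = 1" by eventually_elim (rule st1[OF h(2)], simp)
  then show ?thesis using False by (simp add: tendsto_eventually)
 qed
 show "H b - H a <= (LB t. indicator {a..b} t * P t)" if ab: "0 <= a" "a < b" "b < T" for a b
 proof -
  have "(%n. LB t. ind T t * ((st (?h n) a t - st (?h n) b t) * P t))
    \<longlonglongrightarrow> (LB t. ind T t * ((indicator {a<..} t - indicator {b<..} t) * P t))"
  proof (rule integral_dominated_convergence[where w="%t. M * ind T t"])
   show "AE t in lborel. (%n. ind T t * ((st (?h n) a t - st (?h n) b t) * P t))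
     \<longlonglongrightarrow> ind T t * ((indicator {a<..} t - indicator {b<..} t) * P t)"
    by (intro AE_I2 tendsto_intros lim_st)
   show "AE t in lborel. norm (ind T t * ((st (?h n) a t - st (?h n) b t) * P t)) <= M * ind T t" for n
   proof (rule AE_I2)
    fix t
    have "\<bar>(st (?h n) a t - st (?h n) b t) * P t\<bar> <= 1 * M" if "t \<in> {0..T}"
     unfolding abs_mult using st_range[of "?h n" a t] st_range[of "?h n" b t] M[OF that] by (intro mult_mono) (auto simp del: of_nat_Suc)
    then show "norm (ind T t * ((st (?h n) a t - st (?h n) b t) * P t)) <= M * ind T t"
     by (auto simp: indicator_def simp del: of_nat_Suc)
   qed
  qed (auto simp: iT simp del: of_nat_Suc)
  note l = tendsto_add[OF tendsto_diff[OF lim_ds[of a] lim_ds[of b]] this]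
  have ev: "\<forall>\<^sub>F n in sequentially. ?h n < min (b - a) (T - b)" by (rule order_tendstoD(2)[OF h(1)]) (use ab in simp)
  have "0 <= H a - H b + (LB t. ind T t * ((indicator {a<..} t - indicator {b<..} t) * P t))"
  proof (rule tendsto_lowerbound[OF l])
   show "\<forall>\<^sub>F n in sequentially. 0 <= (LB t. ind T t * (ds (?h n) a t * H t)) - (LB t. ind T t * (ds (?h n) b t * H t))
     + (LB t. ind T t * ((st (?h n) a t - st (?h n) b t) * P t))"
    using ev
   proof eventually_elim
    case (elim n)
    have "st (?h n) a 0 = 0" using st0[OF h(2)] ab by simp
    then show ?case using step[OF h(2) h(2), of a n b n] elim ab unfolding split by simp
   qed
  qed (use ab in auto)
  also have "(LB t. ind T t * ((indicator {a<..} t - indicator {b<..} t) * P t)) = (LB t. indicator {a..b} t * P t)"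
   by (rule integral_cong_AE, measurable) (rule eventually_mono[OF AE_lborel_singleton[of a]], use ab in \<open>auto simp: indicator_def\<close>)
  finally show ?thesis by simp
 qed
 show "H 0 <= h0"
 proof -
  have "(%n. LB t. ind T t * ((st 1 (-2) t - st (?h n) 0 t) * P t))
    \<longlonglongrightarrow> (LB t. ind T t * ((1 - indicator {0<..} t) * P t))"
  proof (rule integral_dominated_convergence[where w="%t. M * ind T t"])
   show "AE t in lborel. (%n. ind T t * ((st 1 (-2) t - st (?h n) 0 t) * P t))
     \<longlonglongrightarrow> ind T t * ((1 - indicator {0<..} t) * P t)"
   proof (rule AE_I2)
    fix t :: real
    show "(%n. ind T t * ((st 1 (-2) t - st (?h n) 0 t) * P t)) \<longlonglongrightarrow> ind T t * ((1 - indicator {0<..} t) * P t)"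
    proof (cases "t \<in> {0<..<T}")
     case True
     then have "st 1 (-2) t = 1" by (intro st1) auto
     then show ?thesis by (auto intro!: tendsto_intros lim_st simp del: of_nat_Suc)
    qed simp
   qed
   show "AE t in lborel. norm (ind T t * ((st 1 (-2) t - st (?h n) 0 t) * P t)) <= M * ind T t" for n
   proof (rule AE_I2)
    fix t
    have "\<bar>(st 1 (-2) t - st (?h n) 0 t) * P t\<bar> <= 1 * M" if "t \<in> {0..T}"
     unfolding abs_mult using st_range[of 1 "-2" t] st_range[of "?h n" 0 t] M[OF that] by (intro mult_mono) (auto simp del: of_nat_Suc)
    then show "norm (ind T t * ((st 1 (-2) t - st (?h n) 0 t) * P t)) <= M * ind T t"
     by (auto simp: indicator_def simp del: of_nat_Suc)
   qed
  qed (auto simp: iT simp del: of_nat_Suc)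
  also have "(LB t. ind T t * ((1 - indicator {0<..} t) * P t)) = (LB t::real. 0)"
   by (rule integral_cong) (auto simp: indicator_def)
  finally have l0: "(%n. LB t. ind T t * ((st 1 (-2) t - st (?h n) 0 t) * P t)) \<longlonglongrightarrow> 0" by simp
  have z: "(LB t. ind T t * (ds 1 (-2) t * H t)) = (LB t::real. 0)"
  proof (rule integral_cong[OF refl])
   fix t :: real
   have "ds 1 (-2) t = 0" if "t \<in> {0<..<T}" unfolding ds_def using S(5)[of "2 / 1 * t + (- 1 - 2 * (-2) / 1)"] that by simp
   then show "ind T t * (ds 1 (-2) t * H t) = 0" by (auto simp: indicator_def)
  qed
  note l = tendsto_add[OF tendsto_minus[OF lim_ds[of 0]] l0]
  have ev: "\<forall>\<^sub>F n in sequentially. ?h n < T" by (rule order_tendstoD(2)[OF h(1) T0])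
  have "- h0 <= - H 0 + 0"
  proof (rule tendsto_lowerbound[OF l])
   show "\<forall>\<^sub>F n in sequentially. - h0 <= - (LB t. ind T t * (ds (?h n) 0 t * H t))
     + (LB t. ind T t * ((st 1 (-2) t - st (?h n) 0 t) * P t))"
    using ev
   proof eventually_elim
    case (elim n)
    have "st 1 (-2) 0 = 1" by (rule st1) auto
    then show ?case using step[OF zero_less_one h(2), of "-2" 0 n] elim unfolding split z by simp
   qed
  qed (use T0 in auto)
  then show ?thesis by simp
 qed
qed


text \<open>After the shift, the integral is a difference of two values of one antiderivative; its
  base point a - 1 lies to the left of a so that the formula holds in a neighbourhood of a.\<close>

lemma sliding_integral_deriv:
 fixes \<phi> :: "real => real"
 assumes \<phi>: "continuous_on UNIV \<phi>" and \<delta>: "0 < \<delta>"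
 shows "((%a. integral {0..\<delta>} (%p. \<phi> (a + p))) has_real_derivative \<phi> (a + \<delta>) - \<phi> a) (at a)"
proof -
 let ?c = "a - 1" and ?J = "%x. integral {a - 1..x} \<phi>"
 have J: "(?J has_real_derivative \<phi> x) (at x)" if "?c < x" for x
 proof -
  have "(?J has_real_derivative \<phi> x) (at x within {?c..x + 1})"
   by (rule integral_has_real_derivative) (use that \<phi> in \<open>auto intro: continuous_on_subset\<close>)
  moreover have "x \<in> interior {?c..x + 1}" using that by simp
  ultimately show ?thesis by (simp only: at_within_interior)
 qed
 have eq: "integral {0..\<delta>} (%p. \<phi> (x + p)) = ?J (x + \<delta>) - ?J x" if "x \<in> {?c<..}" for x
 proof -
  have "integral {0..\<delta>} (%p. \<phi> (x + p)) = integral {x..x + \<delta>} \<phi>"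
   using integral_shift_Icc_real[of 0 \<delta> \<phi> x] by (simp add: o_def add.commute)
  moreover have "?J x + integral {x..x + \<delta>} \<phi> = ?J (x + \<delta>)"
   by (rule Henstock_Kurzweil_Integration.integral_combine)
     (use that \<delta> \<phi> in \<open>auto intro!: integrable_continuous_interval intro: continuous_on_subset\<close>)
  ultimately show ?thesis by simp
 qed
 have "((%x. ?J (x + \<delta>)) has_real_derivative \<phi> (a + \<delta>)) (at a)"
  by (rule DERIV_shift[THEN iffD1, OF J]) (use \<delta> in simp)
 then have "((%x. ?J (x + \<delta>) - ?J x) has_real_derivative \<phi> (a + \<delta>) - \<phi> a) (at a)"
  by (rule DERIV_diff) (rule J, simp)
 then show ?thesis
  by (rule has_field_derivative_transform_within_open[of _ _ _ "{?c<..}"]) (auto simp: eq)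
qed

\<comment> \<open>averaging over the moving square \<open>[\<tau>, \<tau> + \<delta>]\<^sup>2\<close> replaces the usual mollified time diagonal\<close>
lemma sliding_square_deriv:
 fixes H :: "real => real => real"
 assumes H: "continuous_on UNIV (%(t, s). H t s)" and \<delta>: "0 < \<delta>"
 shows "((%\<tau>. integral {0..\<delta>} (%p. integral {0..\<delta>} (%q. H (\<tau> + p) (\<tau> + q)))) has_real_derivative
   integral {0..\<delta>} (%q. H (\<tau> + \<delta>) (\<tau> + q) - H \<tau> (\<tau> + q)) + integral {0..\<delta>} (%p. H (\<tau> + p) (\<tau> + \<delta>) - H (\<tau> + p) \<tau>)) (at \<tau>)"
proof -
 have Hc: "continuous_on S (%x. H (f x) (g x))" if "continuous_on S f" "continuous_on S g" for S :: "'c::topological_space set" and f g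
  using continuous_on_compose2[OF H continuous_on_Pair[OF that]] by simp
 have comm: "(%h. h * c) = (*) c" for c :: real by (intro ext) (rule mult.commute)
 define \<Phi> where "\<Phi> a b = integral {0..\<delta>} (%p. integral {0..\<delta>} (%q. H (a + p) (b + q)))" for a b
 define Fx where "Fx = integral {0..\<delta>} (%q. H (\<tau> + \<delta>) (\<tau> + q) - H \<tau> (\<tau> + q))"
 define Fy where "Fy a b = integral {0..\<delta>} (%p. H (a + p) (b + \<delta>)) - integral {0..\<delta>} (%p. H (a + p) b)" for a b
 have int: "(%x. H (f x) (g x)) integrable_on {0..\<delta>}" if "continuous_on {0..\<delta>} f" "continuous_on {0..\<delta>} g" for f g
  by (intro integrable_continuous_interval Hc that)
 have fx: "((%a. \<Phi> a \<tau>) has_derivative (%h. h * Fx)) (at \<tau> within UNIV)"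
 proof -
  have "continuous_on UNIV (%t. integral (cbox 0 \<delta>) (%q. H t (\<tau> + q)))"
   by (rule integral_continuous_on_param) (auto simp: split_beta' intro!: Hc continuous_intros)
  from sliding_integral_deriv[OF this \<delta>, of \<tau>]
  have "((%a. \<Phi> a \<tau>) has_real_derivative Fx) (at \<tau>)"
   unfolding \<Phi>_def Fx_def by (subst Henstock_Kurzweil_Integration.integral_diff) (auto intro!: int continuous_intros)
  then show ?thesis by (simp add: has_field_derivative_def comm)
 qed
 have fy: "((%b. \<Phi> a b) has_derivative blinfun_apply (blinfun_scaleR_left (Fy a b))) (at b within UNIV)" for a b
 proof -
  have "continuous_on UNIV (%s. integral (cbox 0 \<delta>) (%p. H (a + p) s))"
   by (rule integral_continuous_on_param) (auto simp: split_beta' intro!: Hc continuous_intros)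
  from sliding_integral_deriv[OF this \<delta>, of b]
  have "((%b. integral {0..\<delta>} (%q. integral {0..\<delta>} (%p. H (a + p) (b + q)))) has_real_derivative Fy a b) (at b)"
   unfolding Fy_def by simp
  moreover have "\<Phi> a b = integral {0..\<delta>} (%q. integral {0..\<delta>} (%p. H (a + p) (b + q)))" for b
   unfolding \<Phi>_def using integral_swap_continuous[of 0 0 \<delta> \<delta> "%p q. H (a + p) (b + q)"]
   by (simp add: split_beta' Hc continuous_intros)
  ultimately show ?thesis by (simp add: has_field_derivative_def comm)
 qed
 \<comment> \<open>The chain rule along the diagonal needs the total derivative of
   \<open>\<Phi>\<close>. For this, the derivative in the first variable at the point and a jointly
   continuous derivative in the second suffice.\<close>
 have cy: "continuous (at (\<tau>, \<tau>) within UNIV \<times> UNIV) (%(a, b). blinfun_scaleR_left (Fy a b))"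
 proof -
  have 1: "continuous_on UNIV (%z::real \<times> real. integral (cbox 0 \<delta>) (%p. H (fst z + p) (snd z + c)))" for c
   by (rule integral_continuous_on_param) (auto simp: split_beta' intro!: Hc continuous_intros)
  have "continuous_on UNIV (%z. Fy (fst z) (snd z))"
   unfolding Fy_def using continuous_on_diff[OF 1[of \<delta>] 1[of 0]] by simp
  then have "continuous_on UNIV (%z. blinfun_scaleR_left (Fy (fst z) (snd z)) :: real \<Rightarrow>\<^sub>L real)"
   by (rule bounded_linear.continuous_on[OF bounded_linear_blinfun_scaleR_left])
  then show ?thesis by (simp add: continuous_on_eq_continuous_at split_beta')
 qed
 have "((%(a, b). \<Phi> a b) has_derivative (%(ta, tb). ta * Fx + blinfun_scaleR_left (Fy \<tau> \<tau>) tb)) (at (\<tau>, \<tau>) within UNIV \<times> UNIV)"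
  by (rule has_derivative_partialsI[OF fx fy cy]) auto
 then have d: "((%(a, b). \<Phi> a b) has_derivative (%(ta, tb). ta * Fx + tb * Fy \<tau> \<tau>)) (at (\<tau>, \<tau>))" by simp
 have "((%t. (t, t)) has_derivative (%h. (h, h))) (at \<tau>)" by (auto intro!: derivative_eq_intros)
 from has_derivative_compose[OF this d]
 have "((%t. \<Phi> t t) has_derivative (%h. h * Fx + h * Fy \<tau> \<tau>)) (at \<tau>)" by simp
 moreover have "(%h. h * Fx + h * Fy \<tau> \<tau>) = (%h. (Fx + Fy \<tau> \<tau>) * h)" by (auto simp: algebra_simps)
 moreover have "Fy \<tau> \<tau> = integral {0..\<delta>} (%p. H (\<tau> + p) (\<tau> + \<delta>) - H (\<tau> + p) \<tau>)"
  unfolding Fy_def by (subst Henstock_Kurzweil_Integration.integral_diff) (auto intro!: int continuous_intros)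
 ultimately show ?thesis by (simp add: has_field_derivative_def \<Phi>_def Fx_def)
qed

text \<open>The derivative of the average over the moving square is made of increments of
  \<open>H\<close> between opposite sides. By \<open>I1\<close> and \<open>I2\<close> each is at
  most a double integral, of \<open>P\<close> and of \<open>R\<close>, over the same square, so the
  two one-variable inequalities meet at equal pairs (t, s) and P + R <= C bounds the derivative by C
  \<delta>^2. Dividing by \<delta>^2 and letting \<delta> tend to 0 gives the diagonal
  values.\<close>

lemma time_doubling:
 fixes H P R :: "real => real => real"
 assumes H: "continuous_on ({0..T} \<times> {0..T}) (%(t, s). H t s)" and T0: "0 < T"
  and m [measurable]: "(%(t, s). P t s) \<in> borel_measurable (borel \<Otimes>\<^sub>M borel)" "(%(t, s). R t s) \<in> borel_measurable (borel \<Otimes>\<^sub>M borel)"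
  and M: "!!t s. t \<in> {0..T} ==> s \<in> {0..T} ==> \<bar>P t s\<bar> <= M" "!!t s. t \<in> {0..T} ==> s \<in> {0..T} ==> \<bar>R t s\<bar> <= M"
  and C: "!!t s. t \<in> {0..T} ==> s \<in> {0..T} ==> P t s + R t s <= C"
  and I1: "!!a b s. 0 <= a ==> a < b ==> b < T ==> s \<in> {0..T} ==> H b s - H a s <= (LB t. indicator {a..b} t * P t s)"
  and I2: "!!a b t. 0 <= a ==> a < b ==> b < T ==> t \<in> {0..T} ==> H t b - H t a <= (LB s. indicator {a..b} s * R t s)"
  and t: "t \<in> {0..T}"
 shows "H t t <= H 0 0 + C * t"
proof -
 \<comment> \<open>Clamping both times extends \<open>H\<close> continuously to the plane, as
   \<open>sliding_square_deriv\<close> requires; squares inside [0, T] do not notice the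
   extension.\<close>
 define cl where "cl t = max 0 (min T t)" for t
 define E where "E t s = H (cl t) (cl s)" for t s
 have cl: "cl t \<in> {0..T}" for t using T0 by (auto simp: cl_def)
 have cl_id: "cl t = t" if "t \<in> {0..T}" for t using that by (auto simp: cl_def)
 have clp: "continuous_on UNIV (%z. (cl (fst z), cl (snd z)))"
  unfolding cl_def by (intro continuous_intros)
 have "(%z. (cl (fst z), cl (snd z))) ` UNIV \<subseteq> {0..T} \<times> {0..T}" using cl by auto
 then have E: "continuous_on UNIV (%(t, s). E t s)"
  using continuous_on_compose2[OF H clp] by (simp add: E_def split_beta')
 have Ec: "continuous_on S (%x. E (f x) (g x))" if "continuous_on S f" "continuous_on S g" for S :: "'c::topological_space set" and f g
  using continuous_on_compose2[OF E continuous_on_Pair[OF that]] by simp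
 have E_id: "E t s = H t s" if "t \<in> {0..T}" "s \<in> {0..T}" for t s using that by (simp add: E_def cl_id)
 define G where "G \<delta> \<tau> = integral {0..\<delta>} (%p. integral {0..\<delta>} (%q. E (\<tau> + p) (\<tau> + q)))" for \<delta> \<tau>
 have conv: "integral {0..\<delta>} (%q. \<phi> (\<tau> + q)) = (LB s. indicator {\<tau>..\<tau> + \<delta>} s * \<phi> s)" if "continuous_on UNIV \<phi>" for \<phi> :: "real => real" and \<delta> \<tau>
 proof -
  have "integral {0..\<delta>} (%q. \<phi> (\<tau> + q)) = integral {\<tau>..\<tau> + \<delta>} \<phi>"
   using integral_shift_Icc_real[of 0 \<delta> \<phi> \<tau>] by (simp add: o_def add.commute)
  also have "... = (LINT s:{\<tau>..\<tau> + \<delta>}|lborel. \<phi> s)"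
   by (rule set_borel_integral_eq_integral(2)[symmetric], rule borel_integrable_atLeastAtMost') (rule continuous_on_subset[OF that], simp)
  finally show ?thesis by (simp add: set_lebesgue_integral_def)
 qed
 have G': "\<exists>y. (G \<delta> has_real_derivative y) (at \<tau>) \<and> y <= C * \<delta>\<^sup>2" if \<delta>: "0 < \<delta>" and \<tau>: "0 <= \<tau>" "\<tau> + \<delta> < T" for \<delta> \<tau>
 proof (intro exI conjI)
  show "(G \<delta> has_real_derivative integral {0..\<delta>} (%q. E (\<tau> + \<delta>) (\<tau> + q) - E \<tau> (\<tau> + q)) + integral {0..\<delta>} (%p. E (\<tau> + p) (\<tau> + \<delta>) - E (\<tau> + p) \<tau>)) (at \<tau>)"
   unfolding G_def[abs_def] by (rule sliding_square_deriv[OF E \<delta>])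
  let ?I = "indicator {\<tau>..\<tau> + \<delta>} :: real => real"
  have in_T: "s \<in> {0..T}" if "s \<in> {\<tau>..\<tau> + \<delta>}" for s using that \<tau> by auto
  have ibox: "integrable lborel2 (%(t, s). ?I t * ?I s * \<psi> t s)"
   if [measurable]: "(%(t, s). \<psi> t s) \<in> borel_measurable (borel \<Otimes>\<^sub>M borel)"
   and b: "!!t s. t \<in> {0..T} ==> s \<in> {0..T} ==> \<bar>\<psi> t s\<bar> <= M'" for \<psi> M'
  proof (rule integrable_bound[where f="%z. M' * indicator ({\<tau>..\<tau> + \<delta>} \<times> {\<tau>..\<tau> + \<delta>}) z"])
   show "integrable lborel2 (%z. M' * indicator ({\<tau>..\<tau> + \<delta>} \<times> {\<tau>..\<tau> + \<delta>}) z)"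
    by (intro integrable_mult_right integrable_real_indicator)
      (use \<delta> in \<open>auto simp: lborel.emeasure_pair_measure_Times ennreal_mult_less_top\<close>)
   show "(%(t, s). ?I t * ?I s * \<psi> t s) \<in> borel_measurable lborel2" unfolding split_beta' by measurable
   show "AE z in lborel2. norm (case z of (t, s) => ?I t * ?I s * \<psi> t s) <= norm (M' * indicator ({\<tau>..\<tau> + \<delta>} \<times> {\<tau>..\<tau> + \<delta>}) z)"
   proof (rule AE_I2)
    fix z
    show "norm (case z of (t, s) => ?I t * ?I s * \<psi> t s) <= norm (M' * indicator ({\<tau>..\<tau> + \<delta>} \<times> {\<tau>..\<tau> + \<delta>}) z)"
     using b[OF in_T in_T, of "fst z" "snd z"] by (cases z) (auto simp: indicator_def)
   qed
  qed
  have iP: "integrable lborel2 (%(t, s). ?I t * ?I s * P t s)" by (rule ibox[OF m(1) M(1)])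
  have iR: "integrable lborel2 (%(t, s). ?I t * ?I s * R t s)" by (rule ibox[OF m(2) M(2)])
  have iC: "integrable lborel2 (%(t, s). ?I t * ?I s * C)"
  proof (rule ibox)
   show "\<bar>C\<bar> <= \<bar>C\<bar>" for t s :: real by simp
  qed simp
  have iE: "L1 (%s. ?I s * \<phi> s)" if "continuous_on UNIV \<phi>" for \<phi> :: "real => real"
   using borel_integrable_atLeastAtMost'[OF continuous_on_subset[OF that subset_UNIV]] by (simp add: set_integrable_def)
  have "integral {0..\<delta>} (%q. E (\<tau> + \<delta>) (\<tau> + q) - E \<tau> (\<tau> + q)) = (LB s. ?I s * (E (\<tau> + \<delta>) s - E \<tau> s))"
   by (rule conv) (intro continuous_intros Ec)
  also have "... <= (LB s. LB t. ?I t * ?I s * P t s)"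
  proof (rule integral_mono)
   show "L1 (%s. ?I s * (E (\<tau> + \<delta>) s - E \<tau> s))" by (rule iE) (intro continuous_intros Ec)
   show "L1 (%s. LB t. ?I t * ?I s * P t s)" by (rule lborel_pair.integrable_snd[OF iP])
   fix s
   show "?I s * (E (\<tau> + \<delta>) s - E \<tau> s) <= (LB t. ?I t * ?I s * P t s)"
   proof (cases "s \<in> {\<tau>..\<tau> + \<delta>}")
    case True
    have "E (\<tau> + \<delta>) s - E \<tau> s <= (LB t. ?I t * P t s)"
     using I1[of \<tau> "\<tau> + \<delta>" s] in_T[OF True] \<tau> \<delta> by (simp add: E_id)
    then show ?thesis using True by simp
   qed simp
  qed
  also have "... = (\<integral>z. (case z of (t, s) => ?I t * ?I s * P t s) \<partial>lborel2)" by (rule lborel_pair.integral_snd[OF iP])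
  finally have e1: "integral {0..\<delta>} (%q. E (\<tau> + \<delta>) (\<tau> + q) - E \<tau> (\<tau> + q)) <= (\<integral>z. (case z of (t, s) => ?I t * ?I s * P t s) \<partial>lborel2)" .
  have "integral {0..\<delta>} (%p. E (\<tau> + p) (\<tau> + \<delta>) - E (\<tau> + p) \<tau>) = (LB s. ?I s * (E s (\<tau> + \<delta>) - E s \<tau>))"
   by (rule conv) (intro continuous_intros Ec)
  also have "... <= (LB t. LB s. ?I t * ?I s * R t s)"
  proof (rule integral_mono)
   show "L1 (%s. ?I s * (E s (\<tau> + \<delta>) - E s \<tau>))" by (rule iE) (intro continuous_intros Ec)
   show "L1 (%t. LB s. ?I t * ?I s * R t s)" by (rule lborel_pair.integrable_fst[OF iR])
   fix t
   show "?I t * (E t (\<tau> + \<delta>) - E t \<tau>) <= (LB s. ?I t * ?I s * R t s)"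
   proof (cases "t \<in> {\<tau>..\<tau> + \<delta>}")
    case True
    have "E t (\<tau> + \<delta>) - E t \<tau> <= (LB s. ?I s * R t s)"
     using I2[of \<tau> "\<tau> + \<delta>" t] in_T[OF True] \<tau> \<delta> by (simp add: E_id)
    then show ?thesis using True by simp
   qed simp
  qed
  also have "... = (\<integral>z. (case z of (t, s) => ?I t * ?I s * R t s) \<partial>lborel2)" by (rule lborel_pair.integral_fst[OF iR])
  finally have e2: "integral {0..\<delta>} (%p. E (\<tau> + p) (\<tau> + \<delta>) - E (\<tau> + p) \<tau>) <= (\<integral>z. (case z of (t, s) => ?I t * ?I s * R t s) \<partial>lborel2)" .
  have "(\<integral>z. (case z of (t, s) => ?I t * ?I s * P t s) \<partial>lborel2) + (\<integral>z. (case z of (t, s) => ?I t * ?I s * R t s) \<partial>lborel2)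
   = (\<integral>z. (case z of (t, s) => ?I t * ?I s * P t s) + (case z of (t, s) => ?I t * ?I s * R t s) \<partial>lborel2)"
   by (rule integral_add[OF iP iR, symmetric])
  also have "... <= (\<integral>z. (case z of (t, s) => ?I t * ?I s * C) \<partial>lborel2)"
  proof (rule integral_mono[OF integrable_add[OF iP iR] iC])
   fix z
   show "(case z of (t, s) => ?I t * ?I s * P t s) + (case z of (t, s) => ?I t * ?I s * R t s) <= (case z of (t, s) => ?I t * ?I s * C)"
    using C[OF in_T in_T, of "fst z" "snd z"] by (cases z) (auto simp: indicator_def)
  qed
  also have "... = (LB t. LB s. ?I t * ?I s * C)"
   by (rule lborel_pair.integral_fst[OF iC, symmetric])
  also have "... = C * \<delta>\<^sup>2" using \<delta> by (simp add: power2_eq_square)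
  finally show "integral {0..\<delta>} (%q. E (\<tau> + \<delta>) (\<tau> + q) - E \<tau> (\<tau> + q)) + integral {0..\<delta>} (%p. E (\<tau> + p) (\<tau> + \<delta>) - E (\<tau> + p) \<tau>) <= C * \<delta>\<^sup>2"
   using e1 e2 by linarith
 qed
 have Glip: "G \<delta> \<tau> - G \<delta> 0 <= C * \<delta>\<^sup>2 * \<tau>" if "0 < \<delta>" "0 <= \<tau>" "\<tau> + \<delta> < T" for \<delta> \<tau>
 proof -
  have "G \<delta> \<tau> - C * \<delta>\<^sup>2 * \<tau> <= G \<delta> 0 - C * \<delta>\<^sup>2 * 0"
  proof (rule DERIV_nonpos_imp_nonincreasing[OF that(2)])
   fix x assume x: "0 <= x" "x <= \<tau>"
   have "x + \<delta> < T" using x that by linarith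
   note g = G'[OF that(1) x(1) this]
   then obtain y where y: "(G \<delta> has_real_derivative y) (at x)" "y <= C * \<delta>\<^sup>2" using g by blast
   have "((%x. G \<delta> x - C * \<delta>\<^sup>2 * x) has_real_derivative y - C * \<delta>\<^sup>2) (at x)"
    using DERIV_diff[OF y(1) DERIV_cmult_Id[of "C * \<delta>\<^sup>2"]] .
   then show "\<exists>y. ((%x. G \<delta> x - C * \<delta>\<^sup>2 * x) has_real_derivative y) (at x) \<and> y <= 0" using y(2) by auto
  qed
  then show ?thesis by simp
 qed
 have near: "\<exists>d>0. \<forall>\<delta>. 0 < \<delta> \<and> \<delta> < d \<longrightarrow> \<bar>G \<delta> \<tau> - \<delta>\<^sup>2 * E \<tau> \<tau>\<bar> <= \<delta>\<^sup>2 * e" if e: "0 < e" for e \<tau>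
 proof -
  from E have "\<exists>d>0. \<forall>z\<in>UNIV. dist z (\<tau>, \<tau>) < d \<longrightarrow> dist (case z of (t, s) => E t s) (case (\<tau>, \<tau>) of (t, s) => E t s) < e"
   using e unfolding continuous_on_iff by blast
  then obtain d where d: "0 < d" "!!z. dist z (\<tau>, \<tau>) < d ==> dist (case z of (t, s) => E t s) (E \<tau> \<tau>) < e" by auto
  show ?thesis
  proof (intro exI[of _ "d / 2"] conjI allI impI)
   fix \<delta> :: real assume \<delta>: "0 < \<delta> \<and> \<delta> < d / 2"
   have b: "E \<tau> \<tau> - e <= E (\<tau> + p) (\<tau> + q) \<and> E (\<tau> + p) (\<tau> + q) <= E \<tau> \<tau> + e" if "p \<in> {0..\<delta>}" "q \<in> {0..\<delta>}" for p q
   proof -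
    have "dist (\<tau> + p, \<tau> + q) (\<tau>, \<tau>) <= \<bar>p\<bar> + \<bar>q\<bar>"
     unfolding dist_Pair_Pair using sqrt_sum_squares_le_sum_abs[of p q] by (simp add: dist_real_def)
    then have "dist (E (\<tau> + p) (\<tau> + q)) (E \<tau> \<tau>) < e" using d(2)[of "(\<tau> + p, \<tau> + q)"] that \<delta> by auto
    then show ?thesis by (auto simp: dist_real_def abs_diff_less_iff)
   qed
   have i1: "(%q. E (\<tau> + p) (\<tau> + q)) integrable_on {0..\<delta>}" for p
    by (intro integrable_continuous_interval Ec continuous_intros)
   have i2: "(%p. integral {0..\<delta>} (%q. E (\<tau> + p) (\<tau> + q))) integrable_on {0..\<delta>}"
   proof -
    have "continuous_on UNIV (%p. integral (cbox 0 \<delta>) (%q. E (\<tau> + p) (\<tau> + q)))"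
     by (rule integral_continuous_on_param) (auto simp: split_beta' intro!: Ec continuous_intros)
    then show ?thesis by (intro integrable_continuous_interval) (auto intro: continuous_on_subset)
   qed
   have in1: "(E \<tau> \<tau> - e) * \<delta> <= integral {0..\<delta>} (%q. E (\<tau> + p) (\<tau> + q))"
    "integral {0..\<delta>} (%q. E (\<tau> + p) (\<tau> + q)) <= (E \<tau> \<tau> + e) * \<delta>" if "p \<in> {0..\<delta>}" for p
    using integral_le[OF integrable_const_ivl[of "E \<tau> \<tau> - e" 0 \<delta>] i1[of p]] integral_le[OF i1[of p] integrable_const_ivl[of "E \<tau> \<tau> + e" 0 \<delta>]] b[OF that] \<delta>
    by (auto simp: mult.commute)
   have "(E \<tau> \<tau> - e) * \<delta> * \<delta> <= G \<delta> \<tau>" "G \<delta> \<tau> <= (E \<tau> \<tau> + e) * \<delta> * \<delta>"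
    unfolding G_def
    using integral_le[OF integrable_const_ivl[of "(E \<tau> \<tau> - e) * \<delta>" 0 \<delta>] i2] integral_le[OF i2 integrable_const_ivl[of "(E \<tau> \<tau> + e) * \<delta>" 0 \<delta>]] in1 \<delta>
    by (auto simp: mult.commute)
   then show "\<bar>G \<delta> \<tau> - \<delta>\<^sup>2 * E \<tau> \<tau>\<bar> <= \<delta>\<^sup>2 * e"
    by (simp add: abs_le_iff algebra_simps power2_eq_square)
  qed (use d in simp)
 qed
 have inner: "H \<tau> \<tau> <= H 0 0 + C * \<tau>" if \<tau>: "0 <= \<tau>" "\<tau> < T" for \<tau>
 proof (rule field_le_epsilon)
  fix e :: real assume e: "0 < e"
  obtain d1 where d1: "0 < d1" "!!\<delta>. 0 < \<delta> ==> \<delta> < d1 ==> \<bar>G \<delta> \<tau> - \<delta>\<^sup>2 * E \<tau> \<tau>\<bar> <= \<delta>\<^sup>2 * (e / 2)" using near[of "e / 2" \<tau>] e by auto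
  obtain d2 where d2: "0 < d2" "!!\<delta>. 0 < \<delta> ==> \<delta> < d2 ==> \<bar>G \<delta> 0 - \<delta>\<^sup>2 * E 0 0\<bar> <= \<delta>\<^sup>2 * (e / 2)" using near[of "e / 2" 0] e by auto
  define \<delta> where "\<delta> = min (min d1 d2) (T - \<tau>) / 2"
  have \<delta>: "0 < \<delta>" "\<delta> < d1" "\<delta> < d2" "\<tau> + \<delta> < T" using d1(1) d2(1) \<tau> by (auto simp: \<delta>_def min_def field_simps)
  have "\<delta>\<^sup>2 * E \<tau> \<tau> <= \<delta>\<^sup>2 * (E 0 0 + C * \<tau> + e)"
   using abs_le_D2[OF d1(2)[OF \<delta>(1,2)]] abs_le_D1[OF d2(2)[OF \<delta>(1,3)]] Glip[OF \<delta>(1) \<tau>(1) \<delta>(4)] by (simp add: algebra_simps)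
  then have "E \<tau> \<tau> <= E 0 0 + C * \<tau> + e" using \<delta>(1) by simp
  then show "H \<tau> \<tau> <= H 0 0 + C * \<tau> + e" using \<tau> T0 by (simp add: E_id)
 qed
 show ?thesis
 proof (cases "t = T")
  \<comment> \<open>The squares need room to the right, so t = T is reached by continuity from the
    left.\<close>
  case True
  have "continuous_on {0..T} (%\<tau>. H \<tau> \<tau> - C * \<tau>)"
  proof -
   have "continuous_on {0..T} (%\<tau>. E \<tau> \<tau>)" by (intro Ec continuous_intros)
   then have "continuous_on {0..T} (%\<tau>. H \<tau> \<tau>)" by (rule continuous_on_cong[THEN iffD1, rotated -1]) (auto simp: E_id)
   then show ?thesis by (intro continuous_intros)
  qed
  then have "((%\<tau>. H \<tau> \<tau> - C * \<tau>) \<longlongrightarrow> H T T - C * T) (at T within {0..T})" using T0 by (simp add: continuous_on_def)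
  then have "((%\<tau>. H \<tau> \<tau> - C * \<tau>) \<longlongrightarrow> H T T - C * T) (at_left T)"
   using T0 by (simp add: at_within_Icc_at_left)
  moreover have "\<forall>\<^sub>F \<tau> in at_left T. H \<tau> \<tau> - C * \<tau> <= H 0 0"
   using eventually_at_left_real[OF T0] by eventually_elim (use inner in \<open>auto simp: diff_le_eq\<close>)
  ultimately have "H T T - C * T <= H 0 0" by (rule tendsto_upperbound) simp
  then show ?thesis using True by simp
 qed (use inner t in auto)
qed

section \<open>The doubled functional along two curves\<close>

context slice_curve
begin

lemma sl_continuous:
 assumes "s \<in> {0..T}" "0 < e"
 obtains d where "0 < d" "!!t. t \<in> {0..T} ==> \<bar>t - s\<bar> < d ==> (LB x. \<bar>U (x, t) - U (x, s)\<bar>) < e"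
 using sl_cont[OF assms] by blast

text \<open>Each difference depends on one variable only, and the kernel integrates to 1 in the
  other. This makes \<open>HH\<close> jointly continuous along L1-continuous curves.\<close>

lemma HH_diff_le:
 assumes i: "L1 w" "L1 q" "L1 w'" "L1 q'"
 shows "\<bar>HH w q - HH w' q'\<bar> <= (LB x. \<bar>w x - w' x\<bar>) + (LB x. \<bar>q x - q' x\<bar>)"
proof -
 note a = ent_pair_integrable(2)[OF i(1,2)] and b = ent_pair_integrable(2)[OF i(3,4)]
 have c: "integrable lborel2 (%(y, x). \<bar>w x - w' x\<bar> * \<rho> (x - y))"
  by (rule integrable_pair_x[OF _ integrable_rho]) (use i in auto)
 have d: "integrable lborel2 (%(y, x). \<bar>q y - q' y\<bar> * \<rho> (x - y))"
  by (rule integrable_pair_y[OF _ integrable_rho]) (use i in auto)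
 have "HH w q - HH w' q' = (\<integral>z. (case z of (y, x) => \<bar>w x - q y\<bar> * \<rho> (x - y)) - (case z of (y, x) => \<bar>w' x - q' y\<bar> * \<rho> (x - y)) \<partial>lborel2)"
  unfolding HH_def lborel_pair.integral_fst[OF a] lborel_pair.integral_fst[OF b] by (rule integral_diff[OF a b, symmetric])
 also have "\<bar>...\<bar> <= (\<integral>z. \<bar>(case z of (y, x) => \<bar>w x - q y\<bar> * \<rho> (x - y)) - (case z of (y, x) => \<bar>w' x - q' y\<bar> * \<rho> (x - y))\<bar> \<partial>lborel2)"
  by (rule integral_abs_bound)
 also have "... <= (\<integral>z. (case z of (y, x) => \<bar>w x - w' x\<bar> * \<rho> (x - y)) + (case z of (y, x) => \<bar>q y - q' y\<bar> * \<rho> (x - y)) \<partial>lborel2)"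
 proof (rule integral_mono[OF integrable_abs[OF integrable_diff[OF a b]] integrable_add[OF c d]])
  fix z :: "'a \<times> 'a"
  obtain y x where z: "z = (y, x)" by (cases z)
  have "\<bar>\<bar>w x - q y\<bar> - \<bar>w' x - q' y\<bar>\<bar> * \<rho> (x - y) <= (\<bar>w x - w' x\<bar> + \<bar>q y - q' y\<bar>) * \<rho> (x - y)"
   by (intro mult_right_mono nonneg) linarith
  then show "\<bar>(case z of (y, x) => \<bar>w x - q y\<bar> * \<rho> (x - y)) - (case z of (y, x) => \<bar>w' x - q' y\<bar> * \<rho> (x - y))\<bar>
    <= (case z of (y, x) => \<bar>w x - w' x\<bar> * \<rho> (x - y)) + (case z of (y, x) => \<bar>q y - q' y\<bar> * \<rho> (x - y))"
   using nonneg[of "x - y"] by (simp add: z distrib_right left_diff_distrib[symmetric] abs_mult)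
 qed
 also have "... = (LB y. LB x. \<bar>w x - w' x\<bar> * \<rho> (x - y)) + (LB y. LB x. \<bar>q y - q' y\<bar> * \<rho> (x - y))"
  unfolding lborel_pair.integral_fst[OF c] lborel_pair.integral_fst[OF d] by (rule integral_add[OF c d])
 also have "(LB y. LB x. \<bar>w x - w' x\<bar> * \<rho> (x - y)) = (LB x. LB y. \<bar>w x - w' x\<bar> * \<rho> (x - y))"
  by (rule lborel_pair.Fubini_integral[OF c, symmetric])
 also have "... = (LB x. \<bar>w x - w' x\<bar>)"
  using integral_rho_shift by (simp add: rho_swap)
 also have "(LB y. LB x. \<bar>q y - q' y\<bar> * \<rho> (x - y)) = (LB y. \<bar>q y - q' y\<bar>)"
  using integral_rho_shift by simp
 finally show ?thesis .
qed

lemma HH_commute: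
 assumes i: "L1 w" "L1 q" shows "HH w q = HH q w"
 unfolding HH_def using lborel_pair.Fubini_integral[OF ent_pair_integrable(2)[OF i]] rho_swap
 by (simp add: abs_minus_commute[of "w _"])

lemma PP_bound:
 assumes i: "L1 w" "L1 q" and n: "(LB x. \<bar>w x\<bar>) <= N1" "(LB x. \<bar>q x\<bar>) <= N2"
 shows "\<bar>PP w q\<bar> <= domC N1 N2"
proof -
 note a = ent_pair_integrable(1)[OF i]
 have [measurable]: "w \<in> Borel" "q \<in> Borel" using i by auto
 have m: "(%(y, x). ennreal (dom w (q y) y x)) \<in> borel_measurable lborel2"
  using ent_pair_measurable(2)[of w q] by (simp add: split_beta')
 have "0 <= N1" "0 <= N2" using order_trans[OF integral_nonneg_AE n(1)] order_trans[OF integral_nonneg_AE n(2)] by auto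
 then have 0: "0 <= domC N1 N2"
  unfolding domC_def mass_out_def using L0 mm_nonneg
  by (intro add_nonneg_nonneg mult_nonneg_nonneg integral_nonneg_AE) auto
 have "ennreal \<bar>PP w q\<bar> <= (\<integral>\<^sup>+z. ennreal (norm (case z of (y, x) => ent w (q y) y x)) \<partial>lborel2)"
  unfolding PP_def lborel_pair.integral_fst[OF a] using integral_norm_bound_ennreal[OF a] by simp
 also have "... <= (\<integral>\<^sup>+z. (case z of (y, x) => ennreal (dom w (q y) y x)) \<partial>lborel2)"
  by (intro nn_integral_mono) (auto intro!: ennreal_leI ent_le_dom)
 also have "... = (NN y. (NN x. ennreal (dom w (q y) y x)))"
  using m by (subst lborel.nn_integral_fst[symmetric]) auto
 also have "... <= ennreal (domC N1 N2)"
  by (rule order_trans[OF dom_pair_L1[OF i]], intro ennreal_leI domC_mono n) (auto intro: integral_nonneg_AE)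
 finally show ?thesis using 0 by simp
qed

lemma curve_time_inequality:
 assumes q: "L1 q"
 shows "0 <= a ==> a < b ==> b < T ==> HH (sl b) q - HH (sl a) q <= (LB t. indicator {a..b} t * PP (sl t) q)"
  and "HH (sl 0) q <= HH u0 q"
proof -
 have [measurable]: "q \<in> Borel" using q by auto
 have c: "continuous_on {0..T} (%t. HH (sl t) q)"
  unfolding continuous_on_iff
 proof (intro ballI allI impI)
  fix s e :: real assume s: "s \<in> {0..T}" and e: "0 < e"
  obtain d where d: "0 < d" "!!t. t \<in> {0..T} ==> \<bar>t - s\<bar> < d ==> (LB x. \<bar>U (x, t) - U (x, s)\<bar>) < e"
   by (rule sl_continuous[OF s e]) blast
  have "dist (HH (sl t) q) (HH (sl s) q) < e" if t: "t \<in> {0..T}" "dist t s < d" for t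
   using HH_diff_le[OF U_int[OF t(1)] q U_int[OF s] q] d(2)[OF t(1)] t(2) by (simp add: dist_real_def)
  then show "\<exists>d>0. \<forall>t\<in>{0..T}. dist t s < d \<longrightarrow> dist (HH (sl t) q) (HH (sl s) q) < e" using d(1) by blast
 qed
 have m: "(%t. PP (sl t) q) \<in> Borel"
  unfolding PP_def ent_def outer_def entropy_flux_def sgn_real_def by measurable
 have M: "\<bar>PP (sl t) q\<bar> <= domC N (LB x. \<bar>q x\<bar>)" if "t \<in> {0..T}" for t
  by (rule PP_bound[OF U_int[OF that] q U_bd[OF that] order_refl])
 have di: "0 <= (LB t. ind T t * (\<alpha>' t * HH (sl t) q + \<alpha> t * PP (sl t) q)) - \<alpha> T * HH (sl T) q + \<alpha> 0 * HH u0 q"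
  if "\<alpha> \<in> smooth_supp l" "!!t. 0 <= \<alpha> t" "!!t. (\<alpha> has_real_derivative \<alpha>' t) (at t)"
   "!!t. \<bar>\<alpha> t\<bar> <= C" "!!t. \<bar>\<alpha>' t\<bar> <= C" "\<alpha>' \<in> Borel" for \<alpha> \<alpha>' C l
  by (rule double_inequality[OF q that])
 show "0 <= a ==> a < b ==> b < T ==> HH (sl b) q - HH (sl a) q <= (LB t. indicator {a..b} t * PP (sl t) q)"
  by (rule time_inequality(1)[OF c T0 m M di])
 show "HH (sl 0) q <= HH u0 q"
  by (rule time_inequality(2)[OF c T0 m M di])
qed

end

locale curve_pair = U: slice_curve \<rho> D K R f F A L B \<mu> \<kappa> T N u0 U + V: slice_curve \<rho> D K R g G A L B \<nu> \<kappa> T N v0 V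
 for \<rho> :: "'a::euclidean_space => real" and D K R f F A L B \<mu> \<kappa> T N u0 U g G \<nu> v0 V
begin

theorem doubling:
 assumes C: "!!t s. t \<in> {0..T} ==> s \<in> {0..T} ==> U.PP (U.sl t) (V.sl s) + V.PP (V.sl s) (U.sl t) <= C"
  and t: "t \<in> {0..T}"
 shows "U.HH (U.sl t) (V.sl t) <= U.HH u0 v0 + C * t"
proof -
 let ?H = "%t s. U.HH (U.sl t) (V.sl s)"
 have c: "continuous_on ({0..T} \<times> {0..T}) (%(t, s). ?H t s)"
  unfolding continuous_on_iff
 proof (intro ballI allI impI)
  fix z0 :: "real \<times> real" and e :: real assume z0: "z0 \<in> {0..T} \<times> {0..T}" and e: "0 < e"
  obtain t0 s0 where z0': "z0 = (t0, s0)" and t0: "t0 \<in> {0..T}" and s0: "s0 \<in> {0..T}" using z0 by (cases z0) auto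
  obtain d1 where d1: "0 < d1" "!!t. t \<in> {0..T} ==> \<bar>t - t0\<bar> < d1 ==> (LB x. \<bar>U (x, t) - U (x, t0)\<bar>) < e / 2"
   by (rule U.sl_continuous[OF t0 half_gt_zero[OF e]]) blast
  obtain d2 where d2: "0 < d2" "!!s. s \<in> {0..T} ==> \<bar>s - s0\<bar> < d2 ==> (LB x. \<bar>V (x, s) - V (x, s0)\<bar>) < e / 2"
   by (rule V.sl_continuous[OF s0 half_gt_zero[OF e]]) blast
  have "dist (?H t s) (?H t0 s0) < e" if ts: "t \<in> {0..T}" "s \<in> {0..T}" "dist (t, s) (t0, s0) < min d1 d2" for t s
  proof -
   have "\<bar>t - t0\<bar> < d1" "\<bar>s - s0\<bar> < d2"
    using ts(3) dist_fst_le[of "(t, s)" "(t0, s0)"] dist_snd_le[of "(t, s)" "(t0, s0)"] by (auto simp: dist_real_def)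
   then show ?thesis
    using U.HH_diff_le[OF U.U_int[OF ts(1)] V.U_int[OF ts(2)] U.U_int[OF t0] V.U_int[OF s0]] d1(2)[OF ts(1)] d2(2)[OF ts(2)]
    by (simp add: dist_real_def)
  qed
  then show "\<exists>d>0. \<forall>z\<in>{0..T} \<times> {0..T}. dist z z0 < d \<longrightarrow> dist (case z of (t, s) => ?H t s) (case z0 of (t, s) => ?H t s) < e"
   using d1(1) d2(1) by (intro exI[of _ "min d1 d2"]) (auto simp: z0')
 qed
 note [measurable] = U.U_meas V.U_meas
 have m1: "(%(t, s). U.PP (U.sl t) (V.sl s)) \<in> borel_measurable (borel \<Otimes>\<^sub>M borel)"
  unfolding U.PP_def U.ent_def U.outer_def entropy_flux_def sgn_real_def split_beta' by measurable
 have m2: "(%(t, s). V.PP (V.sl s) (U.sl t)) \<in> borel_measurable (borel \<Otimes>\<^sub>M borel)"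
  unfolding V.PP_def V.ent_def V.outer_def entropy_flux_def sgn_real_def split_beta' by measurable
 have sym: "?H t s = V.HH (V.sl s) (U.sl t)" if "t \<in> {0..T}" "s \<in> {0..T}" for t s
  by (rule U.HH_commute[OF U.U_int[OF that(1)] V.U_int[OF that(2)]])
 have T0: "0 \<in> {0..T}" using U.T0 by simp
 have "?H t t <= ?H 0 0 + C * t"
 proof (rule time_doubling[OF c U.T0 m1 m2 _ _ C _ _ t])
  show "\<bar>U.PP (U.sl t) (V.sl s)\<bar> <= max (U.domC N N) (V.domC N N)" if "t \<in> {0..T}" "s \<in> {0..T}" for t s
   using U.PP_bound[OF U.U_int[OF that(1)] V.U_int[OF that(2)] U.U_bd[OF that(1)] V.U_bd[OF that(2)]] by simp
  show "\<bar>V.PP (V.sl s) (U.sl t)\<bar> <= max (U.domC N N) (V.domC N N)" if "t \<in> {0..T}" "s \<in> {0..T}" for t s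
   using V.PP_bound[OF V.U_int[OF that(2)] U.U_int[OF that(1)] V.U_bd[OF that(2)] U.U_bd[OF that(1)]] by simp
  show "?H b s - ?H a s <= (LB t. indicator {a..b} t * U.PP (U.sl t) (V.sl s))"
   if "0 <= a" "a < b" "b < T" "s \<in> {0..T}" for a b s
   by (rule U.curve_time_inequality(1)[OF V.U_int[OF that(4)] that(1-3)])
  show "?H t b - ?H t a <= (LB s. indicator {a..b} s * V.PP (V.sl s) (U.sl t))"
   if "0 <= a" "a < b" "b < T" "t \<in> {0..T}" for a b t
   using V.curve_time_inequality(1)[OF U.U_int[OF that(4)] that(1-3)] sym[OF that(4)] that by simp
 qed
 \<comment> \<open>The initial slices are exchanged for the data one at a time, the second time
   through the symmetry of \<open>HH\<close>.\<close>
 moreover have "?H 0 0 <= U.HH u0 (V.sl 0)" by (rule U.curve_time_inequality(2)[OF V.U_int[OF T0]])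
 moreover have "U.HH u0 (V.sl 0) <= U.HH u0 v0"
  using V.curve_time_inequality(2)[OF U.u0_int] U.HH_commute[OF U.u0_int V.U_int[OF T0]] U.HH_commute[OF U.u0_int V.u0_int] by simp
 ultimately show ?thesis by linarith
qed

end

text \<open>Extension by zero outside the closed time strip gives a function Borel on the whole
  space, which joint measurability in (x, t, z) relies on. The bound \<open>N\<close> exists because
  the L1 norm of the slices is continuous on a compact interval.\<close>

lemma curve_extension:
 assumes T: "0 < T" and sol: "entropy_solution T f A \<mu> u0 u"
 obtains U N where "U \<in> borel_measurable (borel \<Otimes>\<^sub>M borel)" "!!x t. t \<in> {0..T} ==> U (x, t) = u (x, t)"
  "!!t. t \<in> {0..T} ==> L1 (%x. U (x, t))" "!!t. t \<in> {0..T} ==> (LB x. \<bar>U (x, t)\<bar>) <= N"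
proof -
 let ?S = "UNIV \<times> {0..T} :: ('a \<times> real) set"
 define U where "U p = indicator ?S p *\<^sub>R u p" for p
 have S: "?S \<in> sets borel" by (intro borel_closed closed_Times) auto
 have "u \<in> borel_measurable (restrict_space borel ?S)" using sol by (simp add: entropy_solution_def)
 then have "(%p. indicator ?S p *\<^sub>R u p) \<in> Borel"
  using S by (subst (asm) borel_measurable_restrict_space_iff) auto
 then have m: "U \<in> borel_measurable (borel \<Otimes>\<^sub>M borel)" unfolding U_def[abs_def] borel_prod .
 have U: "U (x, t) = u (x, t)" if "t \<in> {0..T}" for x t using that by (simp add: U_def)
 have c: "C_L1 T u" using sol by (simp add: entropy_solution_def)
 have i: "L1 (%x. u (x, t))" if "t \<in> {0..T}" for t using c that by (simp add: C_L1_def)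
 have "continuous_on {0..T} (%t. LB x. \<bar>u (x, t)\<bar>)"
  unfolding continuous_on_def
 proof
  fix s assume s: "s \<in> {0..T}"
  have "((%t. LB x. \<bar>u (x, t) - u (x, s)\<bar>) \<longlongrightarrow> 0) (at s within {0..T})" using c s by (simp add: C_L1_def)
  then have "((%t. (LB x. \<bar>u (x, t)\<bar>) - (LB x. \<bar>u (x, s)\<bar>)) \<longlongrightarrow> 0) (at s within {0..T})"
  proof (rule Lim_null_comparison[rotated])
   show "\<forall>\<^sub>F t in at s within {0..T}. norm ((LB x. \<bar>u (x, t)\<bar>) - (LB x. \<bar>u (x, s)\<bar>)) <= (LB x. \<bar>u (x, t) - u (x, s)\<bar>)"
    unfolding eventually_at_filter
   proof (rule always_eventually, intro allI impI)
    fix t assume t: "t \<noteq> s" "t \<in> {0..T}"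
    have "(LB x. \<bar>u (x, t)\<bar>) - (LB x. \<bar>u (x, s)\<bar>) = (LB x. \<bar>u (x, t)\<bar> - \<bar>u (x, s)\<bar>)"
     by (rule integral_diff[symmetric]) (use i t s in auto)
    also have "norm ... <= (LB x. norm (\<bar>u (x, t)\<bar> - \<bar>u (x, s)\<bar>))" by (rule integral_norm_bound)
    also have "... <= (LB x. \<bar>u (x, t) - u (x, s)\<bar>)"
     by (rule integral_mono) (use i t s in auto)
    finally show "norm ((LB x. \<bar>u (x, t)\<bar>) - (LB x. \<bar>u (x, s)\<bar>)) <= (LB x. \<bar>u (x, t) - u (x, s)\<bar>)" .
   qed
  qed
  then show "((%t. LB x. \<bar>u (x, t)\<bar>) \<longlongrightarrow> (LB x. \<bar>u (x, s)\<bar>)) (at s within {0..T})"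
   by (simp add: Lim_null[symmetric])
 qed
 then obtain N where "!!t. t \<in> {0..T} ==> \<bar>LB x. \<bar>u (x, t)\<bar>\<bar> <= N"
  by (rule continuous_Icc_bounded) blast
 then have N: "(LB x. \<bar>U (x, t)\<bar>) <= N" if "t \<in> {0..T}" for t
  using order_trans[OF abs_ge_self] that by (simp add: U[OF that])
 have "L1 (%x. U (x, t))" if t: "t \<in> {0..T}" for t unfolding U[OF t] by (rule i[OF t])
 from that[OF m U this N] show thesis .
qed

subsection \<open>The doubled spatial terms\<close>

lemma pair_integral_shift:
 fixes \<phi> :: "'a::euclidean_space => 'a => 'b::{banach, second_countable_topology}"
 assumes "(%(y, x). \<phi> y x) \<in> borel_measurable lborel2"
 shows "(\<integral>(y, x). \<phi> (y + s) (x + t) \<partial>lborel2) = (\<integral>(y, x). \<phi> y x \<partial>lborel2)"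
 using integral_lborel_shift[of "%(y, x). \<phi> y x" "(s, t)"] assms unfolding lborel_prod by (simp add: split_beta')

lemma pair_integral_swap:
 fixes \<phi> :: "'a::euclidean_space => 'a => 'b::{banach, second_countable_topology}"
 assumes "(%(y, x). \<phi> y x) \<in> borel_measurable lborel2"
 shows "(\<integral>(y, x). \<phi> x y \<partial>lborel2) = (\<integral>(y, x). \<phi> y x \<partial>lborel2)"
 using lborel_pair.integral_product_swap[OF assms] by (simp add: split_beta')

lemma pair_integrable_dominated:
 fixes h :: "'a::euclidean_space => 'a => 'b::{banach, second_countable_topology}"
 assumes w: "L1 w" and q: "L1 q" and m: "L1 m"
  and h: "(%(y, x). h y x) \<in> borel_measurable lborel2"
  and le: "!!y x. norm (h y x) <= (\<bar>w x\<bar> + \<bar>q y\<bar>) * \<bar>m (x - y)\<bar>"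
 shows "integrable lborel2 (%(y, x). h y x)"
proof (rule integrable_bound[OF _ h], rule_tac [2] AE_I2)
 show "integrable lborel2 (%(y, x). (\<bar>w x\<bar> + \<bar>q y\<bar>) * \<bar>m (x - y)\<bar>)"
  using integrable_add[OF
    integrable_pair_x[OF integrable_abs[OF w] integrable_abs[OF m]]
    integrable_pair_y[OF integrable_abs[OF q] integrable_abs[OF m]]]
  by (simp add: split_beta' distrib_right)
 fix z :: "'a \<times> 'a"
 show "norm (case z of (y, x) => h y x) <= norm (case z of (y, x) => (\<bar>w x\<bar> + \<bar>q y\<bar>) * \<bar>m (x - y)\<bar>)"
  using order_trans[OF le abs_ge_self] by (simp add: split_beta')
qed

lemma pair_integral_x:
 fixes p m :: "'a::euclidean_space => real"
 assumes p: "L1 p" and m: "L1 m"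
 shows "(\<integral>(y, x). p x * m (x - y) \<partial>lborel2) = (LB x. p x) * (LB v. m v)"
proof -
 have [measurable]: "m \<in> Borel" using m by auto
 have "(\<integral>(y, x). p x * m (x - y) \<partial>lborel2) = (LB x. LB y. p x * m (x - y))"
  by (rule lborel_pair.integral_snd[OF integrable_pair_x[OF p m], symmetric])
 then show ?thesis by (simp add: integral_lborel_reflect)
qed

lemma pair_integral_y:
 fixes p m :: "'a::euclidean_space => real"
 assumes p: "L1 p" and m: "L1 m"
 shows "(\<integral>(y, x). p y * m (x - y) \<partial>lborel2) = (LB x. p x) * (LB v. m v)"
proof -
 have [measurable]: "m \<in> Borel" using m by auto
 have "(LB x. m (x - y)) = (LB v. m v)" for y using integral_lborel_shift[of m "- y"] by simp
 moreover have "(\<integral>(y, x). p y * m (x - y) \<partial>lborel2) = (LB y. LB x. p y * m (x - y))"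
  by (rule lborel_pair.integral_fst[OF integrable_pair_y[OF p m], symmetric])
 ultimately show ?thesis by simp
qed

context entropy_data
begin

text \<open>The doubled functional of A (w) and A (q) with the kernel displaced by
  \<open>\<zeta>\<close>. Displacing the kernel amounts to translating \<open>w\<close> by
  -\<open>\<zeta>\<close> (\<open>JJ_shift\<close>), so jumps of the equation are read off as
  increments of this function.\<close>

definition JJ :: "('a => real) => ('a => real) => 'a => real" where
 "JJ w q \<zeta> = (\<integral>(y, x). \<bar>A (w x) - A (q y)\<bar> * \<rho> (x - y + \<zeta>) \<partial>lborel2)"

text \<open>The gradient of \<open>JJ w q\<close> at 0 (\<open>JJ_taylor\<close>): the vector
  against which all drifts and compensators are paired.\<close>

definition VV :: "('a => real) => ('a => real) => 'a" where
 "VV w q = (\<integral>(y, x). \<bar>A (w x) - A (q y)\<bar> *\<^sub>R D (x - y) \<partial>lborel2)"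

text \<open>What a single jump \<open>z\<close> of the first equation contributes to the doubled
  nonlocal term; \<open>outer_fubini\<close> integrates it over the jumps beyond the cutoff.\<close>

definition XX :: "('a => real) => ('a => real) => 'a => real" where
 "XX w q z = (\<integral>(y, x). sgn (w x - q y) * (A (w (x + z)) - A (w x)) * \<rho> (x - y) \<partial>lborel2)"

definition FL :: "('a => real) => ('a => real) => real" where
 "FL w q = (\<integral>(y, x). entropy_flux f (w x) (q y) \<bullet> D (x - y) \<partial>lborel2)"

definition LI :: "('a => real) => ('a => real) => real" where
 "LI w q = (\<integral>(y, x). \<bar>A (w x) - A (q y)\<bar> * Lin (x - y) \<partial>lborel2)"

definition ball_mass :: real where "ball_mass = (LB v. indicator (cball (0::'a) (R + 1)) v)"

lemma A_diff_le: "\<bar>A s - A t\<bar> <= L * (\<bar>s\<bar> + \<bar>t\<bar>)"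
 by (rule order_trans[OF A_lip mult_left_mono]) (use L0 in auto)

text \<open>Monotonicity of \<open>A\<close> enters here: the sign of s - t is that of A s - A t
  wherever the latter is nonzero.\<close>

lemma sgn_A: "sgn (s - t) * (A s - A t) = \<bar>A s - A t\<bar>"
 using monoD[OF A_mono, of s t] monoD[OF A_mono, of t s] by (auto simp: sgn_real_def)

lemma flux_diff_le: "norm (entropy_flux f s t) <= F * (\<bar>s\<bar> + \<bar>t\<bar>)"
 by (rule order_trans[OF entropy_flux_bound[OF f_lip] mult_left_mono]) (use F0 in auto)

context
 fixes w q :: "'a => real"
 assumes w: "L1 w" and q: "L1 q"
begin

lemma wq_measurable [measurable]: "w \<in> Borel" "q \<in> Borel"
 using w q by auto

lemma A_pair_integrable:
 assumes m: "L1 (m :: 'a => 'b::{banach, second_countable_topology})"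
 shows "integrable lborel2 (%(y, x). \<bar>A (w x) - A (q y)\<bar> *\<^sub>R m (x - y))"
proof -
 have [measurable]: "m \<in> Borel" using m by auto
 show ?thesis
 proof (rule pair_integrable_dominated[OF w q, where m="%v. L * norm (m v)"])
  show "L1 (%v. L * norm (m v))" using m by simp
  show "(%(y, x). \<bar>A (w x) - A (q y)\<bar> *\<^sub>R m (x - y)) \<in> borel_measurable lborel2" unfolding split_beta' by measurable
  show "norm (\<bar>A (w x) - A (q y)\<bar> *\<^sub>R m (x - y)) <= (\<bar>w x\<bar> + \<bar>q y\<bar>) * \<bar>L * norm (m (x - y))\<bar>" for y x
   using mult_right_mono[OF A_diff_le[of "w x" "q y"] norm_ge_zero[of "m (x - y)"]] L0 by (simp add: mult_ac)
 qed
qed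

lemma rho_shift_integrable: "L1 (%v. \<rho> (v + \<zeta>))"
 by (rule integrable_lborel_shift[OF integrable_rho])

lemma JJ_integrable: "integrable lborel2 (%(y, x). \<bar>A (w x) - A (q y)\<bar> * \<rho> (x - y + \<zeta>))"
 using A_pair_integrable[OF rho_shift_integrable] by simp

lemma A_osc_le: "osc (%x. A (w x)) z <= L * osc w z"
 by (rule osc_mono_lipschitz[OF w A_lip A_integrable[OF w]])

lemma A_shift_integrable: "L1 (%x. \<bar>A (w (x + z)) - A (w x)\<bar>)"
 using osc_integrable[OF A_integrable[OF w]] by simp

lemma A_shift_pair:
 "integrable lborel2 (%(y, x). \<bar>A (w (x + z)) - A (w x)\<bar> * \<rho> (x - y))"
 "(\<integral>(y, x). \<bar>A (w (x + z)) - A (w x)\<bar> * \<rho> (x - y) \<partial>lborel2) <= L * osc w z"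
 using integrable_pair_x[OF A_shift_integrable integrable_rho] pair_integral_x[OF A_shift_integrable integrable_rho] A_osc_le[of z]
 by (simp_all add: integral_rho osc_def)

lemma JJ_shift: "JJ w q \<zeta> = (\<integral>(y, x). \<bar>A (w (x - \<zeta>)) - A (q y)\<bar> * \<rho> (x - y) \<partial>lborel2)"
 unfolding JJ_def using pair_integral_shift[of "%y x. \<bar>A (w x) - A (q y)\<bar> * \<rho> (x - y + \<zeta>)" 0 "- \<zeta>"]
 by (simp add: split_beta' diff_add_eq[symmetric])

lemma shift_integrable:
 "integrable lborel2 (%(y, x). \<bar>A (w (x - \<zeta>)) - A (q y)\<bar> * \<rho> (x - y))"
proof (rule pair_integrable_dominated[OF integrable_lborel_shift[OF w, of "- \<zeta>"] q, where m="%v. L * \<rho> v"])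
 show "norm (\<bar>A (w (x - \<zeta>)) - A (q y)\<bar> * \<rho> (x - y)) <= (\<bar>w (x + - \<zeta>)\<bar> + \<bar>q y\<bar>) * \<bar>L * \<rho> (x - y)\<bar>" for y x
  using mult_right_mono[OF A_diff_le[of "w (x - \<zeta>)" "q y"] nonneg[of "x - y"]] L0 nonneg[of "x - y"] by (simp add: mult_ac)
qed (use integrable_rho in \<open>auto simp: split_beta'\<close>)

lemma JJ_diff_le: "JJ w q \<zeta> - JJ w q 0 <= L * osc w \<zeta>"
proof -
 have "JJ w q \<zeta> - JJ w q 0 = (\<integral>z. (case z of (y, x) => \<bar>A (w (x - \<zeta>)) - A (q y)\<bar> * \<rho> (x - y)) - (case z of (y, x) => \<bar>A (w (x - 0)) - A (q y)\<bar> * \<rho> (x - y)) \<partial>lborel2)"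
  unfolding JJ_shift by (rule integral_diff[OF shift_integrable shift_integrable, symmetric])
 also have "... <= (\<integral>(y, x). \<bar>A (w (x + - \<zeta>)) - A (w x)\<bar> * \<rho> (x - y) \<partial>lborel2)"
 proof (rule integral_mono[OF integrable_diff[OF shift_integrable shift_integrable] A_shift_pair(1)])
  fix z :: "'a \<times> 'a"
  obtain y x where z: "z = (y, x)" by (cases z)
  have "(\<bar>A (w (x - \<zeta>)) - A (q y)\<bar> - \<bar>A (w x) - A (q y)\<bar>) * \<rho> (x - y) <= \<bar>A (w (x - \<zeta>)) - A (w x)\<bar> * \<rho> (x - y)"
   by (intro mult_right_mono nonneg) linarith
  then show "(case z of (y, x) => \<bar>A (w (x - \<zeta>)) - A (q y)\<bar> * \<rho> (x - y)) - (case z of (y, x) => \<bar>A (w (x - 0)) - A (q y)\<bar> * \<rho> (x - y))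
   <= (case z of (y, x) => \<bar>A (w (x + - \<zeta>)) - A (w x)\<bar> * \<rho> (x - y))" by (simp add: z left_diff_distrib)
 qed
 also have "... <= L * osc w \<zeta>" using A_shift_pair(2)[of "- \<zeta>"] by (simp add: osc_minus[OF w])
 finally show ?thesis .
qed

lemma XX_integrable: "integrable lborel2 (%(y, x). sgn (w x - q y) * (A (w (x + z)) - A (w x)) * \<rho> (x - y))"
proof (rule integrable_bound[OF A_shift_pair(1)[of z]])
 show "(%(y, x). sgn (w x - q y) * (A (w (x + z)) - A (w x)) * \<rho> (x - y)) \<in> borel_measurable lborel2"
  unfolding split_beta' sgn_real_def by measurable
qed (use nonneg in \<open>auto simp: abs_mult sgn_real_def\<close>)

text \<open>A pointwise inequality of Kato type: inserting A (q y) turns the sign times the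
  increment into a difference of absolute values, and translating x moves \<open>z\<close> into the
  kernel with the opposite sign.\<close>

lemma XX_le: "XX w q z <= JJ w q (- z) - JJ w q 0"
proof -
 have "XX w q z <= (\<integral>v. (case v of (y, x) => \<bar>A (w (x - - z)) - A (q y)\<bar> * \<rho> (x - y)) - (case v of (y, x) => \<bar>A (w (x - 0)) - A (q y)\<bar> * \<rho> (x - y)) \<partial>lborel2)"
  unfolding XX_def
 proof (rule integral_mono[OF XX_integrable integrable_diff[OF shift_integrable shift_integrable]])
  fix v :: "'a \<times> 'a"
  obtain y x where v: "v = (y, x)" by (cases v)
  have "sgn (w x - q y) * (A (w (x + z)) - A (w x)) = sgn (w x - q y) * (A (w (x + z)) - A (q y)) - \<bar>A (w x) - A (q y)\<bar>"
   unfolding sgn_A[symmetric] by (simp add: algebra_simps)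
  also have "... <= \<bar>A (w (x + z)) - A (q y)\<bar> - \<bar>A (w x) - A (q y)\<bar>" by (auto simp: sgn_real_def)
  finally have "sgn (w x - q y) * (A (w (x + z)) - A (w x)) * \<rho> (x - y) <= (\<bar>A (w (x + z)) - A (q y)\<bar> - \<bar>A (w x) - A (q y)\<bar>) * \<rho> (x - y)"
   by (rule mult_right_mono[OF _ nonneg])
  then show "(case v of (y, x) => sgn (w x - q y) * (A (w (x + z)) - A (w x)) * \<rho> (x - y))
   <= (case v of (y, x) => \<bar>A (w (x - - z)) - A (q y)\<bar> * \<rho> (x - y)) - (case v of (y, x) => \<bar>A (w (x - 0)) - A (q y)\<bar> * \<rho> (x - y))"
   by (simp add: v left_diff_distrib)
 qed
 also have "... = JJ w q (- z) - JJ w q 0"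
  unfolding JJ_shift by (rule integral_diff[OF shift_integrable shift_integrable])
 finally show ?thesis .
qed

lemma XX_abs_le: "\<bar>XX w q z\<bar> <= L * osc w z"
proof -
 have "\<bar>XX w q z\<bar> <= (\<integral>v. \<bar>case v of (y, x) => sgn (w x - q y) * (A (w (x + z)) - A (w x)) * \<rho> (x - y)\<bar> \<partial>lborel2)"
  unfolding XX_def by (rule integral_abs_bound)
 also have "... <= (\<integral>(y, x). \<bar>A (w (x + z)) - A (w x)\<bar> * \<rho> (x - y) \<partial>lborel2)"
  by (rule integral_mono[OF integrable_abs[OF XX_integrable] A_shift_pair(1)])
    (use nonneg in \<open>auto simp: abs_mult sgn_real_def\<close>)
 finally show ?thesis using A_shift_pair(2)[of z] by linarith
qed

lemma JJ_swap: "JJ q w \<zeta> = JJ w q (- \<zeta>)"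
proof -
 have e: "\<rho> (y - x + \<zeta>) = \<rho> (x - y + - \<zeta>)" for x y using even[of "x - y + - \<zeta>"] by (simp add: algebra_simps)
 show ?thesis
  unfolding JJ_def using pair_integral_swap[of "%y x. \<bar>A (q x) - A (w y)\<bar> * \<rho> (x - y + \<zeta>)"]
  by (simp add: split_beta' e abs_minus_commute)
qed

lemma VV_swap: "VV q w = - VV w q"
proof -
 have "VV q w = (\<integral>(y, x). \<bar>A (q y) - A (w x)\<bar> *\<^sub>R D (y - x) \<partial>lborel2)"
  unfolding VV_def using pair_integral_swap[of "%y x. \<bar>A (q x) - A (w y)\<bar> *\<^sub>R D (x - y)"] by (simp add: split_beta')
 also have "... = (\<integral>z. - (case z of (y, x) => \<bar>A (w x) - A (q y)\<bar> *\<^sub>R D (x - y)) \<partial>lborel2)"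
 proof (rule integral_cong[OF refl])
  fix v :: "'a \<times> 'a"
  obtain y x where v: "v = (y, x)" by (cases v)
  show "(case v of (y, x) => \<bar>A (q y) - A (w x)\<bar> *\<^sub>R D (y - x)) = - (case v of (y, x) => \<bar>A (w x) - A (q y)\<bar> *\<^sub>R D (x - y))"
   unfolding v prod.case abs_minus_commute[of "A (q y)"] D_swap[of y x] by simp
 qed
 also have "... = - VV w q" unfolding VV_def by (rule integral_minus)
 finally show ?thesis .
qed

text \<open>The two sign terms combine into |A (w (x + z)) - A (q (y + z))| - |A (w x) - A (q y)| at
  most. The kernel depends only on x - y, so moving both points by z leaves the integral unchanged
  and the difference vanishes.\<close>

lemma XX_sum_le: "XX w q z + XX q w z <= 0"
proof -
 let ?h = "%y x. \<bar>A (w x) - A (q y)\<bar> * \<rho> (x - y)"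
 have i1: "integrable lborel2 (%(y, x). ?h y x)" using JJ_integrable[of 0] by simp
 have m: "(%(y, x). ?h y x) \<in> borel_measurable lborel2" using i1 by (rule borel_measurable_integrable)
 have i2: "integrable lborel2 (%(y, x). ?h (y + z) (x + z))"
  using integrable_lborel_shift[of "%(y, x). ?h y x" "(z, z)"] i1 unfolding lborel_prod by (simp add: split_beta')
 have swap: "XX q w z = (\<integral>(y, x). sgn (q y - w x) * (A (q (y + z)) - A (q y)) * \<rho> (x - y) \<partial>lborel2)"
  unfolding XX_def using pair_integral_swap[of "%y x. sgn (q x - w y) * (A (q (x + z)) - A (q x)) * \<rho> (x - y)"]
  by (simp add: split_beta' sgn_real_def rho_swap)
 have i3: "integrable lborel2 (%(y, x). sgn (q y - w x) * (A (q (y + z)) - A (q y)) * \<rho> (x - y))"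
 proof (rule integrable_bound)
  show "integrable lborel2 (%(y, x). \<bar>A (q (y + z)) - A (q y)\<bar> * \<rho> (x - y))"
   by (rule integrable_pair_y[OF _ integrable_rho]) (use osc_integrable[OF A_integrable[OF q]] in simp)
  show "(%(y, x). sgn (q y - w x) * (A (q (y + z)) - A (q y)) * \<rho> (x - y)) \<in> borel_measurable lborel2"
   unfolding split_beta' sgn_real_def by measurable
 qed (use nonneg in \<open>auto simp: abs_mult sgn_real_def\<close>)
 have "XX w q z + XX q w z = (\<integral>v. (case v of (y, x) => sgn (w x - q y) * (A (w (x + z)) - A (w x)) * \<rho> (x - y)) + (case v of (y, x) => sgn (q y - w x) * (A (q (y + z)) - A (q y)) * \<rho> (x - y)) \<partial>lborel2)"
  unfolding swap unfolding XX_def by (rule integral_add[OF XX_integrable i3, symmetric])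
 also have "... <= (\<integral>v. (case v of (y, x) => ?h (y + z) (x + z)) - (case v of (y, x) => ?h y x) \<partial>lborel2)"
 proof (rule integral_mono[OF integrable_add[OF XX_integrable i3] integrable_diff[OF i2 i1]])
  fix v :: "'a \<times> 'a"
  obtain y x where v: "v = (y, x)" by (cases v)
  have s: "sgn (q y - w x) = - sgn (w x - q y)" by (simp add: sgn_real_def)
  have "sgn (w x - q y) * (A (w (x + z)) - A (w x)) + sgn (q y - w x) * (A (q (y + z)) - A (q y))
    = sgn (w x - q y) * (A (w (x + z)) - A (q (y + z))) - \<bar>A (w x) - A (q y)\<bar>"
   unfolding s sgn_A[symmetric] by (simp add: algebra_simps)
  also have "... <= \<bar>A (w (x + z)) - A (q (y + z))\<bar> - \<bar>A (w x) - A (q y)\<bar>" by (auto simp: sgn_real_def)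
  finally have "(sgn (w x - q y) * (A (w (x + z)) - A (w x)) + sgn (q y - w x) * (A (q (y + z)) - A (q y))) * \<rho> (x - y)
    <= (\<bar>A (w (x + z)) - A (q (y + z))\<bar> - \<bar>A (w x) - A (q y)\<bar>) * \<rho> (x - y)" by (rule mult_right_mono[OF _ nonneg])
  then show "(case v of (y, x) => sgn (w x - q y) * (A (w (x + z)) - A (w x)) * \<rho> (x - y)) + (case v of (y, x) => sgn (q y - w x) * (A (q (y + z)) - A (q y)) * \<rho> (x - y))
   <= (case v of (y, x) => ?h (y + z) (x + z)) - (case v of (y, x) => ?h y x)"
   by (simp add: v distrib_right left_diff_distrib)
 qed
 also have "... = 0"
  using pair_integral_shift[OF m, of z z] by (subst integral_diff[OF i2 i1]) simp
 finally show ?thesis .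
qed

text \<open>After a translation the mixed second difference factorises: the increment of |A (w) - A
  (q)| under \<open>\<eta>\<close>, at most that of A (w), times the increment of the kernel under
  \<open>\<zeta>\<close>. The modulus of \<open>w\<close> and that of the kernel each contribute one
  power of the displacement.\<close>

lemma JJ_second_difference:
 assumes Sk: "!!z. (NN v. ennreal \<bar>\<rho> (v + z) - \<rho> v\<bar>) <= ennreal (Sk * norm z)" "0 <= Sk"
  and \<beta>: "!!z. osc w z <= \<beta> * norm z"
 shows "JJ w q (\<zeta> + \<eta>) - JJ w q \<zeta> - (JJ w q \<eta> - JJ w q 0) <= L * \<beta> * Sk * norm \<eta> * norm \<zeta>"
proof -
 let ?\<sigma> = "%v. \<rho> (v + \<zeta>) - \<rho> v"
 have \<sigma>: "L1 ?\<sigma>" by (intro integrable_diff rho_shift_integrable integrable_rho)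
 have e: "x - \<eta> - y + (\<zeta> + \<eta>) = x - y + \<zeta>" for x y by (simp add: algebra_simps)
 have s: "JJ w q (\<zeta> + \<eta>) = (\<integral>(y, x). \<bar>A (w (x - \<eta>)) - A (q y)\<bar> * \<rho> (x - y + \<zeta>) \<partial>lborel2)"
  unfolding JJ_def using pair_integral_shift[of "%y x. \<bar>A (w x) - A (q y)\<bar> * \<rho> (x - y + (\<zeta> + \<eta>))" 0 "- \<eta>"]
  by (simp add: split_beta' e)
 have i: "integrable lborel2 (%(y, x). \<bar>A (w (x - \<eta>)) - A (q y)\<bar> * \<rho> (x - y + \<zeta>))"
 proof (rule pair_integrable_dominated[OF integrable_lborel_shift[OF w, of "- \<eta>"] q, where m="%v. L * \<rho> (v + \<zeta>)"])
  show "norm (\<bar>A (w (x - \<eta>)) - A (q y)\<bar> * \<rho> (x - y + \<zeta>)) <= (\<bar>w (x + - \<eta>)\<bar> + \<bar>q y\<bar>) * \<bar>L * \<rho> (x - y + \<zeta>)\<bar>" for y x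
   using mult_right_mono[OF A_diff_le[of "w (x - \<eta>)" "q y"] nonneg[of "x - y + \<zeta>"]] L0 nonneg[of "x - y + \<zeta>"] by (simp add: mult_ac)
 qed (use rho_shift_integrable in \<open>auto simp: split_beta'\<close>)
 have alg: "(a * r - b * r) - (a * s - b * s) = (a - b) * (r - s)" for a b r s :: real by (simp add: algebra_simps)
 note d1 = integral_diff[OF i JJ_integrable[of \<zeta>]]
  and d2 = integral_diff[OF shift_integrable[of \<eta>] JJ_integrable[of 0]]
  and d3 = integral_diff[OF integrable_diff[OF i JJ_integrable[of \<zeta>]]
   integrable_diff[OF shift_integrable[of \<eta>] JJ_integrable[of 0]]]
 let ?a = "%x. \<bar>A (w (x + - \<eta>)) - A (w x)\<bar>"
 have "JJ w q (\<zeta> + \<eta>) - JJ w q \<zeta> - (JJ w q \<eta> - JJ w q 0)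
   = (\<integral>v. ((case v of (y, x) => \<bar>A (w (x - \<eta>)) - A (q y)\<bar> * \<rho> (x - y + \<zeta>)) - (case v of (y, x) => \<bar>A (w x) - A (q y)\<bar> * \<rho> (x - y + \<zeta>)))
    - ((case v of (y, x) => \<bar>A (w (x - \<eta>)) - A (q y)\<bar> * \<rho> (x - y)) - (case v of (y, x) => \<bar>A (w x) - A (q y)\<bar> * \<rho> (x - y + 0))) \<partial>lborel2)"
  unfolding d3 d1 d2 unfolding s JJ_shift[of \<eta>] unfolding JJ_def ..
 also have "... <= (\<integral>(y, x). ?a x * \<bar>?\<sigma> (x - y)\<bar> \<partial>lborel2)"
 proof (rule integral_mono)
  show "integrable lborel2 (%(y, x). ?a x * \<bar>?\<sigma> (x - y)\<bar>)"
   by (rule integrable_pair_x[OF A_shift_integrable integrable_abs[OF \<sigma>]])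
  show "integrable lborel2 (%v. ((case v of (y, x) => \<bar>A (w (x - \<eta>)) - A (q y)\<bar> * \<rho> (x - y + \<zeta>)) - (case v of (y, x) => \<bar>A (w x) - A (q y)\<bar> * \<rho> (x - y + \<zeta>)))
    - ((case v of (y, x) => \<bar>A (w (x - \<eta>)) - A (q y)\<bar> * \<rho> (x - y)) - (case v of (y, x) => \<bar>A (w x) - A (q y)\<bar> * \<rho> (x - y + 0))))"
   by (intro integrable_diff i JJ_integrable shift_integrable)
  fix v :: "'a \<times> 'a"
  obtain y x where v: "v = (y, x)" by (cases v)
  have "(\<bar>A (w (x - \<eta>)) - A (q y)\<bar> - \<bar>A (w x) - A (q y)\<bar>) * (\<rho> (x - y + \<zeta>) - \<rho> (x - y)) <= \<bar>\<bar>A (w (x - \<eta>)) - A (q y)\<bar> - \<bar>A (w x) - A (q y)\<bar>\<bar> * \<bar>\<rho> (x - y + \<zeta>) - \<rho> (x - y)\<bar>"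
   using abs_ge_self[of "(\<bar>A (w (x - \<eta>)) - A (q y)\<bar> - \<bar>A (w x) - A (q y)\<bar>) * (\<rho> (x - y + \<zeta>) - \<rho> (x - y))"] by (simp only: abs_mult)
  also have "... <= \<bar>A (w (x - \<eta>)) - A (w x)\<bar> * \<bar>\<rho> (x - y + \<zeta>) - \<rho> (x - y)\<bar>"
   by (intro mult_right_mono) auto
  finally show "((case v of (y, x) => \<bar>A (w (x - \<eta>)) - A (q y)\<bar> * \<rho> (x - y + \<zeta>)) - (case v of (y, x) => \<bar>A (w x) - A (q y)\<bar> * \<rho> (x - y + \<zeta>)))
    - ((case v of (y, x) => \<bar>A (w (x - \<eta>)) - A (q y)\<bar> * \<rho> (x - y)) - (case v of (y, x) => \<bar>A (w x) - A (q y)\<bar> * \<rho> (x - y + 0)))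
   <= (case v of (y, x) => ?a x * \<bar>?\<sigma> (x - y)\<bar>)"
   unfolding v prod.case add_0_right alg by simp
 qed
 also have "... = osc (%x. A (w x)) (- \<eta>) * (LB v. \<bar>?\<sigma> v\<bar>)"
  unfolding osc_def by (rule pair_integral_x[OF A_shift_integrable integrable_abs[OF \<sigma>]])
 also have "... <= (L * (\<beta> * norm \<eta>)) * (Sk * norm \<zeta>)"
 proof (rule mult_mono)
  show "osc (%x. A (w x)) (- \<eta>) <= L * (\<beta> * norm \<eta>)"
   using order_trans[OF A_osc_le mult_left_mono[OF \<beta>[of "- \<eta>"] L0]] by simp
  from order_trans[OF osc_nonneg this] show "0 <= L * (\<beta> * norm \<eta>)" .
  have "ennreal (LB v. \<bar>?\<sigma> v\<bar>) = (NN v. ennreal \<bar>?\<sigma> v\<bar>)"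
   by (rule nn_integral_eq_integral[symmetric]) (use \<sigma> in auto)
  then have "ennreal (LB v. \<bar>?\<sigma> v\<bar>) <= ennreal (Sk * norm \<zeta>)" using Sk(1)[of \<zeta>] by (simp only:)
  then show "(LB v. \<bar>?\<sigma> v\<bar>) <= Sk * norm \<zeta>"
   by (rule ennreal_le_iff[THEN iffD1, rotated]) (use Sk(2) in simp)
  show "0 <= (LB v. \<bar>?\<sigma> v\<bar>)" by (simp add: integral_nonneg_AE)
 qed
 finally show ?thesis by (simp add: mult_ac)
qed

text \<open>A coarse bound containing the kernel constant \<open>K\<close>. It is harmless because
  it only multiplies terms that vanish for a fixed kernel: the small moment, or the remainder 1 / n
  in \<open>JJ_small\<close>.\<close>

definition TB :: real where
 "TB = L * K * ball_mass * ((LB x. \<bar>w x\<bar>) + (LB x. \<bar>q x\<bar>))"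

lemma ball_weight:
 assumes m: "m \<in> Borel" "!!v. \<bar>m v\<bar> <= c * indicator (cball 0 (R + 1)) v" and c: "0 <= c"
 shows "\<bar>\<integral>(y, x). \<bar>A (w x) - A (q y)\<bar> * m (x - y) \<partial>lborel2\<bar> <= c * (L * ball_mass * ((LB x. \<bar>w x\<bar>) + (LB x. \<bar>q x\<bar>)))"
proof -
 let ?I = "indicator (cball (0::'a) (R + 1)) :: 'a => real"
 have iI: "L1 (%v. L * c * ?I v)" by (intro integrable_mult_right integrable_real_indicator) auto
 have im: "L1 m"
  by (rule integrable_bound[where f="%v. c * ?I v"])
    (use m order_trans[OF m(2) abs_ge_self] in \<open>auto intro!: integrable_mult_right integrable_real_indicator simp del: abs_mult\<close>)
 note ix = integrable_pair_x[OF integrable_abs[OF w] iI] and iy = integrable_pair_y[OF integrable_abs[OF q] iI]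
 have im2: "integrable lborel2 (%(y, x). \<bar>A (w x) - A (q y)\<bar> * m (x - y))" using A_pair_integrable[OF im] by simp
 have "\<bar>\<integral>(y, x). \<bar>A (w x) - A (q y)\<bar> * m (x - y) \<partial>lborel2\<bar>
   <= (\<integral>v. \<bar>case v of (y, x) => \<bar>A (w x) - A (q y)\<bar> * m (x - y)\<bar> \<partial>lborel2)" by (rule integral_abs_bound)
 also have "... <= (\<integral>v. (case v of (y, x) => \<bar>w x\<bar> * (L * c * ?I (x - y))) + (case v of (y, x) => \<bar>q y\<bar> * (L * c * ?I (x - y))) \<partial>lborel2)"
 proof (rule integral_mono[OF integrable_abs[OF im2] integrable_add[OF ix iy]])
  fix v :: "'a \<times> 'a"
  obtain y x where v: "v = (y, x)" by (cases v)
  have "\<bar>A (w x) - A (q y)\<bar> * \<bar>m (x - y)\<bar> <= (L * (\<bar>w x\<bar> + \<bar>q y\<bar>)) * (c * ?I (x - y))"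
   using L0 by (intro mult_mono A_diff_le m) auto
  then show "\<bar>case v of (y, x) => \<bar>A (w x) - A (q y)\<bar> * m (x - y)\<bar> <= (case v of (y, x) => \<bar>w x\<bar> * (L * c * ?I (x - y))) + (case v of (y, x) => \<bar>q y\<bar> * (L * c * ?I (x - y)))"
   unfolding v prod.case abs_mult abs_abs by (simp only: distrib_left distrib_right mult_ac)
 qed
 also have "... = (LB x. \<bar>w x\<bar>) * (LB v. L * c * ?I v) + (LB x. \<bar>q x\<bar>) * (LB v. L * c * ?I v)"
  unfolding integral_add[OF ix iy] pair_integral_x[OF integrable_abs[OF w] iI] pair_integral_y[OF integrable_abs[OF q] iI] ..
 also have "(LB v. L * c * ?I v) = L * c * ball_mass" unfolding ball_mass_def by (rule integral_mult_right_zero)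
 finally show ?thesis by (simp only: distrib_left distrib_right mult_ac)
qed

lemma LI_le: "\<bar>LI w q\<bar> <= small_moment \<kappa> \<mu> * TB"
proof -
 have "\<bar>Lin v\<bar> <= (K * small_moment \<kappa> \<mu>) * indicator (cball 0 (R + 1)) v" for v
  using Lin_bound[of v] Lin_supp[of v] by (cases "norm v <= R + 1") (auto simp: indicator_def)
 from ball_weight[OF _ this] show ?thesis unfolding LI_def TB_def using small0 K0 by (simp add: mult_ac)
qed

text \<open>The Taylor remainder of the kernel is integrated against |A (w) - A (q)|. The
  restriction to displacements of length at most 1 keeps the remainder supported in the ball of
  radius R + 1.\<close>

lemma JJ_taylor:
 assumes h: "norm h <= 1" shows "\<bar>JJ w q h - JJ w q 0 - h \<bullet> VV w q\<bar> <= (norm h)\<^sup>2 * TB"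
proof -
 have i: "integrable lborel2 (%(y, x). \<bar>A (w x) - A (q y)\<bar> *\<^sub>R D (x - y))" by (rule A_pair_integrable[OF integrable_D])
 have i': "integrable lborel2 (%v. h \<bullet> (case v of (y, x) => \<bar>A (w x) - A (q y)\<bar> *\<^sub>R D (x - y)))" using i by simp
 have "h \<bullet> VV w q = (\<integral>v. h \<bullet> (case v of (y, x) => \<bar>A (w x) - A (q y)\<bar> *\<^sub>R D (x - y)) \<partial>lborel2)"
  unfolding VV_def using i by simp
 then have "JJ w q h - JJ w q 0 - h \<bullet> VV w q = (\<integral>v. ((case v of (y, x) => \<bar>A (w x) - A (q y)\<bar> * \<rho> (x - y + h)) - (case v of (y, x) => \<bar>A (w x) - A (q y)\<bar> * \<rho> (x - y + 0))) - h \<bullet> (case v of (y, x) => \<bar>A (w x) - A (q y)\<bar> *\<^sub>R D (x - y)) \<partial>lborel2)"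
  unfolding JJ_def by (simp only: integral_diff[OF JJ_integrable JJ_integrable]
    integral_diff[OF integrable_diff[OF JJ_integrable JJ_integrable] i'])
 also have "... = (\<integral>(y, x). \<bar>A (w x) - A (q y)\<bar> * (\<rho> (x - y + h) - \<rho> (x - y) - h \<bullet> D (x - y)) \<partial>lborel2)"
  by (rule integral_cong[OF refl]) (auto simp: algebra_simps)
 also have "\<bar>...\<bar> <= (K * (norm h)\<^sup>2) * (L * ball_mass * ((LB x. \<bar>w x\<bar>) + (LB x. \<bar>q x\<bar>)))"
 proof (rule ball_weight)
  fix v
  show "\<bar>\<rho> (v + h) - \<rho> v - h \<bullet> D v\<bar> <= (K * (norm h)\<^sup>2) * indicator (cball 0 (R + 1)) v"
  proof (cases "norm v <= R + 1")
   case True then show ?thesis using taylor[of v h] by simp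
  next
   case False
   moreover have "norm v <= norm (v + h) + norm h" using norm_triangle_ineq4[of "v + h" h] by simp
   ultimately have "R < norm (v + h)" "R < norm v" using h by auto
   then show ?thesis using supp D_supp False by simp
  qed
 qed (use K0 in auto)
 finally show ?thesis by (simp add: TB_def mult_ac)
qed

end

lemmas [measurable del] = wq_measurable

end

lemma le_of_le_add_inverse_nat:
 fixes a b C :: real
 assumes "!!n::nat. m < real n ==> a <= b + C / real n" shows "a <= b"
proof (rule field_le_epsilon)
 fix e :: real assume e: "0 < e"
 obtain n :: nat where n: "max (max m 0) (C / e) < real n" using reals_Archimedean2 by blast
 then have "C / real n <= e" using e by (simp add: field_simps)
 then show "a <= b + e" using assms[of n] n by simp
qed

section \<open>Quadratic increments and the splitting of the doubled spatial term\<close>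

context entropy_data
begin

context
 fixes w q :: "'a => real"
 assumes w: "L1 w" and q: "L1 q"
begin

lemma wq_measurable' [measurable]: "w \<in> Borel" "q \<in> Borel"
 using w q by auto

lemma TB_swap: "TB q w = TB w q" by (simp add: TB_def[OF w q] TB_def[OF q w] add.commute)

lemma JJ_small:
 assumes n: "norm \<zeta> < real n"
 shows "\<bar>real n * (JJ w q ((1 / real n) *\<^sub>R \<zeta>) - JJ w q 0) - \<zeta> \<bullet> VV w q\<bar> <= ((norm \<zeta>)\<^sup>2 * TB w q) / real n"
proof -
 have n0: "0 < real n" using n norm_ge_zero[of \<zeta>] by linarith
 let ?h = "(1 / real n) *\<^sub>R \<zeta>"
 have "norm ?h <= 1" using n n0 by simp
 from mult_left_mono[OF JJ_taylor[OF w q this], of "real n"]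
 have "real n * \<bar>JJ w q ?h - JJ w q 0 - ?h \<bullet> VV w q\<bar> <= real n * ((norm ?h)\<^sup>2 * TB w q)" using n0 by simp
 also have "real n * ((norm ?h)\<^sup>2 * TB w q) = ((norm \<zeta>)\<^sup>2 * TB w q) / real n"
  using n0 by (simp add: power_divide power2_eq_square)
 also have "real n * \<bar>JJ w q ?h - JJ w q 0 - ?h \<bullet> VV w q\<bar> = \<bar>real n * (JJ w q ?h - JJ w q 0 - ?h \<bullet> VV w q)\<bar>"
  using n0 by (simp add: abs_mult)
 also have "real n * (JJ w q ?h - JJ w q 0 - ?h \<bullet> VV w q) = real n * (JJ w q ?h - JJ w q 0) - \<zeta> \<bullet> VV w q"
  using n0 by (simp add: right_diff_distrib)
 finally show ?thesis .
qed

context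
 fixes \<beta> Sk :: real
 assumes Sk: "!!z. (NN v. ennreal \<bar>\<rho> (v + z) - \<rho> v\<bar>) <= ennreal (Sk * norm z)" "0 <= Sk"
  and \<beta>: "!!z. osc w z <= \<beta> * norm z" "0 <= \<beta>"
begin

text \<open>The displacement is divided into n equal steps. By the second-difference bound the
  increment of step k + 1 exceeds that of the first by at most c k |\<zeta>|^2 / n^2; the sum of
  these excesses is n (n - 1) / 2 times c |\<zeta>|^2 / n^2, whence the factor 1/2, while n times
  the first increment tends to \<open>\<zeta> \<bullet> VV\<close>.\<close>

lemma JJ_quadratic: "JJ w q \<zeta> - JJ w q 0 - \<zeta> \<bullet> VV w q <= L * \<beta> * Sk * (norm \<zeta>)\<^sup>2 / 2"
proof -
 let ?c = "L * \<beta> * Sk"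
 have c0: "0 <= ?c" using L0 \<beta>(2) Sk(2) by simp
 have tel: "JJ w q (real k *\<^sub>R h) - JJ w q 0 <= real k * (JJ w q h - JJ w q 0) + ?c * (norm h)\<^sup>2 * (real k * (real k - 1) / 2)" for k h
 proof (induction k)
  case (Suc k)
  have "JJ w q (real k *\<^sub>R h + h) - JJ w q (real k *\<^sub>R h) - (JJ w q h - JJ w q 0) <= ?c * norm h * norm (real k *\<^sub>R h)"
   by (rule JJ_second_difference[OF w q Sk \<beta>(1)])
  also have "... = ?c * (norm h)\<^sup>2 * real k" by (simp add: power2_eq_square)
  finally have 1: "JJ w q (real k *\<^sub>R h + h) - JJ w q (real k *\<^sub>R h) - (JJ w q h - JJ w q 0) <= ?c * (norm h)\<^sup>2 * real k" .
  have 2: "real (Suc k) *\<^sub>R h = real k *\<^sub>R h + h" by (simp add: scaleR_left_distrib add.commute)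
  have 3: "?c * (norm h)\<^sup>2 * (real k * (real k - 1) / 2) + ?c * (norm h)\<^sup>2 * real k = ?c * (norm h)\<^sup>2 * (real (Suc k) * (real (Suc k) - 1) / 2)"
   unfolding distrib_left[symmetric] by (rule arg_cong[where f="(*) _"]) (simp add: field_simps)
  have 4: "real (Suc k) * (JJ w q h - JJ w q 0) = real k * (JJ w q h - JJ w q 0) + (JJ w q h - JJ w q 0)" by (simp add: algebra_simps)
  show ?case unfolding 2 3[symmetric] 4 using Suc 1 by linarith
 qed simp
 show ?thesis
 proof (rule le_of_le_add_inverse_nat)
  fix n :: nat assume n: "norm \<zeta> < real n"
  then have n0: "0 < real n" using norm_ge_zero[of \<zeta>] by linarith
  let ?h = "(1 / real n) *\<^sub>R \<zeta>"
  have e: "real n *\<^sub>R ?h = \<zeta>" using n0 by simp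
  have "(norm ?h)\<^sup>2 * (real n * (real n - 1) / 2) = (norm \<zeta>)\<^sup>2 / 2 * ((real n - 1) / real n)"
   using n0 by (simp add: power_divide power2_eq_square field_simps)
  also have "... <= (norm \<zeta>)\<^sup>2 / 2 * 1" using n0 by (intro mult_left_mono) auto
  finally have "(norm ?h)\<^sup>2 * (real n * (real n - 1) / 2) <= (norm \<zeta>)\<^sup>2 / 2" by simp
  from mult_left_mono[OF this c0]
  have "?c * (norm ?h)\<^sup>2 * (real n * (real n - 1) / 2) <= ?c * (norm \<zeta>)\<^sup>2 / 2" by (simp add: mult.assoc)
  moreover have "real n * (JJ w q ?h - JJ w q 0) <= \<zeta> \<bullet> VV w q + ((norm \<zeta>)\<^sup>2 * TB w q) / real n"
   using abs_le_D1[OF JJ_small[OF n]] by linarith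
  ultimately show "JJ w q \<zeta> - JJ w q 0 - \<zeta> \<bullet> VV w q <= ?c * (norm \<zeta>)\<^sup>2 / 2 + ((norm \<zeta>)\<^sup>2 * TB w q) / real n"
   using tel[of n ?h] unfolding e by linarith
 qed
qed

text \<open>The Lipschitz bound for \<open>JJ\<close>, used for small displacements in the direction
  of \<open>VV\<close> itself, gives |v|^2 <= L \<beta> |v|.\<close>

lemma VV_norm_le: "norm (VV w q) <= L * \<beta>"
proof -
 let ?v = "VV w q"
 have "?v \<bullet> ?v <= L * \<beta> * norm ?v"
 proof (rule le_of_le_add_inverse_nat)
  fix n :: nat assume n: "norm ?v < real n"
  then have n0: "0 < real n" using norm_ge_zero[of ?v] by linarith
  have "JJ w q ((1 / real n) *\<^sub>R ?v) - JJ w q 0 <= L * (\<beta> * norm ((1 / real n) *\<^sub>R ?v))"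
   by (rule order_trans[OF JJ_diff_le[OF w q] mult_left_mono[OF \<beta>(1) L0]])
  from mult_left_mono[OF this, of "real n"]
  have "real n * (JJ w q ((1 / real n) *\<^sub>R ?v) - JJ w q 0) <= L * \<beta> * norm ?v" using n0 by simp
  then show "?v \<bullet> ?v <= L * \<beta> * norm ?v + ((norm ?v)\<^sup>2 * TB w q) / real n"
   using abs_le_D2[OF JJ_small[OF n]] by linarith
 qed
 then have "norm ?v * norm ?v <= L * \<beta> * norm ?v" by (simp add: power2_norm_eq_inner[symmetric] power2_eq_square)
 then show ?thesis using L0 \<beta>(2) by (cases "norm ?v = 0") (auto simp: mult_le_cancel_right)
qed

end

lemma XX_measurable: "XX w q \<in> Borel"
proof -
 have m: "(%(z, v). sgn (w (snd v) - q (fst v)) * (A (w (snd v + z)) - A (w (snd v))) * \<rho> (snd v - fst v)) \<in> borel_measurable (borel \<Otimes>\<^sub>M lborel2)"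
  unfolding split_beta' sgn_real_def by measurable
 show ?thesis
  using lborel.borel_measurable_lebesgue_integral[OF m[unfolded lborel_prod]]
  unfolding XX_def[abs_def] lborel_prod by (simp add: split_beta')
qed

lemma XX_bounded: "\<bar>XX w q z\<bar> <= L * (2 * (LB x. \<bar>w x\<bar>))"
 by (rule order_trans[OF XX_abs_le[OF w q] mult_left_mono[OF osc_le[OF w] L0]])

lemma FL_integrable: "integrable lborel2 (%(y, x). entropy_flux f (w x) (q y) \<bullet> D (x - y))"
proof (rule pair_integrable_dominated[OF w q, where m="%v. F * norm (D v)"])
 show "L1 (%v. F * norm (D v))" using integrable_D by simp
 show "(%(y, x). entropy_flux f (w x) (q y) \<bullet> D (x - y)) \<in> borel_measurable lborel2"
  unfolding split_beta' entropy_flux_def sgn_real_def by measurable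
 fix y x
 have "norm (entropy_flux f (w x) (q y) \<bullet> D (x - y)) <= norm (entropy_flux f (w x) (q y)) * norm (D (x - y))"
  using Cauchy_Schwarz_ineq2 by simp
 also have "... <= (F * (\<bar>w x\<bar> + \<bar>q y\<bar>)) * norm (D (x - y))" by (intro mult_right_mono flux_diff_le) simp
 finally show "norm (entropy_flux f (w x) (q y) \<bullet> D (x - y)) <= (\<bar>w x\<bar> + \<bar>q y\<bar>) * \<bar>F * norm (D (x - y))\<bar>"
  using F0 by (simp add: mult_ac)
qed

lemma FL_swap: "FL q w = - FL w q"
proof -
 have m: "(%(y, x). entropy_flux f (q x) (w y) \<bullet> D (x - y)) \<in> borel_measurable lborel2"
  unfolding split_beta' entropy_flux_def sgn_real_def by measurable
 have "FL q w = (\<integral>(y, x). entropy_flux f (q y) (w x) \<bullet> D (y - x) \<partial>lborel2)"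
  unfolding FL_def using pair_integral_swap[OF m] by (simp add: split_beta')
 also have "... = (\<integral>z. - (case z of (y, x) => entropy_flux f (w x) (q y) \<bullet> D (x - y)) \<partial>lborel2)"
 proof (rule integral_cong[OF refl])
  fix v :: "'a \<times> 'a"
  obtain y x where v: "v = (y, x)" by (cases v)
  show "(case v of (y, x) => entropy_flux f (q y) (w x) \<bullet> D (y - x)) = - (case v of (y, x) => entropy_flux f (w x) (q y) \<bullet> D (x - y))"
   unfolding v prod.case entropy_flux_sym[of f "q y"] D_swap[of y x] by simp
 qed
 finally show ?thesis by (simp add: FL_def)
qed

text \<open>Finiteness of \<open>outm \<kappa> \<mu>\<close> and the bound on each jump by twice the
  L1 norm allow the integral over z to be taken last.\<close>

lemma outer_fubini:
 "integrable lborel2 (%(y, x). sgn (w x - q y) * outer w x * \<rho> (x - y))"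
 "(\<integral>(y, x). sgn (w x - q y) * outer w x * \<rho> (x - y) \<partial>lborel2) = (LINT z|outm \<kappa> \<mu>. XX w q z)"
proof -
 interpret P: pair_sigma_finite "lborel :: ('a \<times> 'a) measure" "outm \<kappa> \<mu>"
  by (intro pair_sigma_finite.intro lborel.sigma_finite_measure_axioms out.sigma_finite_measure_axioms)
 let ?\<Theta> = "%v z. sgn (w (snd v) - q (fst v)) * (A (w (snd v + z)) - A (w (snd v))) * \<rho> (snd v - fst v)"
 have "(%(v, z). ?\<Theta> v z) \<in> borel_measurable (lborel2 \<Otimes>\<^sub>M outm \<kappa> \<mu>)"
  unfolding split_beta' sgn_real_def by measurable
 then have m: "(%(v, z). ?\<Theta> v z) \<in> borel_measurable (lborel \<Otimes>\<^sub>M outm \<kappa> \<mu>)" unfolding lborel_prod .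
 have i: "integrable (lborel \<Otimes>\<^sub>M outm \<kappa> \<mu>) (%(v, z). ?\<Theta> v z)"
 proof (rule integrableI_bounded[OF m])
  have "(\<integral>\<^sup>+vz. ennreal (norm (case vz of (v, z) => ?\<Theta> v z)) \<partial>(lborel \<Otimes>\<^sub>M outm \<kappa> \<mu>))
    = (\<integral>\<^sup>+z. (NN v. ennreal \<bar>?\<Theta> v z\<bar>) \<partial>outm \<kappa> \<mu>)"
   using m by (subst P.nn_integral_snd[symmetric]) (auto simp: split_beta')
  also have "... <= (\<integral>\<^sup>+z. ennreal (L * (2 * (LB x. \<bar>w x\<bar>))) \<partial>outm \<kappa> \<mu>)"
  proof (rule nn_integral_mono)
   fix z
   have j: "L1 (%v::'a \<times> 'a. \<bar>A (w (snd v + z)) - A (w (snd v))\<bar> * \<rho> (snd v - fst v))"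
    using A_shift_pair(1)[OF w q, of z] unfolding lborel_prod by (simp add: split_beta')
   have "(NN v. ennreal \<bar>?\<Theta> v z\<bar>) <= (NN v. ennreal (\<bar>A (w (snd v + z)) - A (w (snd v))\<bar> * \<rho> (snd v - fst v)))"
    using nonneg by (intro nn_integral_mono ennreal_leI) (auto simp: abs_mult sgn_real_def)
   also have "... = ennreal (LB v. \<bar>A (w (snd v + z)) - A (w (snd v))\<bar> * \<rho> (snd v - fst v))"
    using j nonneg by (intro nn_integral_eq_integral) auto
   also have "... <= ennreal (L * (2 * (LB x. \<bar>w x\<bar>)))"
    using order_trans[OF A_shift_pair(2)[OF w q, of z] mult_left_mono[OF osc_le[OF w] L0]] unfolding lborel_prod
    by (intro ennreal_leI) (simp add: split_beta')
   finally show "(NN v. ennreal \<bar>?\<Theta> v z\<bar>) <= ennreal (L * (2 * (LB x. \<bar>w x\<bar>)))" .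
  qed
  also have "... < \<infinity>" by (simp add: ennreal_mult_less_top out.emeasure_eq_measure)
  finally show "(\<integral>\<^sup>+vz. ennreal (norm (case vz of (v, z) => ?\<Theta> v z)) \<partial>(lborel \<Otimes>\<^sub>M outm \<kappa> \<mu>)) < \<infinity>" .
 qed
 have inner: "(LINT z|outm \<kappa> \<mu>. ?\<Theta> v z) = sgn (w (snd v) - q (fst v)) * outer w (snd v) * \<rho> (snd v - fst v)" for v
  unfolding outer_def by simp
 show "integrable lborel2 (%(y, x). sgn (w x - q y) * outer w x * \<rho> (x - y))"
  using P.integrable_fst[OF i] unfolding inner lborel_prod by (simp add: split_beta')
 show "(\<integral>(y, x). sgn (w x - q y) * outer w x * \<rho> (x - y) \<partial>lborel2) = (LINT z|outm \<kappa> \<mu>. XX w q z)"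
  using P.Fubini_integral[OF i] unfolding inner XX_def lborel_prod by (simp add: split_beta')
qed

text \<open>The point of this splitting is symmetry: \<open>FL\<close> and \<open>VV\<close> change
  sign when the two functions are exchanged, \<open>LI\<close> is small with the cutoff, and only
  the jump term calls for an inequality.\<close>

lemma ent_split:
 "(LB y. LB x. ent w (q y) y x) = FL w q + drift \<bullet> VV w q + LI w q + (LINT z|outm \<kappa> \<mu>. XX w q z)"
proof -
 have iD: "integrable lborel2 (%(y, x). \<bar>A (w x) - A (q y)\<bar> *\<^sub>R D (x - y))"
  by (rule A_pair_integrable[OF w q integrable_D])
 have i2: "integrable lborel2 (%v. drift \<bullet> (case v of (y, x) => \<bar>A (w x) - A (q y)\<bar> *\<^sub>R D (x - y)))" using iD by simp
 have i3: "integrable lborel2 (%(y, x). \<bar>A (w x) - A (q y)\<bar> * Lin (x - y))"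
  using A_pair_integrable[OF w q Lin_integrable] by simp
 note i4 = outer_fubini(1)
 have v: "drift \<bullet> VV w q = (\<integral>v. drift \<bullet> (case v of (y, x) => \<bar>A (w x) - A (q y)\<bar> *\<^sub>R D (x - y)) \<partial>lborel2)"
  unfolding VV_def using iD by simp
 have "(LB y. LB x. ent w (q y) y x) = (\<integral>(y, x). ent w (q y) y x \<partial>lborel2)"
  by (rule lborel_pair.integral_fst[OF ent_pair_integrable(1)[OF w q]])
 also have "... = (\<integral>v. (((case v of (y, x) => entropy_flux f (w x) (q y) \<bullet> D (x - y)) + drift \<bullet> (case v of (y, x) => \<bar>A (w x) - A (q y)\<bar> *\<^sub>R D (x - y)))
   + (case v of (y, x) => \<bar>A (w x) - A (q y)\<bar> * Lin (x - y))) + (case v of (y, x) => sgn (w x - q y) * outer w x * \<rho> (x - y)) \<partial>lborel2)"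
  by (rule integral_cong[OF refl]) (auto simp: ent_def inner_add_left)
 also have "... = FL w q + drift \<bullet> VV w q + LI w q + (LINT z|outm \<kappa> \<mu>. XX w q z)"
  unfolding integral_add[OF integrable_add[OF integrable_add[OF FL_integrable i2] i3] i4]
   integral_add[OF integrable_add[OF FL_integrable i2] i3]
   integral_add[OF FL_integrable i2] v outer_fubini(2) FL_def LI_def ..
 finally show ?thesis .
qed

end

lemmas [measurable del] = wq_measurable'

text \<open>With the same flux and measure on both sides the convective and drift terms cancel by
  antisymmetry and the jump terms add up to at most 0. Only the jumps below the cutoff
  remain.\<close>

lemma contraction_static:
 assumes w: "L1 w" and q: "L1 q"
 shows "(LB y. LB x. ent w (q y) y x) + (LB y. LB x. ent q (w y) y x) <= 2 * (small_moment \<kappa> \<mu> * TB w q)"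
proof -
 have i: "integrable (outm \<kappa> \<mu>) (XX w q)" "integrable (outm \<kappa> \<mu>) (XX q w)"
  using XX_measurable[OF w q] XX_measurable[OF q w] XX_bounded[OF w q] XX_bounded[OF q w]
  by (auto intro!: finite_integrable_bounded[OF out.finite_measure_axioms] simp: measurable_cong_sets[OF sets_outm refl])
 have "(LINT z|outm \<kappa> \<mu>. XX w q z) + (LINT z|outm \<kappa> \<mu>. XX q w z) = (LINT z|outm \<kappa> \<mu>. XX w q z + XX q w z)"
  by (rule integral_add[OF i, symmetric])
 also have "... <= (LINT z|outm \<kappa> \<mu>. 0)"
  by (rule integral_mono[OF integrable_add[OF i]]) (auto intro: XX_sum_le[OF w q])
 finally have "(LINT z|outm \<kappa> \<mu>. XX w q z) + (LINT z|outm \<kappa> \<mu>. XX q w z) <= 0" by simp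
 then show ?thesis
  unfolding ent_split[OF w q] ent_split[OF q w] FL_swap[OF w q] VV_swap[OF w q]
  using abs_le_D1[OF LI_le[OF w q]] abs_le_D1[OF LI_le[OF q w]] TB_swap[OF w q] by simp
qed

end

section \<open>Two different equations compared at fixed times\<close>

locale data_pair = U: entropy_data \<rho> D K R f F A L B \<mu> \<kappa> + V: entropy_data \<rho> D K R g G A L B \<nu> \<kappa>
 for \<rho> :: "'a::euclidean_space => real" and D K R f F A L B \<mu> \<kappa> g G \<nu>
begin

text \<open>A signed quantity: for \<kappa> <= min r 1 it is the integral of z over r < |z| <= 1 if
  r <= 1, and minus the integral over 1 < |z| <= r otherwise (\<open>annulus_eq\<close>). It is the
  part of the drift that compensation on the ball of radius r does not absorb.\<close>

definition annulus :: "real => 'a measure => 'a" where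
 "annulus r M = (LINT z|outm \<kappa> M. indicator {z. norm z <= 1} z *\<^sub>R z) - (LINT z|outm \<kappa> M. indicator {z. norm z <= r} z *\<^sub>R z)"

text \<open>On |z| <= r the compensator is shared out as X = XX w q + z . VV and Y = XX q w - z .
  VV, which leaves X + Y <= 0 intact. Then X and Y are at most the increments of \<open>JJ\<close>
  at -z and z minus their first-order parts, quadratic by \<open>JJ_quadratic\<close>; for |z| > r
  the translation modulus is used. What the compensators leave of the two drifts is the annulus
  term, paired with \<open>VV\<close>.\<close>

lemma static_bound:
 assumes w: "L1 w" and q: "L1 q" and u0: "BV u0" and le: "!!z. osc w z <= osc u0 z"
  and Sk: "!!z. (NN v. ennreal \<bar>\<rho> (v + z) - \<rho> v\<bar>) <= ennreal (Sk * norm z)" "0 <= Sk"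
  and FG: "!!s t. norm ((f s - g s) - (f t - g t)) <= Fd * \<bar>s - t\<bar>" and r: "0 < r"
 shows "(LB y. LB x. U.ent w (q y) y x) + (LB y. LB x. V.ent q (w y) y x)
  <= Fd * BV_seminorm u0
   + (LINT z|outm \<kappa> (tv_measure \<mu> \<nu>). (if norm z <= r then L * BV_seminorm u0 * Sk * (norm z)\<^sup>2 / 2 else L * osc u0 z))
   + L * BV_seminorm u0 * norm (annulus r \<mu> - annulus r \<nu>)
   + (small_moment \<kappa> \<mu> + small_moment \<kappa> \<nu>) * U.TB w q"
proof -
 let ?\<beta> = "BV_seminorm u0"
 let ?v = "U.VV w q"
 let ?I = "indicator {z::'a. norm z <= r} :: 'a => real"
 let ?\<xi> = "%z. if norm z <= r then L * ?\<beta> * Sk * (norm z)\<^sup>2 / 2 else L * osc u0 z"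
 have iu0: "L1 u0" using u0 by (simp add: BV_def)
 have [measurable]: "u0 \<in> Borel" using iu0 by auto
 have \<beta>0: "0 <= ?\<beta>" by (rule BV_seminorm_nonneg[OF u0])
 have \<beta>: "osc w z <= ?\<beta> * norm z" for z using order_trans[OF le osc_le_BV[OF u0]] by (simp add: mult.commute)
 note quad = U.JJ_quadratic[OF w q Sk \<beta> \<beta>0]
 have L0: "0 <= L" by (rule U.L0)
 have flux: "U.FL w q + V.FL q w <= Fd * ?\<beta>"
 proof -
  have "U.FL w q + V.FL q w = U.FL w q - V.FL w q" by (simp add: V.FL_swap[OF w q])
  also have "... = (\<integral>z. (case z of (y, x) => entropy_flux f (w x) (q y) \<bullet> D (x - y)) - (case z of (y, x) => entropy_flux g (w x) (q y) \<bullet> D (x - y)) \<partial>lborel2)"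
   unfolding U.FL_def V.FL_def by (rule integral_diff[OF U.FL_integrable[OF w q] V.FL_integrable[OF w q], symmetric])
  also have "... = (\<integral>(y, x). entropy_flux (%s. f s - g s) (w x) (q y) \<bullet> D (x - y) \<partial>lborel2)"
   by (rule integral_cong[OF refl]) (auto simp: entropy_flux_def inner_diff_left scaleR_diff_right algebra_simps)
  also have "... = (LB y. LB x. entropy_flux (%s. f s - g s) (w x) (q y) \<bullet> D (x - y))"
   by (rule lborel_pair.integral_fst[OF U.flux_BV_bound(1)[OF FG w q u0 le], symmetric])
  also have "... <= Fd * ?\<beta>" by (rule U.flux_BV_bound(2)[OF FG w q u0 le])
  finally show ?thesis .
 qed
 have cut: "integrable (outm \<kappa> \<mu>) (%z. indicator {z. norm z <= s} z *\<^sub>R z)" "integrable (outm \<kappa> \<nu>) (%z. indicator {z. norm z <= s} z *\<^sub>R z)" for s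
  by (rule U.out.integrable_const_bound[of _ "\<bar>s\<bar>"], (auto simp: indicator_def)[2])
    (rule V.out.integrable_const_bound[of _ "\<bar>s\<bar>"], (auto simp: indicator_def)[2])
 have iXm: "XX' \<in> borel_measurable (outm \<kappa> M)" if "XX' \<in> Borel" for XX' :: "'a => real" and M :: "'a measure"
  using that by (simp add: measurable_cong_sets[OF sets_outm refl])
 have iX: "integrable (outm \<kappa> \<mu>) (U.XX w q)"
  by (rule finite_integrable_bounded[OF U.out.finite_measure_axioms iXm[OF U.XX_measurable[OF w q]] U.XX_bounded[OF w q]])
 have iY: "integrable (outm \<kappa> \<nu>) (V.XX q w)"
  by (rule finite_integrable_bounded[OF V.out.finite_measure_axioms iXm[OF V.XX_measurable[OF q w]] V.XX_bounded[OF q w]])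
 let ?X = "%z. U.XX w q z + ?I z *\<^sub>R z \<bullet> ?v" and ?Y = "%z. V.XX q w z - ?I z *\<^sub>R z \<bullet> ?v"
 have cutv: "\<bar>?I z *\<^sub>R z \<bullet> ?v\<bar> <= r * norm ?v" for z
 proof (cases "norm z <= r")
  case True then show ?thesis using order_trans[OF Cauchy_Schwarz_ineq2[of z ?v] mult_right_mono[OF True norm_ge_zero]] by simp
 qed (use r in simp)
 \<comment> \<open>A crude common bound whose only purpose is integrability against the finite
   measures; it does not enter the estimate.\<close>
 define C where "C = L * (2 * (LB x. \<bar>w x\<bar>)) + L * (2 * (LB x. \<bar>q x\<bar>)) + r * norm ?v + L * ?\<beta> * Sk * r\<^sup>2 / 2 + L * (2 * (LB x. \<bar>u0 x\<bar>))"
 have nn: "0 <= L * (2 * (LB x. \<bar>w x\<bar>))" "0 <= L * (2 * (LB x. \<bar>q x\<bar>))" "0 <= r * norm ?v" "0 <= L * ?\<beta> * Sk * r\<^sup>2 / 2" "0 <= L * (2 * (LB x. \<bar>u0 x\<bar>))"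
  using L0 \<beta>0 Sk(2) r by (auto intro!: mult_nonneg_nonneg integral_nonneg_AE)
 have levy: "(LINT z|outm \<kappa> \<mu>. ?X z) + (LINT z|outm \<kappa> \<nu>. ?Y z) <= (LINT z|outm \<kappa> (tv_measure \<mu> \<nu>). ?\<xi> z)"
 proof (rule levy_cancellation[OF U.levy V.levy U.\<kappa>0])
  show "?X \<in> Borel" "?Y \<in> Borel"
   using U.XX_measurable[OF w q] V.XX_measurable[OF q w] by measurable
  show "?\<xi> \<in> Borel" unfolding osc_def by measurable
  fix z
  show "\<bar>?X z\<bar> <= C" using abs_triangle_ineq[of "U.XX w q z" "?I z *\<^sub>R z \<bullet> ?v"] U.XX_bounded[OF w q, of z] cutv[of z] nn unfolding C_def by linarith
  show "\<bar>?Y z\<bar> <= C" using abs_triangle_ineq4[of "V.XX q w z" "?I z *\<^sub>R z \<bullet> ?v"] V.XX_bounded[OF q w, of z] cutv[of z] nn unfolding C_def by linarith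
  show "0 <= ?\<xi> z" using L0 \<beta>0 Sk(2) osc_nonneg[of u0 z] by simp
  show "?\<xi> z <= C"
  proof (cases "norm z <= r")
   case True
   have "L * ?\<beta> * Sk * (norm z)\<^sup>2 / 2 <= L * ?\<beta> * Sk * r\<^sup>2 / 2"
    using L0 \<beta>0 Sk(2) power_mono[OF True norm_ge_zero, of 2] by (intro divide_right_mono mult_left_mono) auto
   then have "L * ?\<beta> * Sk * (norm z)\<^sup>2 / 2 <= C" using nn unfolding C_def by linarith
   then show ?thesis using True by simp
  next
   case False
   have "L * osc u0 z <= L * (2 * (LB x. \<bar>u0 x\<bar>))" by (rule mult_left_mono[OF osc_le[OF iu0] L0])
   then have "L * osc u0 z <= C" using nn unfolding C_def by linarith
   then show ?thesis using False by simp
  qed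
  show "?X z + ?Y z <= 0" using U.XX_sum_le[OF w q, of z] by simp
  have far: "L * osc w z <= L * osc u0 z" by (rule mult_left_mono[OF le L0])
  show "?X z <= ?\<xi> z"
  proof (cases "norm z <= r")
   case True
   have "U.XX w q z <= U.JJ w q (- z) - U.JJ w q 0" by (rule U.XX_le[OF w q])
   moreover have "U.JJ w q (- z) - U.JJ w q 0 + z \<bullet> ?v <= L * ?\<beta> * Sk * (norm z)\<^sup>2 / 2" using quad[of "- z"] by simp
   ultimately have "U.XX w q z + z \<bullet> ?v <= L * ?\<beta> * Sk * (norm z)\<^sup>2 / 2" by linarith
   then show ?thesis using True by simp
  next
   case False
   have "U.XX w q z <= L * osc u0 z" using abs_le_D1[OF U.XX_abs_le[OF w q, of z]] far by linarith
   then show ?thesis using False by simp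
  qed
  \<comment> \<open>Exchanging the two functions reflects the displacement (\<open>JJ_swap\<close>),
    so the jumps of the second equation are also estimated by translating \<open>w\<close>. This is
    why the modulus of the first datum alone appears.\<close>
  show "?Y z <= ?\<xi> z"
  proof -
   have Y: "V.XX q w z <= U.JJ w q z - U.JJ w q 0"
    using U.XX_le[OF q w, of z] U.JJ_swap[OF w q, of "- z"] U.JJ_swap[OF w q, of 0] by simp
   show ?thesis
   proof (cases "norm z <= r")
    case True
    have "V.XX q w z - z \<bullet> ?v <= L * ?\<beta> * Sk * (norm z)\<^sup>2 / 2" using Y quad[of z] by linarith
    then show ?thesis using True by simp
   next
    case False
    have "V.XX q w z <= L * osc u0 z" using Y U.JJ_diff_le[OF w q, of z] far by linarith
    then show ?thesis using False by simp
   qed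
  qed
 qed
 have X: "(LINT z|outm \<kappa> \<mu>. ?X z) = (LINT z|outm \<kappa> \<mu>. U.XX w q z) + (LINT z|outm \<kappa> \<mu>. ?I z *\<^sub>R z) \<bullet> ?v"
  by (simp only: integral_add[OF iX integrable_inner_left[OF cut(1)]] integral_inner_left[OF cut(1)])
 have Y: "(LINT z|outm \<kappa> \<nu>. ?Y z) = (LINT z|outm \<kappa> \<nu>. V.XX q w z) - (LINT z|outm \<kappa> \<nu>. ?I z *\<^sub>R z) \<bullet> ?v"
  by (simp only: integral_diff[OF iY integrable_inner_left[OF cut(2)]] integral_inner_left[OF cut(2)])
 have "(annulus r \<mu> - annulus r \<nu>) \<bullet> ?v <= norm (annulus r \<mu> - annulus r \<nu>) * norm ?v" by (rule norm_cauchy_schwarz)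
 also have "... <= norm (annulus r \<mu> - annulus r \<nu>) * (L * ?\<beta>)"
  by (intro mult_left_mono U.VV_norm_le[OF w q Sk \<beta> \<beta>0]) simp
 finally have ann: "(annulus r \<mu> - annulus r \<nu>) \<bullet> ?v <= L * ?\<beta> * norm (annulus r \<mu> - annulus r \<nu>)" by (simp add: mult_ac)
 have dr: "U.drift \<bullet> ?v - V.drift \<bullet> ?v = (annulus r \<mu> - annulus r \<nu>) \<bullet> ?v + (LINT z|outm \<kappa> \<mu>. ?I z *\<^sub>R z) \<bullet> ?v - (LINT z|outm \<kappa> \<nu>. ?I z *\<^sub>R z) \<bullet> ?v"
  by (simp add: annulus_def U.drift_def V.drift_def inner_diff_left)
 have li: "U.LI w q + V.LI q w <= (small_moment \<kappa> \<mu> + small_moment \<kappa> \<nu>) * U.TB w q"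
  using abs_le_D1[OF U.LI_le[OF w q]] abs_le_D1[OF V.LI_le[OF q w]] U.TB_swap[OF w q] by (simp add: distrib_right)
 show ?thesis
  unfolding U.ent_split[OF w q] V.ent_split[OF q w] U.VV_swap[OF w q]
  using flux levy[unfolded X Y] ann dr li by (simp only: inner_minus_right)
qed

end

subsection \<open>Stability of solutions\<close>

text \<open>Replacing \<open>q y\<close> by \<open>q x\<close> costs the modulus of \<open>q\<close>
  averaged over the kernel. The modulus may be linear, which brings in the first moment, or just
  small on the support; the first is used for the final estimate, the second before any rate is
  available.\<close>

lemma (in curve_data) HH_close:
 assumes w: "L1 w" and q: "L1 q"
  and le: "!!v. norm v <= R ==> osc q v <= c * norm v + e" and c: "0 <= c" "0 <= e"
  and m: "(NN v. ennreal (norm v) * ennreal (\<rho> v)) <= ennreal m" "0 <= m"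
 shows "\<bar>HH w q - (LB x. \<bar>w x - q x\<bar>)\<bar> <= c * m + e"
proof -
 have [measurable]: "w \<in> Borel" "q \<in> Borel" using w q by auto
 note a = ent_pair_integrable(2)[OF w q]
 have d: "L1 (%x. \<bar>w x - q x\<bar>)" using w q by auto
 note b = integrable_pair_x[OF d integrable_rho]
 have "HH w q - (LB x. \<bar>w x - q x\<bar>) = (\<integral>v. (case v of (y, x) => \<bar>w x - q y\<bar> * \<rho> (x - y)) - (case v of (y, x) => \<bar>w x - q x\<bar> * \<rho> (x - y)) \<partial>lborel2)"
  unfolding integral_diff[OF a b] HH_def lborel_pair.integral_fst[OF a] pair_integral_x[OF d integrable_rho] integral_rho by simp
 then have "ennreal \<bar>HH w q - (LB x. \<bar>w x - q x\<bar>)\<bar>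
   <= (\<integral>\<^sup>+v. ennreal (norm ((case v of (y, x) => \<bar>w x - q y\<bar> * \<rho> (x - y)) - (case v of (y, x) => \<bar>w x - q x\<bar> * \<rho> (x - y)))) \<partial>lborel2)"
  using integral_norm_bound_ennreal[OF integrable_diff[OF a b]] by simp
 also have "... <= (\<integral>\<^sup>+(y, x). ennreal (\<bar>q y - q x\<bar> * \<rho> (x - y)) \<partial>lborel2)"
 proof (intro nn_integral_mono)
  fix v :: "'a \<times> 'a"
  obtain y x where v: "v = (y, x)" by (cases v)
  have "\<bar>\<bar>w x - q y\<bar> - \<bar>w x - q x\<bar>\<bar> * \<rho> (x - y) <= \<bar>q y - q x\<bar> * \<rho> (x - y)"
   by (intro mult_right_mono nonneg) linarith
  then show "ennreal (norm ((case v of (y, x) => \<bar>w x - q y\<bar> * \<rho> (x - y)) - (case v of (y, x) => \<bar>w x - q x\<bar> * \<rho> (x - y)))) <= (case v of (y, x) => ennreal (\<bar>q y - q x\<bar> * \<rho> (x - y)))"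
   using nonneg[of "x - y"] by (simp add: v left_diff_distrib[symmetric] abs_mult ennreal_leI)
 qed
 also have "... = (NN x. (NN y. ennreal (\<bar>q y - q x\<bar> * \<rho> (x - y))))"
  by (subst lborel_pair.nn_integral_snd[symmetric]) (auto simp: split_beta')
 also have "... = (NN x. (NN v. ennreal (\<bar>q (x - v) - q x\<bar> * \<rho> v)))"
 proof (rule nn_integral_cong)
  fix x
  show "(NN y. ennreal (\<bar>q y - q x\<bar> * \<rho> (x - y))) = (NN v. ennreal (\<bar>q (x - v) - q x\<bar> * \<rho> v))"
   using nn_integral_lborel_reflect[of "%v. ennreal (\<bar>q (x - v) - q x\<bar> * \<rho> v)" x] by simp
 qed
 also have "... = (NN v. (NN x. ennreal (\<bar>q (x - v) - q x\<bar> * \<rho> v)))"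
  by (rule lborel_pair.Fubini') measurable
 also have "... <= (NN v. ennreal c * (ennreal (norm v) * ennreal (\<rho> v)) + ennreal e * ennreal (\<rho> v))"
 proof (intro nn_integral_mono)
  fix v
  have "(NN x. ennreal (\<bar>q (x - v) - q x\<bar> * \<rho> v)) = (NN x. ennreal \<bar>q (x + - v) - q x\<bar> * ennreal (\<rho> v))"
   using nonneg[of v] by (simp add: ennreal_mult)
  also have "... = ennreal (osc q v) * ennreal (\<rho> v)"
   using osc_nn_integral[OF q, of "- v"] osc_minus[OF q, of v] by (simp add: nn_integral_multc)
  also have "... <= ennreal ((c * norm v + e) * \<rho> v)"
  proof (cases "norm v <= R")
   case True
   show ?thesis using nonneg[of v] c le[OF True] osc_nonneg[of q v]
    by (simp add: ennreal_mult[symmetric] ennreal_leI mult_right_mono)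
  qed (use supp[of v] in simp)
  also have "... = ennreal c * (ennreal (norm v) * ennreal (\<rho> v)) + ennreal e * ennreal (\<rho> v)"
   using nonneg[of v] c by (simp add: ennreal_mult[symmetric] ennreal_plus[symmetric] distrib_right mult.assoc del: ennreal_plus)
  finally show "(NN x. ennreal (\<bar>q (x - v) - q x\<bar> * \<rho> v)) <= ennreal c * (ennreal (norm v) * ennreal (\<rho> v)) + ennreal e * ennreal (\<rho> v)" .
 qed
 also have "... = ennreal c * (NN v. ennreal (norm v) * ennreal (\<rho> v)) + ennreal e"
  using mass by (subst nn_integral_add) (auto simp: nn_integral_cmult)
 also have "... <= ennreal c * ennreal m + ennreal e" by (intro add_right_mono mult_left_mono m) simp
 also have "... = ennreal (c * m + e)" using c m by (simp add: ennreal_mult[symmetric] ennreal_plus[symmetric] del: ennreal_plus)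
 finally show ?thesis using c m by (subst (asm) ennreal_le_iff) auto
qed

lemma (in kernel) first_moment: "(NN v. ennreal (norm v) * ennreal (\<rho> v)) <= ennreal R"
proof -
 have "(NN v. ennreal (norm v) * ennreal (\<rho> v)) <= (NN v. ennreal R * ennreal (\<rho> v))"
 proof (intro nn_integral_mono)
  fix v show "ennreal (norm v) * ennreal (\<rho> v) <= ennreal R * ennreal (\<rho> v)"
   using supp[of v] by (cases "norm v <= R") (auto intro!: mult_right_mono ennreal_leI)
 qed
 then show ?thesis using mass by (simp add: nn_integral_cmult)
qed

text \<open>Moving x and y together leaves \<rho> (x - y) unchanged, so the inequality for the
  translate at y is the original one at y + z.\<close>

lemma (in slice_curve) translate: "slice_curve \<rho> D K R f F A L B \<mu> \<kappa> T N (%x. u0 (x + z)) (%p. U (fst p + z, snd p))"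
proof -
 let ?U = "%p. U (fst p + z, snd p)"
 interpret C: curve_data \<rho> D K R f F A L B \<mu> \<kappa> T N "%x. u0 (x + z)" ?U
 proof unfold_locales
  show "0 < T" by (rule T0)
  show "?U \<in> borel_measurable (borel \<Otimes>\<^sub>M borel)" by measurable
  show "L1 (%x. u0 (x + z))" by (rule integrable_lborel_shift[OF u0_int])
  fix t assume t: "t \<in> {0..T}"
  show "L1 (%x. ?U (x, t))" using integrable_lborel_shift[OF U_int[OF t], of z] by simp
  show "(LB x. \<bar>?U (x, t)\<bar>) <= N"
   using U_bd[OF t] integral_lborel_shift[of "%x. \<bar>U (x, t)\<bar>" z] by simp
 qed
 have u0m [measurable]: "u0 \<in> Borel" using u0_int by auto
 show ?thesis
 proof unfold_locales
  fix \<alpha> \<alpha>' :: "real => real" and l C k y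
  assume \<alpha>: "\<alpha> \<in> smooth_supp l" "!!t. 0 <= \<alpha> t" "!!t. (\<alpha> has_real_derivative \<alpha>' t) (at t)" "!!t. \<bar>\<alpha> t\<bar> <= C" "!!t. \<bar>\<alpha>' t\<bar> <= C"
   and [measurable]: "\<alpha>' \<in> Borel"
  have e: "C.test_integrand \<alpha> \<alpha>' k y x t = test_integrand \<alpha> \<alpha>' k (y + z) (x + z) t" for x t
   by (simp add: C.test_integrand_def test_integrand_def ent_def outer_def add.assoc add.commute[of z])
  have 1: "(LB x. C.test_integrand \<alpha> \<alpha>' k y x t) = (LB x. test_integrand \<alpha> \<alpha>' k (y + z) x t)" for t
   unfolding e
  proof (rule integral_lborel_shift)
   show "(%x. test_integrand \<alpha> \<alpha>' k (y + z) x t) \<in> Borel"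
    unfolding test_integrand_def ent_def entropy_flux_def sgn_real_def by measurable
  qed
  have 2: "(LB x. \<bar>?U (x, T) - k\<bar> * \<rho> (x - y)) = (LB x. \<bar>U (x, T) - k\<bar> * \<rho> (x - (y + z)))"
   using integral_lborel_shift[of "%x. \<bar>U (x, T) - k\<bar> * \<rho> (x - (y + z))" z] by simp
  have 3: "(LB x. \<bar>u0 (x + z) - k\<bar> * \<rho> (x - y)) = (LB x. \<bar>u0 x - k\<bar> * \<rho> (x - (y + z)))"
   using integral_lborel_shift[of "%x. \<bar>u0 x - k\<bar> * \<rho> (x - (y + z))" z] by simp
  show "0 <= (LB t. ind T t * (LB x. C.test_integrand \<alpha> \<alpha>' k y x t))
    - \<alpha> T * (LB x. \<bar>?U (x, T) - k\<bar> * \<rho> (x - y)) + \<alpha> 0 * (LB x. \<bar>u0 (x + z) - k\<bar> * \<rho> (x - y))"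
   unfolding 1 2 3 by (rule slice[OF \<alpha>]) measurable
 next
  fix s e :: real assume s: "s \<in> {0..T}" "0 < e"
  have "(LB x. \<bar>?U (x, t) - ?U (x, s)\<bar>) = (LB x. \<bar>U (x, t) - U (x, s)\<bar>)" for t
   using integral_lborel_shift[of "%x. \<bar>U (x, t) - U (x, s)\<bar>" z] by simp
  then show "\<exists>d>0. \<forall>t\<in>{0..T}. \<bar>t - s\<bar> < d \<longrightarrow> (LB x. \<bar>?U (x, t) - ?U (x, s)\<bar>) < e"
   using sl_cont[OF s] by (simp only:)
 qed
qed

lemma (in slice_curve) TB_le:
 assumes i: "L1 w" "L1 q" and n: "(LB x. \<bar>w x\<bar>) <= N1" "(LB x. \<bar>q x\<bar>) <= N2"
 shows "TB w q <= L * K * ball_mass * (N1 + N2)"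
 unfolding TB_def[OF i] using L0 K0 n by (intro mult_left_mono add_mono mult_nonneg_nonneg) (auto simp: ball_mass_def integral_nonneg_AE)

text \<open>The quantification over all kernels and cutoffs allows both to be chosen later, and lets
  a fixed kernel be kept while the cutoff tends to 0.\<close>

locale weak_solution =
 fixes f :: "real => 'a::euclidean_space" and F A L B \<mu> T N u0 U
 assumes curve: "kernel \<rho> D K R ==> 0 < \<kappa> ==> \<kappa> <= 1 ==> slice_curve \<rho> D K R f F A L B \<mu> \<kappa> T N u0 U"
begin

text \<open>The two curves solve the same equation, so by \<open>contraction_static\<close> the rate
  is twice the small moment times \<open>M\<close>. Since \<open>M\<close> does not depend on the
  cutoff, the rate vanishes in the limit.\<close>

lemma contraction_translate:
 assumes k: "kernel \<rho> D K R" and t: "t \<in> {0..T}"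
 shows "curve_data.HH \<rho> (%x. U (x, t)) (%x. U (x + z, t)) <= curve_data.HH \<rho> u0 (%x. u0 (x + z))"
proof -
 let ?U = "%p. U (fst p + z, snd p)"
 let ?\<kappa> = "%n. 1 / real (Suc n)"
 have \<kappa>: "0 < ?\<kappa> n" "?\<kappa> n <= 1" for n by auto
 interpret S: slice_curve \<rho> D K R f F A L B \<mu> 1 T N u0 U by (rule curve[OF k]) auto
 let ?H = "curve_data.HH \<rho>"
 define M where "M = L * K * S.ball_mass * (N + N)"
 have le: "?H (%x. U (x, t)) (%x. U (x + z, t)) <= ?H u0 (%x. u0 (x + z)) + 2 * (small_moment (?\<kappa> n) \<mu> * M) * t" for n
 proof -
  interpret A: slice_curve \<rho> D K R f F A L B \<mu> "?\<kappa> n" T N u0 U by (rule curve[OF k \<kappa>])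
  interpret V: slice_curve \<rho> D K R f F A L B \<mu> "?\<kappa> n" T N "%x. u0 (x + z)" ?U by (rule A.translate)
  interpret P: curve_pair \<rho> D K R f F A L B \<mu> "?\<kappa> n" T N u0 U f F \<mu> "%x. u0 (x + z)" ?U ..
  have "?H (A.sl t) (V.sl t) <= ?H u0 (%x. u0 (x + z)) + 2 * (small_moment (?\<kappa> n) \<mu> * M) * t"
  proof (rule P.doubling[OF _ t])
   fix t s assume ts: "t \<in> {0..T}" "s \<in> {0..T}"
   have "A.PP (A.sl t) (V.sl s) + A.PP (V.sl s) (A.sl t) <= 2 * (small_moment (?\<kappa> n) \<mu> * A.TB (A.sl t) (V.sl s))"
    unfolding A.PP_def by (rule A.contraction_static[OF A.U_int[OF ts(1)] V.U_int[OF ts(2)]])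
   also have "... <= 2 * (small_moment (?\<kappa> n) \<mu> * M)"
    unfolding M_def by (intro mult_left_mono A.TB_le A.U_int V.U_int A.U_bd V.U_bd ts A.small0) simp
   finally show "A.PP (A.sl t) (V.sl s) + V.PP (V.sl s) (A.sl t) <= 2 * (small_moment (?\<kappa> n) \<mu> * M)" .
  qed
  then show ?thesis by simp
 qed
 have "(%n. ?H u0 (%x. u0 (x + z)) + 2 * (small_moment (?\<kappa> n) \<mu> * M) * t) \<longlonglongrightarrow> ?H u0 (%x. u0 (x + z)) + 2 * (0 * M) * t"
  by (intro tendsto_intros small_moment_tendsto S.levy)
 then have "?H (%x. U (x, t)) (%x. U (x + z, t)) <= ?H u0 (%x. u0 (x + z)) + 2 * (0 * M) * t"
  by (rule LIMSEQ_le_const) (use le in auto)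
 then show ?thesis by simp
qed

text \<open>The kernel is removed from \<open>contraction_translate\<close> at the fixed time t. No
  rate is known for U(t) at this stage, so the kernel is taken so small that continuity of
  translations in L1, at time t and for the datum, makes both errors at most e / 2.\<close>

lemma osc_le_initial:
 assumes t: "t \<in> {0..T}"
 shows "osc (%x. U (x, t)) z <= osc u0 z"
proof (rule field_le_epsilon)
 fix e :: real assume "0 < e"
 then have e: "0 < e / 2" by simp
 \<comment> \<open>An arbitrary kernel, serving only to make the integrability of the slices
   available before the actual kernel is chosen.\<close>
 obtain \<rho>' :: "'a => real" and D' K' R' where k': "kernel \<rho>' D' K' R'" by (rule exists_small_kernel[OF zero_less_one]) blast
 interpret S': slice_curve \<rho>' D' K' R' f F A L B \<mu> 1 T N u0 U by (rule curve[OF k']) auto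
 let ?w = "%x. U (x, t)" and ?wz = "%x. U (x + z, t)" and ?u0z = "%x. u0 (x + z)"
 have i: "L1 ?w" "L1 ?wz" "L1 ?u0z"
  using S'.U_int[OF t] integrable_lborel_shift[OF S'.U_int[OF t], of z] integrable_lborel_shift[OF S'.u0_int, of z] by auto
 obtain d1 where d1: "0 < d1" "!!v. norm v < d1 ==> osc ?wz v < e / 2" by (rule osc_tendsto_0[OF i(2) e]) blast
 obtain d2 where d2: "0 < d2" "!!v. norm v < d2 ==> osc ?u0z v < e / 2" by (rule osc_tendsto_0[OF i(3) e]) blast
 have d: "0 < min d1 d2 / 2" "min d1 d2 / 2 < d1" "min d1 d2 / 2 < d2" using d1 d2 by (auto simp: min_def)
 obtain \<rho> :: "'a => real" and D K R where k: "kernel \<rho> D K R" "R <= min d1 d2 / 2" by (rule exists_small_kernel[OF d(1)]) blast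
 interpret S: slice_curve \<rho> D K R f F A L B \<mu> 1 T N u0 U by (rule curve[OF k(1)]) auto
 have a1: "\<bar>S.HH ?w ?wz - (LB x. \<bar>?w x - ?wz x\<bar>)\<bar> <= 0 * R + e / 2"
 proof (rule S.HH_close[OF i(1,2)])
  show "osc ?wz v <= 0 * norm v + e / 2" if "norm v <= R" for v using d1(2)[of v] that k(2) d by simp
 qed (use e S.first_moment S.R0 in auto)
 have a2: "\<bar>S.HH u0 ?u0z - (LB x. \<bar>u0 x - ?u0z x\<bar>)\<bar> <= 0 * R + e / 2"
 proof (rule S.HH_close[OF S.u0_int i(3)])
  show "osc ?u0z v <= 0 * norm v + e / 2" if "norm v <= R" for v using d2(2)[of v] that k(2) d by simp
 qed (use e S.first_moment S.R0 in auto)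
 have a3: "S.HH ?w ?wz <= S.HH u0 ?u0z" by (rule contraction_translate[OF k(1) t])
 have o: "osc ?w z = (LB x. \<bar>?w x - ?wz x\<bar>)" "osc u0 z = (LB x. \<bar>u0 x - ?u0z x\<bar>)"
  unfolding osc_def by (rule integral_cong[OF refl], rule abs_minus_commute)+
 show "osc ?w z <= osc u0 z + e"
  unfolding o using abs_le_D2[OF a1] abs_le_D1[OF a2] a3 by linarith
qed

end

section \<open>Choice of the kernel scale and conclusion\<close>

text \<open>With j = 1 + \<open>\<eta>\<close>, the expression 2 e j^2 a + Y / (2 e) is minimal at e
  = sqrt (Y / a) / (2 j), with value 2 j sqrt (a Y). Taking Y = X + \<open>\<eta>\<close> keeps e
  positive even if X = 0, and \<open>\<eta>\<close> tends to 0 at the end.\<close>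

lemma optimise_scale:
 fixes E a b X :: real
 assumes le: "!!e \<eta>. 0 < e ==> 0 < \<eta> ==> E <= b * (2 * (e * (1 + \<eta>)\<^sup>2 * a) + X / (2 * e))"
  and a: "0 < a" and b: "0 <= b" and X: "0 <= X"
 shows "E <= b * (2 * sqrt (a * X))"
proof -
 let ?h = "%n::nat. inverse (real (Suc n))"
 have "E <= b * (2 * (1 + ?h n) * sqrt (a * (X + ?h n)))" for n
 proof -
  define \<eta> where "\<eta> = ?h n"
  have \<eta>: "0 < \<eta>" by (simp add: \<eta>_def)
  define Y where "Y = X + \<eta>"
  have Y: "0 < Y" "X <= Y" using X \<eta> by (auto simp: Y_def)
  define s where "s = sqrt (Y / a)"
  have s: "0 < s" "s * s * a = Y" using Y a by (auto simp: s_def)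
  define e where "e = s / (2 * (1 + \<eta>))"
  have e: "0 < e" using s \<eta> by (simp add: e_def)
  have sq: "sqrt (a * Y) = s * a"
   by (rule real_sqrt_unique) (use s a in \<open>auto simp: power2_eq_square mult_ac\<close>)
  have j: "2 * (s / (2 * j) * j\<^sup>2 * a) = j * (s * a)" "s * s * a / (2 * (s / (2 * j))) = j * (s * a)" if "0 < j" for j
   using that s(1) by (simp_all add: power2_eq_square field_simps)
  have e1: "2 * (e * (1 + \<eta>)\<^sup>2 * a) = (1 + \<eta>) * (s * a)" and e2: "Y / (2 * e) = (1 + \<eta>) * (s * a)"
   unfolding e_def s(2)[symmetric] by (rule j, use \<eta> in simp)+
  have "E <= b * (2 * (e * (1 + \<eta>)\<^sup>2 * a) + X / (2 * e))" by (rule le[OF e \<eta>])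
  also have "... <= b * (2 * (e * (1 + \<eta>)\<^sup>2 * a) + Y / (2 * e))"
   using e Y b by (intro mult_left_mono add_left_mono divide_right_mono) auto
  also have "... = b * (2 * (1 + \<eta>) * sqrt (a * Y))" unfolding e1 e2 sq by simp
  finally show ?thesis by (simp only: \<eta>_def Y_def)
 qed
 moreover have "(%n. b * (2 * (1 + ?h n) * sqrt (a * (X + ?h n)))) \<longlonglongrightarrow> b * (2 * (1 + 0) * sqrt (a * (X + 0)))"
  by (intro tendsto_intros LIMSEQ_inverse_real_of_nat)
 ultimately have "E <= b * (2 * (1 + 0) * sqrt (a * (X + 0)))" by (intro LIMSEQ_le_const) auto
 then show ?thesis by simp
qed

text \<open>The total variation measure is at most the sum of the two measures, so their common
  moment condition carries over.\<close>

lemma tv_integrable: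
 fixes h :: "'a::euclidean_space => real"
 assumes \<mu>: "levy_measure \<mu>" and \<nu>: "levy_measure \<nu>" and [measurable]: "h \<in> Borel"
  and le: "!!z. \<bar>h z\<bar> <= C * min ((norm z)\<^sup>2) 1"
 shows "integrable (tv_measure \<mu> \<nu>) h"
proof (rule integrableI_bounded)
 have s: "sets (tv_measure \<mu> \<nu>) = sets (restrict_space borel (- {0}))" using levy_sets[OF \<mu>] by simp
 show "h \<in> borel_measurable (tv_measure \<mu> \<nu>)" by (rule punctured_measurable[OF s]) simp
 have r: "radon_punctured \<mu>" "radon_punctured \<nu>" using \<mu> \<nu> by (auto simp: levy_measure_def)
 have C0: "0 <= C"
 proof -
  obtain b :: 'a where "b \<in> Basis" using nonempty_Basis by blast
  then show ?thesis using order_trans[OF abs_ge_zero le[of b]] by simp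
 qed
 let ?m = "%z::'a. ennreal (min ((norm z)\<^sup>2) 1)"
 have m: "?m \<in> borel_measurable M" if "sets M = sets (restrict_space borel (- {0}))" for M :: "'a measure"
 proof -
  have "(%z::'a. min ((norm z)\<^sup>2) 1) \<in> borel_measurable M" by (rule punctured_measurable[OF that]) measurable
  then show ?thesis by measurable
 qed
 have "(\<integral>\<^sup>+z. ennreal (norm (h z)) \<partial>tv_measure \<mu> \<nu>) <= (\<integral>\<^sup>+z. ennreal C * ?m z \<partial>tv_measure \<mu> \<nu>)"
  using le C0 by (intro nn_integral_mono) (simp add: ennreal_mult[symmetric] ennreal_leI)
 also have "... = ennreal C * (\<integral>\<^sup>+z. ?m z \<partial>tv_measure \<mu> \<nu>)" by (rule nn_integral_cmult[OF m[OF s]])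
 also have "... <= ennreal C * ((\<integral>\<^sup>+z. ?m z \<partial>\<mu>) + (\<integral>\<^sup>+z. ?m z \<partial>\<nu>))"
 proof (intro mult_left_mono nn_integral_le_add_measure m[OF s])
  show "sets \<mu> = sets (tv_measure \<mu> \<nu>)" by simp
  show "sets \<nu> = sets (tv_measure \<mu> \<nu>)" using levy_sets[OF \<mu>] levy_sets[OF \<nu>] by simp
  show "emeasure (tv_measure \<mu> \<nu>) E <= emeasure \<mu> E + emeasure \<nu> E" if "E \<in> sets (tv_measure \<mu> \<nu>)" for E
   using that tv_value_le_add[OF r, of E] emeasure_tv_measure[OF r, of E] by simp
 qed simp
 also have "... < \<infinity>" using \<mu> \<nu> by (simp add: levy_measure_def ennreal_mult_less_top)
 finally show "(\<integral>\<^sup>+z. ennreal (norm (h z)) \<partial>tv_measure \<mu> \<nu>) < \<infinity>" .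
qed

lemma min_square_ge:
 assumes "0 < r" "r < x" shows "1 <= (1 / min (r\<^sup>2) 1) * min (x\<^sup>2) (1::real)"
proof -
 have "min (r\<^sup>2) 1 <= min (x\<^sup>2) 1" using power_mono[of r x 2] assms by (intro min.mono) auto
 moreover have "0 < min (r\<^sup>2) 1" using assms by simp
 ultimately show ?thesis by (simp add: field_simps)
qed

lemma square_le_min: "0 <= x ==> x <= r ==> x\<^sup>2 <= max (r\<^sup>2) 1 * min (x\<^sup>2) (1::real)"
proof -
 assume x: "0 <= x" "x <= r"
 show ?thesis
 proof (cases "x\<^sup>2 <= 1")
  case True then show ?thesis using mult_right_mono[of 1 "max (r\<^sup>2) 1" "x\<^sup>2"] by simp
 next
  case False then show ?thesis using power_mono[OF x(2,1), of 2] by simp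
 qed
qed

lemma tv_outer_bound:
 fixes u0 :: "'a::euclidean_space => real"
 assumes \<mu>: "levy_measure \<mu>" and \<nu>: "levy_measure \<nu>" and \<kappa>: "0 < \<kappa>" and r: "0 < r" and c: "0 <= c" "0 <= L" and u0: "L1 u0"
 shows "(LINT z|outm \<kappa> (tv_measure \<mu> \<nu>). (if norm z <= r then c * (norm z)\<^sup>2 / 2 else L * osc u0 z))
   <= c / 2 * (LINT z:{z. 0 < norm z \<and> norm z <= r}|tv_measure \<mu> \<nu>. (norm z)\<^sup>2) + L * (LINT z:{z. norm z > r}|tv_measure \<mu> \<nu>. osc u0 z)"
proof -
 let ?tv = "tv_measure \<mu> \<nu>" and ?A = "{z::'a. 0 < norm z \<and> norm z <= r}" and ?B = "{z::'a. norm z > r}"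
 let ?\<xi> = "%z. if norm z <= r then c * (norm z)\<^sup>2 / 2 else L * osc u0 z"
 have [measurable]: "u0 \<in> Borel" using u0 by auto
 have [measurable]: "osc u0 \<in> Borel" unfolding osc_def[abs_def] by measurable
 have s: "sets ?tv = sets (restrict_space borel (- {0}))" using levy_sets[OF \<mu>] by simp
 have iA: "integrable ?tv (%z. indicator ?A z * (norm z)\<^sup>2)"
  by (rule tv_integrable[OF \<mu> \<nu>, where C="max (r\<^sup>2) 1"]) (use square_le_min[OF norm_ge_zero] in \<open>auto simp: indicator_def\<close>)
 let ?M = "2 * (LB x. \<bar>u0 x\<bar>)"
 have M0: "0 <= ?M" by (simp add: integral_nonneg_AE)
 have iB: "integrable ?tv (%z. indicator ?B z * osc u0 z)"
 proof (rule tv_integrable[OF \<mu> \<nu>, where C="?M * (1 / min (r\<^sup>2) 1)"])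
  fix z
  show "\<bar>indicator ?B z * osc u0 z\<bar> <= ?M * (1 / min (r\<^sup>2) 1) * min ((norm z)\<^sup>2) 1"
  proof (cases "r < norm z")
   case True
   have "osc u0 z * 1 <= ?M * ((1 / min (r\<^sup>2) 1) * min ((norm z)\<^sup>2) 1)"
    using osc_le[OF u0] osc_nonneg M0 min_square_ge[OF r True] by (intro mult_mono) auto
   then show ?thesis using True osc_nonneg[of u0 z] by simp
  qed (use M0 in simp)
 qed measurable
 have "(LINT z|outm \<kappa> ?tv. ?\<xi> z) = (LINT z:{z. \<kappa> < norm z}|?tv. ?\<xi> z)"
  by (rule integral_outm[OF s, symmetric]) measurable
 also have "... <= (LINT z|?tv. c / 2 * (indicator ?A z * (norm z)\<^sup>2) + L * (indicator ?B z * osc u0 z))"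
  unfolding set_lebesgue_integral_def real_scaleR_def
 proof (rule integral_mono_AE'[OF _ AE_I2 AE_I2])
  show "integrable ?tv (%z. c / 2 * (indicator ?A z * (norm z)\<^sup>2) + L * (indicator ?B z * osc u0 z))"
   by (intro integrable_add integrable_mult_right iA iB)
  fix z
  show "indicator {z. \<kappa> < norm z} z * ?\<xi> z <= c / 2 * (indicator ?A z * (norm z)\<^sup>2) + L * (indicator ?B z * osc u0 z)"
   using \<kappa> c osc_nonneg[of u0 z] by (auto simp: indicator_def)
  show "0 <= c / 2 * (indicator ?A z * (norm z)\<^sup>2) + L * (indicator ?B z * osc u0 z)" using c osc_nonneg[of u0 z] by (auto simp: indicator_def)
 qed
 also have "... = c / 2 * (LINT z|?tv. indicator ?A z * (norm z)\<^sup>2) + L * (LINT z|?tv. indicator ?B z * osc u0 z)"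
  by (simp only: integral_add[OF integrable_mult_right[OF iA] integrable_mult_right[OF iB]] integral_mult_right_zero)
 finally show ?thesis by (simp add: set_lebesgue_integral_def)
qed

lemma (in data_pair) annulus_eq:
 assumes M: "levy_measure M" and r: "0 < r" and \<kappa>: "\<kappa> <= min r 1"
 shows "annulus r M = (if r <= 1 then 1 else - 1 :: real) *\<^sub>R (LINT z:{z. min r 1 < norm z \<and> norm z <= max r 1}|M. z)"
proof -
 interpret fm: finite_measure "outm \<kappa> M" by (rule finite_outm_levy[OF M U.\<kappa>0])
 let ?S = "{z::'a. min r 1 < norm z \<and> norm z <= max r 1}" and ?c = "if r <= 1 then 1 else - 1 :: real"
 have cut: "integrable (outm \<kappa> M) (%z. indicator {z. norm z <= s} z *\<^sub>R z)" for s
  by (rule fm.integrable_const_bound[of _ "\<bar>s\<bar>"]) (auto simp: indicator_def)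
 have "annulus r M = (LINT z|outm \<kappa> M. indicator {z. norm z <= 1} z *\<^sub>R z - indicator {z. norm z <= r} z *\<^sub>R z)"
  unfolding annulus_def by (rule integral_diff[OF cut cut, symmetric])
 also have "... = (LINT z|outm \<kappa> M. ?c *\<^sub>R (indicator ?S z *\<^sub>R z))"
  by (rule integral_cong[OF refl]) (auto simp: indicator_def)
 also have "... = ?c *\<^sub>R (LINT z|outm \<kappa> M. indicator ?S z *\<^sub>R z)" by (rule integral_scaleR_right)
 also have "(LINT z|outm \<kappa> M. indicator ?S z *\<^sub>R z) = (LINT z:{z. \<kappa> < norm z}|M. indicator ?S z *\<^sub>R z)"
  by (rule integral_outm[OF levy_sets[OF M], symmetric]) measurable
 also have "... = (LINT z:?S|M. z)"
  unfolding set_lebesgue_integral_def by (rule integral_cong[OF refl]) (use \<kappa> in \<open>auto simp: indicator_def\<close>)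
 finally show ?thesis .
qed

lemma (in data_pair) norm_annulus_diff:
 assumes r: "0 < r" and \<kappa>: "\<kappa> <= min r 1"
 shows "norm (annulus r \<mu> - annulus r \<nu>) = norm ((LINT z:{z. min r 1 < norm z \<and> norm z <= max r 1}|\<mu>. z) - (LINT z:{z. min r 1 < norm z \<and> norm z <= max r 1}|\<nu>. z))"
 unfolding annulus_eq[OF U.levy r \<kappa>] annulus_eq[OF V.levy r \<kappa>] scaleR_right_diff_distrib[symmetric] norm_scaleR by simp

text \<open>Two costs compete in the scale e. Passing from \<open>HH\<close> to L1 distances at time
  t and for the data costs the seminorm times the first moment each time, hence 2 e a; the jumps up
  to r contribute T L sqrt d S2 / (2 e), with the 1/2 from \<open>JJ_quadratic\<close> and sqrt d /
  e from the kernel. Both carry the factor \<open>BV_seminorm u0\<close>, so it stays outside the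
  root.\<close>

theorem stability_estimate:
 fixes f g :: "real => 'a::euclidean_space"
 assumes U: "weak_solution f F A L B \<mu> T N u0 U" and V: "weak_solution g G A L B \<nu> T N v0 V"
  and u0: "BV u0" and FG: "!!s t. norm ((f s - g s) - (f t - g t)) <= Fd * \<bar>s - t\<bar>"
  and r: "0 < r" and t: "t \<in> {0..T}"
 defines "d \<equiv> real DIM('a)" and "tv \<equiv> tv_measure \<mu> \<nu>"
 defines "S2 \<equiv> (LINT z:{z. 0 < norm z \<and> norm z <= r}|tv. (norm z)\<^sup>2)"
  and "Out \<equiv> (LINT z:{z. norm z > r}|tv. osc u0 z)"
  and "Ann \<equiv> norm ((LINT z:{z. min r 1 < norm z \<and> norm z <= max r 1}|\<mu>. z) - (LINT z:{z. min r 1 < norm z \<and> norm z <= max r 1}|\<nu>. z))"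
 shows "(LB x. \<bar>U (x, t) - V (x, t)\<bar>) <= (LB x. \<bar>u0 x - v0 x\<bar>) + BV_seminorm u0 * T * Fd
  + BV_seminorm u0 * (2 * sqrt (d * sqrt d / (d + 1) * (T * L * sqrt d * S2)))
  + BV_seminorm u0 * T * L * Ann + T * L * Out"
proof -
 let ?\<beta> = "BV_seminorm u0" and ?a = "d * sqrt d / (d + 1)" and ?X = "T * L * sqrt d * S2"
 interpret U: weak_solution f F A L B \<mu> T N u0 U by fact
 interpret V: weak_solution g G A L B \<nu> T N v0 V by fact
 have d1: "1 <= d" using DIM_positive[where 'a='a] by (simp add: d_def Suc_le_eq)
 have \<beta>0: "0 <= ?\<beta>" by (rule BV_seminorm_nonneg[OF u0])
 have Fd0: "0 <= Fd" using order_trans[OF norm_ge_zero FG[of 1 0]] by simp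
 have T0: "0 <= T" using t by simp
 have S20: "0 <= S2" unfolding S2_def set_lebesgue_integral_def by (intro integral_nonneg_AE) auto
 have Out0: "0 <= Out" unfolding Out_def set_lebesgue_integral_def by (intro integral_nonneg_AE AE_I2) (simp add: osc_nonneg)
 have Ann0: "0 <= Ann" by (simp add: Ann_def)
 have L0: "0 <= L"
 proof -
  obtain \<rho> :: "'a => real" and D K R where "kernel \<rho> D K R" by (rule exists_small_kernel[OF zero_less_one]) blast
  then interpret S: slice_curve \<rho> D K R f F A L B \<mu> 1 T N u0 U by (rule U.curve) auto
  show ?thesis by (rule S.L0)
 qed
 have step: "(LB x. \<bar>U (x, t) - V (x, t)\<bar>) - (LB x. \<bar>u0 x - v0 x\<bar>) - ?\<beta> * T * Fd - ?\<beta> * T * L * Ann - T * L * Out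
   <= ?\<beta> * (2 * (e * (1 + \<eta>)\<^sup>2 * ?a) + ?X / (2 * e))" if e: "0 < e" and \<eta>: "0 < \<eta>" for e \<eta>
 proof -
  obtain \<rho> :: "'a => real" and D K R where k: "kernel \<rho> D K R"
   and Sk': "!!z. (NN w. ennreal \<bar>\<rho> (w + z) - \<rho> w\<bar>) <= ennreal (sqrt (real DIM('a)) * norm z / e)"
   and m: "(NN w. ennreal (norm w) * ennreal (\<rho> w)) <= ennreal (e * (1 + \<eta>)\<^sup>2 * (real DIM('a) * sqrt (real DIM('a)) / (real DIM('a) + 1)))"
   by (rule kernel_exists[OF e \<eta>]) blast
  define Sk where "Sk = sqrt d / e"
  have Sk: "(NN w. ennreal \<bar>\<rho> (w + z) - \<rho> w\<bar>) <= ennreal (Sk * norm z)" for z using Sk'[of z] by (simp add: Sk_def d_def)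
  have Sk0: "0 <= Sk" using e d1 by (simp add: Sk_def)
  define mm where "mm = e * (1 + \<eta>)\<^sup>2 * ?a"
  have mm: "(NN w. ennreal (norm w) * ennreal (\<rho> w)) <= ennreal mm" using m by (simp add: mm_def d_def)
  have mm0: "0 <= mm" using e d1 by (simp add: mm_def)
  interpret SU: slice_curve \<rho> D K R f F A L B \<mu> 1 T N u0 U by (rule U.curve[OF k]) auto
  interpret SV: slice_curve \<rho> D K R g G A L B \<nu> 1 T N v0 V by (rule V.curve[OF k]) auto
  let ?H = "curve_data.HH \<rho>" and ?\<kappa> = "%n. 1 / real (Suc n)"
  let ?u = "%x. U (x, t)" and ?v = "%x. V (x, t)"
  define \<Xi> where "\<Xi> = L * ?\<beta> * Sk / 2 * S2 + L * Out"
  define M where "M = L * K * SU.ball_mass * (N + N)"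
  let ?C = "%n. Fd * ?\<beta> + \<Xi> + L * ?\<beta> * Ann + (small_moment (?\<kappa> n) \<mu> + small_moment (?\<kappa> n) \<nu>) * M"
  have le: "?H ?u ?v <= ?H u0 v0 + ?C n * t" if n: "?\<kappa> n <= min r 1" for n
  proof -
   have \<kappa>: "0 < ?\<kappa> n" "?\<kappa> n <= 1" by auto
   interpret A: slice_curve \<rho> D K R f F A L B \<mu> "?\<kappa> n" T N u0 U by (rule U.curve[OF k \<kappa>])
   interpret B: slice_curve \<rho> D K R g G A L B \<nu> "?\<kappa> n" T N v0 V by (rule V.curve[OF k \<kappa>])
   interpret P: curve_pair \<rho> D K R f F A L B \<mu> "?\<kappa> n" T N u0 U g G \<nu> v0 V ..
   interpret Q: data_pair \<rho> D K R f F A L B \<mu> "?\<kappa> n" g G \<nu> ..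
   have "?H (A.sl t) (B.sl t) <= ?H u0 v0 + ?C n * t"
   proof (rule P.doubling[OF _ t])
    fix t s assume ts: "t \<in> {0..T}" "s \<in> {0..T}"
    have "A.PP (A.sl t) (B.sl s) + B.PP (B.sl s) (A.sl t)
     <= Fd * ?\<beta> + (LINT z|outm (?\<kappa> n) (tv_measure \<mu> \<nu>). (if norm z <= r then L * ?\<beta> * Sk * (norm z)\<^sup>2 / 2 else L * osc u0 z))
      + L * ?\<beta> * norm (Q.annulus r \<mu> - Q.annulus r \<nu>)
      + (small_moment (?\<kappa> n) \<mu> + small_moment (?\<kappa> n) \<nu>) * A.TB (A.sl t) (B.sl s)"
     unfolding A.PP_def B.PP_def
     by (rule Q.static_bound[OF A.U_int[OF ts(1)] B.U_int[OF ts(2)] u0 U.osc_le_initial[OF ts(1)] Sk Sk0 FG r])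
    also have "... <= ?C n"
    proof (intro add_mono order_refl)
     show "(LINT z|outm (?\<kappa> n) (tv_measure \<mu> \<nu>). (if norm z <= r then L * ?\<beta> * Sk * (norm z)\<^sup>2 / 2 else L * osc u0 z)) <= \<Xi>"
      unfolding \<Xi>_def S2_def Out_def tv_def
      by (rule tv_outer_bound[OF SU.levy SV.levy \<kappa>(1) r _ L0 SU.u0_int]) (use L0 \<beta>0 Sk0 in simp)
     show "L * ?\<beta> * norm (Q.annulus r \<mu> - Q.annulus r \<nu>) <= L * ?\<beta> * Ann"
      unfolding Q.norm_annulus_diff[OF r n] Ann_def ..
     show "(small_moment (?\<kappa> n) \<mu> + small_moment (?\<kappa> n) \<nu>) * A.TB (A.sl t) (B.sl s) <= (small_moment (?\<kappa> n) \<mu> + small_moment (?\<kappa> n) \<nu>) * M"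
      unfolding M_def by (intro mult_left_mono A.TB_le A.U_int B.U_int A.U_bd B.U_bd ts add_nonneg_nonneg A.small0 B.small0)
    qed
    finally show "A.PP (A.sl t) (B.sl s) + B.PP (B.sl s) (A.sl t) <= ?C n" .
   qed
   then show ?thesis by simp
  qed
  have "(%n. ?H u0 v0 + ?C n * t) \<longlonglongrightarrow> ?H u0 v0 + (Fd * ?\<beta> + \<Xi> + L * ?\<beta> * Ann + (0 + 0) * M) * t"
   by (intro tendsto_intros small_moment_tendsto SU.levy SV.levy)
  moreover have "\<exists>m. \<forall>n\<ge>m. ?H ?u ?v <= ?H u0 v0 + ?C n * t"
  proof -
   have "0 < min r 1" using r by simp
   then obtain m :: nat where m: "inverse (real (Suc m)) < min r 1" using reals_Archimedean by blast
   show ?thesis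
   proof (intro exI[of _ m] allI impI le)
    fix n assume "m <= n"
    then have "?\<kappa> n <= 1 / real (Suc m)" by (intro divide_left_mono) auto
    then show "?\<kappa> n <= min r 1" using m by (simp only: inverse_eq_divide)
   qed
  qed
  ultimately have HH: "?H ?u ?v <= ?H u0 v0 + (Fd * ?\<beta> + \<Xi> + L * ?\<beta> * Ann + (0 + 0) * M) * t" by (rule LIMSEQ_le_const)
  have \<Xi>0: "0 <= \<Xi>" unfolding \<Xi>_def using L0 \<beta>0 Sk0 S20 Out0 by (intro add_nonneg_nonneg mult_nonneg_nonneg) auto
  have "0 <= Fd * ?\<beta> + \<Xi> + L * ?\<beta> * Ann" using \<Xi>0 Fd0 \<beta>0 L0 Ann0 by simp
  then have "(Fd * ?\<beta> + \<Xi> + L * ?\<beta> * Ann) * t <= (Fd * ?\<beta> + \<Xi> + L * ?\<beta> * Ann) * T" using t by (intro mult_left_mono) auto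
  with HH have HH': "?H ?u ?v <= ?H u0 v0 + (Fd * ?\<beta> + \<Xi> + L * ?\<beta> * Ann) * T" by simp
  have osc_u: "osc ?u v <= ?\<beta> * norm v + 0" for v
   using order_trans[OF U.osc_le_initial[OF t] osc_le_BV[OF u0]] by (simp add: mult.commute)
  have osc_u0: "osc u0 v <= ?\<beta> * norm v + 0" for v
   using osc_le_BV[OF u0] by (simp add: mult.commute)
  \<comment> \<open>The arguments are exchanged because \<open>HH_close\<close> uses the modulus of
    its second function, here U(t) and then \<open>u0\<close>; \<open>HH_commute\<close> restores
    the order.\<close>
  have c1: "\<bar>?H ?v ?u - (LB x. \<bar>?v x - ?u x\<bar>)\<bar> <= ?\<beta> * mm + 0"
   by (rule SU.HH_close[OF SV.U_int[OF t] SU.U_int[OF t] osc_u \<beta>0 order_refl mm mm0])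
  have c2: "\<bar>?H v0 u0 - (LB x. \<bar>v0 x - u0 x\<bar>)\<bar> <= ?\<beta> * mm + 0"
   by (rule SU.HH_close[OF SV.u0_int SU.u0_int osc_u0 \<beta>0 order_refl mm mm0])
  have s: "?H ?v ?u = ?H ?u ?v" "?H v0 u0 = ?H u0 v0"
   by (rule SU.HH_commute[OF SV.U_int[OF t] SU.U_int[OF t]], rule SU.HH_commute[OF SV.u0_int SU.u0_int])
  have i: "(LB x. \<bar>?v x - ?u x\<bar>) = (LB x. \<bar>?u x - ?v x\<bar>)" "(LB x. \<bar>v0 x - u0 x\<bar>) = (LB x. \<bar>u0 x - v0 x\<bar>)"
   by (rule integral_cong[OF refl], rule abs_minus_commute)+
  have tot: "(LB x. \<bar>?u x - ?v x\<bar>) <= (LB x. \<bar>u0 x - v0 x\<bar>) + 2 * (?\<beta> * mm) + (Fd * ?\<beta> + \<Xi> + L * ?\<beta> * Ann) * T"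
   using abs_le_D2[OF c1] abs_le_D1[OF c2] HH' unfolding s i by linarith
  have "?\<beta> * (2 * mm + ?X / (2 * e)) = 2 * (?\<beta> * mm) + (L * ?\<beta> * Sk / 2 * S2) * T"
   using e by (simp add: Sk_def field_simps)
  then show ?thesis using tot unfolding \<Xi>_def mm_def[symmetric] by (simp add: algebra_simps)
 qed
 have a0: "0 < ?a" and X0: "0 <= ?X" using d1 T0 L0 S20 by auto
 from optimise_scale[OF step a0 \<beta>0 X0] show ?thesis by linarith
qed

text \<open>By continuity the set where the essential bound is exceeded is open, and a nonempty open
  set is not null.\<close>

lemma continuous_Linf_bounded:
 fixes A :: "real => real"
 assumes c: "continuous_on UNIV A" and A: "Linf lborel A"
 shows "\<bar>A s\<bar> <= Linf_norm lborel A"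
proof (rule ccontr)
 let ?S = "{s. Linf_norm lborel A < \<bar>A s\<bar>}"
 assume "\<not> ?thesis"
 then have "s \<in> ?S" by simp
 then have ne: "?S \<noteq> {}" by blast
 have o: "open ?S" by (intro open_Collect_less continuous_intros continuous_on_subset[OF c]) auto
 have "AE s in lborel. s \<notin> ?S" using Linf_AE_le[OF A] by eventually_elim simp
 then have "?S \<in> null_sets lborel" using o by (subst (asm) AE_iff_null_sets[symmetric]) auto
 then have "negligible ?S" unfolding negligible_iff_null_sets by (rule null_sets_completionI)
 then show False using open_not_negligible[OF o ne] by simp
qed

lemma weak_solutionI:
 fixes f :: "real => 'a::euclidean_space"
 assumes f: "W1inf f f'" and A: "W1inf A A'" "mono A" "A 0 = 0" and \<mu>: "levy_measure \<mu>" and T: "0 < T"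
  and u: "entropy_solution T f A \<mu> u0 u" and u0: "L1 u0"
  and U: "U \<in> borel_measurable (borel \<Otimes>\<^sub>M borel)" "!!x t. t \<in> {0..T} ==> U (x, t) = u (x, t)"
   "!!t. t \<in> {0..T} ==> L1 (%x. U (x, t))" "!!t. t \<in> {0..T} ==> (LB x. \<bar>U (x, t)\<bar>) <= N"
 shows "weak_solution f (Linf_norm lborel f') A (Linf_norm lborel A') (Linf_norm lborel A) \<mu> T N u0 U"
proof (rule weak_solution.intro)
 fix \<rho> :: "'a => real" and D K R and \<kappa> :: real
 assume k: "kernel \<rho> D K R" and \<kappa>: "0 < \<kappa>" "\<kappa> <= 1"
 interpret kernel \<rho> D K R by fact
 have ca: "continuous_on UNIV A" "Linf lborel A" using A(1) by (auto simp: W1inf_def)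
 interpret E: entropy_curve \<rho> D K R f "Linf_norm lborel f'" A "Linf_norm lborel A'" "Linf_norm lborel A" \<mu> \<kappa> T N u0 U u
  by unfold_locales
    (use W1inf_lipschitz[OF f] W1inf_lipschitz[OF A(1)] A(2,3) continuous_Linf_bounded[OF ca] \<mu> \<kappa> T U u0 u in \<open>simp_all add: real_norm_def[symmetric] del: real_norm_def\<close>)
 show "slice_curve \<rho> D K R f (Linf_norm lborel f') A (Linf_norm lborel A') (Linf_norm lborel A) \<mu> \<kappa> T N u0 U"
  by (rule E.slice_curve_axioms)
qed

theorem theorem3p4:
  fixes f g f' g' :: "real \<Rightarrow> real ^ 'd"
    and A A' :: "real \<Rightarrow> real"
    and u0 v0 :: "real ^ 'd \<Rightarrow> real"
    and \<mu> \<nu> :: "(real ^ 'd) measure"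
    and u v :: "(real ^ 'd) \<times> real \<Rightarrow> real"
    and T r :: real
  assumes f: "W1inf f f'" "f 0 = 0"
    and g: "W1inf g g'" "g 0 = 0"
    and A: "W1inf A A'" "mono A" "A 0 = 0"
    and u0: "Linf lborel u0" "integrable lborel u0" "BV u0"
    and v0: "Linf lborel v0" "integrable lborel v0" "BV v0"
    and \<mu>: "levy_measure \<mu>"
    and \<nu>: "levy_measure \<nu>"
    and T: "T > 0"
    and r: "r > 0"
    and u: "entropy_solution T f A \<mu> u0 u"
    and v: "entropy_solution T g A \<nu> v0 v"
  shows "C_L1_norm T (\<lambda>p. u p - v p)
    \<le> (LINT x|lborel. \<bar>u0 x - v0 x\<bar>)
      + BV_seminorm u0 * T * Linf_norm lborel (\<lambda>s. f' s - g' s)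
      + BV_seminorm u0
          * sqrt (4 * (real CARD('d))\<^sup>2 / (real CARD('d) + 1) * T * Linf_norm lborel A'
              * (LINT z:{z. 0 < norm z \<and> norm z \<le> r}|tv_measure \<mu> \<nu>. (norm z)\<^sup>2))
      + BV_seminorm u0 * T * Linf_norm lborel A'
          * norm ((LINT z:{z. min r 1 < norm z \<and> norm z \<le> max r 1}|\<mu>. z)
                - (LINT z:{z. min r 1 < norm z \<and> norm z \<le> max r 1}|\<nu>. z))
      + T * Linf_norm lborel A'
          * (LINT z:{z. norm z > r}|tv_measure \<mu> \<nu>. LINT x|lborel. \<bar>u0 (x + z) - u0 x\<bar>)"
proof -
 obtain U N1 where U: "U \<in> borel_measurable (borel \<Otimes>\<^sub>M borel)" "!!x t. t \<in> {0..T} ==> U (x, t) = u (x, t)"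
  "!!t. t \<in> {0..T} ==> L1 (%x. U (x, t))" "!!t. t \<in> {0..T} ==> (LB x. \<bar>U (x, t)\<bar>) <= N1"
  by (rule curve_extension[OF T u]) blast
 obtain V N2 where V: "V \<in> borel_measurable (borel \<Otimes>\<^sub>M borel)" "!!x t. t \<in> {0..T} ==> V (x, t) = v (x, t)"
  "!!t. t \<in> {0..T} ==> L1 (%x. V (x, t))" "!!t. t \<in> {0..T} ==> (LB x. \<bar>V (x, t)\<bar>) <= N2"
  by (rule curve_extension[OF T v]) blast
 \<comment> \<open>Both curves must live in one locale with a single L1 bound, hence the
   maximum.\<close>
 have N1: "(LB x. \<bar>U (x, t)\<bar>) <= max N1 N2" if "t \<in> {0..T}" for t using U(4)[OF that] by simp
 have N2: "(LB x. \<bar>V (x, t)\<bar>) <= max N1 N2" if "t \<in> {0..T}" for t using V(4)[OF that] by simp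
 note wU = weak_solutionI[OF f(1) A \<mu> T u u0(2) U(1-3) N1]
 note wV = weak_solutionI[OF g(1) A \<nu> T v v0(2) V(1-3) N2]
 let ?d = "real CARD('d)" and ?L = "Linf_norm lborel A'" and ?S = "LINT z:{z. 0 < norm z \<and> norm z <= r}|tv_measure \<mu> \<nu>. (norm z)\<^sup>2"
 \<comment> \<open>The sqrt d from the first moment and the sqrt d from the translation modulus
   complete d to d^2, and the factor 2 from the optimisation enters the root as 4; this assembles
   c_d.\<close>
 have sq: "2 * sqrt (?d * sqrt ?d / (?d + 1) * (T * ?L * sqrt ?d * ?S)) = sqrt (4 * ?d\<^sup>2 / (?d + 1) * T * ?L * ?S)"
 proof -
  have "?d * sqrt ?d / (?d + 1) * (T * ?L * sqrt ?d * ?S) = (?d * (sqrt ?d * sqrt ?d)) / (?d + 1) * T * ?L * ?S" by simp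
  also have "... = ?d\<^sup>2 / (?d + 1) * T * ?L * ?S" by (simp add: power2_eq_square)
  finally have e: "?d * sqrt ?d / (?d + 1) * (T * ?L * sqrt ?d * ?S) = ?d\<^sup>2 / (?d + 1) * T * ?L * ?S" .
  have "sqrt (4 * ?d\<^sup>2 / (?d + 1) * T * ?L * ?S) = sqrt (4 * (?d\<^sup>2 / (?d + 1) * T * ?L * ?S))" by simp
  also have "... = 2 * sqrt (?d\<^sup>2 / (?d + 1) * T * ?L * ?S)" by (simp only: real_sqrt_mult[of 4] real_sqrt_four)
  finally show ?thesis unfolding e by simp
 qed
 show ?thesis
  unfolding C_L1_norm_def
 proof (rule cSUP_least)
  show "{0..T} \<noteq> {}" using T by simp
  fix t assume t: "t \<in> {0..T}"
  have "(LB x. \<bar>u (x, t) - v (x, t)\<bar>) = (LB x. \<bar>U (x, t) - V (x, t)\<bar>)"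
   by (simp add: U(2)[OF t] V(2)[OF t])
  also note stability_estimate[OF wU wV u0(3) W1inf_diff_lipschitz[OF f(1) g(1)] r t]
  finally show "(LB x. \<bar>u (x, t) - v (x, t)\<bar>)
   <= (LB x. \<bar>u0 x - v0 x\<bar>)
   + BV_seminorm u0 * T * Linf_norm lborel (%s. f' s - g' s)
   + BV_seminorm u0
     * sqrt (4 * (real CARD('d))\<^sup>2 / (real CARD('d) + 1) * T * Linf_norm lborel A'
       * (LINT z:{z. 0 < norm z \<and> norm z <= r}|tv_measure \<mu> \<nu>. (norm z)\<^sup>2))
   + BV_seminorm u0 * T * Linf_norm lborel A'
     * norm ((LINT z:{z. min r 1 < norm z \<and> norm z <= max r 1}|\<mu>. z)
        - (LINT z:{z. min r 1 < norm z \<and> norm z <= max r 1}|\<nu>. z))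
   + T * Linf_norm lborel A'
     * (LINT z:{z. norm z > r}|tv_measure \<mu> \<nu>. LB x. \<bar>u0 (x + z) - u0 x\<bar>)"
   unfolding sq[symmetric] by (simp add: osc_def)
 qed
qed

end
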